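(* Let $M\in\mathcal O(B_q)$ and let $v\in M$ be a maximal vector of weight $\lambda\in\mathcal P$. Then the map $$B_q^{--}\otimes\mathbb Cv\to H(\lambda),\qquad F\otimes v\mapsto F.\bar 1,$$ where $\bar1\in H(\lambda)$ is the class of $1$, is an isomorphism of $B_q(\mathfrak g)$-modules. In particular, all the $H(\lambda)$ are simple $B_q(\mathfrak g)$-modules.
   Context: All vector spaces and tensor products are over $\mathbb C$. Let $q\in\mathbb{C}^*$ be not a root of unity; powers $q^r$, $r\in\mathbb Q$, are taken with respect to a fixed homomorphism $\mathbb Q\to\mathbb C^*$, $1\mapsto q$. Let $\mathfrak g$ be a finite dimensional complex semisimple Lie algebra with Cartan subalgebra $\mathfrak h$, $n=\dim\mathfrak h$, simple roots $\alpha_1,\dots,\alpha_n$, root lattice $Q$, weight lattice $\mathcal P$, $\mathcal P_+=\mathcal P\cap(\mathbb Q\otimes_{\mathbb Z}Q)$, $(\cdot,\cdot)$ the inner product on $\mathfrak h^*$ given by the Killing form, $q_i=q^{(\alpha_i,\alpha_i)/2}$. $\widetilde{U_q^+}$ is the Hopf algebra generated by $e_i$ ($1\le i\le n$), $t_\lambda^{\pm1}$ ($\lambda\in\mathcal P_+$) with relations $t_\lambda t_\mu=t_{\lambda+\mu}$, $t_0=1$, $t_\lambda e_it_\lambda^{-1}=q^{(\alpha_i,\lambda)}e_i$, and $\Delta(t_\lambda)=t_\lambda\otimes t_\lambda$, $\Delta(e_i)=e_i\otimes t_i^{-1}+1\otimes e_i$, $\varepsilon(e_i)=0$, $\varepsilon(t_\lambda)=1$,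 where $t_i=t_{\alpha_i}$. $\widetilde{U_q^-}$ is the Hopf algebra generated by $f_i$, ${t'_\lambda}^{\pm1}$ with relations $t'_\lambda t'_\mu=t'_{\lambda+\mu}$, $t'_0=1$, $t'_\lambda f_i{t'_\lambda}^{-1}=q^{-(\alpha_i,\lambda)}f_i$, and $\Delta(t'_\lambda)=t'_\lambda\otimes t'_\lambda$, $\Delta(f_i)=f_i\otimes1+t'_i\otimes f_i$, $\varepsilon(f_i)=0$, $\varepsilon(t'_\lambda)=1$, where $t'_i=t'_{\alpha_i}$. The bilinear form $\varphi:\widetilde{U_q^+}\times\widetilde{U_q^-}\to\mathbb C$ is determined by $\varphi(a,bb')=\sum\varphi(a_{(1)},b)\varphi(a_{(2)},b')$, $\varphi(aa',b)=\sum\varphi(a,b_{(2)})\varphi(a',b_{(1)})$, $\varphi(a,1)=\varepsilon(a)$, $\varphi(1,b)=\varepsilon(b)$ and $\varphi(e_i,f_j)=\delta_{ij}/(q_i^{-1}-q_i)$, $\varphi(t_\lambda,t'_\mu)=q^{-(\lambda,\mu)}$, $\varphi(e_i,t'_\lambda)=\varphi(t_\lambda,f_i)=0$. $U_q^+$ and $U_q^-$ are the quotients of $\widetilde{U_q^+},\widetilde{U_q^-}$ by the left and right radicals of $\varphi$; $\varphi$ also denotes the induced nondegenerate pairing. Put $e_i'=(q_i^{-1}-q_i)t_ie_i$, so $\varphi(e_i',f_j)=\delta_{ij}$. The Heisenberg double $H_\varphi(U_q^+,U_q^-)$ is $U_q^-\otimes U_q^+$ (pure tensors $b\sharp a$)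 with product $(b\sharp a)(b'\sharp a')=\sum\varphi(a_{(1)},b'_{(1)})\,bb'_{(2)}\sharp a_{(2)}a'$. The q-Boson algebra is $B_q=B_q(\mathfrak g)=H_\varphi(U_q^+,U_q^-)/(t_\lambda-t'_\lambda:\lambda\in\mathcal P_+)$; in it $t_\lambda e_i't_\lambda^{-1}=q^{(\alpha_i,\lambda)}e_i'$, $t_\lambda f_it_\lambda^{-1}=q^{-(\alpha_i,\lambda)}f_i$, $e_i'f_j=q^{-(\alpha_i,\alpha_j)}f_je_i'+\delta_{ij}$. $B_q^{++}$, $B_q^{--}$ are the subalgebras generated by the $e_i'$, resp. the $f_i$ (identified with the corresponding subalgebras of $U_q^+$, $U_q^-$). $\mathcal O(B_q)$ is the full subcategory of left $B_q$-modules $M$ such that: (i) $M=\bigoplus_{\lambda\in\mathcal P}M_\lambda$, $M_\lambda=\{m\in M\mid t_\mu.m=q^{(\mu,\lambda)}m\ \text{for all }\mu\in\mathcal P_+\}$; (ii) for any $m\in M$ there is an integer $l>0$ such that $e_{i_1}'\cdots e_{i_l}'.m=0$ for all $1\le i_1,\dots,i_l\le n$. A maximal vector is a nonzero $m\in M$ with $e_i'.m=0$ for all $i$; it has weight $\lambda$ if $m\in M_\lambda$. For $\lambda\in\mathcal P$, $I_\lambda=\sum_iB_qe_i'+\sum_{\alpha\in\mathcal P_+}B_q(t_\alpha-q^{(\lambda,\alpha)})$ is a left ideal of $B_q$ and $H(\lambda)=B_q/I_\lambda$. $B_q^{--}\otimes\mathbb Cv$ is a $B_q$-module by: for $x,f\in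 B_q^{--}$, $e\in B_q^{++}$, $t=t_\mu$: $e.(x\otimes v)=\sum\varphi(e,x_{(1)})x_{(2)}\otimes v$, $f.(x\otimes v)=fx\otimes v$, $t.(x\otimes v)=txt^{-1}\otimes tv$.
   Formalization: The quotient of the Heisenberg double by all t_λ−t'_λ is the zero ring when g≠0, since t_λt'_λ=q^{-(λ,λ)}t'_λt_λ there; B_q is instead taken to be the subalgebra of the Heisenberg double generated by the e'_i, f_i and t_λ, in which the three displayed relations hold. *)

theory Defs
  imports
    Complex_Main
    "HOL-Library.Function_Algebras"
    "HOL-Library.Product_Plus"
    "HOL-Library.Poly_Mapping"
    "HOL-Algebra.Module"
    "HOL-Algebra.QuotRing"
    "HOL-Algebra.Generated_Rings"
    "HOL-Algebra.Generated_Groups"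
begin

section \<open>Left modules over a ring\<close>

text \<open>The locale \<open>module\<close> of HOL-Algebra requires a commutative ring of scalars.\<close>

locale left_module = R?: ring R + M?: abelian_group M
  for R :: "('a, 'b) ring_scheme" (structure)
    and M :: "('a, 'm, 'c) module_scheme" (structure) +
  assumes smult_closed:
      "\<lbrakk>a \<in> carrier R; x \<in> carrier M\<rbrakk> \<Longrightarrow> a \<odot>\<^bsub>M\<^esub> x \<in> carrier M"
    and smult_l_distr:
      "\<lbrakk>a \<in> carrier R; b \<in> carrier R; x \<in> carrier M\<rbrakk> \<Longrightarrow>
        (a \<oplus> b) \<odot>\<^bsub>M\<^esub> x = a \<odot>\<^bsub>M\<^esub> x \<oplus>\<^bsub>M\<^esub> b \<odot>\<^bsub>M\<^esub> x"
    and smult_r_distr: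
      "\<lbrakk>a \<in> carrier R; x \<in> carrier M; y \<in> carrier M\<rbrakk> \<Longrightarrow>
        a \<odot>\<^bsub>M\<^esub> (x \<oplus>\<^bsub>M\<^esub> y) = a \<odot>\<^bsub>M\<^esub> x \<oplus>\<^bsub>M\<^esub> a \<odot>\<^bsub>M\<^esub> y"
    and smult_assoc:
      "\<lbrakk>a \<in> carrier R; b \<in> carrier R; x \<in> carrier M\<rbrakk> \<Longrightarrow>
        (a \<otimes> b) \<odot>\<^bsub>M\<^esub> x = a \<odot>\<^bsub>M\<^esub> (b \<odot>\<^bsub>M\<^esub> x)"
    and smult_one: "x \<in> carrier M \<Longrightarrow> \<one> \<odot>\<^bsub>M\<^esub> x = x"

definition simple_module :: "('a, 'b) ring_scheme \<Rightarrow> ('a, 'm) module \<Rightarrow> bool" where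
  "simple_module R M \<longleftrightarrow>
     left_module R M \<and> carrier M \<noteq> {\<zero>\<^bsub>M\<^esub>} \<and>
     (\<forall>N. submodule N R M \<longrightarrow> N = {\<zero>\<^bsub>M\<^esub>} \<or> N = carrier M)"

definition module_iso ::
  "('a, 'b) ring_scheme \<Rightarrow> ('a, 'm) module \<Rightarrow> ('a, 'n) module \<Rightarrow> ('m \<Rightarrow> 'n) \<Rightarrow> bool" where
  "module_iso R M N h \<longleftrightarrow>
     left_module R M \<and> left_module R N \<and> bij_betw h (carrier M) (carrier N) \<and>
     (\<forall>x\<in>carrier M. \<forall>y\<in>carrier M. h (x \<oplus>\<^bsub>M\<^esub> y) = h x \<oplus>\<^bsub>N\<^esub> h y) \<and>
     (\<forall>a\<in>carrier R. \<forall>x\<in>carrier M. h (a \<odot>\<^bsub>M\<^esub> x) = a \<odot>\<^bsub>N\<^esub> h x)"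

text \<open>The ring multiplication and unit of a \<open>module\<close> record play no role for left modules;
  they are filled arbitrarily below.\<close>

definition regular_module :: "('a, 'b) ring_scheme \<Rightarrow> ('a, 'a) module" where
  "regular_module R =
     \<lparr>carrier = carrier R, mult = mult R, one = one R, zero = zero R, add = add R,
      smult = mult R\<rparr>"

definition quotient_module :: "('a, 'm) module \<Rightarrow> 'm set \<Rightarrow> ('a, 'm set) module" where
  "quotient_module M N =
     \<lparr>carrier = a_rcosets\<^bsub>M\<^esub> N, mult = (\<lambda>X Y. N), one = N, zero = N, add = set_add M,
      smult = (\<lambda>a X. \<Union>x\<in>X. N +>\<^bsub>M\<^esub> (a \<odot>\<^bsub>M\<^esub> x))\<rparr>"


section \<open>Free algebras, tensor products\<close>

instantiation list :: (type) monoid_add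
begin

definition zero_list :: "'a list" where "zero_list = []"
definition plus_list :: "'a list \<Rightarrow> 'a list \<Rightarrow> 'a list" where "plus_list = (@)"

instance by standard (simp_all add: zero_list_def plus_list_def)

end

text \<open>With this instance, \<^typ>\<open>'x list \<Rightarrow>\<^sub>0 complex\<close> is the free complex algebra on \<^typ>\<open>'x\<close>
  (multiplication of words is concatenation), and \<^typ>\<open>('x list \<times> 'y list) \<Rightarrow>\<^sub>0 complex\<close> is the
  tensor product of two free algebras, the word pair \<open>(u, v)\<close> standing for \<open>u \<otimes> v\<close>.\<close>

type_synonym 'x free = "'x list \<Rightarrow>\<^sub>0 complex"
type_synonym ('x, 'y) free2 = "('x list \<times> 'y list) \<Rightarrow>\<^sub>0 complex"

abbreviation monom :: "'a \<Rightarrow> 'a \<Rightarrow>\<^sub>0 complex" where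
  "monom w \<equiv> Poly_Mapping.single w 1"

definition cscale :: "complex \<Rightarrow> ('a \<Rightarrow>\<^sub>0 complex) \<Rightarrow> 'a \<Rightarrow>\<^sub>0 complex" where
  "cscale c p = Poly_Mapping.map ((*) c) p"

definition lin_ext :: "('a \<Rightarrow> 'b \<Rightarrow>\<^sub>0 complex) \<Rightarrow> ('a \<Rightarrow>\<^sub>0 complex) \<Rightarrow> 'b \<Rightarrow>\<^sub>0 complex" where
  "lin_ext f p = (\<Sum>w\<in>Poly_Mapping.keys p. cscale (Poly_Mapping.lookup p w) (f w))"

definition free_alg :: "'x set \<Rightarrow> 'x free ring" where
  "free_alg X =
     \<lparr>carrier = {p. \<forall>w\<in>Poly_Mapping.keys p. set w \<subseteq> X},
      mult = (*), one = 1, zero = 0, add = (+)\<rparr>"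

definition tens :: "'x free \<Rightarrow> 'y free \<Rightarrow> ('x, 'y) free2" where
  "tens a b = (\<Sum>u\<in>Poly_Mapping.keys a. \<Sum>v\<in>Poly_Mapping.keys b.
     Poly_Mapping.single (u, v) (Poly_Mapping.lookup a u * Poly_Mapping.lookup b v))"

text \<open>The tensor product of two complex vector spaces, as the free vector space on pairs modulo
  bilinearity.\<close>

definition free_space :: "'a set \<Rightarrow> (complex, 'a \<Rightarrow>\<^sub>0 complex) module" where
  "free_space S =
     \<lparr>carrier = {p. Poly_Mapping.keys p \<subseteq> S}, mult = (\<lambda>x y. 0), one = 0, zero = 0, add = (+),
      smult = cscale\<rparr>"

definition tensor_relations ::
  "(complex, 'a) module \<Rightarrow> (complex, 'b) module \<Rightarrow> ('a \<times> 'b \<Rightarrow>\<^sub>0 complex) set" where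
  "tensor_relations V W = Modules.module.span cscale
     ({monom (x \<oplus>\<^bsub>V\<^esub> x', y) - monom (x, y) - monom (x', y) | x x' y.
         x \<in> carrier V \<and> x' \<in> carrier V \<and> y \<in> carrier W} \<union>
      {monom (x, y \<oplus>\<^bsub>W\<^esub> y') - monom (x, y) - monom (x, y') | x y y'.
         x \<in> carrier V \<and> y \<in> carrier W \<and> y' \<in> carrier W} \<union>
      {monom (c \<odot>\<^bsub>V\<^esub> x, y) - cscale c (monom (x, y)) | c x y.
         x \<in> carrier V \<and> y \<in> carrier W} \<union>
      {monom (x, c \<odot>\<^bsub>W\<^esub> y) - cscale c (monom (x, y)) | c x y.
         x \<in> carrier V \<and> y \<in> carrier W})"

definition tensor_product ::
  "(complex, 'a) module \<Rightarrow> (complex, 'b) module \<Rightarrow>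
   (complex, ('a \<times> 'b \<Rightarrow>\<^sub>0 complex) set) module" where
  "tensor_product V W =
     quotient_module (free_space (carrier V \<times> carrier W)) (tensor_relations V W)"

definition pure_tensor ::
  "(complex, 'a) module \<Rightarrow> (complex, 'b) module \<Rightarrow> 'a \<Rightarrow> 'b \<Rightarrow>
   ('a \<times> 'b \<Rightarrow>\<^sub>0 complex) set" where
  "pure_tensor V W x y =
     tensor_relations V W +>\<^bsub>free_space (carrier V \<times> carrier W)\<^esub> monom (x, y)"


section \<open>Semisimple Lie algebras and the parameter \<open>q\<close>\<close>

datatype 'w plus_gen = GenE nat | GenT 'w
datatype 'w minus_gen = GenF nat | GenT' 'w

text \<open>The Lie algebra is the whole type \<^typ>\<open>'g\<close>.  A linear functional on the Cartan subalgebra is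
  represented by its extension by zero to \<^typ>\<open>'g\<close>.  The simple roots are
  \<open>simple_root 1, \<dots>, simple_root rank\<close>, \<open>qpow r\<close> is \<open>q\<^sup>r\<close>, and \<open>pairing\<close> is the form \<open>\<phi>\<close>, lifted to
  the free algebras.\<close>

record 'g q_boson_data =
  scal :: "complex \<Rightarrow> 'g \<Rightarrow> 'g"
  bracket :: "'g \<Rightarrow> 'g \<Rightarrow> 'g"
  cartan :: "'g set"
  rank :: nat
  simple_root :: "nat \<Rightarrow> 'g \<Rightarrow> complex"
  qparam :: complex
  qpow :: "rat \<Rightarrow> complex"
  pairing :: "('g \<Rightarrow> complex) plus_gen free \<Rightarrow> ('g \<Rightarrow> complex) minus_gen free \<Rightarrow> complex"

definition fin_dim_lie_algebra :: "'g::ab_group_add q_boson_data \<Rightarrow> bool" where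
  "fin_dim_lie_algebra D \<longleftrightarrow>
     vector_space (scal D) \<and>
     (\<exists>B. finite B \<and> Modules.module.span (scal D) B = UNIV) \<and>
     (\<forall>x y z. bracket D (x + y) z = bracket D x z + bracket D y z) \<and>
     (\<forall>x y z. bracket D x (y + z) = bracket D x y + bracket D x z) \<and>
     (\<forall>c x y. bracket D (scal D c x) y = scal D c (bracket D x y)) \<and>
     (\<forall>c x y. bracket D x (scal D c y) = scal D c (bracket D x y)) \<and>
     (\<forall>x. bracket D x x = 0) \<and>
     (\<forall>x y z. bracket D x (bracket D y z) + bracket D y (bracket D z x)
        + bracket D z (bracket D x y) = 0)"

definition lie_ideal :: "'g::ab_group_add q_boson_data \<Rightarrow> 'g set \<Rightarrow> bool" where
  "lie_ideal D I \<longleftrightarrow>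
     Modules.module.subspace (scal D) I \<and> (\<forall>x. \<forall>y\<in>I. bracket D x y \<in> I)"

definition derived :: "'g::ab_group_add q_boson_data \<Rightarrow> 'g set \<Rightarrow> 'g set" where
  "derived D S = Modules.module.span (scal D) {bracket D x y | x y. x \<in> S \<and> y \<in> S}"

definition semisimple :: "'g::ab_group_add q_boson_data \<Rightarrow> bool" where
  "semisimple D \<longleftrightarrow>
     (\<forall>I. lie_ideal D I \<and> (\<exists>k. (derived D ^^ k) I = {0}) \<longrightarrow> I = {0})"

text \<open>A Cartan subalgebra of a complex semisimple Lie algebra: a maximal abelian subalgebra all of
  whose elements act semisimply (that is, diagonalizably) in the adjoint representation.\<close>

definition abelian_subalgebra :: "'g::ab_group_add q_boson_data \<Rightarrow> 'g set \<Rightarrow> bool" where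
  "abelian_subalgebra D S \<longleftrightarrow>
     Modules.module.subspace (scal D) S \<and> (\<forall>x\<in>S. \<forall>y\<in>S. bracket D x y = 0)"

definition is_cartan_subalgebra :: "'g::ab_group_add q_boson_data \<Rightarrow> bool" where
  "is_cartan_subalgebra D \<longleftrightarrow>
     abelian_subalgebra D (cartan D) \<and>
     (\<forall>S. abelian_subalgebra D S \<and> cartan D \<subseteq> S \<longrightarrow> S = cartan D) \<and>
     (\<forall>H\<in>cartan D. Modules.module.span (scal D) {x. \<exists>c. bracket D H x = scal D c x} = UNIV)"

definition lin_trace :: "(complex \<Rightarrow> 'g::ab_group_add \<Rightarrow> 'g) \<Rightarrow> ('g \<Rightarrow> 'g) \<Rightarrow> complex" where
  "lin_trace s f =
     (let B = (SOME B. \<not> Modules.module.dependent s B \<and> Modules.module.span s B = UNIV)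
      in \<Sum>b\<in>B. Modules.module.representation s B (f b) b)"

definition killing :: "'g::ab_group_add q_boson_data \<Rightarrow> 'g \<Rightarrow> 'g \<Rightarrow> complex" where
  "killing D x y = lin_trace (scal D) (\<lambda>z. bracket D x (bracket D y z))"

definition dual_cartan :: "'g::ab_group_add q_boson_data \<Rightarrow> ('g \<Rightarrow> complex) set" where
  "dual_cartan D =
     {l. (\<forall>x\<in>cartan D. \<forall>y\<in>cartan D. l (x + y) = l x + l y) \<and>
         (\<forall>c. \<forall>x\<in>cartan D. l (scal D c x) = c * l x) \<and>
         (\<forall>x. x \<notin> cartan D \<longrightarrow> l x = 0)}"

definition killing_dual ::
  "'g::ab_group_add q_boson_data \<Rightarrow> ('g \<Rightarrow> complex) \<Rightarrow> 'g" where
  "killing_dual D l = (THE h. h \<in> cartan D \<and> (\<forall>x\<in>cartan D. killing D h x = l x))"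

definition dform ::
  "'g::ab_group_add q_boson_data \<Rightarrow> ('g \<Rightarrow> complex) \<Rightarrow> ('g \<Rightarrow> complex) \<Rightarrow> complex" where
  "dform D l m = killing D (killing_dual D l) (killing_dual D m)"

definition roots :: "'g::ab_group_add q_boson_data \<Rightarrow> ('g \<Rightarrow> complex) set" where
  "roots D =
     {l \<in> dual_cartan D. l \<noteq> 0 \<and>
        (\<exists>x. x \<noteq> 0 \<and> (\<forall>h\<in>cartan D. bracket D h x = scal D (l h) x))}"

definition nodes :: "'g q_boson_data \<Rightarrow> nat set" where
  "nodes D = {1..rank D}"

definition are_simple_roots :: "'g::ab_group_add q_boson_data \<Rightarrow> bool" where
  "are_simple_roots D \<longleftrightarrow>
     rank D = vector_space.dim (scal D) (cartan D) \<and>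
     (\<forall>i\<in>nodes D. simple_root D i \<in> roots D) \<and>
     (\<forall>c. (\<forall>x. (\<Sum>i\<in>nodes D. c i * simple_root D i x) = 0) \<longrightarrow> (\<forall>i\<in>nodes D. c i = 0)) \<and>
     (\<forall>b\<in>roots D. \<exists>k :: nat \<Rightarrow> nat.
        b = (\<lambda>x. \<Sum>i\<in>nodes D. of_nat (k i) * simple_root D i x) \<or>
        b = (\<lambda>x. - (\<Sum>i\<in>nodes D. of_nat (k i) * simple_root D i x)))"

definition rational_root_span ::
  "'g q_boson_data \<Rightarrow> ('g \<Rightarrow> complex) set" where
  "rational_root_span D =
     {l. \<exists>k :: nat \<Rightarrow> rat. l = (\<lambda>x. \<Sum>i\<in>nodes D. of_rat (k i) * simple_root D i x)}"

definition weight_lattice ::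
  "'g::ab_group_add q_boson_data \<Rightarrow> ('g \<Rightarrow> complex) set" where
  "weight_lattice D =
     {l \<in> dual_cartan D. \<forall>b\<in>roots D. 2 * dform D l b / dform D b b \<in> \<int>}"

definition weight_lattice_plus ::
  "'g::ab_group_add q_boson_data \<Rightarrow> ('g \<Rightarrow> complex) set" where
  "weight_lattice_plus D = weight_lattice D \<inter> rational_root_span D"

text \<open>All exponents that occur below are rational, but \<^const>\<open>dform\<close> takes values in
  \<^typ>\<open>complex\<close>.\<close>

definition qexp :: "'g q_boson_data \<Rightarrow> complex \<Rightarrow> complex" where
  "qexp D c = qpow D (THE r. of_rat r = c)"

abbreviation qform ::
  "'g::ab_group_add q_boson_data \<Rightarrow> ('g \<Rightarrow> complex) \<Rightarrow> ('g \<Rightarrow> complex) \<Rightarrow> complex" where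
  "qform D l m \<equiv> qexp D (dform D l m)"

definition qi :: "'g::ab_group_add q_boson_data \<Rightarrow> nat \<Rightarrow> complex" where
  "qi D i = qexp D (dform D (simple_root D i) (simple_root D i) / 2)"

definition is_qpow :: "'g q_boson_data \<Rightarrow> bool" where
  "is_qpow D \<longleftrightarrow>
     qparam D \<noteq> 0 \<and> (\<forall>k>0. qparam D ^ k \<noteq> 1) \<and>
     (\<forall>r. qpow D r \<noteq> 0) \<and> (\<forall>r s. qpow D (r + s) = qpow D r * qpow D s) \<and>
     qpow D 1 = qparam D"


section \<open>The Hopf pairing\<close>

text \<open>Everything is expressed on the free algebras on the generators: the Hopf algebras
  \<open>U\<^sup>+\<close>, \<open>U\<^sup>-\<close> with a tilde are the quotients of \<open>free_plus\<close>, \<open>free_minus\<close> by the ideals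
  \<open>rel_plus\<close>, \<open>rel_minus\<close>; the comultiplication lifts to the free algebras.  The inverse of
  \<open>t\<^sub>\<lambda>\<close> is \<open>t\<^sub>-\<^sub>\<lambda>\<close>.\<close>

type_synonym 'g pfree = "('g \<Rightarrow> complex) plus_gen free"
type_synonym 'g mfree = "('g \<Rightarrow> complex) minus_gen free"
type_synonym 'g mpfree = "(('g \<Rightarrow> complex) minus_gen, ('g \<Rightarrow> complex) plus_gen) free2"

definition gens_plus ::
  "'g::ab_group_add q_boson_data \<Rightarrow> ('g \<Rightarrow> complex) plus_gen set" where
  "gens_plus D = GenE ` nodes D \<union> GenT ` weight_lattice_plus D"

definition gens_minus ::
  "'g::ab_group_add q_boson_data \<Rightarrow> ('g \<Rightarrow> complex) minus_gen set" where
  "gens_minus D = GenF ` nodes D \<union> GenT' ` weight_lattice_plus D"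

abbreviation free_plus :: "'g::ab_group_add q_boson_data \<Rightarrow> 'g pfree ring" where
  "free_plus D \<equiv> free_alg (gens_plus D)"

abbreviation free_minus :: "'g::ab_group_add q_boson_data \<Rightarrow> 'g mfree ring" where
  "free_minus D \<equiv> free_alg (gens_minus D)"

definition rel_plus :: "'g::ab_group_add q_boson_data \<Rightarrow> 'g pfree set" where
  "rel_plus D = Idl\<^bsub>free_plus D\<^esub>
     ({monom [GenT l, GenT m] - monom [GenT (l + m)] | l m.
         l \<in> weight_lattice_plus D \<and> m \<in> weight_lattice_plus D} \<union>
      {monom [GenT 0] - 1} \<union>
      {monom [GenT l, GenE i, GenT (- l)] - cscale (qform D (simple_root D i) l) (monom [GenE i])
         | l i. l \<in> weight_lattice_plus D \<and> i \<in> nodes D})"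

definition rel_minus :: "'g::ab_group_add q_boson_data \<Rightarrow> 'g mfree set" where
  "rel_minus D = Idl\<^bsub>free_minus D\<^esub>
     ({monom [GenT' l, GenT' m] - monom [GenT' (l + m)] | l m.
         l \<in> weight_lattice_plus D \<and> m \<in> weight_lattice_plus D} \<union>
      {monom [GenT' 0] - 1} \<union>
      {monom [GenT' l, GenF i, GenT' (- l)]
           - cscale (qexp D (- dform D (simple_root D i) l)) (monom [GenF i])
         | l i. l \<in> weight_lattice_plus D \<and> i \<in> nodes D})"

definition comult_plus ::
  "'g q_boson_data \<Rightarrow> 'g pfree \<Rightarrow>
   (('g \<Rightarrow> complex) plus_gen, ('g \<Rightarrow> complex) plus_gen) free2" where
  "comult_plus D = lin_ext (\<lambda>w. prod_list (map (\<lambda>g. case g of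
       GenE i \<Rightarrow> monom ([GenE i], [GenT (- simple_root D i)]) + monom ([], [GenE i])
     | GenT l \<Rightarrow> monom ([GenT l], [GenT l])) w))"

definition comult_minus ::
  "'g q_boson_data \<Rightarrow> 'g mfree \<Rightarrow>
   (('g \<Rightarrow> complex) minus_gen, ('g \<Rightarrow> complex) minus_gen) free2" where
  "comult_minus D = lin_ext (\<lambda>w. prod_list (map (\<lambda>g. case g of
       GenF i \<Rightarrow> monom ([GenF i], []) + monom ([GenT' (simple_root D i)], [GenF i])
     | GenT' l \<Rightarrow> monom ([GenT' l], [GenT' l])) w))"

definition counit_plus :: "'g pfree \<Rightarrow> complex" where
  "counit_plus a = (\<Sum>w\<in>Poly_Mapping.keys a. Poly_Mapping.lookup a w *
     prod_list (map (\<lambda>g. case g of GenE i \<Rightarrow> 0 | GenT l \<Rightarrow> 1) w))"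

definition counit_minus :: "'g mfree \<Rightarrow> complex" where
  "counit_minus b = (\<Sum>w\<in>Poly_Mapping.keys b. Poly_Mapping.lookup b w *
     prod_list (map (\<lambda>g. case g of GenF i \<Rightarrow> 0 | GenT' l \<Rightarrow> 1) w))"

text \<open>The defining properties of \<open>\<phi>\<close>; the two clauses on \<^const>\<open>rel_plus\<close>, \<^const>\<open>rel_minus\<close> say
  that the form is defined on the Hopf algebras themselves.\<close>

definition is_pairing :: "'g::ab_group_add q_boson_data \<Rightarrow> bool" where
  "is_pairing D \<longleftrightarrow> (let phi = pairing D; A = carrier (free_plus D); B = carrier (free_minus D);
       P = weight_lattice_plus D in
     (\<forall>a\<in>A. \<forall>a'\<in>A. \<forall>b\<in>B. phi (a + a') b = phi a b + phi a' b) \<and>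
     (\<forall>a\<in>A. \<forall>b\<in>B. \<forall>b'\<in>B. phi a (b + b') = phi a b + phi a b') \<and>
     (\<forall>c. \<forall>a\<in>A. \<forall>b\<in>B. phi (cscale c a) b = c * phi a b \<and> phi a (cscale c b) = c * phi a b) \<and>
     (\<forall>a\<in>rel_plus D. \<forall>b\<in>B. phi a b = 0) \<and>
     (\<forall>a\<in>A. \<forall>b\<in>rel_minus D. phi a b = 0) \<and>
     (\<forall>a\<in>A. \<forall>b\<in>B. \<forall>b'\<in>B. phi a (b * b') =
        (\<Sum>(u, v)\<in>Poly_Mapping.keys (comult_plus D a).
           Poly_Mapping.lookup (comult_plus D a) (u, v) * phi (monom u) b * phi (monom v) b')) \<and>
     (\<forall>a\<in>A. \<forall>a'\<in>A. \<forall>b\<in>B. phi (a * a') b =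
        (\<Sum>(u, v)\<in>Poly_Mapping.keys (comult_minus D b).
           Poly_Mapping.lookup (comult_minus D b) (u, v) * phi a (monom v) * phi a' (monom u))) \<and>
     (\<forall>a\<in>A. phi a 1 = counit_plus a) \<and>
     (\<forall>b\<in>B. phi 1 b = counit_minus b) \<and>
     (\<forall>i\<in>nodes D. \<forall>j\<in>nodes D. phi (monom [GenE i]) (monom [GenF j]) =
        (if i = j then 1 / (inverse (qi D i) - qi D i) else 0)) \<and>
     (\<forall>l\<in>P. \<forall>m\<in>P. phi (monom [GenT l]) (monom [GenT' m]) = qexp D (- dform D l m)) \<and>
     (\<forall>i\<in>nodes D. \<forall>l\<in>P. phi (monom [GenE i]) (monom [GenT' l]) = 0 \<and>
        phi (monom [GenT l]) (monom [GenF i]) = 0))"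

definition q_boson_datum :: "'g::ab_group_add q_boson_data \<Rightarrow> bool" where
  "q_boson_datum D \<longleftrightarrow>
     fin_dim_lie_algebra D \<and> semisimple D \<and> is_cartan_subalgebra D \<and> are_simple_roots D \<and>
     is_qpow D \<and> is_pairing D"

definition rad_plus :: "'g::ab_group_add q_boson_data \<Rightarrow> 'g pfree set" where
  "rad_plus D = {a \<in> carrier (free_plus D). \<forall>b\<in>carrier (free_minus D). pairing D a b = 0}"

definition rad_minus :: "'g::ab_group_add q_boson_data \<Rightarrow> 'g mfree set" where
  "rad_minus D = {b \<in> carrier (free_minus D). \<forall>a\<in>carrier (free_plus D). pairing D a b = 0}"


section \<open>The Heisenberg double\<close>

text \<open>\<open>U\<^sup>+\<close> and \<open>U\<^sup>-\<close> are the quotients of the free algebras by \<^const>\<open>rad_plus\<close> and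
  \<^const>\<open>rad_minus\<close>, so \<open>U\<^sup>- \<otimes> U\<^sup>+\<close> is the tensor product of the free algebras modulo \<open>heis_ker\<close>.\<close>

definition heis_mult ::
  "'g q_boson_data \<Rightarrow> 'g mpfree \<Rightarrow> 'g mpfree \<Rightarrow> 'g mpfree" where
  "heis_mult D x y =
     (\<Sum>(w, u)\<in>Poly_Mapping.keys x. \<Sum>(w', u')\<in>Poly_Mapping.keys y.
      \<Sum>(u1, u2)\<in>Poly_Mapping.keys (comult_plus D (monom u)).
      \<Sum>(w1, w2)\<in>Poly_Mapping.keys (comult_minus D (monom w')).
        Poly_Mapping.single (w @ w2, u2 @ u')
          (Poly_Mapping.lookup x (w, u) * Poly_Mapping.lookup y (w', u') *
           Poly_Mapping.lookup (comult_plus D (monom u)) (u1, u2) *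
           Poly_Mapping.lookup (comult_minus D (monom w')) (w1, w2) *
           pairing D (monom u1) (monom w1)))"

definition heis_free :: "'g::ab_group_add q_boson_data \<Rightarrow> 'g mpfree ring" where
  "heis_free D =
     \<lparr>carrier = {p. \<forall>(w, u)\<in>Poly_Mapping.keys p. set w \<subseteq> gens_minus D \<and> set u \<subseteq> gens_plus D},
      mult = heis_mult D, one = 1, zero = 0, add = (+)\<rparr>"

definition heis_ker :: "'g::ab_group_add q_boson_data \<Rightarrow> 'g mpfree set" where
  "heis_ker D = Modules.module.span cscale
     ({tens b a | b a. b \<in> rad_minus D \<and> a \<in> carrier (free_plus D)} \<union>
      {tens b a | b a. b \<in> carrier (free_minus D) \<and> a \<in> rad_plus D})"

definition heis :: "'g::ab_group_add q_boson_data \<Rightarrow> 'g mpfree set ring" where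
  "heis D = heis_free D Quot heis_ker D"

definition sharp ::
  "'g::ab_group_add q_boson_data \<Rightarrow> 'g mfree \<Rightarrow> 'g pfree \<Rightarrow> 'g mpfree set" where
  "sharp D b a = heis_ker D +>\<^bsub>heis_free D\<^esub> tens b a"


section \<open>The q-Boson algebra\<close>

definition e_prime_free :: "'g::ab_group_add q_boson_data \<Rightarrow> nat \<Rightarrow> 'g pfree" where
  "e_prime_free D i =
     cscale (inverse (qi D i) - qi D i) (monom [GenT (simple_root D i), GenE i])"

definition e_prime :: "'g::ab_group_add q_boson_data \<Rightarrow> nat \<Rightarrow> 'g mpfree set" where
  "e_prime D i = sharp D 1 (e_prime_free D i)"

definition f_gen :: "'g::ab_group_add q_boson_data \<Rightarrow> nat \<Rightarrow> 'g mpfree set" where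
  "f_gen D i = sharp D (monom [GenF i]) 1"

definition t_gen ::
  "'g::ab_group_add q_boson_data \<Rightarrow> ('g \<Rightarrow> complex) \<Rightarrow> 'g mpfree set" where
  "t_gen D l = sharp D 1 (monom [GenT l])"

definition scalar_elt :: "'g::ab_group_add q_boson_data \<Rightarrow> complex \<Rightarrow> 'g mpfree set" where
  "scalar_elt D c = sharp D 1 (cscale c 1)"

definition gen_subalgebra ::
  "'g::ab_group_add q_boson_data \<Rightarrow> 'g mpfree set set \<Rightarrow> 'g mpfree set set" where
  "gen_subalgebra D S = generate_ring (heis D) (range (scalar_elt D) \<union> S)"

text \<open>The q-Boson algebra is the Heisenberg double with the torus elements \<open>t'\<^sub>\<lambda>\<close> eliminated in favour
  of \<open>t\<^sub>\<lambda>\<close>.  This is not the quotient of the algebra \<^const>\<open>heis\<close> by the two-sided ideal generated by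
  all \<open>t\<^sub>\<lambda> - t'\<^sub>\<lambda>\<close>: in \<^const>\<open>heis\<close> one has \<open>t\<^sub>\<lambda> t'\<^sub>\<mu> = q\<^bsup>-(\<lambda>,\<mu>)\<^esup> t'\<^sub>\<mu> t\<^sub>\<lambda>\<close>, so in that
  quotient the invertible element \<open>t\<^sub>\<lambda>\<^sup>2\<close> equals \<open>q\<^bsup>-(\<lambda>,\<lambda>)\<^esup> t\<^sub>\<lambda>\<^sup>2\<close>, and the quotient is the zero ring
  unless the Lie algebra is zero.  The subalgebra generated by the \<open>e'\<^sub>i\<close>, \<open>f\<^sub>i\<close>, \<open>t\<^sub>\<lambda>\<close> is
  \<open>B\<^sup>-\<^sup>- \<otimes> U\<^sup>+\<close>; the relations
  \<open>t\<^sub>\<lambda> e'\<^sub>i t\<^sub>\<lambda>\<^sup>-\<^sup>1 = q\<^bsup>(\<alpha>\<^sub>i,\<lambda>)\<^esup> e'\<^sub>i\<close>,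
  \<open>t\<^sub>\<lambda> f\<^sub>i t\<^sub>\<lambda>\<^sup>-\<^sup>1 = q\<^bsup>-(\<alpha>\<^sub>i,\<lambda>)\<^esup> f\<^sub>i\<close>,
  \<open>e'\<^sub>i f\<^sub>j = q\<^bsup>-(\<alpha>\<^sub>i,\<alpha>\<^sub>j)\<^esup> f\<^sub>j e'\<^sub>i + \<delta>\<^sub>i\<^sub>j\<close> of the q-Boson algebra hold in it.\<close>

definition Bq :: "'g::ab_group_add q_boson_data \<Rightarrow> 'g mpfree set ring" where
  "Bq D = (heis D)\<lparr>carrier := gen_subalgebra D
     (e_prime D ` nodes D \<union> f_gen D ` nodes D \<union> t_gen D ` weight_lattice_plus D)\<rparr>"

definition Bpp :: "'g::ab_group_add q_boson_data \<Rightarrow> 'g mpfree set set" where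
  "Bpp D = gen_subalgebra D (e_prime D ` nodes D)"

definition Bmm :: "'g::ab_group_add q_boson_data \<Rightarrow> 'g mpfree set set" where
  "Bmm D = gen_subalgebra D (f_gen D ` nodes D)"

definition weight_space ::
  "'g::ab_group_add q_boson_data \<Rightarrow> ('g mpfree set, 'm) module \<Rightarrow>
   ('g \<Rightarrow> complex) \<Rightarrow> 'm set" where
  "weight_space D M l =
     {m \<in> carrier M. \<forall>k\<in>weight_lattice_plus D. t_gen D k \<odot>\<^bsub>M\<^esub> m = scalar_elt D (qform D k l) \<odot>\<^bsub>M\<^esub> m}"

definition category_O ::
  "'g::ab_group_add q_boson_data \<Rightarrow> ('g mpfree set, 'm) module \<Rightarrow> bool" where
  "category_O D M \<longleftrightarrow>
     left_module (Bq D) M \<and>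
     (\<forall>m\<in>carrier M. \<exists>!c :: ('g \<Rightarrow> complex) \<Rightarrow> 'm.
        (\<forall>l. l \<notin> weight_lattice D \<longrightarrow> c l = \<zero>\<^bsub>M\<^esub>) \<and>
        (\<forall>l\<in>weight_lattice D. c l \<in> weight_space D M l) \<and>
        finite {l. c l \<noteq> \<zero>\<^bsub>M\<^esub>} \<and>
        m = finsum M c {l. c l \<noteq> \<zero>\<^bsub>M\<^esub>}) \<and>
     (\<forall>m\<in>carrier M. \<exists>k>0. \<forall>is. length is = k \<and> set is \<subseteq> nodes D \<longrightarrow>
        foldr (\<lambda>i x. e_prime D i \<odot>\<^bsub>M\<^esub> x) is m = \<zero>\<^bsub>M\<^esub>)"

definition maximal_vector ::
  "'g::ab_group_add q_boson_data \<Rightarrow> ('g mpfree set, 'm) module \<Rightarrow> 'm \<Rightarrow> bool" where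
  "maximal_vector D M m \<longleftrightarrow>
     m \<in> carrier M \<and> m \<noteq> \<zero>\<^bsub>M\<^esub> \<and> (\<forall>i\<in>nodes D. e_prime D i \<odot>\<^bsub>M\<^esub> m = \<zero>\<^bsub>M\<^esub>)"

definition I_ideal ::
  "'g::ab_group_add q_boson_data \<Rightarrow> ('g \<Rightarrow> complex) \<Rightarrow> 'g mpfree set set" where
  "I_ideal D l = generate (add_monoid (Bq D))
     ({b \<otimes>\<^bsub>Bq D\<^esub> e_prime D i | b i. b \<in> carrier (Bq D) \<and> i \<in> nodes D} \<union>
      {b \<otimes>\<^bsub>Bq D\<^esub> (t_gen D k \<ominus>\<^bsub>Bq D\<^esub> scalar_elt D (qform D l k)) | b k.
         b \<in> carrier (Bq D) \<and> k \<in> weight_lattice_plus D})"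

definition H_module ::
  "'g::ab_group_add q_boson_data \<Rightarrow> ('g \<Rightarrow> complex) \<Rightarrow>
   ('g mpfree set, 'g mpfree set set) module" where
  "H_module D l = quotient_module (regular_module (Bq D)) (I_ideal D l)"

definition one_bar ::
  "'g::ab_group_add q_boson_data \<Rightarrow> ('g \<Rightarrow> complex) \<Rightarrow> 'g mpfree set set" where
  "one_bar D l = I_ideal D l +>\<^bsub>Bq D\<^esub> \<one>\<^bsub>Bq D\<^esub>"


section \<open>The module on \<open>B\<^sup>-\<^sup>- \<otimes> \<complex>v\<close>\<close>

definition Bmm_space ::
  "'g::ab_group_add q_boson_data \<Rightarrow> (complex, 'g mpfree set) module" where
  "Bmm_space D =
     \<lparr>carrier = Bmm D, mult = mult (heis D), one = one (heis D), zero = zero (heis D),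
      add = add (heis D), smult = (\<lambda>c x. scalar_elt D c \<otimes>\<^bsub>heis D\<^esub> x)\<rparr>"

definition line_space ::
  "'g::ab_group_add q_boson_data \<Rightarrow> ('g mpfree set, 'm) module \<Rightarrow> 'm \<Rightarrow>
   (complex, 'm) module" where
  "line_space D M v =
     \<lparr>carrier = {scalar_elt D c \<odot>\<^bsub>M\<^esub> v | c. True}, mult = mult M, one = one M, zero = zero M,
      add = add M, smult = (\<lambda>c x. scalar_elt D c \<odot>\<^bsub>M\<^esub> x)\<rparr>"

abbreviation Bmm_tensor ::
  "'g::ab_group_add q_boson_data \<Rightarrow> ('g mpfree set, 'm) module \<Rightarrow> 'm \<Rightarrow>
   'g mpfree set \<Rightarrow> 'm \<Rightarrow> ('g mpfree set \<times> 'm \<Rightarrow>\<^sub>0 complex) set" where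
  "Bmm_tensor D M v \<equiv> pure_tensor (Bmm_space D) (line_space D M v)"

text \<open>\<open>contract D a b\<close> is \<open>\<Sum> \<phi>(a, b\<^sub>(\<^sub>1\<^sub>)) b\<^sub>(\<^sub>2\<^sub>)\<close>.\<close>

definition contract :: "'g q_boson_data \<Rightarrow> 'g pfree \<Rightarrow> 'g mfree \<Rightarrow> 'g mfree" where
  "contract D a b =
     (\<Sum>(w1, w2)\<in>Poly_Mapping.keys (comult_minus D b).
        Poly_Mapping.single w2
          (Poly_Mapping.lookup (comult_minus D b) (w1, w2) * pairing D a (monom w1)))"

text \<open>\<open>N\<close> is the vector space \<open>B\<^sup>-\<^sup>- \<otimes> \<complex>v\<close> with the action of the q-Boson algebra which is
  prescribed on its generating subalgebras.  Elements of \<open>B\<^sup>+\<^sup>+\<close> and \<open>B\<^sup>-\<^sup>-\<close> are identified with elements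
  of \<open>U\<^sup>+\<close> and \<open>U\<^sup>-\<close> via \<open>1 \<sharp> a\<close> and \<open>b \<sharp> 1\<close>.\<close>

definition is_tensor_module ::
  "'g::ab_group_add q_boson_data \<Rightarrow> ('g mpfree set, 'm) module \<Rightarrow> 'm \<Rightarrow>
   ('g mpfree set, ('g mpfree set \<times> 'm \<Rightarrow>\<^sub>0 complex) set) module \<Rightarrow> bool" where
  "is_tensor_module D M v N \<longleftrightarrow>
     (let V = tensor_product (Bmm_space D) (line_space D M v) in
     left_module (Bq D) N \<and>
     carrier N = carrier V \<and> zero N = zero V \<and> add N = add V \<and>
     (\<forall>a\<in>carrier (free_plus D). \<forall>b\<in>carrier (free_minus D).
        sharp D 1 a \<in> Bpp D \<and> sharp D b 1 \<in> Bmm D \<longrightarrow>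
        sharp D 1 a \<odot>\<^bsub>N\<^esub> Bmm_tensor D M v (sharp D b 1) v =
          Bmm_tensor D M v (sharp D (contract D a b) 1) v) \<and>
     (\<forall>f\<in>Bmm D. \<forall>x\<in>Bmm D.
        f \<odot>\<^bsub>N\<^esub> Bmm_tensor D M v x v = Bmm_tensor D M v (f \<otimes>\<^bsub>Bq D\<^esub> x) v) \<and>
     (\<forall>k\<in>weight_lattice_plus D. \<forall>x\<in>Bmm D.
        t_gen D k \<odot>\<^bsub>N\<^esub> Bmm_tensor D M v x v =
          Bmm_tensor D M v (t_gen D k \<otimes>\<^bsub>Bq D\<^esub> x \<otimes>\<^bsub>Bq D\<^esub> inv\<^bsub>Bq D\<^esub> t_gen D k) (t_gen D k \<odot>\<^bsub>M\<^esub> v)))"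

end

theory Submission
  imports Defs
begin

text \<open>
  The Heisenberg double is \<open>U\<^sup>- \<otimes> U\<^sup>+\<close> as a vector space, and the q-Boson algebra \<open>B\<^sub>q\<close> is its
  subalgebra generated by the \<open>e'\<^sub>i\<close>, \<open>f\<^sub>i\<close> and \<open>t\<^sub>\<mu>\<close>.  The theorem rests on the decomposition
  \<open>B\<^sub>q = B\<^sup>-\<^sup>- \<oplus> I\<^sub>\<lambda>\<close>, which makes \<open>F \<mapsto> F.1\<close> a bijection from \<open>B\<^sup>-\<^sup>-\<close> to \<open>H(\<lambda>)\<close>.

  \<^item> That \<open>B\<^sup>-\<^sup>- + I\<^sub>\<lambda>\<close> is everything (\<open>BQ_decomposition\<close>) follows from the commutation relations: this sum
    contains \<open>1\<close> and is stable under left multiplication by the generators.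

  \<^item> That the sum is direct (\<open>fm_inj_mod_J\<close>) needs a map.  As \<open>-\<lambda>\<close> is a weight, \<open>b \<sharp> a \<mapsto> \<phi>(a, t'\<^sub>-\<^sub>\<lambda>) b\<close>
    is a linear map from the double to \<open>U\<^sup>-\<close>.  By the Hopf properties of \<open>\<phi>\<close> its kernel is a left
    ideal; it kills \<open>e'\<^sub>i\<close> and \<open>t\<^sub>\<mu> - q\<^bsup>(\<lambda>,\<mu>)\<^esup>\<close>, hence all of \<open>I\<^sub>\<lambda>\<close>, and it is the identity on \<open>B\<^sup>-\<^sup>-\<close>.

  Applied to a product \<open>(1 \<sharp> a)(b \<sharp> 1)\<close> with \<open>a \<in> B\<^sup>+\<^sup>+\<close>, the same map gives
  \<open>\<Sum> \<phi>(a, b\<^sub>(\<^sub>1\<^sub>) t'\<^sub>-\<^sub>\<lambda>) b\<^sub>(\<^sub>2\<^sub>)\<close>, and \<open>t'\<^sub>-\<^sub>\<lambda>\<close> may be dropped here because the \<open>e'\<^sub>i\<close> do not see it.  So \<open>B\<^sup>+\<^sup>+\<close>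
  acts on \<open>H(\<lambda>) = B\<^sup>-\<^sup>-\<close> by contraction (\<open>Bpp_action\<close>), which is the action prescribed on
  \<open>B\<^sup>-\<^sup>- \<otimes> \<complex>v\<close>; the actions of the \<open>f\<^sub>i\<close> and of the torus agree as well, since \<open>v\<close> has weight \<open>\<lambda>\<close>.  The module
  structure on \<open>B\<^sup>-\<^sup>- \<otimes> \<complex>v\<close> therefore exists, by transport from \<open>H(\<lambda>)\<close>, and any structure with the
  prescribed action of the generators is isomorphic to \<open>H(\<lambda>)\<close> by the stated map.

  For simplicity, take a nonzero element \<open>x\<close> of \<open>B\<^sup>-\<^sup>-\<close> in a submodule.  Each \<open>e'\<^sub>i\<close> lowers the degree in
  the \<open>f\<^sub>j\<close>, so repeated application leads to a nonzero element killed by all \<open>e'\<^sub>i\<close>.  It is a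
  scalar (\<open>singular_vector_scalar\<close>): it pairs to zero with every word that contains some \<open>e\<^sub>i\<close>, and \<open>\<phi>\<close>
  is nondegenerate on \<open>U\<^sup>-\<close>.  So the submodule contains the class of \<open>1\<close>.

  Lie theory enters through the equality \<open>P\<^sub>+ = P\<close>, which provides the element \<open>t'\<^sub>-\<^sub>\<lambda>\<close> of
  \<open>U\<^sup>-\<close>.  It says that weights are rational combinations of roots, and follows from the
  integrality of the Cartan numbers and the nondegeneracy of the Killing form on the
  Cartan subalgebra; both are derived from semisimplicity by \<open>sl\<^sub>2\<close> arguments.
\<close>

section \<open>Traces and diagonalizable endomorphisms\<close>

context vector_space
begin

text \<open>The matrix coefficients of \<open>f\<close> with respect to two bases.  Exchanging the double sum that this
  expansion produces gives both the independence of the trace from the basis and its cyclicity.\<close>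

lemma representation_linear_image:
  assumes B: "finite B" "independent B" "span B = UNIV" and C: "finite C" "independent C" "span C = UNIV"
    and f: "\<And>x y. f (x + y) = f x + f y" "\<And>c x. f (c *s x) = c *s f x"
  shows "representation B (f v) b = (\<Sum>c\<in>C. representation C v c * representation B (f c) b)"
proof -
  have f0: "f 0 = 0" using f(1)[of 0 0] by simp
  have fs: "f (sum g A) = (\<Sum>a\<in>A. f (g a))" for g and A :: "'b set"
    by (induction A rule: infinite_finite_induct) (auto simp: f f0)
  have "v = (\<Sum>c\<in>C. representation C v c *s c)"
    using sum_representation_eq[of C v C] C by auto
  then have "f v = (\<Sum>c\<in>C. representation C v c *s f c)"
    by (metis (no_types, lifting) fs f(2) sum.cong)
  then show ?thesis
    using B by (simp add: representation_sum representation_scale)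
qed

lemma trace_basis_indep:
  assumes B: "finite B" "independent B" "span B = UNIV" and C: "finite C" "independent C" "span C = UNIV"
    and f: "\<And>x y. f (x + y) = f x + f y" "\<And>c x. f (c *s x) = c *s f x"
  shows "(\<Sum>b\<in>B. representation B (f b) b) = (\<Sum>c\<in>C. representation C (f c) c)"
proof -
  have "(\<Sum>b\<in>B. representation B (f b) b)
      = (\<Sum>b\<in>B. \<Sum>c\<in>C. representation C b c * representation B (f c) b)"
    by (intro sum.cong refl representation_linear_image[OF B C f])
  also have "\<dots> = (\<Sum>c\<in>C. \<Sum>b\<in>B. representation B (f c) b * representation C b c)"
    by (subst sum.swap) (simp add: mult.commute)
  also have "\<dots> = (\<Sum>c\<in>C. representation C (f c) c)"
    by (intro sum.cong refl representation_linear_image[OF C B, of "\<lambda>x. x", symmetric])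
  finally show ?thesis .
qed

lemma trace_cyclic:
  assumes B: "finite B" "independent B" "span B = UNIV"
    and f: "\<And>x y. f (x + y) = f x + f y" "\<And>c x. f (c *s x) = c *s f x"
    and g: "\<And>x y. g (x + y) = g x + g y" "\<And>c x. g (c *s x) = c *s g x"
  shows "(\<Sum>b\<in>B. representation B (f (g b)) b) = (\<Sum>b\<in>B. representation B (g (f b)) b)"
proof -
  have "(\<Sum>b\<in>B. representation B (f (g b)) b)
      = (\<Sum>b\<in>B. \<Sum>c\<in>B. representation B (g b) c * representation B (f c) b)"
    by (intro sum.cong refl representation_linear_image[OF B B f])
  also have "\<dots> = (\<Sum>c\<in>B. \<Sum>b\<in>B. representation B (f c) b * representation B (g b) c)"
    by (subst sum.swap) (simp add: mult.commute)
  also have "\<dots> = (\<Sum>c\<in>B. representation B (g (f c)) c)"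
    by (intro sum.cong refl representation_linear_image[OF B B g, symmetric])
  finally show ?thesis .
qed

text \<open>A subspace stable under an endomorphism inherits the eigenspace decomposition: applying
  \<open>f - \<mu> e\<close> removes the eigenvalue \<open>\<mu> e\<close> from a sum of eigenvectors, whence the induction.\<close>

lemma eigencomponents_in_stable_subspace:
  assumes W: "subspace W" "\<And>x. x \<in> W \<Longrightarrow> f x \<in> W"
    and f: "\<And>x y. f (x + y) = f x + f y" "\<And>c x. f (c *s x) = c *s f x"
    and fin: "finite F" and inj: "inj_on \<mu> F" and eig: "\<And>d. d \<in> F \<Longrightarrow> f (v d) = \<mu> d *s v d"
    and sum: "(\<Sum>d\<in>F. v d) \<in> W" and d: "d \<in> F"
  shows "v d \<in> W"
  using fin inj eig sum d
proof (induction F arbitrary: v d rule: finite_induct)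
  case (insert e F)
  have f0: "f 0 = 0" using f(1)[of 0 0] by simp
  have fs: "f (sum g A) = (\<Sum>a\<in>A. f (g a))" for g and A :: "'c set"
    by (induction A rule: infinite_finite_induct) (auto simp: f f0)
  have "f (\<Sum>d\<in>insert e F. v d) - \<mu> e *s (\<Sum>d\<in>insert e F. v d) \<in> W"
    by (intro subspace_diff subspace_scale W insert.prems(3))
  also have "f (\<Sum>d\<in>insert e F. v d) = (\<Sum>d\<in>insert e F. \<mu> d *s v d)"
    unfolding fs by (intro sum.cong refl insert.prems(2))
  also have "\<dots> - \<mu> e *s (\<Sum>d\<in>insert e F. v d) = (\<Sum>d\<in>insert e F. (\<mu> d - \<mu> e) *s v d)"
    by (simp add: scale_sum_right sum_subtractf[symmetric] scale_left_diff_distrib del: sum.insert)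
  also have "\<dots> = (\<Sum>d\<in>F. (\<mu> d - \<mu> e) *s v d)"
    using insert.hyps by simp
  finally have *: "(\<Sum>d\<in>F. (\<mu> d - \<mu> e) *s v d) \<in> W" .
  have vF: "v d \<in> W" if "d \<in> F" for d
  proof -
    have inj': "inj_on \<mu> F" using insert.prems(1) by (rule inj_on_subset) blast
    have "\<mu> d \<noteq> \<mu> e" using inj_onD[OF insert.prems(1), of d e] insert.hyps(2) that by auto
    moreover have "(\<mu> d - \<mu> e) *s v d \<in> W"
    proof (rule insert.IH[OF inj' _ * that])
      fix k assume "k \<in> F"
      then have "f (v k) = \<mu> k *s v k" by (intro insert.prems(2)) simp
      then show "f ((\<mu> k - \<mu> e) *s v k) = \<mu> k *s ((\<mu> k - \<mu> e) *s v k)"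
        by (simp add: f(2) mult.commute)
    qed
    then have "inverse (\<mu> d - \<mu> e) *s (\<mu> d - \<mu> e) *s v d \<in> W"
      by (rule subspace_scale[OF W(1)])
    ultimately show ?thesis by simp
  qed
  have "v e = (\<Sum>d\<in>insert e F. v d) - (\<Sum>d\<in>F. v d)"
    using insert.hyps by simp
  moreover have "\<dots> \<in> W"
    by (intro subspace_diff[OF W(1)] insert.prems(3) subspace_sum[OF W(1)] vF)
  ultimately show ?case using vF[of d] insert.prems(4) by (cases "d = e") simp_all
qed simp

lemma eigenvector_expansion:
  assumes "x \<in> span {x. \<exists>c. f x = c *s x}"
    and f: "\<And>x y. f (x + y) = f x + f y" "\<And>c x. f (c *s x) = c *s f x"
  obtains F v where "finite F" "\<And>d. f (v d) = d *s v d" "x = (\<Sum>d\<in>F. v d)"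
proof -
  have f0: "f 0 = 0" using f(1)[of 0 0] by simp
  have "\<exists>F v. finite F \<and> (\<forall>d. f (v d) = d *s v d) \<and> x = (\<Sum>d\<in>F. v d)"
    using assms(1)
  proof (induction rule: span_induct_alt)
    case base
    show ?case by (rule exI[of _ "{}"], rule exI[of _ "\<lambda>_. 0"]) (auto simp: f0)
  next
    case (step c y z)
    then obtain F v e where F: "finite F" "\<forall>d. f (v d) = d *s v d" "z = (\<Sum>d\<in>F. v d)" "f y = e *s y"
      by auto
    let ?v = "\<lambda>d. (if d \<in> F then v d else 0) + (if d = e then c *s y else 0)"
    have "(\<Sum>d\<in>insert e F. ?v d) = (\<Sum>d\<in>insert e F. if d \<in> F then v d else 0) + c *s y"
      using F(1) by (simp add: sum.distrib del: sum.insert)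
    also have "(\<Sum>d\<in>insert e F. if d \<in> F then v d else 0) = z"
      unfolding F(3) using F(1) by (intro sum.mono_neutral_cong_right) auto
    finally have "c *s y + z = (\<Sum>d\<in>insert e F. ?v d)" by simp
    moreover have "\<forall>d. f (?v d) = d *s ?v d"
      using F by (auto simp: f f0 scale_right_distrib mult.commute)
    ultimately show ?case using F(1) by (intro exI[of _ "insert e F"] exI[of _ ?v]) auto
  qed
  then show ?thesis using that by blast
qed

text \<open>Induction over the family: a joint eigenspace of the earlier operators is stable under the next one,
  which commutes with them, so it contains the eigencomponents of its vectors.\<close>

lemma joint_eigenvectors_span:
  assumes "finite I"
    and "\<And>i x y. i \<in> I \<Longrightarrow> f i (x + y) = f i x + f i y"
    and "\<And>i c x. i \<in> I \<Longrightarrow> f i (c *s x) = c *s f i x"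
    and "\<And>i j x. i \<in> I \<Longrightarrow> j \<in> I \<Longrightarrow> f i (f j x) = f j (f i x)"
    and "\<And>i. i \<in> I \<Longrightarrow> span {x. \<exists>c. f i x = c *s x} = UNIV"
    and W: "subspace W" "\<And>i x. i \<in> I \<Longrightarrow> x \<in> W \<Longrightarrow> f i x \<in> W"
  shows "W \<subseteq> span {x \<in> W. \<forall>i\<in>I. \<exists>c. f i x = c *s x}"
  using assms(1-5) W(2)
proof (induction I rule: finite_induct)
  case empty
  then show ?case by (auto intro: span_base)
next
  case (insert i I)
  note lin = insert.prems(1,2)
  let ?E = "{x \<in> W. \<forall>i\<in>I. \<exists>c. f i x = c *s x}" and ?E' = "{x \<in> W. \<forall>j\<in>insert i I. \<exists>c. f j x = c *s x}"
  have "?E \<subseteq> span ?E'"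
  proof
    fix x assume x: "x \<in> ?E"
    then obtain c where c: "\<And>j. j \<in> I \<Longrightarrow> f j x = c j *s x" by (auto simp: bchoice_iff)
    let ?W = "{y \<in> W. \<forall>j\<in>I. f j y = c j *s y}"
    have f0: "f j 0 = 0" if "j \<in> insert i I" for j using lin(1)[OF that, of 0 0] by simp
    have W': "subspace ?W"
      using W(1) lin f0 by (auto simp: subspace_def scale_right_distrib mult.commute)
    have stable: "f i y \<in> ?W" if "y \<in> ?W" for y
    proof -
      have "f j (f i y) = c j *s f i y" if j: "j \<in> I" for j
        using insert.prems(3)[of j i y] insert.prems(2)[of i "c j" y] \<open>y \<in> ?W\<close> j by simp
      then show ?thesis using that insert.prems(5)[of i y] by simp
    qed
    obtain F v where F: "finite F" "\<And>d. f i (v d) = d *s v d" "x = (\<Sum>d\<in>F. v d)"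
      by (rule eigenvector_expansion[of x "f i"]) (use lin insert.prems(4)[of i] in auto)
    have xW: "(\<Sum>d\<in>F. v d) \<in> ?W"
      using x c unfolding F(3)[symmetric] by simp
    have "v d \<in> ?W" if "d \<in> F" for d
      by (rule eigencomponents_in_stable_subspace[OF W' stable _ _ F(1) _ _ xW that, where \<mu> = "\<lambda>d. d"])
        (use lin F(2) in auto)
    then have "v d \<in> ?E'" if "d \<in> F" for d using F(2) that by blast
    then show "x \<in> span ?E'" unfolding F(3) by (intro span_sum span_base)
  qed
  then have "span ?E \<subseteq> span ?E'" by (simp add: span_minimal)
  moreover have "W \<subseteq> span ?E"
    by (rule insert.IH; rule insert.prems; simp)
  ultimately show ?case by (rule order_trans[rotated])
qed

text \<open>Induction on the number of functionals.  By independence the new functional differs at some vector from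
  the combination of the others that agrees with it on the dual vectors found so far; subtracting these
  vectors gives a vector on which only the new functional is nonzero.\<close>

lemma dual_family_exists:
  fixes f :: "'i \<Rightarrow> 'b \<Rightarrow> 'a"
  assumes "finite I" and H: "subspace H"
    and "\<And>i x y. i \<in> I \<Longrightarrow> x \<in> H \<Longrightarrow> y \<in> H \<Longrightarrow> f i (x + y) = f i x + f i y"
    and "\<And>i c x. i \<in> I \<Longrightarrow> x \<in> H \<Longrightarrow> f i (c *s x) = c * f i x"
    and "\<And>c. (\<And>x. x \<in> H \<Longrightarrow> (\<Sum>i\<in>I. c i * f i x) = 0) \<Longrightarrow> (\<And>i. i \<in> I \<Longrightarrow> c i = 0)"
  shows "\<exists>x. \<forall>i\<in>I. x i \<in> H \<and> (\<forall>j\<in>I. f j (x i) = (if i = j then 1 else 0))"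
  using assms(1,3-5)
proof (induction I rule: finite_induct)
  case empty
  show ?case by simp
next
  case (insert k I)
  have "\<exists>x. \<forall>i\<in>I. x i \<in> H \<and> (\<forall>j\<in>I. f j (x i) = (if i = j then 1 else 0))"
  proof (rule insert.IH)
    fix c i assume c: "\<And>x. x \<in> H \<Longrightarrow> (\<Sum>i\<in>I. c i * f i x) = 0" and i: "i \<in> I"
    have "(\<Sum>i\<in>insert k I. (if i = k then 0 else c i) * f i x) = 0" if "x \<in> H" for x
    proof -
      have "(\<Sum>i\<in>insert k I. (if i = k then 0 else c i) * f i x) = (\<Sum>i\<in>I. c i * f i x)"
        using insert.hyps by (intro sum.mono_neutral_cong_right) auto
      then show ?thesis using c[OF that] by simp
    qed
    from insert.prems(3)[OF this, of i] show "c i = 0" using i insert.hyps by (simp split: if_splits)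
  qed (use insert.prems(1,2) in auto)
  then obtain x where x: "\<And>i. i \<in> I \<Longrightarrow> x i \<in> H"
    "\<And>i j. i \<in> I \<Longrightarrow> j \<in> I \<Longrightarrow> f j (x i) = (if i = j then 1 else 0)" by metis
  note lin_add = insert.prems(1)
  have fs: "f j (\<Sum>a\<in>A. u a) = (\<Sum>a\<in>A. f j (u a))" if "j \<in> insert k I" "\<And>a. a \<in> A \<Longrightarrow> u a \<in> H" "finite A"
    for j u and A :: "'i set"
    using that(3,2)
  proof (induction A rule: finite_induct)
    case empty
    then show ?case using insert.prems(2)[OF that(1), of 0 0] H by (simp add: subspace_0)
  next
    case (insert a A)
    then have "f j (u a + sum u A) = f j (u a) + f j (sum u A)"
      by (intro lin_add[OF that(1)] subspace_sum[OF H]) auto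
    then show ?case using insert by simp
  qed
  define g where "g y = f k y - (\<Sum>j\<in>I. f k (x j) * f j y)" for y
  have "\<exists>y\<in>H. g y \<noteq> 0"
  proof (rule ccontr)
    assume no: "\<not> (\<exists>y\<in>H. g y \<noteq> 0)"
    have "(\<Sum>i\<in>insert k I. (if i = k then 1 else - f k (x i)) * f i y) = 0" if "y \<in> H" for y
    proof -
      have "(\<Sum>i\<in>I. (if i = k then 1 else - f k (x i)) * f i y) = - (\<Sum>j\<in>I. f k (x j) * f j y)"
        unfolding sum_negf[symmetric] using insert.hyps by (intro sum.cong) auto
      then show ?thesis using no that insert.hyps by (auto simp: g_def)
    qed
    from insert.prems(3)[OF this, of k] show False by simp
  qed
  then obtain y where y: "y \<in> H" "g y \<noteq> 0" by blast
  define z where "z = y - (\<Sum>j\<in>I. f j y *s x j)"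
  have sH: "(\<Sum>j\<in>I. f j y *s x j) \<in> H" using x H by (intro subspace_sum subspace_scale) auto
  have zH: "z \<in> H" unfolding z_def using y sH H by (intro subspace_diff) auto
  have fz: "f i z = f i y - (\<Sum>j\<in>I. f j y * f i (x j))" if i: "i \<in> insert k I" for i
  proof -
    have "f i y = f i (z + (\<Sum>j\<in>I. f j y *s x j))" by (simp add: z_def)
    also have "\<dots> = f i z + f i (\<Sum>j\<in>I. f j y *s x j)" using insert.prems(1)[OF i zH sH] .
    also have "f i (\<Sum>j\<in>I. f j y *s x j) = (\<Sum>j\<in>I. f i (f j y *s x j))"
      using i x H insert.hyps by (intro fs) (auto intro: subspace_scale)
    also have "\<dots> = (\<Sum>j\<in>I. f j y * f i (x j))"
      using i x insert.prems(2) by (intro sum.cong) auto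
    finally show ?thesis by simp
  qed
  have fzI: "f i z = 0" if "i \<in> I" for i
  proof -
    have "(\<Sum>j\<in>I. f j y * f i (x j)) = (\<Sum>j\<in>I. if j = i then f j y else 0)"
      using x that by (intro sum.cong) auto
    then show ?thesis using fz[of i] that insert.hyps by simp
  qed
  have fzk: "f k z = g y" using fz[of k] by (simp add: g_def mult.commute)
  define u where "u = inverse (g y) *s z"
  have u: "u \<in> H" "f k u = 1" "\<And>i. i \<in> I \<Longrightarrow> f i u = 0"
    using zH fzk fzI y H insert.prems(2) by (auto simp: u_def subspace_scale)
  define x' where "x' i = (if i = k then u else x i + (- f k (x i)) *s u)" for i
  have "x' i \<in> H \<and> (\<forall>j\<in>insert k I. f j (x' i) = (if i = j then 1 else 0))" if "i \<in> insert k I" for i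
  proof (cases "i = k")
    case True
    then show ?thesis using u insert.hyps by (auto simp: x'_def)
  next
    case False
    then have i: "i \<in> I" using that by simp
    have us: "(- f k (x i)) *s u \<in> H" using u H by (intro subspace_scale)
    have "f j (x' i) = f j (x i) + (- f k (x i)) * f j u" if "j \<in> insert k I" for j
      using False insert.prems(1)[OF that x(1)[OF i] us] insert.prems(2)[OF that u(1)]
      by (simp add: x'_def del: scale_minus_left)
    moreover have "x' i \<in> H"
      using False x(1)[OF i] us subspace_add[OF H] by (simp add: x'_def del: scale_minus_left)
    moreover have "f j (x i) + (- f k (x i)) * f j u = (if i = j then 1 else 0)" if "j \<in> insert k I" for j
      using False that u(2) u(3)[of j] x(2)[OF i, of j] by (cases "j = k") auto
    ultimately show ?thesis by simp
  qed
  then show ?case by (intro exI[of _ x'] ballI)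
qed

end

section \<open>Semisimple Lie algebras with a Cartan subalgebra\<close>

locale lie_cartan =
  fixes D :: "'g::ab_group_add q_boson_data"
  assumes lie: "fin_dim_lie_algebra D" and semisimple: "semisimple D"
    and cartan: "is_cartan_subalgebra D" and simple: "are_simple_roots D"
begin

abbreviation "br \<equiv> bracket D"
abbreviation "sc \<equiv> scal D"
abbreviation "hh \<equiv> cartan D"

sublocale vs: vector_space "scal D"
  using lie by (simp add: fin_dim_lie_algebra_def)

lemma independent_finite: "vs.independent A \<Longrightarrow> finite A"
proof -
  obtain T where "finite T" "vs.span T = UNIV"
    using lie by (auto simp: fin_dim_lie_algebra_def)
  then show "vs.independent A \<Longrightarrow> finite A"
    using vs.independent_span_bound[of T A] by auto
qed

lemma br_add: "br (x + y) z = br x z + br y z" "br x (y + z) = br x y + br x z"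
  and br_scale: "br (sc c x) y = sc c (br x y)" "br x (sc c y) = sc c (br x y)"
  and br_self [simp]: "br x x = 0"
  using lie by (simp_all add: fin_dim_lie_algebra_def)

lemma br_zero [simp]: "br 0 x = 0" "br x 0 = 0"
  using br_add(1)[of 0 0 x] br_add(2)[of x 0 0] by simp_all

lemma br_anti: "br x y = - br y x"
proof -
  have "br (x + y) (x + y) = br x y + br y x" by (simp only: br_add) simp
  then show ?thesis by (simp add: eq_neg_iff_add_eq_0)
qed

lemma br_minus: "br (- x) y = - br x y" "br x (- y) = - br x y"
  using br_add(1)[of x "- x" y] br_add(2)[of x y "- y"] by (simp_all add: eq_neg_iff_add_eq_0 add.commute)

lemma br_diff: "br (x - y) z = br x z - br y z" "br x (y - z) = br x y - br x z"
  using br_add(1)[of x "- y" z] br_add(2)[of x y "- z"] by (simp_all add: br_minus)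

lemma br_sum: "br (sum f A) y = (\<Sum>a\<in>A. br (f a) y)" "br y (sum f A) = (\<Sum>a\<in>A. br y (f a))"
  by (induction A rule: infinite_finite_induct) (auto simp: br_add)

lemma jacobi: "br x (br y z) = br (br x y) z + br y (br x z)"
proof -
  have "br x (br y z) + br y (br z x) + br z (br x y) = 0"
    using lie by (auto simp: fin_dim_lie_algebra_def)
  then show ?thesis
    using br_anti[of z x] br_anti[of z "br x y"] by (simp add: br_minus algebra_simps)
qed

lemma abelian_ideal_zero:
  assumes "lie_ideal D I" "\<And>x y. x \<in> I \<Longrightarrow> y \<in> I \<Longrightarrow> br x y = 0"
  shows "I = {0}"
proof -
  have "0 \<in> I" using assms(1) vs.subspace_0[of I] by (simp add: lie_ideal_def)
  then have "{br x y |x y. x \<in> I \<and> y \<in> I} = {0}" using assms(2) by auto (use br_zero in metis)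
  then have "derived D I = {0}" by (simp add: derived_def)
  then have "(derived D ^^ 1) I = {0}" by simp
  then show ?thesis using semisimple assms(1) unfolding semisimple_def by blast
qed

lemma center_zero: assumes "\<And>y. br x y = 0" shows "x = 0"
proof -
  have "lie_ideal D {z. \<forall>y. br z y = 0}"
    by (auto simp: lie_ideal_def vs.subspace_def br_add br_scale)
      (metis br_anti br_zero(1) neg_equal_0_iff_equal)
  then have "{z. \<forall>y. br z y = 0} = {0}" by (rule abelian_ideal_zero) auto
  then show ?thesis using assms by auto
qed

lemma cartan_subspace: "vs.subspace hh" and cartan_abelian: "x \<in> hh \<Longrightarrow> y \<in> hh \<Longrightarrow> br x y = 0"
  and cartan_maximal: "abelian_subalgebra D S \<Longrightarrow> hh \<subseteq> S \<Longrightarrow> S = hh"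
  and cartan_diag: "H \<in> hh \<Longrightarrow> vs.span {x. \<exists>c. br H x = sc c x} = UNIV"
  using cartan by (auto simp: is_cartan_subalgebra_def abelian_subalgebra_def)

text \<open>Adjoining \<open>x\<close> gives an abelian subalgebra that contains the Cartan subalgebra, which is maximal.\<close>

lemma centralizer_cartan: assumes "\<And>h. h \<in> hh \<Longrightarrow> br h x = 0" shows "x \<in> hh"
proof -
  let ?S = "vs.span (insert x hh)"
  have x: "br x h = 0" if "h \<in> hh" for h using assms[OF that] br_anti[of x h] by simp
  have sp: "vs.span hh = hh" using cartan_subspace by (simp add: vs.span_eq_iff)
  have S: "\<exists>h k. h \<in> hh \<and> y = h + sc k x" if "y \<in> ?S" for y
  proof -
    have "\<exists>k. y - sc k x \<in> hh" using that by (simp add: vs.span_insert sp)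
    then obtain k where "y - sc k x \<in> hh" ..
    then show ?thesis by (intro exI[of _ "y - sc k x"] exI[of _ k]) auto
  qed
  have "br y z = 0" if "y \<in> ?S" "z \<in> ?S" for y z
    using S[OF that(1)] S[OF that(2)]
    by (auto simp: br_add br_scale assms x cartan_abelian)
  then have "abelian_subalgebra D ?S" by (auto simp: abelian_subalgebra_def)
  moreover have "hh \<subseteq> ?S" by (meson subset_insertI subset_trans vs.span_superset)
  ultimately have "?S = hh" by (rule cartan_maximal)
  then show ?thesis by (metis insertI1 vs.span_base)
qed

definition wspace :: "('g \<Rightarrow> complex) \<Rightarrow> 'g set" where
  "wspace l = {x. \<forall>h\<in>hh. br h x = sc (l h) x}"

lemma wspace_zero: "wspace 0 \<subseteq> hh"
  by (auto simp: wspace_def intro: centralizer_cartan)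

lemma br_wspace:
  assumes "x \<in> wspace l" "y \<in> wspace m" shows "br x y \<in> wspace (l + m)"
  using assms by (auto simp: wspace_def jacobi[of _ x y] br_scale vs.scale_left_distrib)

lemma dual_cartanD:
  assumes "l \<in> dual_cartan D"
  shows "x \<in> hh \<Longrightarrow> y \<in> hh \<Longrightarrow> l (x + y) = l x + l y" "x \<in> hh \<Longrightarrow> l (sc c x) = c * l x"
    "x \<notin> hh \<Longrightarrow> l x = 0"
  using assms by (auto simp: dual_cartan_def)

lemma dual_cartan_sum:
  assumes "l \<in> dual_cartan D" "finite A" "\<And>a. a \<in> A \<Longrightarrow> f a \<in> hh"
  shows "l (sum f A) = (\<Sum>a\<in>A. l (f a))"
  using assms(2,3)
proof (induction A rule: finite_induct)
  case empty
  show ?case using dual_cartanD(2)[OF assms(1), of 0 0] cartan_subspace by (simp add: vs.subspace_0)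
next
  case (insert a A)
  have "l (f a + sum f A) = l (f a) + l (sum f A)"
    by (intro dual_cartanD[OF assms(1)] vs.subspace_sum[OF cartan_subspace] insert.prems) auto
  then show ?case using insert by simp
qed

text \<open>The eigenvalues of a joint eigenvector depend linearly on the element of the Cartan subalgebra.\<close>

lemma weight_functional:
  assumes "x \<noteq> 0" and "\<And>h. h \<in> hh \<Longrightarrow> \<exists>c. br h x = sc c x"
  shows "\<exists>l\<in>insert 0 (roots D). x \<in> wspace l"
proof -
  define l where "l h = (if h \<in> hh then SOME c. br h x = sc c x else 0)" for h
  have l: "br h x = sc (l h) x" if "h \<in> hh" for h
    using someI_ex[OF assms(2)[OF that]] that by (simp add: l_def)
  have eq: "c = d" if "sc c x = sc d x" for c d
    using that assms(1) vs.scale_cancel_right by blast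
  have "l (h + k) = l h + l k" if "h \<in> hh" "k \<in> hh" for h k
    using l[OF that(1)] l[OF that(2)] l[OF vs.subspace_add[OF cartan_subspace that]]
    by (intro eq) (simp add: br_add vs.scale_left_distrib)
  moreover have "l (sc c h) = c * l h" if "h \<in> hh" for h c
    using l[OF that] l[OF vs.subspace_scale[OF cartan_subspace that, of c]]
    by (intro eq) (auto simp: br_scale)
  ultimately have "l \<in> dual_cartan D" by (auto simp: dual_cartan_def l_def)
  moreover have "x \<in> wspace l" using l by (simp add: wspace_def)
  ultimately show ?thesis using assms(1) l by (cases "l = 0") (auto simp: roots_def)
qed

lemma weight_vectors_span:
  assumes W: "vs.subspace W" "\<And>h x. h \<in> hh \<Longrightarrow> x \<in> W \<Longrightarrow> br h x \<in> W"
  shows "W \<subseteq> vs.span {x \<in> W. \<exists>l\<in>insert 0 (roots D). x \<in> wspace l}"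
proof -
  obtain T where T: "T \<subseteq> hh" "vs.independent T" "hh \<subseteq> vs.span T"
    using vs.maximal_independent_subset by blast
  have fin: "finite T" using T independent_finite by blast
  have comm: "br h (br k x) = br k (br h x)" if "h \<in> T" "k \<in> T" for h k x
    using jacobi[of h k x] cartan_abelian[of h k] that T(1) by (metis add.left_neutral br_zero(1) subsetD)
  have "W \<subseteq> vs.span {x \<in> W. \<forall>h\<in>T. \<exists>c. br h x = sc c x}"
    using T(1) W(2)
    by (intro vs.joint_eigenvectors_span[where f = br, OF fin _ _ comm _ W(1)] br_add br_scale cartan_diag) auto
  also have "{x \<in> W. \<forall>h\<in>T. \<exists>c. br h x = sc c x} \<subseteq> {x \<in> W. \<exists>l\<in>insert 0 (roots D). x \<in> wspace l}"
  proof (intro Collect_mono impI conjI; elim conjE)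
    fix x assume x: "\<forall>h\<in>T. \<exists>c. br h x = sc c x"
    have "\<exists>c. br h x = sc c x" if "h \<in> vs.span T" for h
      using that
    proof (induction rule: vs.span_induct_alt)
      case base
      show ?case by (auto intro!: exI[of _ 0])
    next
      case (step c y z)
      then have "\<exists>d. br z x = sc d x" "\<exists>e. br y x = sc e x" using x by blast+
      then obtain d e where "br z x = sc d x" "br y x = sc e x" by blast
      then show ?case by (intro exI[of _ "c * e + d"]) (simp add: br_add br_scale vs.scale_left_distrib)
    qed
    then show "\<exists>l\<in>insert 0 (roots D). x \<in> wspace l"
      using weight_functional[of x] T(3) by (cases "x = 0") (auto simp: wspace_def)
  qed
  finally show ?thesis using vs.span_mono by blast
qed

lemma simple_rootD:
  "i \<in> nodes D \<Longrightarrow> simple_root D i \<in> roots D" "i \<in> nodes D \<Longrightarrow> simple_root D i \<in> dual_cartan D"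
  using simple by (auto simp: are_simple_roots_def roots_def)

lemma finite_nodes [simp]: "finite (nodes D)"
  by (simp add: nodes_def)

lemma dual_basis_exists:
  "\<exists>x. \<forall>i\<in>nodes D. x i \<in> hh \<and> (\<forall>j\<in>nodes D. simple_root D j (x i) = (if i = j then 1 else 0))"
proof (rule vs.dual_family_exists[OF _ cartan_subspace])
  fix c i assume c: "\<And>x. x \<in> hh \<Longrightarrow> (\<Sum>i\<in>nodes D. c i * simple_root D i x) = 0" and i: "i \<in> nodes D"
  have "(\<Sum>i\<in>nodes D. c i * simple_root D i x) = 0" for x
    using c[of x] dual_cartanD(3)[OF simple_rootD(2)] by (cases "x \<in> hh") (simp_all add: sum.neutral)
  moreover have "(\<forall>x. (\<Sum>i\<in>nodes D. c i * simple_root D i x) = 0) \<longrightarrow> (\<forall>i\<in>nodes D. c i = 0)"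
    using simple by (simp add: are_simple_roots_def)
  ultimately show "c i = 0" using i by simp
qed (simp_all add: dual_cartanD(1,2)[OF simple_rootD(2)])

end

text \<open>A basis of weight vectors, and the basis of the Cartan subalgebra dual to the simple roots.\<close>

locale root_data = lie_cartan D for D :: "'g::ab_group_add q_boson_data" +
  fixes B :: "'g set" and wt :: "'g \<Rightarrow> 'g \<Rightarrow> complex" and Hd :: "nat \<Rightarrow> 'g"
  assumes B_indep: "vs.independent B" and B_span: "vs.span B = UNIV"
    and B_wt: "b \<in> B \<Longrightarrow> wt b \<in> insert 0 (roots D)" "b \<in> B \<Longrightarrow> b \<in> wspace (wt b)"
    and Hd: "i \<in> nodes D \<Longrightarrow> Hd i \<in> hh"
      "i \<in> nodes D \<Longrightarrow> j \<in> nodes D \<Longrightarrow> simple_root D j (Hd i) = (if i = j then 1 else 0)"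

lemma (in lie_cartan) root_data_exists: "\<exists>B wt Hd. root_data D B wt Hd"
proof -
  let ?E = "{x \<in> UNIV. \<exists>l\<in>insert 0 (roots D). x \<in> wspace l}"
  have E: "vs.span ?E = UNIV" using weight_vectors_span[of UNIV] vs.subspace_UNIV by blast
  obtain B where B: "B \<subseteq> ?E" "vs.independent B" "?E \<subseteq> vs.span B"
    using vs.maximal_independent_subset by blast
  have "vs.span ?E \<subseteq> vs.span B" using B(3) by (intro vs.span_minimal vs.subspace_span)
  then have span: "vs.span B = UNIV" using E by blast
  have "\<forall>b\<in>B. \<exists>l. l \<in> insert 0 (roots D) \<and> b \<in> wspace l" using B(1) by blast
  then obtain wt where wt: "\<forall>b\<in>B. wt b \<in> insert 0 (roots D) \<and> b \<in> wspace (wt b)"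
    by (rule bchoice[THEN exE])
  obtain Hd where Hd: "\<forall>i\<in>nodes D. Hd i \<in> hh \<and> (\<forall>j\<in>nodes D. simple_root D j (Hd i) = (if i = j then 1 else 0))"
    using dual_basis_exists ..
  have "root_data D B wt Hd"
    by (intro root_data.intro root_data_axioms.intro lie_cartan_axioms)
      (use B(2) span wt Hd in \<open>blast+\<close>)
  then show ?thesis by blast
qed

context root_data
begin

lemma B_finite: "finite B" using B_indep by (rule independent_finite)

abbreviation "rep \<equiv> vs.representation B"

lemma rep_sum: "(\<Sum>b\<in>B. sc (rep x b) b) = x"
  using vs.sum_representation_eq[of B x B] B_indep B_span B_finite by auto

lemma rep_linear: "rep (x + y) b = rep x b + rep y b" "rep (x - y) b = rep x b - rep y b"
  "rep (sc c x) b = c * rep x b" "rep 0 b = 0"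
  using B_indep B_span
  by (simp_all add: vs.representation_add vs.representation_diff vs.representation_scale vs.representation_zero)

lemma br_B: "h \<in> hh \<Longrightarrow> b \<in> B \<Longrightarrow> br h b = sc (wt b h) b"
  using B_wt(2)[of b] by (simp add: wspace_def)

lemma rep_B: "b \<in> B \<Longrightarrow> rep b c = (if c = b then 1 else 0)"
  using vs.representation_basis[OF B_indep] by auto

lemma rep_br:
  assumes "h \<in> hh" "b \<in> B" shows "rep (br h x) b = wt b h * rep x b"
proof -
  have "br h x = (\<Sum>c\<in>B. sc (rep x c * wt c h) c)"
    by (subst rep_sum[of x, symmetric]) (simp add: br_sum br_scale br_B assms(1))
  then have "rep (br h x) b = (\<Sum>c\<in>B. rep x c * wt c h * rep c b)"
    using B_indep B_span by (simp add: vs.representation_sum vs.representation_scale)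
  also have "\<dots> = (\<Sum>c\<in>B. if c = b then rep x c * wt c h else 0)"
    by (intro sum.cong) (auto simp: rep_B)
  finally show ?thesis using assms(2) B_finite by simp
qed

lemma rep_nonzero: "x \<noteq> 0 \<Longrightarrow> \<exists>b\<in>B. rep x b \<noteq> 0"
proof (rule ccontr)
  assume "\<not> (\<exists>b\<in>B. rep x b \<noteq> 0)"
  then have "(\<Sum>b\<in>B. sc (rep x b) b) = 0" by (intro sum.neutral) auto
  then show "x \<noteq> 0 \<Longrightarrow> False" by (simp add: rep_sum)
qed

lemma eigenvalue_is_weight:
  assumes "h \<in> hh" "x \<noteq> 0" "br h x = sc c x"
  shows "\<exists>b\<in>B. wt b h = c"
proof -
  obtain b where b: "b \<in> B" "rep x b \<noteq> 0" using rep_nonzero[OF assms(2)] by blast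
  have "wt b h * rep x b = c * rep x b"
    using rep_br[OF assms(1) b(1), of x] unfolding assms(3) rep_linear by (rule sym)
  then have "wt b h = c" using b(2) by auto
  then show ?thesis using b(1) by blast
qed

lemma weights_separate:
  assumes "h \<in> hh" "\<And>b. b \<in> B \<Longrightarrow> wt b h = 0"
  shows "h = 0"
proof (rule center_zero)
  fix y
  show "br h y = 0"
    by (subst rep_sum[of y, symmetric]) (simp add: br_sum br_scale br_B assms)
qed

text \<open>The height grading is given by the element of the Cartan subalgebra on which all simple roots
  take the value \<open>1\<close>.\<close>

definition "H0 = (\<Sum>i\<in>nodes D. Hd i)"

lemma H0: "H0 \<in> hh" unfolding H0_def by (intro vs.subspace_sum[OF cartan_subspace] Hd)

lemma simple_root_H0: "i \<in> nodes D \<Longrightarrow> simple_root D i H0 = 1"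
  by (simp add: H0_def dual_cartan_sum[OF simple_rootD(2)] Hd)

lemma root_height:
  assumes "\<beta> \<in> roots D" shows "\<exists>k::int. k \<noteq> 0 \<and> \<beta> H0 = of_int k"
proof -
  obtain k :: "nat \<Rightarrow> nat" where k: "\<beta> = (\<lambda>x. \<Sum>i\<in>nodes D. of_nat (k i) * simple_root D i x) \<or>
        \<beta> = (\<lambda>x. - (\<Sum>i\<in>nodes D. of_nat (k i) * simple_root D i x))"
    using simple assms unfolding are_simple_roots_def by blast
  let ?n = "\<Sum>i\<in>nodes D. k i"
  have "(\<Sum>i\<in>nodes D. of_nat (k i) * simple_root D i H0) = of_nat ?n"
    by (simp add: simple_root_H0)
  then have *: "\<beta> H0 = of_int (int ?n) \<or> \<beta> H0 = of_int (- int ?n)" using k by auto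
  have "?n \<noteq> 0"
  proof
    assume "?n = 0"
    then have "\<forall>i\<in>nodes D. k i = 0" by simp
    then have "\<beta> = 0" using k by (auto simp: fun_eq_iff)
    then show False using assms by (simp add: roots_def)
  qed
  moreover obtain l :: int where "l = int ?n \<or> l = - int ?n" "\<beta> H0 = of_int l" using * by blast
  ultimately have "l \<noteq> 0" by (auto simp del: of_nat_sum sum_eq_0_iff)
  then show ?thesis using \<open>\<beta> H0 = of_int l\<close> by blast
qed

definition hgt :: "'g \<Rightarrow> int" where "hgt b = (SOME k. wt b H0 = of_int k)"

lemma wt_H0: assumes "b \<in> B" shows "wt b H0 = of_int (hgt b)"
proof -
  have "\<exists>k::int. wt b H0 = of_int k"
    using B_wt(1)[OF assms] root_height[of "wt b"] by (auto intro: exI[of _ 0])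
  then show ?thesis unfolding hgt_def by (rule someI_ex)
qed

lemma hgt_zero: "b \<in> B \<Longrightarrow> hgt b = 0 \<Longrightarrow> wt b = 0"
  using B_wt(1)[of b] root_height[of "wt b"] wt_H0[of b] by auto

definition gr :: "int \<Rightarrow> 'g set" where "gr k = {x. br H0 x = sc (of_int k) x}"

lemma subspace_gr: "vs.subspace (gr k)"
  by (auto simp: vs.subspace_def gr_def br_add br_scale vs.scale_right_distrib mult.commute)

lemma br_gr: "x \<in> gr j \<Longrightarrow> y \<in> gr k \<Longrightarrow> br x y \<in> gr (j + k)"
  by (simp add: gr_def jacobi[of _ x y] br_scale vs.scale_left_distrib)

lemma gr_nonzero: assumes "x \<in> gr k" "x \<noteq> 0" shows "k \<in> hgt ` B"
proof -
  obtain b where b: "b \<in> B" "wt b H0 = of_int k"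
    using eigenvalue_is_weight[OF H0 assms(2), of "of_int k"] assms(1) by (auto simp: gr_def)
  then have "hgt b = k" using wt_H0[OF b(1)] by simp
  then show ?thesis using b(1) by blast
qed

lemma wspace_gr: "x \<in> wspace l \<Longrightarrow> l H0 = of_int k \<Longrightarrow> x \<in> gr k"
  using H0 by (simp add: wspace_def gr_def)

lemma gr_zero: "gr 0 = hh"
proof
  show "hh \<subseteq> gr 0" using cartan_abelian[OF H0] by (auto simp: gr_def)
  show "gr 0 \<subseteq> hh"
  proof
    fix x assume x: "x \<in> gr 0"
    have "sc (rep x b) b \<in> hh" if b: "b \<in> B" for b
    proof (cases "rep x b = 0")
      case True
      then show ?thesis using vs.subspace_0[OF cartan_subspace] by simp
    next
      case False
      have "of_int (hgt b) * rep x b = 0"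
        using rep_br[OF H0 b, of x] x wt_H0[OF b] by (simp add: gr_def rep_linear)
      then have "wt b = 0" using False hgt_zero[OF b] by simp
      then have "b \<in> hh" using B_wt(2)[OF b] wspace_zero by auto
      then show ?thesis by (rule vs.subspace_scale[OF cartan_subspace])
    qed
    then have "(\<Sum>b\<in>B. sc (rep x b) b) \<in> hh" by (intro vs.subspace_sum[OF cartan_subspace])
    then show "x \<in> hh" by (simp add: rep_sum)
  qed
qed

lemma gr_expansion:
  obtains v where "\<And>k. v k \<in> gr k" "x = (\<Sum>k\<in>hgt ` B. v k)"
proof
  let ?v = "\<lambda>k. \<Sum>b\<in>{b \<in> B. hgt b = k}. sc (rep x b) b"
  show "?v k \<in> gr k" for k
  proof (intro vs.subspace_sum[OF subspace_gr] vs.subspace_scale[OF subspace_gr])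
    fix b assume "b \<in> {b \<in> B. hgt b = k}"
    then show "b \<in> gr k" using wspace_gr[OF B_wt(2)] wt_H0 by auto
  qed
  show "x = (\<Sum>k\<in>hgt ` B. ?v k)"
    using sum.image_gen[OF B_finite, of "\<lambda>b. sc (rep x b) b" hgt] by (simp add: rep_sum)
qed

text \<open>The iterates have pairwise different heights, and only finitely many heights occur.\<close>

lemma ad_nilpotent:
  assumes "x \<in> gr p" "p \<noteq> 0" "v \<in> gr q"
  shows "\<exists>m. (br x ^^ m) v = 0"
proof (rule ccontr)
  assume nz: "\<not> ?thesis"
  have "(br x ^^ m) v \<in> gr (q + int m * p)" for m
  proof (induction m)
    case (Suc m)
    from br_gr[OF assms(1) Suc] show ?case by (simp add: algebra_simps)
  qed (use assms in simp)
  then have "range (\<lambda>m. q + int m * p) \<subseteq> hgt ` B" using gr_nonzero nz by blast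
  then have "finite (range (\<lambda>m. q + int m * p))" using B_finite finite_subset by blast
  moreover have "inj (\<lambda>m. q + int m * p)" using assms(2) by (auto intro: injI)
  ultimately show False using finite_imageD by blast
qed

text \<open>The eigenvalue computation for \<open>sl\<^sub>2\<close>: apply \<open>x\<close> to an eigenvector of \<open>[x, y]\<close> as often as
  possible, then \<open>y\<close> as often as possible.  The Heisenberg case \<open>a = 0\<close> is included; there the
  conclusion says that \<open>[x, y]\<close> has no eigenvalue other than \<open>0\<close>.\<close>

lemma sl2_eigenvalues:
  assumes x: "x \<in> gr p" and y: "y \<in> gr (- p)" and p: "p \<noteq> 0"
    and hx: "br (br x y) x = sc a x" and hy: "br (br x y) y = sc (- a) y"
    and v: "v \<in> gr q" "v \<noteq> 0" "br (br x y) v = sc c v"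
  shows "\<exists>k::int. 2 * c = of_int k * a"
proof -
  let ?h = "br x y"
  define M where "M = (LEAST m. (br x ^^ m) v = 0)"
  have M0: "(br x ^^ M) v = 0" unfolding M_def by (rule LeastI_ex[OF ad_nilpotent[OF x p v(1)]])
  then obtain m where m: "M = Suc m" using v(2) by (cases M) auto
  define u where "u = (br x ^^ m) v"
  have u0: "u \<noteq> 0" unfolding u_def using not_less_Least[of m "\<lambda>m. (br x ^^ m) v = 0"] m by (simp add: M_def)
  have xu: "br x u = 0" using M0 m by (simp add: u_def)
  have hu: "br ?h u = sc (c + of_nat m * a) u"
  proof -
    have "br ?h ((br x ^^ j) v) = sc (c + of_nat j * a) ((br x ^^ j) v)" for j
    proof (induction j)
      case (Suc j)
      have "br ?h (br x ((br x ^^ j) v)) = sc a (br x ((br x ^^ j) v)) + sc (c + of_nat j * a) (br x ((br x ^^ j) v))"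
        by (simp only: jacobi[of ?h x] hx br_scale Suc)
      also have "\<dots> = sc (a + (c + of_nat j * a)) (br x ((br x ^^ j) v))"
        by (rule vs.scale_left_distrib[symmetric])
      finally have "br ?h (br x ((br x ^^ j) v)) = \<dots>" .
      then show ?case by (simp add: algebra_simps)
    qed (use v in simp)
    then show ?thesis by (simp add: u_def)
  qed
  have ugr: "u \<in> gr (q + int m * p)"
  proof -
    have "(br x ^^ j) v \<in> gr (q + int j * p)" for j
    proof (induction j)
      case (Suc j)
      from br_gr[OF x Suc] show ?case by (simp add: algebra_simps)
    qed (use v in simp)
    then show ?thesis by (simp add: u_def)
  qed
  define c' where "c' = c + of_nat m * a"
  define w where "w j = (br y ^^ j) u" for j
  have wS: "w (Suc j) = br y (w j)" for j by (simp add: w_def)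
  have hw: "br ?h (w j) = sc (c' - of_nat j * a) (w j)" for j
  proof (induction j)
    case (Suc j)
    have "br ?h (br y (w j)) = sc (- a) (br y (w j)) + sc (c' - of_nat j * a) (br y (w j))"
      by (simp only: jacobi[of ?h y] hy br_scale Suc)
    also have "\<dots> = sc (- a + (c' - of_nat j * a)) (br y (w j))"
      by (rule vs.scale_left_distrib[symmetric])
    finally have "br ?h (br y (w j)) = \<dots>" .
    moreover have "- a + (c' - of_nat j * a) = c' - of_nat (Suc j) * a" by (simp add: algebra_simps)
    ultimately show ?case by (simp only: wS)
  qed (use hu in \<open>simp add: w_def c'_def\<close>)
  have xw: "br x (w (Suc j)) = sc (of_nat (Suc j) * (c' - of_nat j * a / 2)) (w j)" for j
  proof (induction j)
    case 0
    then show ?case using hw[of 0] xu by (simp add: wS jacobi[of x y]) (simp add: w_def)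
  next
    case (Suc j)
    have "br x (w (Suc (Suc j))) = br ?h (w (Suc j)) + br y (br x (w (Suc j)))"
      by (simp add: wS[of "Suc j"] jacobi[of x y])
    also have "\<dots> = sc ((c' - of_nat (Suc j) * a) + of_nat (Suc j) * (c' - of_nat j * a / 2)) (w (Suc j))"
      unfolding Suc hw by (simp only: br_scale wS[symmetric] vs.scale_left_distrib)
    also have "(c' - of_nat (Suc j) * a) + of_nat (Suc j) * (c' - of_nat j * a / 2)
        = of_nat (Suc (Suc j)) * (c' - of_nat (Suc j) * a / 2)"
      by (simp add: field_simps)
    finally show ?case .
  qed
  have ex: "\<exists>j. w j = 0" unfolding w_def using ad_nilpotent[OF y _ ugr] p by simp
  define N where "N = (LEAST j. w j = 0)"
  have N0: "w N = 0" unfolding N_def by (rule LeastI_ex[OF ex])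
  then obtain n where n: "N = Suc n" using u0 by (cases N) (auto simp: w_def)
  have wn: "w n \<noteq> 0" using not_less_Least[of n "\<lambda>j. w j = 0"] n by (simp add: N_def)
  have "of_nat (Suc n) * (c' - of_nat n * a / 2) = 0"
    using xw[of n] N0 n wn by simp
  then have "c' = of_nat n * a / 2" by (simp del: of_nat_Suc)
  then have "2 * c' = of_nat n * a" by (simp add: mult.commute)
  then have "2 * c = of_int (int n - 2 * int m) * a"
    by (simp add: c'_def algebra_simps)
  then show ?thesis by blast
qed

text \<open>The bracket \<open>h\<close> of opposite root vectors acts on them by \<open>\<plusminus>\<alpha>(h)\<close>, so the \<open>sl\<^sub>2\<close> computation applies to
  every weight vector.  If \<open>\<alpha>(h)\<close> were zero, all weights would vanish on \<open>h\<close> and \<open>h\<close> would be central.\<close>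

lemma root_bracket:
  assumes \<alpha>: "\<alpha> \<in> roots D" and x: "x \<in> wspace \<alpha>" and y: "y \<in> wspace (- \<alpha>)"
  shows "br x y \<in> hh" and "b \<in> B \<Longrightarrow> \<exists>k::int. 2 * wt b (br x y) = of_int k * \<alpha> (br x y)"
    and "br x y \<noteq> 0 \<Longrightarrow> \<alpha> (br x y) \<noteq> 0"
proof -
  obtain p :: int where p: "p \<noteq> 0" "\<alpha> H0 = of_int p" using root_height[OF \<alpha>] by blast
  have xg: "x \<in> gr p" and yg: "y \<in> gr (- p)" using wspace_gr x y p by auto
  show h: "br x y \<in> hh" using br_gr[OF xg yg] gr_zero by simp
  have *: "\<exists>k::int. 2 * wt b (br x y) = of_int k * \<alpha> (br x y)" if b: "b \<in> B" for b
  proof (rule sl2_eigenvalues[OF xg yg p(1)])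
    show "br (br x y) x = sc (\<alpha> (br x y)) x" "br (br x y) y = sc (- \<alpha> (br x y)) y"
      using x y h by (simp_all add: wspace_def)
    show "b \<in> gr (hgt b)" using wspace_gr[OF B_wt(2)] wt_H0 b by auto
    show "b \<noteq> 0" using b B_indep vs.dependent_zero by blast
    show "br (br x y) b = sc (wt b (br x y)) b" using br_B[OF h b] .
  qed
  then show "b \<in> B \<Longrightarrow> \<exists>k::int. 2 * wt b (br x y) = of_int k * \<alpha> (br x y)" .
  show "\<alpha> (br x y) \<noteq> 0" if "br x y \<noteq> 0"
  proof
    assume "\<alpha> (br x y) = 0"
    then have "wt b (br x y) = 0" if "b \<in> B" for b using *[OF that] by auto
    then show False using weights_separate[OF h] \<open>br x y \<noteq> 0\<close> by blast
  qed
qed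

end

section \<open>The Killing form\<close>

context root_data
begin

abbreviation "kil \<equiv> killing D"

lemma lin_trace_B:
  assumes f: "\<And>x y. f (x + y) = f x + f y" "\<And>c x. f (sc c x) = sc c (f x)"
  shows "lin_trace sc f = (\<Sum>b\<in>B. rep (f b) b)"
proof -
  define C where "C = (SOME C. \<not> vs.dependent C \<and> vs.span C = UNIV)"
  have C: "vs.independent C \<and> vs.span C = UNIV"
    unfolding C_def by (rule someI[of _ B]) (simp add: B_indep B_span)
  have "lin_trace sc f = (\<Sum>b\<in>C. vs.representation C (f b) b)"
    by (simp add: lin_trace_def Let_def C_def)
  also have "\<dots> = (\<Sum>b\<in>B. rep (f b) b)"
    using C independent_finite[of C] by (intro vs.trace_basis_indep B_finite B_indep B_span f) auto
  finally show ?thesis .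
qed

lemma killing_B: "kil x y = (\<Sum>b\<in>B. rep (br x (br y b)) b)"
  unfolding killing_def by (rule lin_trace_B) (simp_all add: br_add br_scale)

lemma kil_linear:
  "kil (x + y) z = kil x z + kil y z" "kil z (x + y) = kil z x + kil z y"
  "kil (sc c x) z = c * kil x z" "kil z (sc c x) = c * kil z x"
  by (simp_all add: killing_B br_add br_scale rep_linear sum.distrib sum_distrib_left)

lemma kil_zero [simp]: "kil 0 x = 0" "kil x 0 = 0"
  using kil_linear(3)[of 0 0 x] kil_linear(4)[where c = 0 and x = 0 and z = x] by simp_all

lemma kil_sum: "kil (sum f A) y = (\<Sum>a\<in>A. kil (f a) y)" "kil y (sum f A) = (\<Sum>a\<in>A. kil y (f a))"
  by (induction A rule: infinite_finite_induct) (simp_all add: kil_linear)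

lemma kil_minus: "kil (- x) z = - kil x z"
  using kil_linear(1)[of x "- x" z] by (simp add: eq_neg_iff_add_eq_0 add.commute)

lemma kil_sym: "kil x y = kil y x"
  unfolding killing_B
  by (rule vs.trace_cyclic[OF B_finite B_indep B_span]) (simp_all add: br_add br_scale)

lemma kil_invariant: "kil (br x y) z = kil x (br y z)"
proof -
  have c: "(\<Sum>b\<in>B. rep (br y (br x (br z b))) b) = (\<Sum>b\<in>B. rep (br x (br z (br y b))) b)"
    by (rule vs.trace_cyclic[OF B_finite B_indep B_span, of "br y" "\<lambda>w. br x (br z w)"])
      (simp_all add: br_add br_scale)
  have j: "br (br u v) w = br u (br v w) - br v (br u w)" for u v w
    using jacobi[of u v w] by simp
  have "kil (br x y) z = (\<Sum>b\<in>B. rep (br x (br y (br z b))) b) - (\<Sum>b\<in>B. rep (br y (br x (br z b))) b)"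
    unfolding killing_B j rep_linear sum_subtractf ..
  also have "\<dots> = kil x (br y z)"
    unfolding killing_B j br_diff rep_linear sum_subtractf c ..
  finally show ?thesis .
qed

lemma kil_cartan:
  assumes "h \<in> hh" "k \<in> hh" shows "kil h k = (\<Sum>b\<in>B. wt b h * wt b k)"
  unfolding killing_B by (intro sum.cong refl) (simp add: rep_br assms rep_B)

lemma kil_eigenvectors:
  assumes "br h x = sc a x" "br h y = sc b y" "a + b \<noteq> 0"
  shows "kil x y = 0"
proof -
  have "kil (br x h) y = kil x (br h y)" by (rule kil_invariant)
  then have "- (a * kil x y) = b * kil x y"
    by (simp add: br_anti[of x h] assms(1,2) kil_minus kil_linear)
  then have "(a + b) * kil x y = 0" by (simp add: algebra_simps eq_neg_iff_add_eq_0 neg_eq_iff_add_eq_0)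
  then show ?thesis using assms(3) by simp
qed

text \<open>The radical of the Killing form; semisimplicity will force it to be zero.\<close>

definition "rad = {x. \<forall>y. kil x y = 0}"

lemma rad_subspace: "vs.subspace rad"
  by (auto simp: vs.subspace_def rad_def kil_linear)

lemma rad_br: assumes "x \<in> rad" shows "br x y \<in> rad" "br y x \<in> rad"
proof -
  show "br x y \<in> rad" using assms by (simp add: rad_def kil_invariant)
  then show "br y x \<in> rad" using vs.subspace_neg[OF rad_subspace] br_anti[of y x] by simp
qed

lemma rad_components:
  assumes "x \<in> rad" obtains v where "\<And>k. k \<in> hgt ` B \<Longrightarrow> v k \<in> rad \<inter> gr k" "x = (\<Sum>k\<in>hgt ` B. v k)"
proof -
  obtain v where v: "\<And>k. v k \<in> gr k" "x = (\<Sum>k\<in>hgt ` B. v k)" using gr_expansion by blast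
  have s: "(\<Sum>k\<in>hgt ` B. v k) \<in> rad" using assms v(2) by simp
  have "v k \<in> rad" if "k \<in> hgt ` B" for k
  proof (rule vs.eigencomponents_in_stable_subspace[OF rad_subspace _ br_add(2) br_scale(2) _ _ _ s that])
    show "inj_on (of_int :: int \<Rightarrow> complex) (hgt ` B)" by (auto intro: inj_onI)
    show "br H0 (v d) = sc (of_int d) (v d)" for d using v(1)[of d] by (simp add: gr_def)
  qed (use B_finite rad_br in auto)
  then show ?thesis using that[of v] v by blast
qed

text \<open>The radical contains no coroot: if \<open>h = [x, y] \<noteq> 0\<close>, then all weights take half-integral
  multiples of \<open>\<alpha>(h) \<noteq> 0\<close> as values on \<open>h\<close>, so \<open>\<kappa>(h, h)\<close> is \<open>\<alpha>(h)\<^sup>2\<close> times a positive number.\<close>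

lemma rad_root_bracket:
  assumes \<alpha>: "\<alpha> \<in> roots D" and x: "x \<in> rad" "x \<in> wspace \<alpha>" and y: "y \<in> wspace (- \<alpha>)"
  shows "br x y = 0"
proof (rule ccontr)
  let ?h = "br x y"
  assume nz: "?h \<noteq> 0"
  note rb = root_bracket[OF \<alpha> x(2) y]
  obtain k :: "'g \<Rightarrow> int" where k: "\<And>b. b \<in> B \<Longrightarrow> 2 * wt b ?h = of_int (k b) * \<alpha> ?h"
    using rb(2) by metis
  have w: "wt b ?h = of_int (k b) * (\<alpha> ?h / 2)" if "b \<in> B" for b
    using k[OF that] by (simp add: field_simps)
  have "kil ?h ?h = (\<Sum>b\<in>B. of_int ((k b)\<^sup>2) * (\<alpha> ?h / 2)\<^sup>2)"
    unfolding kil_cartan[OF rb(1) rb(1)]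
    by (intro sum.cong refl) (simp add: w power2_eq_square algebra_simps)
  also have "\<dots> = of_int (\<Sum>b\<in>B. (k b)\<^sup>2) * (\<alpha> ?h / 2)\<^sup>2"
    by (simp only: of_int_sum sum_distrib_right)
  finally have "of_int (\<Sum>b\<in>B. (k b)\<^sup>2) * (\<alpha> ?h / 2)\<^sup>2 = 0"
    using rad_br(1)[OF x(1), of y] by (simp add: rad_def)
  then have "(of_int (\<Sum>b\<in>B. (k b)\<^sup>2) :: complex) = 0"
    using rb(3)[OF nz] by (simp del: of_int_sum)
  then have "(\<Sum>b\<in>B. (k b)\<^sup>2) = 0" by (simp only: of_int_eq_0_iff)
  then have "k b = 0" if "b \<in> B" for b
    using that B_finite by (simp add: sum_nonneg_eq_0_iff)
  then have "wt b ?h = 0" if "b \<in> B" for b using w that by simp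
  then show False using weights_separate[OF rb(1)] nz by blast
qed

text \<open>Reduction to weight vectors.  The bracket of two weight vectors of opposite heights lies in the Cartan
  subalgebra and is again a weight vector, so it is zero unless the weights are opposite.\<close>

lemma rad_gr_bracket:
  assumes k: "k \<noteq> 0" and x: "x \<in> rad \<inter> gr k" and y: "y \<in> gr (- k)"
  shows "br x y = 0"
proof -
  let ?E1 = "{x \<in> rad \<inter> gr k. \<exists>l\<in>insert 0 (roots D). x \<in> wspace l}"
  let ?E2 = "{y \<in> gr (- k). \<exists>l\<in>insert 0 (roots D). y \<in> wspace l}"
  have stable: "br h z \<in> gr j" if "h \<in> hh" "z \<in> gr j" for h z j
    using br_gr[of h 0 z j] that gr_zero by simp
  have xE: "x \<in> vs.span ?E1"
    by (rule subsetD[OF weight_vectors_span x])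
      (use rad_br stable vs.subspace_inter[OF rad_subspace subspace_gr] in auto)
  have yE: "y \<in> vs.span ?E2"
    by (rule subsetD[OF weight_vectors_span y]) (use stable subspace_gr in auto)
  have E: "br u v = 0" if u: "u \<in> ?E1" and v: "v \<in> ?E2" for u v
  proof (cases "u = 0 \<or> v = 0")
    case False
    obtain \<alpha> where \<alpha>: "\<alpha> \<in> insert 0 (roots D)" "u \<in> wspace \<alpha>" using u by blast
    obtain \<beta> where \<beta>: "\<beta> \<in> insert 0 (roots D)" "v \<in> wspace \<beta>" using v by blast
    have "sc (\<alpha> H0) u = sc (of_int k) u" using \<alpha>(2) u H0 by (simp add: wspace_def gr_def)
    then have "\<alpha> H0 = of_int k" using False by simp
    then have "\<alpha> \<noteq> 0" using k by auto
    then have \<alpha>r: "\<alpha> \<in> roots D" using \<alpha>(1) by simp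
    have z: "br u v \<in> wspace (\<alpha> + \<beta>)" by (rule br_wspace[OF \<alpha>(2) \<beta>(2)])
    have zh: "br u v \<in> hh" using br_gr[of u k v "- k"] u v gr_zero by simp
    show ?thesis
    proof (cases "\<exists>h\<in>hh. (\<alpha> + \<beta>) h \<noteq> 0")
      case True
      then obtain h where h: "h \<in> hh" "(\<alpha> + \<beta>) h \<noteq> 0" by blast
      have "sc ((\<alpha> + \<beta>) h) (br u v) = 0"
        using z h(1) cartan_abelian[OF h(1) zh] by (simp add: wspace_def)
      then show ?thesis using h(2) by (simp only: vs.scale_eq_0_iff) simp
    next
      case no: False
      have "v \<in> wspace (- \<alpha>)"
        unfolding wspace_def
      proof (intro CollectI ballI)
        fix h assume h: "h \<in> hh"
        then have "\<alpha> h + \<beta> h = 0" using no by simp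
        then have "\<beta> h = (- \<alpha>) h" by (simp add: add_eq_0_iff)
        then show "br h v = sc ((- \<alpha>) h) v" using \<beta>(2) h by (simp add: wspace_def)
      qed
      then show ?thesis using rad_root_bracket[OF \<alpha>r _ \<alpha>(2)] u by simp
    qed
  qed auto
  have 1: "vs.subspace {u. \<forall>v\<in>?E2. br u v = 0}" by (auto simp: vs.subspace_def br_add br_scale)
  have "vs.span ?E1 \<subseteq> {u. \<forall>v\<in>?E2. br u v = 0}" using E by (intro vs.span_minimal[OF _ 1]) blast
  then have x0: "\<forall>v\<in>?E2. br x v = 0" using xE by blast
  have 2: "vs.subspace {v. br x v = 0}" by (auto simp: vs.subspace_def br_add br_scale)
  have "vs.span ?E2 \<subseteq> {v. br x v = 0}" using x0 by (intro vs.span_minimal[OF _ 2]) blast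
  then show ?thesis using yE by blast
qed

text \<open>The components of nonzero height of the radical span an ideal \<open>T\<close>.  A vector of \<open>T\<close> which is killed by
  all elements of \<open>T\<close> of positive height and has minimal height among such vectors is also
  killed by the elements of negative height, so \<open>T \<noteq> 0\<close> would have a nonzero centre, which is an
  abelian ideal.\<close>

lemma rad_gr_zero: assumes k0: "k \<noteq> 0" shows "rad \<inter> gr k = {0}"
proof (rule ccontr)
  have zero: "0 \<in> rad \<inter> gr j" for j
    using vs.subspace_0[OF rad_subspace] vs.subspace_0[OF subspace_gr] by simp
  assume nz: "rad \<inter> gr k \<noteq> {0}"
  define G where "G = (\<Union>j\<in>{j. j \<noteq> 0}. rad \<inter> gr j)"
  define T where "T = vs.span G"
  define Z where "Z = {z \<in> T. \<forall>t\<in>T. br t z = 0}"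
  have Tsub: "vs.subspace T" by (simp add: T_def)
  have T_ideal: "br w t \<in> T" if "t \<in> T" for w t
  proof -
    have "br w t \<in> T" if t: "t \<in> G" for t
    proof -
      obtain j where j: "j \<noteq> 0" "t \<in> rad \<inter> gr j" using t by (auto simp: G_def)
      obtain v where v: "\<And>i. v i \<in> gr i" "w = (\<Sum>i\<in>hgt ` B. v i)" using gr_expansion by blast
      have "br (v i) t \<in> T" for i
      proof (cases "i + j = 0")
        case True
        then have "i = - j" by simp
        then have "br t (v i) = 0" using rad_gr_bracket[OF j] v(1)[of i] by simp
        then show ?thesis using br_anti[of "v i" t] vs.subspace_0[OF Tsub] by simp
      next
        case False
        then have "br (v i) t \<in> G" using br_gr[OF v(1)[of i], of t j] j rad_br(2)[of t "v i"]
          by (auto simp: G_def)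
        then show ?thesis by (simp add: T_def vs.span_base)
      qed
      then show ?thesis unfolding v(2) br_sum by (intro vs.subspace_sum[OF Tsub])
    qed
    moreover have "vs.subspace {t. br w t \<in> T}"
      using Tsub by (auto simp: vs.subspace_def br_add br_scale)
    ultimately have "vs.span G \<subseteq> {t. br w t \<in> T}" by (intro vs.span_minimal) auto
    then show ?thesis using that by (auto simp: T_def)
  qed
  have "lie_ideal D Z"
    unfolding lie_ideal_def
  proof (intro conjI allI ballI)
    show "vs.subspace Z" using Tsub by (auto simp: Z_def vs.subspace_def br_add br_scale)
    fix w z assume z: "z \<in> Z"
    have "br t (br w z) = 0" if t: "t \<in> T" for t
    proof -
      have "br t w \<in> T" using T_ideal[OF t, of w] br_anti[of t w] vs.subspace_neg[OF Tsub] by simp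
      then have "br (br t w) z = 0" "br t z = 0" using z t by (simp_all add: Z_def)
      then show ?thesis by (simp add: jacobi[of t w z])
    qed
    then show "br w z \<in> Z" using T_ideal[of z w] z by (simp add: Z_def)
  qed
  then have Z0: "Z = {0}" by (rule abelian_ideal_zero) (auto simp: Z_def)
  \<comment> \<open>The set \<open>V\<close> contains a vector of nonzero height: take one of the highest positive height that occurs in
    the radical or, if there is none, any vector of the radical of nonzero height.\<close>
  define V where "V = {v \<in> rad. \<forall>j>0. \<forall>x\<in>rad \<inter> gr j. br x v = 0}"
  define A where "A = {m. m \<noteq> 0 \<and> (\<exists>v\<in>V \<inter> gr m. v \<noteq> 0)}"
  have finA: "finite A"
  proof (rule finite_subset)
    show "A \<subseteq> hgt ` B" using gr_nonzero by (auto simp: A_def)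
  qed (use B_finite in simp)
  have "A \<noteq> {}"
  proof (cases "\<exists>j>0. rad \<inter> gr j \<noteq> {0}")
    case True
    define P where "P = {j. j > 0 \<and> rad \<inter> gr j \<noteq> {0}}"
    have "P \<subseteq> hgt ` B"
    proof
      fix j assume "j \<in> P"
      then obtain v where "v \<in> gr j" "v \<noteq> 0" using zero[of j] by (auto simp: P_def)
      then show "j \<in> hgt ` B" by (rule gr_nonzero)
    qed
    then have finP: "finite P" using B_finite finite_subset by blast
    have P: "P \<noteq> {}" using True by (simp add: P_def)
    define m where "m = Max P"
    have m: "m \<in> P" unfolding m_def using finP P by (rule Max_in)
    then obtain v where v: "v \<in> rad \<inter> gr m" "v \<noteq> 0" using zero[of m] by (auto simp: P_def)
    have "br x v = 0" if "j > 0" "x \<in> rad \<inter> gr j" for j x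
    proof (rule ccontr)
      assume "br x v \<noteq> 0"
      moreover have "br x v \<in> rad \<inter> gr (j + m)" using br_gr that v rad_br by simp
      ultimately have "j + m \<in> P" using that m by (auto simp: P_def)
      then have "j + m \<le> m" unfolding m_def using finP by (intro Max_ge)
      then show False using that by simp
    qed
    then have "v \<in> V" using v by (simp add: V_def)
    then have "m \<in> A" using v m by (auto simp: A_def P_def)
    then show ?thesis by blast
  next
    case False
    obtain v where v: "v \<in> rad \<inter> gr k" "v \<noteq> 0" using nz zero[of k] by blast
    have "v \<in> V" using v False by (auto simp: V_def)
    then have "k \<in> A" using v k0 by (auto simp: A_def)
    then show ?thesis by blast
  qed
  define m where "m = Min A"
  have "m \<in> A" unfolding m_def using finA \<open>A \<noteq> {}\<close> by (rule Min_in)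
  then obtain v where m: "m \<noteq> 0" and v: "v \<in> V" "v \<in> gr m" "v \<noteq> 0" by (auto simp: A_def)
  have V_D: "br x v = 0" if "j > 0" "x \<in> rad \<inter> gr j" for j x
    using v(1) that by (auto simp: V_def)
  have vrad: "v \<in> rad" using v by (simp add: V_def)
  \<comment> \<open>Induction on the depth of \<open>y\<close>: for \<open>x\<close> of positive height, \<open>[x, y]\<close> kills \<open>v\<close>, by the induction
    hypothesis if its height is negative and because \<open>v \<in> V\<close> if it is positive; in height \<open>0\<close> it vanishes.  So
    \<open>[y, v]\<close> lies in \<open>V\<close>, and by minimality of the height of \<open>v\<close> it can only be nonzero in height \<open>0\<close>, where
    it vanishes too.\<close>
  have neg: "br y v = 0" if "n > 0" "y \<in> rad \<inter> gr (- int n)" for n y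
    using that
  proof (induction n arbitrary: y rule: less_induct)
    case (less n)
    have "br y v \<in> rad \<inter> gr (m - int n)" using br_gr[of y "- int n" v m] less.prems v(2) rad_br(1) by simp
    show ?case
    proof (cases "m = int n")
      case True
      then have "br v y = 0" using rad_gr_bracket[OF m, of v y] vrad v(2) less.prems by simp
      then show ?thesis using br_anti[of y v] by simp
    next
      case False
      have "br y v \<in> V"
        unfolding V_def
      proof (intro CollectI conjI allI ballI impI)
        fix j :: int and x assume j: "j > 0" and x: "x \<in> rad \<inter> gr j"
        have xv: "br x v = 0" using v(1) j x by (auto simp: V_def)
        have xy: "br x y \<in> rad \<inter> gr (j - int n)" using br_gr[of x j y "- int n"] less.prems x rad_br(1) by simp
        have "br (br x y) v = 0"
        proof (cases "j = int n")
          case True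
          then have "br x y = 0" using rad_gr_bracket[of j x y] j x less.prems by simp
          then show ?thesis by simp
        next
          case False
          show ?thesis
          proof (cases "j > int n")
            case True
            then show ?thesis using V_D[of "j - int n"] xy by simp
          next
            case le: False
            have e: "j - int n = - int (n - nat j)" using le j by simp
            show ?thesis
            proof (rule less.IH)
              show "n - nat j < n" using j less.prems by simp
              show "0 < n - nat j" using j le False by simp
              show "br x y \<in> rad \<inter> gr (- int (n - nat j))" using xy unfolding e .
            qed
          qed
        qed
        then show "br x (br y v) = 0" by (simp add: jacobi[of x y v] xv)
      qed (use less.prems rad_br in simp)
      then have "br y v \<noteq> 0 \<Longrightarrow> m - int n \<in> A"
        using \<open>br y v \<in> rad \<inter> gr (m - int n)\<close> False by (auto simp: A_def)
      moreover have "m - int n \<notin> A"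
      proof
        assume "m - int n \<in> A"
        then have "m \<le> m - int n" unfolding m_def using finA by (intro Min_le)
        then show False using less.prems by simp
      qed
      ultimately show ?thesis by blast
    qed
  qed
  have "br t v = 0" if t: "t \<in> G" for t
  proof -
    obtain j where j: "j \<noteq> 0" "t \<in> rad \<inter> gr j" using t by (auto simp: G_def)
    show ?thesis
    proof (cases "j > 0")
      case True
      then show ?thesis using v(1) j by (auto simp: V_def)
    next
      case False
      then show ?thesis using neg[of "nat (- j)" t] j by simp
    qed
  qed
  moreover have "vs.subspace {t. br t v = 0}" by (auto simp: vs.subspace_def br_add br_scale)
  ultimately have "vs.span G \<subseteq> {t. br t v = 0}" by (intro vs.span_minimal) auto
  then have "\<forall>t\<in>T. br t v = 0" by (auto simp: T_def)
  moreover have "v \<in> G" using m vrad v(2) by (auto simp: G_def)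
  then have "v \<in> T" by (simp add: T_def vs.span_base)
  ultimately have "v \<in> Z" by (simp add: Z_def)
  then show False using Z0 v(3) by simp
qed

text \<open>Only the height-zero component of the radical is left; it lies in the Cartan subalgebra, and its bracket
  with a weight vector of nonzero height lies in a zero component of the radical, so it is central.\<close>

theorem killing_nondegenerate: assumes "\<And>y. kil x y = 0" shows "x = 0"
proof (rule center_zero)
  fix y
  have xr: "x \<in> rad" using assms by (simp add: rad_def)
  obtain v where v: "\<And>k. k \<in> hgt ` B \<Longrightarrow> v k \<in> rad \<inter> gr k" "x = (\<Sum>k\<in>hgt ` B. v k)"
    using rad_components[OF xr] by blast
  have "v k \<in> hh" if "k \<in> hgt ` B" for k
  proof (cases "k = 0")
    case True
    then show ?thesis using v(1)[OF that] gr_zero by simp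
  next
    case False
    then show ?thesis using v(1)[OF that] rad_gr_zero[OF False] vs.subspace_0[OF cartan_subspace] by auto
  qed
  then have xh: "x \<in> hh" unfolding v(2) by (intro vs.subspace_sum[OF cartan_subspace])
  have xb: "br x b = 0" if b: "b \<in> B" for b
  proof (cases "hgt b = 0")
    case True
    then show ?thesis using br_B[OF xh b] hgt_zero[OF b] by simp
  next
    case False
    have "b \<in> gr (hgt b)" using wspace_gr[OF B_wt(2)[OF b] wt_H0[OF b]] .
    then have "br x b \<in> rad \<inter> gr (hgt b)"
      using br_gr[of x 0 b "hgt b"] gr_zero xh rad_br(1)[OF xr] by simp
    then show ?thesis using rad_gr_zero[OF False] by simp
  qed
  show "br x y = 0" by (subst rep_sum[of y, symmetric]) (simp add: br_sum br_scale xb)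
qed

end

section \<open>The form on the dual of the Cartan subalgebra\<close>

text \<open>A linear system with integer coefficients, integer right-hand side and at most one complex
  solution has only rational solutions: every \<open>\<rat>\<close>-linear functional on \<open>\<complex>\<close> that kills \<open>1\<close> maps a
  solution to a solution of the homogeneous system.\<close>

lemma rational_solution:
  fixes A :: "'i \<Rightarrow> 'j \<Rightarrow> int" and c :: "'i \<Rightarrow> complex"
  assumes int: "\<And>j. j \<in> J \<Longrightarrow> (\<Sum>i\<in>I. c i * of_int (A i j)) \<in> \<int>"
    and inj: "\<And>d :: 'i \<Rightarrow> complex. (\<And>j. j \<in> J \<Longrightarrow> (\<Sum>i\<in>I. d i * of_int (A i j)) = 0) \<Longrightarrow> (\<And>i. i \<in> I \<Longrightarrow> d i = 0)"
  shows "\<exists>r :: 'i \<Rightarrow> rat. \<forall>i\<in>I. c i = of_rat (r i)"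
proof -
  interpret Q: vector_space "\<lambda>(r::rat) (x::complex). of_rat r * x"
    by unfold_locales (simp_all add: of_rat_add of_rat_mult algebra_simps)
  define E where "E = Q.extend_basis {1}"
  have ind1: "Q.independent {1}" by simp
  have E: "Q.independent E" "Q.span E = UNIV" "1 \<in> E"
    using Q.independent_extend_basis[OF ind1] Q.span_extend_basis[OF ind1]
      Q.extend_basis_superset[OF ind1] by (auto simp: E_def)
  define \<theta> where "\<theta> b x = Q.representation E x b" for b x
  have sum: "\<theta> b (\<Sum>i\<in>I. f i) = (\<Sum>i\<in>I. \<theta> b (f i))" for b f
    using E by (simp add: \<theta>_def Q.representation_sum)
  have scale: "\<theta> b (of_rat r * x) = r * \<theta> b x" for b r x
    using E by (simp add: \<theta>_def Q.representation_scale)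
  have one: "\<theta> b 1 = (if b = 1 then 1 else 0)" for b
    using E by (simp add: \<theta>_def Q.representation_basis)
  have int0: "\<theta> b (of_int n) = 0" if "b \<noteq> 1" for b n
    using scale[of b "of_int n" 1] one[of b] that by simp
  have zero: "\<theta> b (c i) = 0" if b: "b \<noteq> 1" and i: "i \<in> I" for b i
  proof -
    have "(\<Sum>i\<in>I. of_rat (\<theta> b (c i)) * of_int (A i j)) = (0::complex)" if j: "j \<in> J" for j
    proof -
      obtain n where n: "(\<Sum>i\<in>I. c i * of_int (A i j)) = of_int n" using int[OF j] by (auto elim: Ints_cases)
      have "\<theta> b (\<Sum>i\<in>I. c i * of_int (A i j)) = (\<Sum>i\<in>I. \<theta> b (c i) * of_int (A i j))"
        unfolding sum
      proof (intro sum.cong refl)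
        fix i
        show "\<theta> b (c i * of_int (A i j)) = \<theta> b (c i) * of_int (A i j)"
          using scale[of b "of_int (A i j)" "c i"] by (simp add: mult.commute)
      qed
      then have "(\<Sum>i\<in>I. \<theta> b (c i) * of_int (A i j)) = 0" using int0[OF b] n by simp
      then have "(of_rat (\<Sum>i\<in>I. \<theta> b (c i) * of_int (A i j)) :: complex) = 0" by simp
      then show ?thesis by (simp add: of_rat_sum of_rat_mult)
    qed
    from inj[OF this i] have "(of_rat (\<theta> b (c i)) :: complex) = 0" by simp
    then show ?thesis by simp
  qed
  have "c i = of_rat (\<theta> 1 (c i))" if i: "i \<in> I" for i
  proof -
    have "c i = (\<Sum>b | \<theta> b (c i) \<noteq> 0. of_rat (\<theta> b (c i)) * b)"
      using Q.sum_nonzero_representation_eq[OF E(1), of "c i"] E(2) by (simp add: \<theta>_def)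
    also have "\<dots> = (\<Sum>b\<in>{1}. of_rat (\<theta> b (c i)) * b)"
      using zero[OF _ i] by (intro sum.mono_neutral_left) auto
    finally show ?thesis by simp
  qed
  then show ?thesis by (intro exI[of _ "\<lambda>i. \<theta> 1 (c i)"]) simp
qed

context root_data
begin

lemma roots_vanish:
  assumes z: "z \<in> hh" and "\<And>j. j \<in> nodes D \<Longrightarrow> simple_root D j z = 0"
  shows "z = 0"
proof (rule weights_separate[OF z])
  fix b assume b: "b \<in> B"
  show "wt b z = 0"
  proof (cases "wt b = 0")
    case False
    then have "wt b \<in> roots D" using B_wt(1)[OF b] by simp
    then obtain k :: "nat \<Rightarrow> nat" where "wt b = (\<lambda>x. \<Sum>i\<in>nodes D. of_nat (k i) * simple_root D i x) \<or>
        wt b = (\<lambda>x. - (\<Sum>i\<in>nodes D. of_nat (k i) * simple_root D i x))"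
      using simple unfolding are_simple_roots_def by blast
    then show ?thesis using assms(2) by auto
  qed simp
qed

lemma cartan_expansion:
  assumes x: "x \<in> hh" shows "x = (\<Sum>i\<in>nodes D. sc (simple_root D i x) (Hd i))"
proof -
  let ?s = "\<Sum>i\<in>nodes D. sc (simple_root D i x) (Hd i)"
  have s: "?s \<in> hh" by (intro vs.subspace_sum[OF cartan_subspace] vs.subspace_scale[OF cartan_subspace] Hd)
  have xs: "x - ?s \<in> hh" using vs.subspace_diff[OF cartan_subspace x s] .
  have "simple_root D j (x - ?s) = 0" if j: "j \<in> nodes D" for j
  proof -
    note dj = simple_rootD(2)[OF j]
    have "simple_root D j ?s = (\<Sum>i\<in>nodes D. simple_root D i x * simple_root D j (Hd i))"
      using vs.subspace_scale[OF cartan_subspace] Hd(1)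
      by (simp add: dual_cartan_sum[OF dj] dual_cartanD(2)[OF dj])
    also have "\<dots> = (\<Sum>i\<in>nodes D. if i = j then simple_root D i x else 0)"
      by (intro sum.cong refl) (simp add: Hd(2) j)
    finally have "simple_root D j ?s = simple_root D j x" using j by simp
    moreover have "simple_root D j (x - ?s) + simple_root D j ?s = simple_root D j x"
      using dual_cartanD(1)[OF dj xs s] by simp
    ultimately show ?thesis by simp
  qed
  then have "x - ?s = 0" by (intro roots_vanish[OF xs])
  then show ?thesis by simp
qed

lemma functional_expansion:
  assumes l: "l \<in> dual_cartan D" shows "l = (\<lambda>x. \<Sum>i\<in>nodes D. l (Hd i) * simple_root D i x)"
proof
  fix x
  show "l x = (\<Sum>i\<in>nodes D. l (Hd i) * simple_root D i x)"
  proof (cases "x \<in> hh")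
    case True
    have "l x = l (\<Sum>i\<in>nodes D. sc (simple_root D i x) (Hd i))"
      using cartan_expansion[OF True] by simp
    also have "\<dots> = (\<Sum>i\<in>nodes D. l (sc (simple_root D i x) (Hd i)))"
      by (intro dual_cartan_sum[OF l]) (auto intro: vs.subspace_scale[OF cartan_subspace] Hd)
    also have "\<dots> = (\<Sum>i\<in>nodes D. l (Hd i) * simple_root D i x)"
      by (intro sum.cong refl) (simp add: dual_cartanD(2)[OF l] Hd mult.commute)
    finally show ?thesis .
  next
    case False
    then show ?thesis using dual_cartanD(3)[OF l] dual_cartanD(3)[OF simple_rootD(2)]
      by (simp add: sum.neutral)
  qed
qed

text \<open>The Cartan subalgebra is orthogonal to the weight vectors of nonzero height.\<close>

lemma kil_cartan_nondegenerate:
  assumes h: "h \<in> hh" and z: "\<And>x. x \<in> hh \<Longrightarrow> kil h x = 0" shows "h = 0"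
proof (rule killing_nondegenerate)
  fix y
  have "kil h b = 0" if b: "b \<in> B" for b
  proof (cases "hgt b = 0")
    case True
    then have "b \<in> hh" using B_wt(2)[OF b] hgt_zero[OF b] wspace_zero by auto
    then show ?thesis by (rule z)
  next
    case False
    then show ?thesis
      using br_B[OF H0 b] wt_H0[OF b] cartan_abelian[OF H0 h]
      by (intro kil_eigenvectors[where h = H0 and a = 0 and b = "of_int (hgt b)"]) auto
  qed
  then show "kil h y = 0"
    by (subst rep_sum[of y, symmetric]) (simp add: kil_sum kil_linear)
qed

lemma killing_dual_exists:
  assumes l: "l \<in> dual_cartan D" shows "\<exists>!h. h \<in> hh \<and> (\<forall>x\<in>hh. kil h x = l x)"
proof -
  have "\<exists>y. \<forall>i\<in>nodes D. y i \<in> hh \<and> (\<forall>j\<in>nodes D. kil (Hd j) (y i) = (if i = j then 1 else 0))"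
  proof (rule vs.dual_family_exists[OF finite_nodes cartan_subspace])
    fix c i assume c: "\<And>x. x \<in> hh \<Longrightarrow> (\<Sum>i\<in>nodes D. c i * kil (Hd i) x) = 0" and i: "i \<in> nodes D"
    let ?s = "\<Sum>i\<in>nodes D. sc (c i) (Hd i)"
    have s: "?s \<in> hh" by (intro vs.subspace_sum[OF cartan_subspace] vs.subspace_scale[OF cartan_subspace] Hd)
    have "?s = 0" using c by (intro kil_cartan_nondegenerate[OF s]) (simp add: kil_sum kil_linear)
    moreover have "simple_root D i ?s = (\<Sum>j\<in>nodes D. c j * simple_root D i (Hd j))"
      using vs.subspace_scale[OF cartan_subspace] Hd(1)
      by (simp add: dual_cartan_sum[OF simple_rootD(2)[OF i]] dual_cartanD(2)[OF simple_rootD(2)[OF i]])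
    moreover have "\<dots> = (\<Sum>j\<in>nodes D. if j = i then c j else 0)"
      by (intro sum.cong refl) (simp add: Hd(2) i)
    moreover have "simple_root D i 0 = 0"
      using dual_cartan_sum[OF simple_rootD(2)[OF i], of "{}"] by simp
    ultimately show "c i = 0" using i by simp
  qed (simp_all add: kil_linear)
  then obtain y where y: "\<And>i. i \<in> nodes D \<Longrightarrow> y i \<in> hh"
    "\<And>i j. i \<in> nodes D \<Longrightarrow> j \<in> nodes D \<Longrightarrow> kil (Hd j) (y i) = (if i = j then 1 else 0)"
    by metis
  let ?h = "\<Sum>j\<in>nodes D. sc (l (Hd j)) (y j)"
  have h: "?h \<in> hh" by (intro vs.subspace_sum[OF cartan_subspace] vs.subspace_scale[OF cartan_subspace] y)
  have hH: "kil ?h (Hd i) = l (Hd i)" if i: "i \<in> nodes D" for i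
  proof -
    have "kil ?h (Hd i) = (\<Sum>j\<in>nodes D. l (Hd j) * kil (Hd i) (y j))"
      by (simp add: kil_sum kil_linear kil_sym[of "y _" "Hd i"])
    also have "\<dots> = (\<Sum>j\<in>nodes D. if j = i then l (Hd j) else 0)"
      by (intro sum.cong refl) (simp add: y(2) i)
    finally show ?thesis using i by simp
  qed
  have "kil ?h x = l x" if x: "x \<in> hh" for x
  proof -
    have "kil ?h x = kil ?h (\<Sum>i\<in>nodes D. sc (simple_root D i x) (Hd i))"
      using cartan_expansion[OF x] by simp
    also have "\<dots> = (\<Sum>i\<in>nodes D. simple_root D i x * kil ?h (Hd i))"
      unfolding kil_sum(2) kil_linear ..
    also have "\<dots> = (\<Sum>i\<in>nodes D. l (Hd i) * simple_root D i x)"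
      by (intro sum.cong refl) (simp add: hH mult.commute)
    finally show ?thesis using functional_expansion[OF l] by metis
  qed
  then have ex: "?h \<in> hh \<and> (\<forall>x\<in>hh. kil ?h x = l x)" using h by blast
  show ?thesis
  proof (rule ex1I[where a = ?h])
    show "?h \<in> hh \<and> (\<forall>x\<in>hh. kil ?h x = l x)" by (rule ex)
    fix k assume k: "k \<in> hh \<and> (\<forall>x\<in>hh. kil k x = l x)"
    have d: "k - ?h \<in> hh" using vs.subspace_diff[OF cartan_subspace] k h by blast
    have "kil (k - ?h) x = 0" if "x \<in> hh" for x
      using kil_linear(1)[of "k - ?h" ?h x] k ex that by simp
    then have "k - ?h = 0" by (rule kil_cartan_nondegenerate[OF d])
    then show "k = ?h" by simp
  qed
qed

abbreviation "kd \<equiv> killing_dual D"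

lemma kd:
  assumes "l \<in> dual_cartan D"
  shows "kd l \<in> hh" "x \<in> hh \<Longrightarrow> kil (kd l) x = l x"
  using theI'[OF killing_dual_exists[OF assms]] by (simp_all add: killing_dual_def)

lemma dform_eq: "l \<in> dual_cartan D \<Longrightarrow> m \<in> dual_cartan D \<Longrightarrow> dform D l m = l (kd m)"
  by (simp add: dform_def kd)

lemma dform_sym: "dform D l m = dform D m l"
  by (simp add: dform_def kil_sym)

lemma dual_cartan_closed:
  assumes "l \<in> dual_cartan D" "m \<in> dual_cartan D"
  shows "l + m \<in> dual_cartan D" "- l \<in> dual_cartan D"
  using assms by (auto simp: dual_cartan_def algebra_simps)

lemma zero_dual_cartan: "0 \<in> dual_cartan D"
  by (simp add: dual_cartan_def)

lemma dform_linear: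
  assumes "l \<in> dual_cartan D" "m \<in> dual_cartan D" "r \<in> dual_cartan D"
  shows "dform D (l + m) r = dform D l r + dform D m r" "dform D (- l) r = - dform D l r"
  using assms by (simp_all add: dform_eq dual_cartan_closed)

lemma roots_dual: "\<beta> \<in> roots D \<Longrightarrow> \<beta> \<in> dual_cartan D"
  by (simp add: roots_def)

text \<open>By nondegeneracy some weight vector \<open>b\<close> of weight \<open>-\<alpha>\<close> does not pair to zero with a given root vector
  \<open>x\<close> of weight \<open>\<alpha>\<close>.  Invariance of the form shows that \<open>[x, b]\<close> is a nonzero multiple of the element dual to
  \<open>\<alpha>\<close>, to which the \<open>sl\<^sub>2\<close> computation applies.\<close>

theorem cartan_integer:
  assumes \<alpha>: "\<alpha> \<in> roots D" and \<beta>: "\<beta> \<in> roots D"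
  shows "dform D \<alpha> \<alpha> \<noteq> 0" and "2 * dform D \<beta> \<alpha> / dform D \<alpha> \<alpha> \<in> \<int>"
proof -
  obtain x where x: "x \<noteq> 0" "x \<in> wspace \<alpha>" using \<alpha> by (auto simp: roots_def wspace_def)
  obtain y where "kil x y \<noteq> 0" using killing_nondegenerate x(1) by blast
  moreover have "kil x y = (\<Sum>b\<in>B. rep y b * kil x b)"
    by (subst rep_sum[of y, symmetric]) (simp add: kil_sum kil_linear)
  ultimately obtain b where b: "b \<in> B" "kil x b \<noteq> 0" by (metis (no_types, lifting) mult_zero_right sum.neutral)
  have wtb: "wt b h = - \<alpha> h" if "h \<in> hh" for h
  proof -
    have "\<alpha> h + wt b h = 0"
      using kil_eigenvectors[where h = h and x = x and a = "\<alpha> h" and y = b and b = "wt b h"] x(2) br_B[OF that b(1)] b(2) that by (auto simp: wspace_def)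
    then show ?thesis by (simp add: add_eq_0_iff)
  qed
  have bw: "b \<in> wspace (- \<alpha>)" using br_B[OF _ b(1)] wtb by (simp add: wspace_def)
  let ?h = "br x b"
  note rb = root_bracket[OF \<alpha> x(2) bw]
  note d\<alpha> = roots_dual[OF \<alpha>]
  have hd: "?h - sc (kil x b) (kd \<alpha>) \<in> hh"
    using rb(1) kd(1)[OF d\<alpha>] by (intro vs.subspace_diff[OF cartan_subspace] vs.subspace_scale[OF cartan_subspace])
  have "kil (?h - sc (kil x b) (kd \<alpha>)) k = 0" if k: "k \<in> hh" for k
  proof -
    have "kil ?h k = kil x (- br k b)" by (simp add: kil_invariant br_anti[of b k])
    also have "\<dots> = \<alpha> k * kil x b"
      by (simp add: br_B[OF k b(1)] wtb[OF k] kil_linear)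
    finally have "kil ?h k = kil (sc (kil x b) (kd \<alpha>)) k" by (simp add: kil_linear kd(2)[OF d\<alpha> k])
    then show ?thesis using kil_linear(1)[of "?h - sc (kil x b) (kd \<alpha>)" "sc (kil x b) (kd \<alpha>)" k] by simp
  qed
  then have h: "?h = sc (kil x b) (kd \<alpha>)" using kil_cartan_nondegenerate[OF hd] by simp
  have "kd \<alpha> \<noteq> 0"
  proof
    assume 0: "kd \<alpha> = 0"
    have "\<alpha> k = 0" for k
      using kd(2)[OF d\<alpha>, of k] 0 dual_cartanD(3)[OF d\<alpha>, of k] by (cases "k \<in> hh") auto
    then show False using \<alpha> by (auto simp: roots_def)
  qed
  then have hnz: "?h \<noteq> 0" using h b(2) by simp
  have val: "\<gamma> ?h = kil x b * dform D \<gamma> \<alpha>" if "\<gamma> \<in> dual_cartan D" for \<gamma>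
    unfolding h using kd(1)[OF d\<alpha>] by (simp add: dual_cartanD(2)[OF that] dform_eq that d\<alpha>)
  show nz: "dform D \<alpha> \<alpha> \<noteq> 0" using rb(3)[OF hnz] val[OF d\<alpha>] by auto
  obtain z where z: "z \<noteq> 0" "z \<in> wspace \<beta>" using \<beta> by (auto simp: roots_def wspace_def)
  obtain b' where b': "b' \<in> B" "wt b' ?h = \<beta> ?h"
    using eigenvalue_is_weight[OF rb(1) z(1)] z(2) rb(1) by (auto simp: wspace_def)
  obtain k :: int where "2 * \<beta> ?h = of_int k * \<alpha> ?h" using rb(2)[OF b'(1)] b'(2) by auto
  then have "kil x b * (2 * dform D \<beta> \<alpha>) = kil x b * (of_int k * dform D \<alpha> \<alpha>)"
    by (simp add: val d\<alpha> roots_dual[OF \<beta>] algebra_simps)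
  then have "2 * dform D \<beta> \<alpha> = of_int k * dform D \<alpha> \<alpha>" using b(2) by simp
  then have "2 * dform D \<beta> \<alpha> / dform D \<alpha> \<alpha> = of_int k" using nz by simp
  then show "2 * dform D \<beta> \<alpha> / dform D \<alpha> \<alpha> \<in> \<int>" by simp
qed

lemma weight_lattice_dual: "l \<in> weight_lattice D \<Longrightarrow> l \<in> dual_cartan D"
  by (simp add: weight_lattice_def)

lemma weight_lattice_closed:
  assumes l: "l \<in> weight_lattice D" and m: "m \<in> weight_lattice D"
  shows "l + m \<in> weight_lattice D" "- l \<in> weight_lattice D"
proof -
  note d = weight_lattice_dual[OF l] weight_lattice_dual[OF m]
  have "2 * dform D (l + m) b / dform D b b \<in> \<int>" "2 * dform D (- l) b / dform D b b \<in> \<int>"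
    if b: "b \<in> roots D" for b
  proof -
    have i: "2 * dform D l b / dform D b b \<in> \<int>" "2 * dform D m b / dform D b b \<in> \<int>"
      using l m b by (simp_all add: weight_lattice_def)
    show "2 * dform D (l + m) b / dform D b b \<in> \<int>"
      using Ints_add[OF i] by (simp add: dform_linear[OF d roots_dual[OF b]] add_divide_distrib distrib_left)
    show "2 * dform D (- l) b / dform D b b \<in> \<int>"
      using Ints_minus[OF i(1)] by (simp add: dform_linear[OF d roots_dual[OF b]])
  qed
  then show "l + m \<in> weight_lattice D" "- l \<in> weight_lattice D"
    using dual_cartan_closed[OF d] by (simp_all add: weight_lattice_def)
qed

lemma zero_weight_lattice: "0 \<in> weight_lattice D"
  using zero_dual_cartan by (simp add: weight_lattice_def dform_eq roots_dual)

text \<open>The coordinates of a weight with respect to the simple roots solve an integer linear system whose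
  matrix is the Cartan matrix; its kernel is zero because the form is nondegenerate.\<close>

theorem weight_lattice_rational: "weight_lattice D \<subseteq> rational_root_span D"
proof
  fix l assume l: "l \<in> weight_lattice D"
  note dl = weight_lattice_dual[OF l]
  let ?\<alpha> = "simple_root D"
  have "\<exists>n::int. 2 * dform D (?\<alpha> i) (?\<alpha> j) / dform D (?\<alpha> j) (?\<alpha> j) = of_int n"
    if "i \<in> nodes D" "j \<in> nodes D" for i j
    using cartan_integer(2)[OF simple_rootD(1)[OF that(2)] simple_rootD(1)[OF that(1)]] by (auto elim: Ints_cases)
  then obtain A :: "nat \<Rightarrow> nat \<Rightarrow> int" where
    A: "\<And>i j. i \<in> nodes D \<Longrightarrow> j \<in> nodes D \<Longrightarrow> 2 * dform D (?\<alpha> i) (?\<alpha> j) / dform D (?\<alpha> j) (?\<alpha> j) = of_int (A i j)"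
    by metis
  have sum: "(\<Sum>i\<in>nodes D. d i * of_int (A i j))
      = 2 * (\<Sum>i\<in>nodes D. d i * dform D (?\<alpha> i) (?\<alpha> j)) / dform D (?\<alpha> j) (?\<alpha> j)"
    if j: "j \<in> nodes D" for d j
    by (simp add: A[symmetric] j sum_distrib_left sum_divide_distrib mult_ac)
  have "\<exists>r :: nat \<Rightarrow> rat. \<forall>i\<in>nodes D. l (Hd i) = of_rat (r i)"
  proof (rule rational_solution)
    fix j assume j: "j \<in> nodes D"
    note dj = simple_rootD(2)[OF j]
    have "dform D l (?\<alpha> j) = (\<Sum>i\<in>nodes D. l (Hd i) * dform D (?\<alpha> i) (?\<alpha> j))"
      by (simp add: dform_eq dl simple_rootD dj) (subst functional_expansion[OF dl], rule refl)
    moreover have "2 * dform D l (?\<alpha> j) / dform D (?\<alpha> j) (?\<alpha> j) \<in> \<int>"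
      using l simple_rootD(1)[OF j] by (simp add: weight_lattice_def)
    ultimately show "(\<Sum>i\<in>nodes D. l (Hd i) * of_int (A i j)) \<in> \<int>"
      by (simp only: sum[OF j])
  next
    fix d :: "nat \<Rightarrow> complex" and i
    assume z: "\<And>j. j \<in> nodes D \<Longrightarrow> (\<Sum>i\<in>nodes D. d i * of_int (A i j)) = 0" and i: "i \<in> nodes D"
    let ?h = "\<Sum>i\<in>nodes D. sc (d i) (kd (?\<alpha> i))"
    have h: "?h \<in> hh"
      by (intro vs.subspace_sum[OF cartan_subspace] vs.subspace_scale[OF cartan_subspace] kd simple_rootD)
    have "?\<alpha> j ?h = 0" if j: "j \<in> nodes D" for j
    proof -
      note dj = simple_rootD(2)[OF j]
      have "?\<alpha> j ?h = (\<Sum>i\<in>nodes D. ?\<alpha> j (sc (d i) (kd (?\<alpha> i))))"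
        by (intro dual_cartan_sum[OF dj] finite_nodes vs.subspace_scale[OF cartan_subspace] kd simple_rootD)
      also have "\<dots> = (\<Sum>i\<in>nodes D. d i * dform D (?\<alpha> i) (?\<alpha> j))"
        by (intro sum.cong refl)
          (simp add: dual_cartanD(2)[OF dj] kd simple_rootD dform_sym[of _ "?\<alpha> j"] dform_eq dj)
      also have "\<dots> = 0"
        using z[OF j] cartan_integer(1)[OF simple_rootD(1)[OF j] simple_rootD(1)[OF j]] by (simp add: sum[OF j])
      finally show ?thesis .
    qed
    then have "?h = 0" by (rule roots_vanish[OF h])
    then have "kil ?h (Hd i) = 0" by simp
    moreover have "kil ?h (Hd i) = (\<Sum>j\<in>nodes D. d j * ?\<alpha> j (Hd i))"
      by (simp add: kil_sum kil_linear kd(2) simple_rootD(2) Hd(1)[OF i])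
    moreover have "\<dots> = (\<Sum>j\<in>nodes D. if j = i then d j else 0)"
      by (intro sum.cong refl) (auto simp: Hd(2) i)
    ultimately show "d i = 0" using i by simp
  qed
  then obtain r :: "nat \<Rightarrow> rat" where r: "\<And>i. i \<in> nodes D \<Longrightarrow> l (Hd i) = of_rat (r i)" by blast
  have "l = (\<lambda>x. \<Sum>i\<in>nodes D. of_rat (r i) * ?\<alpha> i x)"
    by (subst functional_expansion[OF dl]) (simp add: r)
  then show "l \<in> rational_root_span D" unfolding rational_root_span_def by blast
qed

end

text \<open>The Hopf algebras see the Lie algebra only through the lattice of torus elements and the form on it.
  By the first equation torus elements are available for all weights.\<close>

lemma (in lie_cartan) weight_lattice_facts:
  shows "weight_lattice_plus D = weight_lattice D"
    and "i \<in> nodes D \<Longrightarrow> simple_root D i \<in> weight_lattice D"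
    and "0 \<in> weight_lattice D"
    and "l \<in> weight_lattice D \<Longrightarrow> m \<in> weight_lattice D \<Longrightarrow> l + m \<in> weight_lattice D"
    and "l \<in> weight_lattice D \<Longrightarrow> - l \<in> weight_lattice D"
    and "dform D l m = dform D m l"
    and "l \<in> weight_lattice D \<Longrightarrow> m \<in> weight_lattice D \<Longrightarrow> dform D l (- m) = - dform D l m"
proof -
  obtain B wt Hd where "root_data D B wt Hd" using root_data_exists by blast
  then interpret root_data D B wt Hd .
  show "weight_lattice_plus D = weight_lattice D"
    using weight_lattice_rational by (auto simp: weight_lattice_plus_def)
  show "i \<in> nodes D \<Longrightarrow> simple_root D i \<in> weight_lattice D"
    using cartan_integer(2) simple_rootD by (simp add: weight_lattice_def)
  show "0 \<in> weight_lattice D" by (rule zero_weight_lattice)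
  show "l \<in> weight_lattice D \<Longrightarrow> m \<in> weight_lattice D \<Longrightarrow> l + m \<in> weight_lattice D"
    and "l \<in> weight_lattice D \<Longrightarrow> - l \<in> weight_lattice D"
    by (simp_all add: weight_lattice_closed)
  show "dform D l m = dform D m l" by (rule dform_sym)
  show "l \<in> weight_lattice D \<Longrightarrow> m \<in> weight_lattice D \<Longrightarrow> dform D l (- m) = - dform D l m"
    using dform_linear(2)[of m l l] dform_sym weight_lattice_dual by simp
qed

section \<open>Linear maps on finitely supported functions\<close>

lemma lookup_cscale [simp]: "Poly_Mapping.lookup (cscale c p) k = c * Poly_Mapping.lookup p k"
  by (simp add: cscale_def Poly_Mapping.map.rep_eq when_def)

lemma cscale_single [simp]: "cscale c (Poly_Mapping.single k d) = Poly_Mapping.single k (c * d)"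
  by (rule poly_mapping_eqI) (simp add: lookup_single when_def)

global_interpretation cs: vector_space "cscale :: complex \<Rightarrow> ('a \<Rightarrow>\<^sub>0 complex) \<Rightarrow> 'a \<Rightarrow>\<^sub>0 complex"
  by unfold_locales (auto intro!: poly_mapping_eqI simp: lookup_add algebra_simps)

lemma keys_cscale: "Poly_Mapping.keys (cscale c p) \<subseteq> Poly_Mapping.keys p"
  by (auto simp: in_keys_iff)

lemma poly_mapping_expand:
  "p = (\<Sum>k\<in>Poly_Mapping.keys p. Poly_Mapping.single k (Poly_Mapping.lookup p k))"
  by (rule poly_mapping_eqI) (auto simp: lookup_sum lookup_single when_def in_keys_iff)

definition pm_sum :: "('a \<Rightarrow> complex \<Rightarrow> 'b) \<Rightarrow> ('a \<Rightarrow>\<^sub>0 complex) \<Rightarrow> 'b::comm_monoid_add" where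
  "pm_sum \<Phi> p = (\<Sum>k\<in>Poly_Mapping.keys p. \<Phi> k (Poly_Mapping.lookup p k))"

lemma pm_sum_add:
  assumes "\<And>k. \<Phi> k 0 = 0" "\<And>k x y. \<Phi> k (x + y) = \<Phi> k x + \<Phi> k y"
  shows "pm_sum \<Phi> (p + q) = pm_sum \<Phi> p + pm_sum \<Phi> q"
  unfolding pm_sum_def lookup_add[symmetric]
  using setsum_keys_plus_distrib[of \<Phi> p q] assms by (simp add: lookup_add)

lemma pm_sum_zero [simp]: "pm_sum \<Phi> 0 = 0"
  by (simp add: pm_sum_def)

lemma pm_sum_single: "\<Phi> k 0 = 0 \<Longrightarrow> pm_sum \<Phi> (Poly_Mapping.single k c) = \<Phi> k c"
  by (simp add: pm_sum_def)

lemma pm_sum_cong: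
  "(\<And>k. k \<in> Poly_Mapping.keys p \<Longrightarrow> \<Phi> k (Poly_Mapping.lookup p k) = \<Psi> k (Poly_Mapping.lookup p k))
    \<Longrightarrow> pm_sum \<Phi> p = pm_sum \<Psi> p"
  by (simp add: pm_sum_def)

text \<open>The restriction to the support of \<open>p\<close> is what allows conditions on the letters of words to be used.\<close>

lemma additive_eqI:
  fixes h g :: "('a \<Rightarrow>\<^sub>0 complex) \<Rightarrow> 'b::cancel_comm_monoid_add"
  assumes "\<And>p q. h (p + q) = h p + h q" "\<And>p q. g (p + q) = g p + g q"
    and "\<And>k c. k \<in> Poly_Mapping.keys p \<Longrightarrow> h (Poly_Mapping.single k c) = g (Poly_Mapping.single k c)"
  shows "h p = g p"
proof -
  have 0: "h 0 = 0" "g 0 = 0" using assms(1,2)[of 0 0] by simp_all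
  have "h (\<Sum>k\<in>A. Poly_Mapping.single k (Poly_Mapping.lookup p k))
      = g (\<Sum>k\<in>A. Poly_Mapping.single k (Poly_Mapping.lookup p k))" if "finite A" "A \<subseteq> Poly_Mapping.keys p" for A
    using that by (induction A rule: finite_induct) (simp_all add: 0 assms)
  from this[of "Poly_Mapping.keys p"] show ?thesis using poly_mapping_expand[of p] by simp
qed

lemma in_span_monoms:
  assumes "cs.subspace W" "\<And>k. k \<in> Poly_Mapping.keys p \<Longrightarrow> monom k \<in> W"
  shows "p \<in> W"
proof -
  have "(\<Sum>k\<in>Poly_Mapping.keys p. cscale (Poly_Mapping.lookup p k) (monom k)) \<in> W"
    by (intro cs.subspace_sum cs.subspace_scale assms)
  then show ?thesis using poly_mapping_expand[of p] by simp
qed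

lemma lin_ext_pm_sum: "lin_ext f p = pm_sum (\<lambda>k c. cscale c (f k)) p"
  by (simp add: lin_ext_def pm_sum_def)

lemma lin_ext_add: "lin_ext f (p + q) = lin_ext f p + lin_ext f q"
  by (simp add: lin_ext_pm_sum pm_sum_add cs.scale_left_distrib)

lemma lin_ext_zero [simp]: "lin_ext f 0 = 0"
  by (simp add: lin_ext_pm_sum)

lemma lin_ext_single [simp]: "lin_ext f (Poly_Mapping.single k c) = cscale c (f k)"
  by (simp add: lin_ext_pm_sum pm_sum_single)

lemma lin_ext_cscale: "lin_ext f (cscale c p) = cscale c (lin_ext f p)"
  by (rule additive_eqI[where h = "\<lambda>p. lin_ext f (cscale c p)"])
    (simp_all add: cs.scale_right_distrib lin_ext_add)

lemma lin_ext_fun_add: "lin_ext (\<lambda>k. f k + g k) p = lin_ext f p + lin_ext g p"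
  by (rule additive_eqI[where h = "lin_ext (\<lambda>k. f k + g k)"])
    (simp_all add: lin_ext_add cs.scale_right_distrib)

lemma lin_ext_fun_cscale: "lin_ext (\<lambda>k. cscale c (f k)) p = cscale c (lin_ext f p)"
  by (rule additive_eqI[where h = "lin_ext (\<lambda>k. cscale c (f k))"])
    (simp_all add: lin_ext_add cs.scale_right_distrib mult.commute)

lemma lin_ext_monom: "lin_ext monom p = p"
  by (rule additive_eqI[where h = "lin_ext monom"]) (simp_all add: lin_ext_add)

text \<open>\<open>ev f\<close> is the linear functional with values \<open>f\<close> on the basis.\<close>

definition ev :: "('a \<Rightarrow> complex) \<Rightarrow> ('a \<Rightarrow>\<^sub>0 complex) \<Rightarrow> complex" where
  "ev f = pm_sum (\<lambda>k c. c * f k)"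

lemma ev_add: "ev f (p + q) = ev f p + ev f q"
  by (simp add: ev_def pm_sum_add distrib_right)

lemma ev_zero [simp]: "ev f 0 = 0"
  by (simp add: ev_def)

lemma ev_single [simp]: "ev f (Poly_Mapping.single k c) = c * f k"
  by (simp add: ev_def pm_sum_single)

lemma ev_cscale: "ev f (cscale c p) = c * ev f p"
  by (rule additive_eqI[where h = "\<lambda>p. ev f (cscale c p)"])
    (simp_all add: cs.scale_right_distrib ev_add distrib_left)

lemma ev_uminus: "ev f (- p) = - ev f p"
  using ev_add[of f p "- p"] by (simp add: eq_neg_iff_add_eq_0 add.commute)

lemma ev_diff: "ev f (p - q) = ev f p - ev f q"
  using ev_add[of f p "- q"] by (simp add: ev_uminus)

lemma ev_sum: "ev f (sum g A) = (\<Sum>a\<in>A. ev f (g a))"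
  by (induction A rule: infinite_finite_induct) (simp_all add: ev_add)

lemma ev_lin_ext: "ev f (lin_ext g p) = ev (\<lambda>k. ev f (g k)) p"
  by (rule additive_eqI[where h = "\<lambda>p. ev f (lin_ext g p)"]) (simp_all add: lin_ext_add ev_add ev_cscale)

lemma ev_fun_mult: "ev (\<lambda>k. c * f k) p = c * ev f p"
  by (simp add: ev_def pm_sum_def sum_distrib_left mult_ac)

lemma ev_fun_zero [simp]: "ev (\<lambda>k. 0) p = 0"
  by (simp add: ev_def pm_sum_def)

lemma ev_cong: "(\<And>k. k \<in> Poly_Mapping.keys p \<Longrightarrow> f k = g k) \<Longrightarrow> ev f p = ev g p"
  unfolding ev_def by (rule pm_sum_cong) simp

lemma ev_swap: "ev (\<lambda>k. ev (\<lambda>l. f k l) q) p = ev (\<lambda>l. ev (\<lambda>k. f k l) p) q"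
  unfolding ev_def pm_sum_def sum_distrib_left by (subst sum.swap) (simp add: mult_ac)

section \<open>Sums over the coproduct of a word\<close>

text \<open>On words in the generators all coefficients of the coproduct are \<open>1\<close>.  If \<open>\<delta> g\<close> lists the
  terms of \<open>\<Delta>(g)\<close> for a letter \<open>g\<close>, then \<open>sweedler \<delta> w F\<close> is the Sweedler sum
  \<open>\<Sum> F w\<^sub>(\<^sub>1\<^sub>) w\<^sub>(\<^sub>2\<^sub>)\<close>.\<close>

primrec sweedler ::
  "('x \<Rightarrow> ('x list \<times> 'x list) list) \<Rightarrow> 'x list \<Rightarrow> ('x list \<Rightarrow> 'x list \<Rightarrow> 'b) \<Rightarrow> 'b::comm_monoid_add" where
  "sweedler \<delta> [] F = F [] []"
| "sweedler \<delta> (g # w) F = (\<Sum>(a, b)\<leftarrow>\<delta> g. sweedler \<delta> w (\<lambda>u v. F (a @ u) (b @ v)))"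

lemma sum_list_map_cong: "(\<And>x. x \<in> set xs \<Longrightarrow> f x = g x) \<Longrightarrow> (\<Sum>x\<leftarrow>xs. f x) = (\<Sum>x\<leftarrow>xs. g x)"
  by (metis map_cong)

lemma sweedler_cong: "(\<And>u v. F u v = G u v) \<Longrightarrow> sweedler \<delta> w F = sweedler \<delta> w G"
  by (subgoal_tac "F = G") auto

lemma sweedler_append:
  "sweedler \<delta> (w @ w') F = sweedler \<delta> w (\<lambda>u v. sweedler \<delta> w' (\<lambda>u' v'. F (u @ u') (v @ v')))"
  by (induction w arbitrary: F) simp_all

lemma sweedler_add:
  "sweedler \<delta> w (\<lambda>u v. F u v + G u v) = sweedler \<delta> w F + sweedler \<delta> w G"
  by (induction w arbitrary: F G) (simp_all add: sum_list_addf case_prod_unfold)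

lemma sweedler_zero [simp]: "sweedler \<delta> w (\<lambda>u v. 0) = 0"
  by (induction w) (simp_all add: case_prod_unfold)

lemma sweedler_hom:
  fixes \<delta> :: "'x \<Rightarrow> ('x list \<times> 'x list) list"
  assumes "h 0 = 0" "\<And>x y. h (x + y) = h x + h y"
  shows "h (sweedler \<delta> w F) = sweedler \<delta> w (\<lambda>u v. h (F u v))"
proof (induction w arbitrary: F)
  case (Cons g w)
  have "h (\<Sum>x\<leftarrow>xs. f x) = (\<Sum>x\<leftarrow>xs. h (f x))" for xs :: "('x list \<times> 'x list) list" and f
    by (induction xs) (simp_all add: assms)
  then show ?case by (simp add: Cons case_prod_unfold)
qed simp

lemma sweedler_swap:
  fixes \<delta> :: "'x \<Rightarrow> ('x list \<times> 'x list) list" and F :: "_ \<Rightarrow> _ \<Rightarrow> _ \<Rightarrow> _ \<Rightarrow> 'b::comm_monoid_add"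
  shows "sweedler \<delta> w (\<lambda>u v. sweedler \<epsilon> w' (\<lambda>x y. F u v x y)) = sweedler \<epsilon> w' (\<lambda>x y. sweedler \<delta> w (\<lambda>u v. F u v x y))"
proof (induction w arbitrary: F)
  case (Cons g w)
  have "sweedler \<epsilon> w' (\<lambda>x y. \<Sum>k\<leftarrow>ks. f k x y) = (\<Sum>k\<leftarrow>ks. sweedler \<epsilon> w' (f k))"
    for ks :: "('x list \<times> 'x list) list" and f :: "_ \<Rightarrow> _ \<Rightarrow> _ \<Rightarrow> 'b"
    by (induction ks) (simp_all add: sweedler_add)
  then show ?case by (simp add: Cons case_prod_unfold)
qed simp

definition letter_closed :: "('x \<Rightarrow> ('x list \<times> 'x list) list) \<Rightarrow> 'x set \<Rightarrow> bool" where
  "letter_closed \<delta> X \<longleftrightarrow> (\<forall>g\<in>X. \<forall>(a, b)\<in>set (\<delta> g). set a \<subseteq> X \<and> set b \<subseteq> X)"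

lemma sweedler_cong_set:
  assumes "letter_closed \<delta> X" "set w \<subseteq> X"
    and "\<And>u v. set u \<subseteq> X \<Longrightarrow> set v \<subseteq> X \<Longrightarrow> F u v = G u v"
  shows "sweedler \<delta> w F = sweedler \<delta> w G"
  using assms(2,3)
proof (induction w arbitrary: F G)
  case (Cons g w)
  show ?case
    unfolding sweedler.simps
  proof (rule sum_list_map_cong, clarify)
    fix a b assume "(a, b) \<in> set (\<delta> g)"
    then have ab: "set a \<subseteq> X" "set b \<subseteq> X" using assms(1) Cons.prems(1) by (fastforce simp: letter_closed_def)+
    show "sweedler \<delta> w (\<lambda>u v. F (a @ u) (b @ v)) = sweedler \<delta> w (\<lambda>u v. G (a @ u) (b @ v))"
      by (rule Cons.IH) (use Cons.prems ab in auto)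
  qed
qed simp

text \<open>If the coproduct of a letter outside \<open>X\<close> keeps a letter outside \<open>X\<close> in every term, then so does the
  coproduct of a word.  Identities between words over \<open>X\<close> extend by zero to all words in this way.\<close>

lemma sweedler_bad_word:
  assumes "\<And>g a b. g \<notin> X \<Longrightarrow> (a, b) \<in> set (\<delta> g) \<Longrightarrow> \<not> set a \<subseteq> X \<or> \<not> set b \<subseteq> X"
    and "\<not> set w \<subseteq> X" and "\<And>u v. \<not> set u \<subseteq> X \<or> \<not> set v \<subseteq> X \<Longrightarrow> F u v = 0"
  shows "sweedler \<delta> w F = 0"
  using assms(2,3)
proof (induction w arbitrary: F)
  case (Cons g w)
  have "sweedler \<delta> w (\<lambda>u v. F (a @ u) (b @ v)) = 0" if ab: "(a, b) \<in> set (\<delta> g)" for a b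
  proof (cases "g \<in> X")
    case True
    then show ?thesis using Cons.prems by (intro Cons.IH) auto
  next
    case False
    from assms(1)[OF this ab] have "F (a @ u) (b @ v) = 0" for u v
      by (intro Cons.prems(2)) auto
    then show ?thesis by simp
  qed
  then have "(\<Sum>(a, b)\<leftarrow>\<delta> g. sweedler \<delta> w (\<lambda>u v. F (a @ u) (b @ v))) = (\<Sum>x\<leftarrow>\<delta> g. 0)"
    by (intro sum_list_map_cong) auto
  then show ?case by simp
qed simp

text \<open>Coassociativity on letters suffices because the coproduct is multiplicative.\<close>

lemma sweedler_coassoc:
  assumes letter: "\<And>g (F :: _ \<Rightarrow> _ \<Rightarrow> _ \<Rightarrow> 'b::comm_monoid_add).
      (\<Sum>(a, b)\<leftarrow>\<delta> g. sweedler \<delta> a (\<lambda>a1 a2. F a1 a2 b)) = (\<Sum>(a, b)\<leftarrow>\<delta> g. sweedler \<delta> b (\<lambda>b1 b2. F a b1 b2))"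
  shows "sweedler \<delta> w (\<lambda>u v. sweedler \<delta> u (\<lambda>u1 u2. F u1 u2 v))
    = sweedler \<delta> w (\<lambda>u v. sweedler \<delta> v (\<lambda>v1 v2. (F u v1 v2 :: 'b)))"
proof (induction w arbitrary: F)
  case (Cons g w)
  have "sweedler \<delta> (g # w) (\<lambda>u v. sweedler \<delta> u (\<lambda>u1 u2. F u1 u2 v))
      = (\<Sum>(a, b)\<leftarrow>\<delta> g. sweedler \<delta> a (\<lambda>a1 a2. sweedler \<delta> w (\<lambda>u v. sweedler \<delta> u (\<lambda>u1 u2. F (a1 @ u1) (a2 @ u2) (b @ v)))))"
    by (simp add: sweedler_append) (subst sweedler_swap, rule refl)
  also have "\<dots> = (\<Sum>(a, b)\<leftarrow>\<delta> g. sweedler \<delta> b (\<lambda>b1 b2. sweedler \<delta> w (\<lambda>u v. sweedler \<delta> v (\<lambda>v1 v2. F (a @ u) (b1 @ v1) (b2 @ v2)))))"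
    unfolding Cons by (rule letter)
  also have "\<dots> = sweedler \<delta> (g # w) (\<lambda>u v. sweedler \<delta> v (\<lambda>v1 v2. F u v1 v2))"
    by (simp add: sweedler_append) (subst sweedler_swap, rule refl)
  finally show ?case .
qed simp

definition coproduct :: "('x \<Rightarrow> ('x list \<times> 'x list) list) \<Rightarrow> 'x list \<Rightarrow> ('x, 'x) free2" where
  "coproduct \<delta> w = prod_list (map (\<lambda>g. \<Sum>k\<leftarrow>\<delta> g. monom k) w)"

lemma pm_sum_monom_mult:
  assumes "\<And>k. \<Phi> k 0 = 0" "\<And>k x y. \<Phi> k (x + y) = \<Phi> k x + \<Phi> k y"
  shows "pm_sum (\<Phi> :: _ \<Rightarrow> _ \<Rightarrow> 'b::cancel_comm_monoid_add) (monom (a, b) * q)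
    = pm_sum (\<lambda>(u, v). \<Phi> (a @ u, b @ v)) q"
proof (rule additive_eqI[where h = "\<lambda>q. pm_sum \<Phi> (monom (a, b) * q)" and g = "pm_sum (\<lambda>(u, v). \<Phi> (a @ u, b @ v))"])
  show "pm_sum \<Phi> (monom (a, b) * (p + q)) = pm_sum \<Phi> (monom (a, b) * p) + pm_sum \<Phi> (monom (a, b) * q)" for p q
    by (simp add: distrib_left pm_sum_add assms)
  show "pm_sum (\<lambda>(u, v). \<Phi> (a @ u, b @ v)) (p + q)
      = pm_sum (\<lambda>(u, v). \<Phi> (a @ u, b @ v)) p + pm_sum (\<lambda>(u, v). \<Phi> (a @ u, b @ v)) q" for p q
    by (rule pm_sum_add) (auto simp: assms)
  show "pm_sum \<Phi> (monom (a, b) * Poly_Mapping.single k c)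
      = pm_sum (\<lambda>(u, v). \<Phi> (a @ u, b @ v)) (Poly_Mapping.single k c)" for k c
    by (cases k) (simp add: mult_single pm_sum_single assms plus_list_def)
qed

text \<open>The definitions of the pairing and of the double sum over the support of a coproduct, with its
  coefficients; this turns such sums into Sweedler sums over words.\<close>

lemma pm_sum_coproduct:
  fixes \<delta> :: "'x \<Rightarrow> ('x list \<times> 'x list) list"
  assumes "\<And>k. \<Phi> k 0 = 0" "\<And>k x y. \<Phi> k (x + y) = \<Phi> k x + \<Phi> k y"
  shows "pm_sum \<Phi> (coproduct \<delta> w) = sweedler \<delta> w (\<lambda>u v. \<Phi> (u, v) 1 :: 'b::cancel_comm_monoid_add)"
  using assms
proof (induction w arbitrary: \<Phi>)
  case Nil
  have "(1 :: ('x, 'x) free2) = monom ([], [])"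
    by (simp add: single_one[symmetric] zero_prod_def zero_list_def del: single_one)
  moreover have "pm_sum \<Phi> (monom ([], [])) = \<Phi> ([], []) 1" by (rule pm_sum_single) (rule Nil(1))
  ultimately show ?case unfolding coproduct_def by simp
next
  case (Cons g w)
  note prems = Cons.prems and IH = Cons.IH
  have "pm_sum \<Phi> ((\<Sum>k\<leftarrow>ks. monom k) * coproduct \<delta> w)
      = (\<Sum>(a, b)\<leftarrow>ks. sweedler \<delta> w (\<lambda>u v. \<Phi> (a @ u, b @ v) 1))" for ks
  proof (induction ks)
    case (Cons k ks)
    obtain a b where k: "k = (a, b)" by (cases k)
    have "pm_sum \<Phi> (monom (a, b) * coproduct \<delta> w) = sweedler \<delta> w (\<lambda>u v. \<Phi> (a @ u, b @ v) 1)"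
      by (subst pm_sum_monom_mult, (rule prems)+, subst IH) (auto simp: prems)
    then show ?case by (simp add: distrib_right pm_sum_add prems Cons.IH k)
  qed simp
  then show ?case by (simp add: coproduct_def)
qed

section \<open>The pairing on words\<close>

definition delta_plus ::
  "'g q_boson_data \<Rightarrow> ('g \<Rightarrow> complex) plus_gen \<Rightarrow> (('g \<Rightarrow> complex) plus_gen list \<times> ('g \<Rightarrow> complex) plus_gen list) list" where
  "delta_plus D g = (case g of
     GenE i \<Rightarrow> [([GenE i], [GenT (- simple_root D i)]), ([], [GenE i])] | GenT l \<Rightarrow> [([GenT l], [GenT l])])"

definition delta_minus ::
  "'g q_boson_data \<Rightarrow> ('g \<Rightarrow> complex) minus_gen \<Rightarrow> (('g \<Rightarrow> complex) minus_gen list \<times> ('g \<Rightarrow> complex) minus_gen list) list" where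
  "delta_minus D g = (case g of
     GenF i \<Rightarrow> [([GenF i], []), ([GenT' (simple_root D i)], [GenF i])] | GenT' l \<Rightarrow> [([GenT' l], [GenT' l])])"

lemma delta_simps [simp]:
  "delta_plus D (GenE i) = [([GenE i], [GenT (- simple_root D i)]), ([], [GenE i])]"
  "delta_plus D (GenT l) = [([GenT l], [GenT l])]"
  "delta_minus D (GenF i) = [([GenF i], []), ([GenT' (simple_root D i)], [GenF i])]"
  "delta_minus D (GenT' l) = [([GenT' l], [GenT' l])]"
  by (simp_all add: delta_plus_def delta_minus_def)

lemma comult_plus_eq: "comult_plus D = lin_ext (coproduct (delta_plus D))"
  unfolding comult_plus_def coproduct_def
  by (intro arg_cong[where f = lin_ext] ext arg_cong[where f = prod_list] map_cong refl)
    (simp add: delta_plus_def split: plus_gen.splits)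

lemma comult_minus_eq: "comult_minus D = lin_ext (coproduct (delta_minus D))"
  unfolding comult_minus_def coproduct_def
  by (intro arg_cong[where f = lin_ext] ext arg_cong[where f = prod_list] map_cong refl)
    (simp add: delta_minus_def split: minus_gen.splits)

lemma delta_plus_coassoc:
  "sweedler (delta_plus D) w (\<lambda>u v. sweedler (delta_plus D) u (\<lambda>u1 u2. F u1 u2 v))
    = sweedler (delta_plus D) w (\<lambda>u v. sweedler (delta_plus D) v (\<lambda>v1 v2. F u v1 v2))"
  by (rule sweedler_coassoc) (auto simp: delta_plus_def add_ac split: plus_gen.splits)

lemma delta_minus_coassoc:
  "sweedler (delta_minus D) w (\<lambda>u v. sweedler (delta_minus D) u (\<lambda>u1 u2. F u1 u2 v))
    = sweedler (delta_minus D) w (\<lambda>u v. sweedler (delta_minus D) v (\<lambda>v1 v2. F u v1 v2))"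
  by (rule sweedler_coassoc) (auto simp: delta_minus_def add_ac split: minus_gen.splits)

locale q_boson =
  fixes D :: "'g::ab_group_add q_boson_data"
  assumes datum: "q_boson_datum D"
begin

abbreviation "P \<equiv> weight_lattice D"
abbreviation "\<alpha> \<equiv> simple_root D"
abbreviation "Xp \<equiv> gens_plus D"
abbreviation "Xm \<equiv> gens_minus D"
abbreviation "swp \<equiv> sweedler (delta_plus D)"
abbreviation "swm \<equiv> sweedler (delta_minus D)"

lemma lie_cartan: "lie_cartan D"
  using datum by (simp add: q_boson_datum_def lie_cartan_def)

lemmas lattice = lie_cartan.weight_lattice_facts[OF lie_cartan]

lemma pairing: "is_pairing D" and qpow: "is_qpow D"
  using datum by (simp_all add: q_boson_datum_def)

lemma letters:
  "GenE i \<in> Xp \<longleftrightarrow> i \<in> nodes D" "GenT l \<in> Xp \<longleftrightarrow> l \<in> P"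
  "GenF i \<in> Xm \<longleftrightarrow> i \<in> nodes D" "GenT' l \<in> Xm \<longleftrightarrow> l \<in> P"
  by (auto simp: gens_plus_def gens_minus_def lattice(1))

lemma carrier_free: "carrier (free_plus D) = {p. \<forall>w\<in>Poly_Mapping.keys p. set w \<subseteq> Xp}"
  "carrier (free_minus D) = {p. \<forall>w\<in>Poly_Mapping.keys p. set w \<subseteq> Xm}"
  by (simp_all add: free_alg_def)

lemma carrier_free_subspace: "cs.subspace (carrier (free_plus D))" "cs.subspace (carrier (free_minus D))"
  unfolding cs.subspace_def carrier_free using keys_add keys_cscale by fastforce+

lemma monom_carrier [simp]:
  "monom u \<in> carrier (free_plus D) \<longleftrightarrow> set u \<subseteq> Xp" "monom w \<in> carrier (free_minus D) \<longleftrightarrow> set w \<subseteq> Xm"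
  by (simp_all add: carrier_free)

lemma closed_plus: "letter_closed (delta_plus D) Xp"
  using lattice(2,5) by (auto simp: letter_closed_def delta_plus_def letters split: plus_gen.splits)

lemma closed_minus: "letter_closed (delta_minus D) Xm"
  using lattice(2) by (auto simp: letter_closed_def delta_minus_def letters split: minus_gen.splits)

text \<open>The pairing of words, extended by zero to words with letters outside the generating sets, so
  that the Hopf pairing identities hold for all words.\<close>

definition ph :: "('g \<Rightarrow> complex) plus_gen list \<Rightarrow> ('g \<Rightarrow> complex) minus_gen list \<Rightarrow> complex" where
  "ph u w = (if set u \<subseteq> Xp \<and> set w \<subseteq> Xm then pairing D (monom u) (monom w) else 0)"

lemma ph_bad: "\<not> set u \<subseteq> Xp \<Longrightarrow> ph u w = 0" "\<not> set w \<subseteq> Xm \<Longrightarrow> ph u w = 0"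
  by (auto simp: ph_def)

lemma monom_mult: "monom u * monom v = (monom (u @ v) :: 'x free)"
  by (simp add: mult_single plus_list_def)

lemma ph_append_right: "ph u (w @ w') = swp u (\<lambda>u1 u2. ph u1 w * ph u2 w')"
proof (cases "set u \<subseteq> Xp \<and> set w \<subseteq> Xm \<and> set w' \<subseteq> Xm")
  case True
  then have u: "set u \<subseteq> Xp" and c: "monom u \<in> carrier (free_plus D)" "monom w \<in> carrier (free_minus D)"
      "monom w' \<in> carrier (free_minus D)" by simp_all
  let ?phi = "pairing D"
  have "?phi (monom u) (monom w * monom w') =
        (\<Sum>(u1, u2)\<in>Poly_Mapping.keys (comult_plus D (monom u)).
           Poly_Mapping.lookup (comult_plus D (monom u)) (u1, u2) * ?phi (monom u1) (monom w) * ?phi (monom u2) (monom w'))"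
    using pairing c unfolding is_pairing_def Let_def by meson
  also have "\<dots> = pm_sum (\<lambda>(u1, u2) c. c * ?phi (monom u1) (monom w) * ?phi (monom u2) (monom w')) (coproduct (delta_plus D) u)"
    by (simp add: comult_plus_eq pm_sum_def case_prod_unfold)
  also have "\<dots> = swp u (\<lambda>u1 u2. 1 * ?phi (monom u1) (monom w) * ?phi (monom u2) (monom w'))"
    by (subst pm_sum_coproduct) (auto simp: algebra_simps)
  also have "\<dots> = swp u (\<lambda>u1 u2. ph u1 w * ph u2 w')"
    by (rule sweedler_cong_set[OF closed_plus u]) (use True in \<open>simp add: ph_def\<close>)
  finally show ?thesis using True by (simp add: ph_def monom_mult)
next
  case False
  show ?thesis
  proof (cases "set u \<subseteq> Xp")
    case True
    then have "(\<lambda>u1 u2. ph u1 w * ph u2 w') = (\<lambda>u1 u2. 0)" using False True by (auto simp: ph_def fun_eq_iff)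
    then have "swp u (\<lambda>u1 u2. ph u1 w * ph u2 w') = 0" by simp
    then show ?thesis using False True by (auto simp: ph_def)
  next
    case bad: False
    have "swp u (\<lambda>u1 u2. ph u1 w * ph u2 w') = 0"
      by (rule sweedler_bad_word[OF _ bad])
        (auto simp: ph_def delta_plus_def letters split: plus_gen.splits if_splits)
    then show ?thesis using bad by (simp add: ph_bad)
  qed
qed

lemma ph_append_left: "ph (u @ u') w = swm w (\<lambda>w1 w2. ph u w2 * ph u' w1)"
proof (cases "set w \<subseteq> Xm \<and> set u \<subseteq> Xp \<and> set u' \<subseteq> Xp")
  case True
  then have w: "set w \<subseteq> Xm" and c: "monom w \<in> carrier (free_minus D)" "monom u \<in> carrier (free_plus D)"
      "monom u' \<in> carrier (free_plus D)" by simp_all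
  let ?phi = "pairing D"
  have "?phi (monom u * monom u') (monom w) =
        (\<Sum>(w1, w2)\<in>Poly_Mapping.keys (comult_minus D (monom w)).
           Poly_Mapping.lookup (comult_minus D (monom w)) (w1, w2) * ?phi (monom u) (monom w2) * ?phi (monom u') (monom w1))"
    using pairing c unfolding is_pairing_def Let_def by meson
  also have "\<dots> = pm_sum (\<lambda>(w1, w2) c. c * ?phi (monom u) (monom w2) * ?phi (monom u') (monom w1)) (coproduct (delta_minus D) w)"
    by (simp add: comult_minus_eq pm_sum_def case_prod_unfold)
  also have "\<dots> = swm w (\<lambda>w1 w2. 1 * ?phi (monom u) (monom w2) * ?phi (monom u') (monom w1))"
    by (subst pm_sum_coproduct) (auto simp: algebra_simps)
  also have "\<dots> = swm w (\<lambda>w1 w2. ph u w2 * ph u' w1)"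
    by (rule sweedler_cong_set[OF closed_minus w]) (use True in \<open>simp add: ph_def\<close>)
  finally show ?thesis using True by (simp add: ph_def monom_mult)
next
  case False
  show ?thesis
  proof (cases "set w \<subseteq> Xm")
    case True
    then have "(\<lambda>w1 w2. ph u w2 * ph u' w1) = (\<lambda>w1 w2. 0)" using False True by (auto simp: ph_def fun_eq_iff)
    then have "swm w (\<lambda>w1 w2. ph u w2 * ph u' w1) = 0" by simp
    then show ?thesis using False True by (auto simp: ph_def)
  next
    case bad: False
    have "swm w (\<lambda>w1 w2. ph u w2 * ph u' w1) = 0"
      by (rule sweedler_bad_word[OF _ bad])
        (auto simp: ph_def delta_minus_def letters split: minus_gen.splits if_splits)
    then show ?thesis using bad by (simp add: ph_bad)
  qed
qed

lemma monom_Nil: "monom [] = (1 :: 'x free)"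
  by (simp add: single_one[symmetric] zero_list_def del: single_one)

text \<open>The counits on words.\<close>

fun epsp :: "('g \<Rightarrow> complex) plus_gen list \<Rightarrow> complex" where
  "epsp [] = 1" | "epsp (GenE i # u) = 0" | "epsp (GenT l # u) = epsp u"

fun epsm :: "('g \<Rightarrow> complex) minus_gen list \<Rightarrow> complex" where
  "epsm [] = 1" | "epsm (GenF i # u) = 0" | "epsm (GenT' l # u) = epsm u"

lemma ph_Nil_right: "set u \<subseteq> Xp \<Longrightarrow> ph u [] = epsp u"
proof -
  assume u: "set u \<subseteq> Xp"
  have "\<forall>a\<in>carrier (free_plus D). pairing D a 1 = counit_plus a"
    using pairing unfolding is_pairing_def Let_def by meson
  then have "ph u [] = counit_plus (monom u)" using u by (simp add: ph_def monom_Nil del: single_one)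
  also have "\<dots> = epsp u"
    unfolding counit_plus_def by (induction u rule: epsp.induct) simp_all
  finally show ?thesis .
qed

lemma ph_Nil_left: "set w \<subseteq> Xm \<Longrightarrow> ph [] w = epsm w"
proof -
  assume w: "set w \<subseteq> Xm"
  have "\<forall>b\<in>carrier (free_minus D). pairing D 1 b = counit_minus b"
    using pairing unfolding is_pairing_def Let_def by meson
  then have "ph [] w = counit_minus (monom w)" using w by (simp add: ph_def monom_Nil del: single_one)
  also have "\<dots> = epsm w"
    unfolding counit_minus_def by (induction w rule: epsm.induct) simp_all
  finally show ?thesis .
qed

text \<open>The factor in \<open>e'\<^sub>i = (q\<^sub>i\<^sup>-\<^sup>1 - q\<^sub>i) t\<^sub>i e\<^sub>i\<close>.\<close>

definition "cc i = inverse (qi D i) - qi D i"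

lemma ph_letters:
  "i \<in> nodes D \<Longrightarrow> j \<in> nodes D \<Longrightarrow> ph [GenE i] [GenF j] = (if i = j then 1 / cc i else 0)"
  "l \<in> P \<Longrightarrow> m \<in> P \<Longrightarrow> ph [GenT l] [GenT' m] = qexp D (- dform D l m)"
  "i \<in> nodes D \<Longrightarrow> l \<in> P \<Longrightarrow> ph [GenE i] [GenT' l] = 0"
  "i \<in> nodes D \<Longrightarrow> l \<in> P \<Longrightarrow> ph [GenT l] [GenF i] = 0"
proof -
  note p = pairing[unfolded is_pairing_def Let_def lattice(1)]
  show "i \<in> nodes D \<Longrightarrow> j \<in> nodes D \<Longrightarrow> ph [GenE i] [GenF j] = (if i = j then 1 / cc i else 0)"
    using p by (simp add: ph_def letters cc_def)
  show "l \<in> P \<Longrightarrow> m \<in> P \<Longrightarrow> ph [GenT l] [GenT' m] = qexp D (- dform D l m)"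
    using p by (simp add: ph_def letters)
  show "i \<in> nodes D \<Longrightarrow> l \<in> P \<Longrightarrow> ph [GenE i] [GenT' l] = 0"
    using p by (simp add: ph_def letters)
  show "i \<in> nodes D \<Longrightarrow> l \<in> P \<Longrightarrow> ph [GenT l] [GenF i] = 0"
    using p by (simp add: ph_def letters)
qed

lemma swp_counit_left: "set u \<subseteq> Xp \<Longrightarrow> swp u (\<lambda>u1 u2. ph u1 [] * F u2) = F u"
proof -
  have *: "swp u (\<lambda>u1 u2. epsp u1 * F u2) = F u" for u F
  proof (induction u arbitrary: F)
    case (Cons g u)
    show ?case by (cases g) (simp_all add: Cons)
  qed simp
  assume u: "set u \<subseteq> Xp"
  have "swp u (\<lambda>u1 u2. ph u1 [] * F u2) = swp u (\<lambda>u1 u2. epsp u1 * F u2)"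
    by (rule sweedler_cong_set[OF closed_plus u]) (simp add: ph_Nil_right)
  then show ?thesis by (simp add: *)
qed

lemma swm_counit_left:
  "set w \<subseteq> Xm \<Longrightarrow> swm w (\<lambda>w1 w2. cscale (ph [] w1) (F w2)) = F w"
proof -
  have *: "swm w (\<lambda>w1 w2. cscale (epsm w1) (F w2)) = F w" for w F
  proof (induction w arbitrary: F)
    case (Cons g w)
    show ?case by (cases g) (simp_all add: Cons)
  qed simp
  assume w: "set w \<subseteq> Xm"
  have "swm w (\<lambda>w1 w2. cscale (ph [] w1) (F w2)) = swm w (\<lambda>w1 w2. cscale (epsm w1) (F w2))"
    by (rule sweedler_cong_set[OF closed_minus w]) (simp add: ph_Nil_left)
  then show ?thesis by (simp add: *)
qed

definition PH :: "'g pfree \<Rightarrow> 'g mfree \<Rightarrow> complex" where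
  "PH a b = ev (\<lambda>u. ev (ph u) b) a"

lemma PH_monom [simp]: "PH (monom u) b = ev (ph u) b" "PH a (monom w) = ev (\<lambda>u. ph u w) a"
  by (simp_all add: PH_def)

lemma pairing_eq:
  assumes a: "a \<in> carrier (free_plus D)" and b: "b \<in> carrier (free_minus D)"
  shows "pairing D a b = PH a b"
proof -
  note p = pairing[unfolded is_pairing_def Let_def]
  let ?A = "carrier (free_plus D)" and ?B = "carrier (free_minus D)"
  note p1 = p[THEN conjunct1] and p2 = p[THEN conjunct2, THEN conjunct1]
    and p3 = p[THEN conjunct2, THEN conjunct2, THEN conjunct1]
  have add1: "pairing D (x + y) z = pairing D x z + pairing D y z" if "x \<in> ?A" "y \<in> ?A" "z \<in> ?B" for x y z
    using p1 that by blast
  have add2: "pairing D x (y + z) = pairing D x y + pairing D x z" if "x \<in> ?A" "y \<in> ?B" "z \<in> ?B" for x y z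
    using p2 that by blast
  have scale: "pairing D (cscale c x) y = c * pairing D x y \<and> pairing D x (cscale c y) = c * pairing D x y"
    if "x \<in> ?A" "y \<in> ?B" for x y c
    using p3 that by blast
  have zA: "0 \<in> ?A" and zB: "0 \<in> ?B" using carrier_free_subspace cs.subspace_0 by blast+
  have z1: "pairing D 0 y = 0" if "y \<in> ?B" for y using scale[OF zA that, of 0] by simp
  have z2: "pairing D x 0 = 0" if "x \<in> ?A" for x using scale[OF that zB, of 0] by simp
  have left: "pairing D (\<Sum>k\<in>S. cscale (f k) (monom k)) y = (\<Sum>k\<in>S. f k * pairing D (monom k) y)"
    if "finite S" "\<forall>k\<in>S. set k \<subseteq> Xp" "y \<in> ?B" for S f y
    using that(1,2)
  proof (induction S rule: finite_induct)
    case (insert k S)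
    have "cscale (f k) (monom k) \<in> ?A" "(\<Sum>k\<in>S. cscale (f k) (monom k)) \<in> ?A"
      using insert.prems carrier_free_subspace(1)
      by (intro cs.subspace_scale cs.subspace_sum carrier_free_subspace(1); simp)+
    then show ?case using insert add1 scale[of "monom k" y "f k"] that(3) by (simp del: cscale_single)
  qed (simp add: z1 that)
  have right: "pairing D x (\<Sum>k\<in>S. cscale (f k) (monom k)) = (\<Sum>k\<in>S. f k * pairing D x (monom k))"
    if "finite S" "\<forall>k\<in>S. set k \<subseteq> Xm" "x \<in> ?A" for S f x
    using that(1,2)
  proof (induction S rule: finite_induct)
    case (insert k S)
    have "cscale (f k) (monom k) \<in> ?B" "(\<Sum>k\<in>S. cscale (f k) (monom k)) \<in> ?B"
      using insert.prems carrier_free_subspace(2)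
      by (intro cs.subspace_scale cs.subspace_sum carrier_free_subspace(2); simp)+
    then show ?case using insert add2 scale[of x "monom k" "f k"] that(3) by (simp del: cscale_single)
  qed (simp add: z2 that)
  have ka: "\<forall>k\<in>Poly_Mapping.keys a. set k \<subseteq> Xp" and kb: "\<forall>k\<in>Poly_Mapping.keys b. set k \<subseteq> Xm"
    using a b by (simp_all add: carrier_free)
  have "pairing D a b = pairing D (\<Sum>k\<in>Poly_Mapping.keys a. cscale (Poly_Mapping.lookup a k) (monom k)) b"
    using poly_mapping_expand[of a] by simp
  also have "\<dots> = (\<Sum>u\<in>Poly_Mapping.keys a. Poly_Mapping.lookup a u * pairing D (monom u) b)"
    by (rule left[OF _ ka b]) simp
  also have "\<dots> = (\<Sum>u\<in>Poly_Mapping.keys a. Poly_Mapping.lookup a u * ev (ph u) b)"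
  proof (intro sum.cong refl arg_cong2[where f = "(*)"])
    fix u assume u: "u \<in> Poly_Mapping.keys a"
    have "pairing D (monom u) b = pairing D (monom u) (\<Sum>k\<in>Poly_Mapping.keys b. cscale (Poly_Mapping.lookup b k) (monom k))"
      using poly_mapping_expand[of b] by simp
    also have "\<dots> = (\<Sum>w\<in>Poly_Mapping.keys b. Poly_Mapping.lookup b w * pairing D (monom u) (monom w))"
      by (rule right[OF _ kb]) (use u ka in auto)
    also have "\<dots> = (\<Sum>w\<in>Poly_Mapping.keys b. Poly_Mapping.lookup b w * ph u w)"
      using u ka kb by (intro sum.cong refl) (simp add: ph_def)
    finally show "pairing D (monom u) b = ev (ph u) b" by (simp add: ev_def pm_sum_def)
  qed
  finally show ?thesis by (simp add: PH_def ev_def pm_sum_def)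
qed

lemma rad_minus_iff: "b \<in> rad_minus D \<longleftrightarrow> b \<in> carrier (free_minus D) \<and> (\<forall>u. ev (ph u) b = 0)"
proof -
  have "(\<forall>a\<in>carrier (free_plus D). PH a b = 0) \<longleftrightarrow> (\<forall>u. ev (ph u) b = 0)" (is "?l \<longleftrightarrow> ?r")
  proof
    assume ?l
    have "ev (ph u) b = 0" for u
    proof (cases "set u \<subseteq> Xp")
      case True
      then show ?thesis using \<open>?l\<close>[rule_format, of "monom u"] by simp
    next
      case False
      then have "ph u = (\<lambda>w. 0)" by (simp add: ph_bad fun_eq_iff)
      then show ?thesis by simp
    qed
    then show ?r by blast
  qed (simp add: PH_def)
  then show ?thesis by (auto simp: rad_minus_def pairing_eq)
qed

lemma rad_plus_iff: "a \<in> rad_plus D \<longleftrightarrow> a \<in> carrier (free_plus D) \<and> (\<forall>w. ev (\<lambda>u. ph u w) a = 0)"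
proof -
  have "(\<forall>b\<in>carrier (free_minus D). PH a b = 0) \<longleftrightarrow> (\<forall>w. ev (\<lambda>u. ph u w) a = 0)" (is "?l \<longleftrightarrow> ?r")
  proof
    assume ?l
    have "ev (\<lambda>u. ph u w) a = 0" for w
    proof (cases "set w \<subseteq> Xm")
      case True
      then show ?thesis using \<open>?l\<close>[rule_format, of "monom w"] by simp
    next
      case False
      then show ?thesis by (simp add: ph_bad)
    qed
    then show ?r by blast
  next
    assume ?r
    then show ?l by (simp add: PH_def ev_swap[of "\<lambda>u w. ph u w"])
  qed
  then show ?thesis by (auto simp: rad_plus_def pairing_eq)
qed

end

lemma supported_subspace: "cs.subspace {p. \<forall>k\<in>Poly_Mapping.keys p. Q k}"
  unfolding cs.subspace_def by (auto dest!: subsetD[OF keys_add] subsetD[OF keys_cscale])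

lemma lin_ext_in_subspace:
  assumes "cs.subspace W" "\<And>k. k \<in> Poly_Mapping.keys p \<Longrightarrow> f k \<in> W"
  shows "lin_ext f p \<in> W"
  unfolding lin_ext_def by (intro cs.subspace_sum cs.subspace_scale assms)

lemma sweedler_in_subspace:
  assumes "letter_closed \<delta> X" "set w \<subseteq> X" and W: "cs.subspace W"
    and "\<And>u v. set u \<subseteq> X \<Longrightarrow> set v \<subseteq> X \<Longrightarrow> F u v \<in> W"
  shows "sweedler \<delta> w F \<in> W"
  using assms(2,4)
proof (induction w arbitrary: F)
  case (Cons g w)
  have 1: "sweedler \<delta> w (\<lambda>u v. F (a @ u) (b @ v)) \<in> W" if ab: "(a, b) \<in> set (\<delta> g)" for a b
  proof -
    have "set a \<subseteq> X" "set b \<subseteq> X" using assms(1) Cons.prems(1) ab by (fastforce simp: letter_closed_def)+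
    then show ?thesis using Cons.prems by (intro Cons.IH) auto
  qed
  have "(\<Sum>(a, b)\<leftarrow>ks. sweedler \<delta> w (\<lambda>u v. F (a @ u) (b @ v))) \<in> W" if "set ks \<subseteq> set (\<delta> g)" for ks
    using that by (induction ks) (auto intro!: cs.subspace_0[OF W] cs.subspace_add[OF W] 1)
  then show ?case by simp
qed simp

lemma tens_lin_ext: "tens b a = lin_ext (\<lambda>w. lin_ext (\<lambda>u. monom (w, u)) a) b"
  by (simp add: tens_def lin_ext_def cs.scale_sum_right)

lemma tens_linear:
  "tens (b + b') a = tens b a + tens b' a" "tens b (a + a') = tens b a + tens b a'"
  "tens (cscale c b) a = cscale c (tens b a)" "tens b (cscale c a) = cscale c (tens b a)"
  by (simp_all add: tens_lin_ext lin_ext_add lin_ext_cscale lin_ext_fun_add lin_ext_fun_cscale)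

lemma tens_zero [simp]: "tens 0 a = 0" "tens b 0 = 0"
  using tens_linear(3)[of 0 0 a] tens_linear(4)[of b 0 0] by simp_all

lemma tens_uminus: "tens (- b) a = - tens b a" "tens b (- a) = - tens b a"
  using tens_linear(1)[of b "- b" a] tens_linear(2)[of b a "- a"] by (simp_all add: eq_neg_iff_add_eq_0 add.commute)

lemma tens_diff: "tens (b - b') a = tens b a - tens b' a" "tens b (a - a') = tens b a - tens b a'"
  using tens_linear(1)[of b "- b'" a] tens_linear(2)[of b a "- a'"] by (simp_all add: tens_uminus)

lemma tens_monom [simp]: "tens (monom w) (monom u) = monom (w, u)"
  by (simp add: tens_lin_ext)

lemma keys_tens: "Poly_Mapping.keys (tens b a) \<subseteq> Poly_Mapping.keys b \<times> Poly_Mapping.keys a"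
proof -
  have "tens b a \<in> {p. \<forall>k\<in>Poly_Mapping.keys p. k \<in> Poly_Mapping.keys b \<times> Poly_Mapping.keys a}"
    unfolding tens_lin_ext by (intro lin_ext_in_subspace supported_subspace) simp
  then show ?thesis by blast
qed

lemma pm_sum_coproduct_scale:
  fixes W :: "_ \<Rightarrow> _ \<Rightarrow> 'a \<Rightarrow>\<^sub>0 complex"
  shows "pm_sum (\<lambda>(u, v) c. cscale c (W u v)) (coproduct \<delta> w) = sweedler \<delta> w W"
proof -
  have "pm_sum (\<lambda>(u, v) c. cscale c (W u v)) (coproduct \<delta> w)
      = sweedler \<delta> w (\<lambda>u v. (\<lambda>(u, v) c. cscale c (W u v)) (u, v) 1)"
    by (rule pm_sum_coproduct) (simp_all add: case_prod_unfold cs.scale_left_distrib)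
  then show ?thesis by simp
qed

context q_boson
begin

section \<open>The Heisenberg double\<close>

abbreviation "HF \<equiv> carrier (heis_free D)"
abbreviation "AA \<equiv> carrier (free_plus D)"
abbreviation "BB \<equiv> carrier (free_minus D)"

lemma HF_eq: "HF = {p. \<forall>k\<in>Poly_Mapping.keys p. set (fst k) \<subseteq> Xm \<and> set (snd k) \<subseteq> Xp}"
  by (simp add: heis_free_def case_prod_unfold)

lemma HF_subspace: "cs.subspace HF"
  unfolding HF_eq by (rule supported_subspace)

lemma single_HF: "set w \<subseteq> Xm \<Longrightarrow> set u \<subseteq> Xp \<Longrightarrow> Poly_Mapping.single (w, u) c \<in> HF"
  by (simp add: HF_eq)

lemma HF_keys: "x \<in> HF \<Longrightarrow> (w, u) \<in> Poly_Mapping.keys x \<Longrightarrow> set w \<subseteq> Xm \<and> set u \<subseteq> Xp"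
  unfolding HF_eq by force

lemma tens_HF: "b \<in> BB \<Longrightarrow> a \<in> AA \<Longrightarrow> tens b a \<in> HF"
  using keys_tens[of b a] unfolding HF_eq carrier_free by force

fun hm where
  "hm (w, u) (w', u') = swp u (\<lambda>u1 u2. swm w' (\<lambda>w1 w2. Poly_Mapping.single (w @ w2, u2 @ u') (ph u1 w1)))"

text \<open>The product of the double, extended bilinearly from the basis elements \<open>w \<sharp> u\<close>.\<close>

definition HM :: "'g mpfree \<Rightarrow> 'g mpfree \<Rightarrow> 'g mpfree" where
  "HM x y = lin_ext (\<lambda>k. lin_ext (hm k) y) x"

lemma HM_linear:
  "HM (x + x') y = HM x y + HM x' y" "HM x (y + y') = HM x y + HM x y'"
  "HM (cscale c x) y = cscale c (HM x y)" "HM x (cscale c y) = cscale c (HM x y)"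
  by (simp_all add: HM_def lin_ext_add lin_ext_cscale lin_ext_fun_add lin_ext_fun_cscale)

lemma HM_zero [simp]: "HM 0 y = 0" "HM x 0 = 0"
  using HM_linear(3)[of 0 0 y] HM_linear(4)[of x 0 0] by simp_all

lemma HM_monom: "HM (monom k) y = lin_ext (hm k) y" "HM x (monom k') = lin_ext (\<lambda>k. hm k k') x"
  by (simp_all add: HM_def)

lemma heis_mult_eq:
  assumes "x \<in> HF" "y \<in> HF" shows "heis_mult D x y = HM x y"
proof -
  have *: "(\<Sum>(u1, u2)\<in>Poly_Mapping.keys (comult_plus D (monom u)).
      \<Sum>(w1, w2)\<in>Poly_Mapping.keys (comult_minus D (monom w')).
        Poly_Mapping.single (w @ w2, u2 @ u')
          (c * d * Poly_Mapping.lookup (comult_plus D (monom u)) (u1, u2) *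
           Poly_Mapping.lookup (comult_minus D (monom w')) (w1, w2) * pairing D (monom u1) (monom w1)))
      = cscale c (cscale d (hm (w, u) (w', u')))" (is "?l = _")
    if u: "set u \<subseteq> Xp" and w': "set w' \<subseteq> Xm" for c d w u w' u'
  proof -
    let ?S = "\<lambda>u1 u2 w1 w2. Poly_Mapping.single (w @ w2, u2 @ u') (pairing D (monom u1) (monom w1))"
    have "?l = cscale (c * d) (pm_sum (\<lambda>(u1, u2) p. cscale p (pm_sum (\<lambda>(w1, w2) q. cscale q (?S u1 u2 w1 w2))
          (coproduct (delta_minus D) w'))) (coproduct (delta_plus D) u))"
      by (simp add: comult_plus_eq comult_minus_eq pm_sum_def case_prod_unfold cs.scale_sum_right mult_ac)
    also have "\<dots> = cscale (c * d) (swp u (\<lambda>u1 u2. swm w' (?S u1 u2)))"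
      by (simp only: pm_sum_coproduct_scale)
    also have "swp u (\<lambda>u1 u2. swm w' (?S u1 u2)) = hm (w, u) (w', u')"
      unfolding hm.simps
      by (intro sweedler_cong_set[OF closed_plus u] sweedler_cong_set[OF closed_minus w'])
        (simp add: ph_def)
    finally show ?thesis by simp
  qed
  have "heis_mult D x y = (\<Sum>k\<in>Poly_Mapping.keys x. \<Sum>k'\<in>Poly_Mapping.keys y.
      cscale (Poly_Mapping.lookup x k) (cscale (Poly_Mapping.lookup y k') (hm k k')))"
    unfolding heis_mult_def
  proof (intro sum.cong refl, clarify, intro sum.cong refl, clarify)
    fix w u w' u' assume "(w, u) \<in> Poly_Mapping.keys x" "(w', u') \<in> Poly_Mapping.keys y"
    then have "set u \<subseteq> Xp" "set w' \<subseteq> Xm" using assms HF_keys by blast+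
    from *[OF this] show "(\<Sum>(u1, u2)\<in>Poly_Mapping.keys (comult_plus D (monom u)).
      \<Sum>(w1, w2)\<in>Poly_Mapping.keys (comult_minus D (monom w')).
        Poly_Mapping.single (w @ w2, u2 @ u')
          (Poly_Mapping.lookup x (w, u) * Poly_Mapping.lookup y (w', u') *
           Poly_Mapping.lookup (comult_plus D (monom u)) (u1, u2) *
           Poly_Mapping.lookup (comult_minus D (monom w')) (w1, w2) * pairing D (monom u1) (monom w1)))
      = cscale (Poly_Mapping.lookup x (w, u)) (cscale (Poly_Mapping.lookup y (w', u')) (hm (w, u) (w', u')))" .
  qed
  then show ?thesis by (simp add: HM_def lin_ext_def cs.scale_sum_right)
qed

lemma hm_closed:
  assumes "set w \<subseteq> Xm" "set u \<subseteq> Xp" "set w' \<subseteq> Xm" "set u' \<subseteq> Xp"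
  shows "hm (w, u) (w', u') \<in> HF"
  unfolding hm.simps
  by (intro sweedler_in_subspace[OF closed_plus] sweedler_in_subspace[OF closed_minus] HF_subspace single_HF)
    (use assms in simp_all)

lemma HM_closed:
  assumes "x \<in> HF" "y \<in> HF" shows "HM x y \<in> HF"
  unfolding HM_def
proof (intro lin_ext_in_subspace HF_subspace)
  fix k k' assume kk: "k \<in> Poly_Mapping.keys x" "k' \<in> Poly_Mapping.keys y"
  obtain w u w' u' where k: "k = (w, u)" "k' = (w', u')" by (cases k, cases k')
  have "set w \<subseteq> Xm" "set u \<subseteq> Xp" "set w' \<subseteq> Xm" "set u' \<subseteq> Xp"
    using HF_keys assms kk unfolding k by blast+
  then show "hm k k' \<in> HF" unfolding k by (rule hm_closed)
qed

lemma cscale_swp: "cscale c (swp u F) = swp u (\<lambda>u1 u2. cscale c (F u1 u2))"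
  and cscale_swm: "cscale c (swm w G) = swm w (\<lambda>w1 w2. cscale c (G w1 w2))"
  by (rule sweedler_hom; simp add: cs.scale_right_distrib)+

lemma lin_ext_swp: "lin_ext f (swp u F) = swp u (\<lambda>u1 u2. lin_ext f (F u1 u2))"
  and lin_ext_swm: "lin_ext f (swm w G) = swm w (\<lambda>w1 w2. lin_ext f (G w1 w2))"
  by (rule sweedler_hom; simp add: lin_ext_add)+

lemma ev_swp: "ev f (swp u F) = swp u (\<lambda>u1 u2. ev f (F u1 u2))"
  and ev_swm: "ev f (swm w G) = swm w (\<lambda>w1 w2. ev f (G w1 w2))"
  by (rule sweedler_hom; simp add: ev_add)+

lemma single_swp: "Poly_Mapping.single k (swp u F) = swp u (\<lambda>u1 u2. Poly_Mapping.single k (F u1 u2))"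
  and single_swm: "Poly_Mapping.single k (swm w G) = swm w (\<lambda>w1 w2. Poly_Mapping.single k (G w1 w2))"
  by (rule sweedler_hom; simp add: single_add)+

lemma mult_swp: "c * swp u F = swp u (\<lambda>u1 u2. c * F u1 u2)" "swp u F * c = swp u (\<lambda>u1 u2. F u1 u2 * c)"
  and mult_swm: "c * swm w G = swm w (\<lambda>w1 w2. c * G w1 w2)" "swm w G * c = swm w (\<lambda>w1 w2. G w1 w2 * c)"
  for c :: complex
  by (rule sweedler_hom; simp add: algebra_simps)+

text \<open>Associativity on basis elements.  Both sides are the sum of
  \<open>\<phi>(u\<^sub>(\<^sub>1\<^sub>), w'\<^sub>(\<^sub>1\<^sub>)) \<phi>(u\<^sub>(\<^sub>2\<^sub>), w''\<^sub>(\<^sub>2\<^sub>)) \<phi>(u'\<^sub>(\<^sub>1\<^sub>), w''\<^sub>(\<^sub>1\<^sub>)) w w'\<^sub>(\<^sub>2\<^sub>) w''\<^sub>(\<^sub>3\<^sub>) \<sharp> u\<^sub>(\<^sub>3\<^sub>) u'\<^sub>(\<^sub>2\<^sub>) u''\<close>.\<close>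

lemma hm_assoc:
  "lin_ext (\<lambda>k. hm k (w'', u'')) (hm (w, u) (w', u')) = lin_ext (hm (w, u)) (hm (w', u') (w'', u''))"
proof -
  let ?G = "\<lambda>u1 x1 x2 a1 a2 c1 c2 y2 z1 z2. Poly_Mapping.single (w @ x2 @ y2, a2 @ c2 @ u'') (ph c1 z1 * (ph u1 x1 * ph a1 z2))"
  have "lin_ext (\<lambda>k. hm k (w'', u'')) (hm (w, u) (w', u'))
      = swp u (\<lambda>u1 u2. swm w' (\<lambda>x1 x2. swp u2 (\<lambda>a1 a2. swp u' (\<lambda>c1 c2. swm w'' (\<lambda>y1 y2. swm y1 (\<lambda>z1 z2.
          ?G u1 x1 x2 a1 a2 c1 c2 y2 z1 z2))))))"
    by (simp add: lin_ext_swp lin_ext_swm sweedler_append cscale_swp cscale_swm ph_append_left single_swm mult_swm mult_ac)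
  also have "\<dots> = swm w' (\<lambda>x1 x2. swp u (\<lambda>u1 u2. swp u2 (\<lambda>a1 a2. swp u' (\<lambda>c1 c2. swm w'' (\<lambda>y1 y2. swm y1 (\<lambda>z1 z2.
          ?G u1 x1 x2 a1 a2 c1 c2 y2 z1 z2))))))"
    by (rule sweedler_swap)
  also have "\<dots> = swm w' (\<lambda>x1 x2. swp u (\<lambda>u1 u2. swp u2 (\<lambda>a1 a2. swp u' (\<lambda>c1 c2. swm w'' (\<lambda>y1 y2. swm y2 (\<lambda>t1 t2.
          ?G u1 x1 x2 a1 a2 c1 c2 t2 y1 t1))))))"
    by (rule sweedler_cong, rule sweedler_cong, rule sweedler_cong, rule sweedler_cong, rule delta_minus_coassoc)
  also have "\<dots> = swm w' (\<lambda>x1 x2. swp u (\<lambda>u1 u2. swp u1 (\<lambda>b1 b2. swp u' (\<lambda>c1 c2. swm w'' (\<lambda>y1 y2. swm y2 (\<lambda>t1 t2.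
          ?G b1 x1 x2 b2 u2 c1 c2 t2 y1 t1))))))"
    by (rule sweedler_cong, rule delta_plus_coassoc[symmetric])
  finally have L: "lin_ext (\<lambda>k. hm k (w'', u'')) (hm (w, u) (w', u')) = \<dots>" .
  have "lin_ext (hm (w, u)) (hm (w', u') (w'', u''))
      = swp u' (\<lambda>c1 c2. swm w'' (\<lambda>y1 y2. swp u (\<lambda>u1 u2. swm w' (\<lambda>x1 x2. swm y2 (\<lambda>t1 t2. swp u1 (\<lambda>b1 b2.
          ?G b1 x1 x2 b2 u2 c1 c2 t2 y1 t1))))))"
    by (simp add: lin_ext_swp lin_ext_swm sweedler_append cscale_swp cscale_swm ph_append_right single_swp mult_swp mult_ac)
  also have "\<dots> = swp u' (\<lambda>c1 c2. swm w'' (\<lambda>y1 y2. swp u (\<lambda>u1 u2. swm w' (\<lambda>x1 x2. swp u1 (\<lambda>b1 b2. swm y2 (\<lambda>t1 t2. 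
          ?G b1 x1 x2 b2 u2 c1 c2 t2 y1 t1))))))"
    by (rule sweedler_cong, rule sweedler_cong, rule sweedler_cong, rule sweedler_cong, rule sweedler_swap)
  also have "\<dots> = swp u' (\<lambda>c1 c2. swm w'' (\<lambda>y1 y2. swm w' (\<lambda>x1 x2. swp u (\<lambda>u1 u2. swp u1 (\<lambda>b1 b2. swm y2 (\<lambda>t1 t2. 
          ?G b1 x1 x2 b2 u2 c1 c2 t2 y1 t1))))))"
    by (rule sweedler_cong, rule sweedler_cong, rule sweedler_swap)
  also have "\<dots> = swp u' (\<lambda>c1 c2. swm w' (\<lambda>x1 x2. swm w'' (\<lambda>y1 y2. swp u (\<lambda>u1 u2. swp u1 (\<lambda>b1 b2. swm y2 (\<lambda>t1 t2. 
          ?G b1 x1 x2 b2 u2 c1 c2 t2 y1 t1))))))"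
    by (rule sweedler_cong, rule sweedler_swap)
  also have "\<dots> = swm w' (\<lambda>x1 x2. swp u' (\<lambda>c1 c2. swm w'' (\<lambda>y1 y2. swp u (\<lambda>u1 u2. swp u1 (\<lambda>b1 b2. swm y2 (\<lambda>t1 t2. 
          ?G b1 x1 x2 b2 u2 c1 c2 t2 y1 t1))))))"
    by (rule sweedler_swap)
  also have "\<dots> = swm w' (\<lambda>x1 x2. swp u' (\<lambda>c1 c2. swp u (\<lambda>u1 u2. swm w'' (\<lambda>y1 y2. swp u1 (\<lambda>b1 b2. swm y2 (\<lambda>t1 t2. 
          ?G b1 x1 x2 b2 u2 c1 c2 t2 y1 t1))))))"
    by (rule sweedler_cong, rule sweedler_cong, rule sweedler_swap)
  also have "\<dots> = swm w' (\<lambda>x1 x2. swp u (\<lambda>u1 u2. swp u' (\<lambda>c1 c2. swm w'' (\<lambda>y1 y2. swp u1 (\<lambda>b1 b2. swm y2 (\<lambda>t1 t2. 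
          ?G b1 x1 x2 b2 u2 c1 c2 t2 y1 t1))))))"
    by (rule sweedler_cong, rule sweedler_swap)
  also have "\<dots> = swm w' (\<lambda>x1 x2. swp u (\<lambda>u1 u2. swp u' (\<lambda>c1 c2. swp u1 (\<lambda>b1 b2. swm w'' (\<lambda>y1 y2. swm y2 (\<lambda>t1 t2. 
          ?G b1 x1 x2 b2 u2 c1 c2 t2 y1 t1))))))"
    by (rule sweedler_cong, rule sweedler_cong, rule sweedler_cong, rule sweedler_swap)
  also have "\<dots> = swm w' (\<lambda>x1 x2. swp u (\<lambda>u1 u2. swp u1 (\<lambda>b1 b2. swp u' (\<lambda>c1 c2. swm w'' (\<lambda>y1 y2. swm y2 (\<lambda>t1 t2. 
          ?G b1 x1 x2 b2 u2 c1 c2 t2 y1 t1))))))"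
    by (rule sweedler_cong, rule sweedler_cong, rule sweedler_swap)
  finally show ?thesis using L by simp
qed

end

context q_boson
begin

lemma HM_assoc: "HM (HM x y) z = HM x (HM y z)"
proof -
  have 1: "HM (HM (monom k) (monom k')) (monom k'') = HM (monom k) (HM (monom k') (monom k''))" for k k' k''
    by (cases k, cases k', cases k'') (simp add: HM_monom hm_assoc del: hm.simps)
  have 1: "HM (HM (Poly_Mapping.single k a) (Poly_Mapping.single k' b)) (Poly_Mapping.single k'' c)
      = HM (Poly_Mapping.single k a) (HM (Poly_Mapping.single k' b) (Poly_Mapping.single k'' c))" for k k' k'' a b c
  proof -
    have s: "Poly_Mapping.single k a = cscale a (monom k)" "Poly_Mapping.single k' b = cscale b (monom k')"
      "Poly_Mapping.single k'' c = cscale c (monom k'')" by simp_all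
    show ?thesis unfolding s HM_linear 1 by (simp only: cs.scale_scale mult_ac)
  qed
  have 2: "HM (HM (Poly_Mapping.single k a) (Poly_Mapping.single k' b)) z
      = HM (Poly_Mapping.single k a) (HM (Poly_Mapping.single k' b) z)" for k k' a b
    by (rule additive_eqI[where h = "\<lambda>z. HM (HM (Poly_Mapping.single k a) (Poly_Mapping.single k' b)) z"]) (simp_all add: HM_linear 1)
  have 3: "HM (HM (Poly_Mapping.single k a) y) z = HM (Poly_Mapping.single k a) (HM y z)" for k a
    by (rule additive_eqI[where h = "\<lambda>y. HM (HM (Poly_Mapping.single k a) y) z"]) (simp_all add: HM_linear 2)
  show ?thesis
    by (rule additive_eqI[where h = "\<lambda>x. HM (HM x y) z"]) (simp_all add: HM_linear 3)
qed

lemma one_monom: "(1 :: 'g mpfree) = monom ([], [])"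
  by (simp add: single_one[symmetric] zero_prod_def zero_list_def del: single_one)

lemma swp_counit_left_vector:
  assumes u: "set u \<subseteq> Xp" shows "swp u (\<lambda>u1 u2. cscale (ph u1 []) (F u2)) = F u"
proof -
  have *: "swp u (\<lambda>u1 u2. cscale (epsp u1) (F u2)) = F u" for u F
  proof (induction u arbitrary: F)
    case (Cons g u)
    show ?case by (cases g) (simp_all add: Cons)
  qed simp
  have "swp u (\<lambda>u1 u2. cscale (ph u1 []) (F u2)) = swp u (\<lambda>u1 u2. cscale (epsp u1) (F u2))"
    by (rule sweedler_cong_set[OF closed_plus u]) (simp add: ph_Nil_right)
  then show ?thesis by (simp add: *)
qed

lemma HM_one: assumes "x \<in> HF" shows "HM 1 x = x" "HM x 1 = x"
proof -
  have l: "hm ([], []) (w, u) = monom (w, u)" if "set w \<subseteq> Xm" for w u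
    using swm_counit_left[OF that, of "\<lambda>w. monom (w, u)"] by simp
  have r: "hm (w, u) ([], []) = monom (w, u)" if "set u \<subseteq> Xp" for w u
    using swp_counit_left_vector[OF that, of "\<lambda>u. monom (w, u)"] by simp
  have keys: "set (fst k) \<subseteq> Xm" "set (snd k) \<subseteq> Xp" if "k \<in> Poly_Mapping.keys x" for k
    using HF_keys[OF assms, of "fst k" "snd k"] that by simp_all
  have "lin_ext (hm ([], [])) x = lin_ext monom x"
    unfolding lin_ext_def
    by (intro sum.cong refl arg_cong2[where f = cscale]) (metis l keys(1) prod.collapse)
  moreover have "lin_ext (\<lambda>k. hm k ([], [])) x = lin_ext monom x"
    unfolding lin_ext_def
    by (intro sum.cong refl arg_cong2[where f = cscale]) (metis r keys(2) prod.collapse)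
  ultimately show "HM 1 x = x" "HM x 1 = x"
    unfolding one_monom HM_monom lin_ext_monom by simp_all
qed

lemma one_HF: "1 \<in> HF"
  by (simp add: one_monom single_HF)

lemma heis_free_simps: "mult (heis_free D) = heis_mult D" "one (heis_free D) = 1"
  "zero (heis_free D) = 0" "add (heis_free D) = (+)"
  by (simp_all add: heis_free_def)

lemma heis_free_ring: "ring (heis_free D)"
proof (rule ringI)
  show "abelian_group (heis_free D)"
  proof (rule abelian_groupI)
    fix x assume "x \<in> HF"
    then show "\<exists>y\<in>HF. y \<oplus>\<^bsub>heis_free D\<^esub> x = \<zero>\<^bsub>heis_free D\<^esub>"
      using cs.subspace_neg[OF HF_subspace] by (intro bexI[of _ "- x"]) (simp_all add: heis_free_simps)
  qed (simp_all add: heis_free_simps cs.subspace_add[OF HF_subspace] cs.subspace_0[OF HF_subspace] add_ac)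
  show "monoid (heis_free D)"
    by (rule monoidI) (simp_all add: heis_free_simps heis_mult_eq HM_closed one_HF HM_assoc HM_one)
qed (simp_all add: heis_free_simps heis_mult_eq HM_closed HM_linear cs.subspace_add[OF HF_subspace])

text \<open>The pairing of \<open>U\<^sup>- \<otimes> U\<^sup>+\<close> with pairs of words, whose radical is \<open>heis_ker\<close>.\<close>

definition Phi :: "('g \<Rightarrow> complex) plus_gen list \<Rightarrow> ('g \<Rightarrow> complex) minus_gen list \<Rightarrow> 'g mpfree \<Rightarrow> complex" where
  "Phi u' w' = ev (\<lambda>(w, u). ph u' w * ph u w')"

lemma Phi_linear: "Phi u' w' (p + q) = Phi u' w' p + Phi u' w' q" "Phi u' w' (cscale c p) = c * Phi u' w' p"
  "Phi u' w' (p - q) = Phi u' w' p - Phi u' w' q" "Phi u' w' (- p) = - Phi u' w' p" "Phi u' w' 0 = 0"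
  by (simp_all add: Phi_def ev_add ev_cscale ev_diff ev_uminus)

lemma Phi_single [simp]: "Phi u' w' (Poly_Mapping.single (w, u) c) = c * (ph u' w * ph u w')"
  by (simp add: Phi_def)

lemma Phi_sum: "Phi u' w' (sum f A) = (\<Sum>a\<in>A. Phi u' w' (f a))"
  by (simp add: Phi_def ev_sum)

lemma Phi_tens: "Phi u' w' (tens b a) = ev (ph u') b * ev (\<lambda>u. ph u w') a"
proof -
  have c: "ev (\<lambda>w. ph u' w * C) b = ev (ph u') b * C" for C
    using ev_fun_mult[of C "ph u'" b] by (simp add: mult.commute)
  show ?thesis by (simp add: Phi_def tens_lin_ext ev_lin_ext ev_fun_mult c)
qed

lemma heis_ker_subspace: "cs.subspace (heis_ker D)"
  by (simp add: heis_ker_def)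

lemma rad_subspaces: "cs.subspace (rad_minus D)" "cs.subspace (rad_plus D)"
  using carrier_free_subspace
  by (auto simp: cs.subspace_def rad_minus_iff rad_plus_iff ev_add ev_cscale)

lemma tens_in_ker:
  "b \<in> rad_minus D \<Longrightarrow> a \<in> AA \<Longrightarrow> tens b a \<in> heis_ker D"
  "b \<in> BB \<Longrightarrow> a \<in> rad_plus D \<Longrightarrow> tens b a \<in> heis_ker D"
  unfolding heis_ker_def by (rule cs.span_base, blast)+

text \<open>Elimination: if not all \<open>a\<^sub>j\<close> lie in the radical, then pairing the second factors with a
  suitable word expresses one \<open>b\<^sub>j\<close> through the others modulo the radical, and the sum gets shorter.\<close>

lemma tensor_sum_in_ker:
  assumes "finite J" "\<And>j. j \<in> J \<Longrightarrow> b j \<in> BB" "\<And>j. j \<in> J \<Longrightarrow> a j \<in> AA"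
    and "\<And>u' w'. Phi u' w' (\<Sum>j\<in>J. tens (b j) (a j)) = 0"
  shows "(\<Sum>j\<in>J. tens (b j) (a j)) \<in> heis_ker D"
  using assms
proof (induction "card J" arbitrary: J a rule: less_induct)
  case less
  note b = less.prems(2) and a = less.prems(3)
  show ?case
  proof (cases "\<forall>j\<in>J. a j \<in> rad_plus D")
    case True
    then show ?thesis by (intro cs.subspace_sum[OF heis_ker_subspace] tens_in_ker(2) b) auto
  next
    case False
    then obtain i w' where i: "i \<in> J" and nz: "ev (\<lambda>u. ph u w') (a i) \<noteq> 0"
      using a by (auto simp: rad_plus_iff)
    define t where "t j = ev (\<lambda>u. ph u w') (a j)" for j
    define r where "r = (\<Sum>j\<in>J. cscale (t j) (b j))"
    have rB: "r \<in> BB" unfolding r_def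
      by (intro cs.subspace_sum cs.subspace_scale carrier_free_subspace b)
    have "ev (ph u') r = 0" for u'
      using less.prems(4)[of u' w'] by (simp add: r_def ev_sum ev_cscale Phi_sum Phi_tens t_def mult.commute)
    then have rr: "r \<in> rad_minus D" using rB by (simp add: rad_minus_iff)
    let ?J = "J - {i}" and ?a = "\<lambda>j. a j - cscale (t j / t i) (a i)"
    have bi: "b i = cscale (1 / t i) r - (\<Sum>j\<in>?J. cscale (t j / t i) (b j))"
    proof -
      have "r = cscale (t i) (b i) + (\<Sum>j\<in>?J. cscale (t j) (b j))"
        unfolding r_def using less.prems(1) i by (rule sum.remove)
      then have "cscale (1 / t i) r = b i + (\<Sum>j\<in>?J. cscale (t j / t i) (b j))"
        using nz by (simp add: cs.scale_right_distrib cs.scale_sum_right t_def)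
      then show ?thesis by simp
    qed
    have tsum: "tens (sum f A) c = (\<Sum>j\<in>A. tens (f j) c)" for f and A :: "'a set" and c
      by (induction A rule: infinite_finite_induct) (simp_all add: tens_linear)
    have split: "(\<Sum>j\<in>J. tens (b j) (a j)) = tens (cscale (1 / t i) r) (a i) + (\<Sum>j\<in>?J. tens (b j) (?a j))"
    proof -
      have "(\<Sum>j\<in>J. tens (b j) (a j)) = tens (b i) (a i) + (\<Sum>j\<in>?J. tens (b j) (a j))"
        using less.prems(1) i by (rule sum.remove)
      also have "tens (b i) (a i) = tens (cscale (1 / t i) r) (a i) - (\<Sum>j\<in>?J. cscale (t j / t i) (tens (b j) (a i)))"
        by (subst bi) (simp only: tens_diff tsum tens_linear)
      finally show ?thesis by (simp add: tens_diff tens_linear sum_subtractf)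
    qed
    have k1: "tens (cscale (1 / t i) r) (a i) \<in> heis_ker D"
      by (intro tens_in_ker(1) cs.subspace_scale rad_subspaces rr a i)
    have ar: "Phi u' v' (tens (cscale (1 / t i) r) (a i)) = 0" for u' v'
      using rr by (simp add: Phi_tens ev_cscale rad_minus_iff)
    have "(\<Sum>j\<in>?J. tens (b j) (?a j)) \<in> heis_ker D"
    proof (rule less.hyps)
      show "card ?J < card J" using i less.prems(1) by (metis card_Diff1_less)
      show "finite ?J" using less.prems(1) by simp
      show "?a j \<in> AA" if "j \<in> ?J" for j
        using that a i by (intro cs.subspace_diff cs.subspace_scale carrier_free_subspace) auto
      show "Phi u' v' (\<Sum>j\<in>?J. tens (b j) (?a j)) = 0" for u' v'
        using less.prems(4)[of u' v'] unfolding split Phi_linear(1) ar by simp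
    qed (use b in simp)
    then show ?thesis unfolding split by (rule cs.subspace_add[OF heis_ker_subspace k1])
  qed
qed

theorem heis_ker_iff: "p \<in> heis_ker D \<longleftrightarrow> p \<in> HF \<and> (\<forall>u' w'. Phi u' w' p = 0)"
proof
  have W: "cs.subspace {p \<in> HF. \<forall>u' w'. Phi u' w' p = 0}"
    using HF_subspace by (auto simp: cs.subspace_def Phi_linear)
  assume "p \<in> heis_ker D"
  moreover have "heis_ker D \<subseteq> {p \<in> HF. \<forall>u' w'. Phi u' w' p = 0}"
    unfolding heis_ker_def
    by (rule cs.span_minimal[OF _ W]) (auto simp: rad_minus_iff rad_plus_iff Phi_tens tens_HF)
  ultimately show "p \<in> HF \<and> (\<forall>u' w'. Phi u' w' p = 0)" by blast
next
  assume p: "p \<in> HF \<and> (\<forall>u' w'. Phi u' w' p = 0)"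
  let ?b = "\<lambda>k. cscale (Poly_Mapping.lookup p k) (monom (fst k))" and ?a = "\<lambda>k. monom (snd k)"
  have e: "p = (\<Sum>k\<in>Poly_Mapping.keys p. tens (?b k) (?a k))"
    using poly_mapping_expand[of p] by (simp only: tens_linear tens_monom) simp
  have "(\<Sum>k\<in>Poly_Mapping.keys p. tens (?b k) (?a k)) \<in> heis_ker D"
  proof (rule tensor_sum_in_ker)
    fix k assume k: "k \<in> Poly_Mapping.keys p"
    obtain w u where "k = (w, u)" by (cases k)
    then have "set (fst k) \<subseteq> Xm" "set (snd k) \<subseteq> Xp" using HF_keys[of p w u] p k by auto
    then show "?b k \<in> BB" "?a k \<in> AA"
      by (auto intro: cs.subspace_scale[OF carrier_free_subspace(2)] simp del: cscale_single)
  next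
    show "Phi u' w' (\<Sum>k\<in>Poly_Mapping.keys p. tens (?b k) (?a k)) = 0" for u' w'
      using p unfolding e[symmetric] by blast
  qed simp
  then show "p \<in> heis_ker D" using e by simp
qed

text \<open>The Hopf pairing identities express the value of the pairing on a product through its values on
  either factor, so the radical is an ideal.\<close>

lemma Phi_HM_left:
  "Phi u' w' (HM (monom (w0, u0)) p)
    = swp u0 (\<lambda>r1 r2. swp u' (\<lambda>s1 s2. swm w' (\<lambda>y1 y2. ph s1 w0 * ph r2 y2 * Phi (s2 @ r1) y1 p)))"
proof (rule additive_eqI[where h = "\<lambda>p. Phi u' w' (HM (monom (w0, u0)) p)" and p = p])
  fix k :: "('g \<Rightarrow> complex) minus_gen list \<times> ('g \<Rightarrow> complex) plus_gen list" and c
  obtain w u where k: "k = (w, u)" by (cases k)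
  have "Phi u' w' (hm (w0, u0) (w, u)) = swp u0 (\<lambda>r1 r2. swm w (\<lambda>x1 x2.
      swp u' (\<lambda>s1 s2. swm w' (\<lambda>y1 y2. ph s1 w0 * ph r2 y2 * (ph s2 x2 * ph r1 x1 * ph u y1)))))"
    by (simp add: Phi_def ev_swp ev_swm ph_append_left ph_append_right mult_swp mult_swm mult_ac)
  also have "\<dots> = swp u0 (\<lambda>r1 r2. swp u' (\<lambda>s1 s2. swm w' (\<lambda>y1 y2. swm w (\<lambda>x1 x2.
      ph s1 w0 * ph r2 y2 * (ph s2 x2 * ph r1 x1 * ph u y1)))))"
    by (subst sweedler_swap, subst sweedler_swap) (rule refl)
  also have "\<dots> = swp u0 (\<lambda>r1 r2. swp u' (\<lambda>s1 s2. swm w' (\<lambda>y1 y2.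
      ph s1 w0 * ph r2 y2 * Phi (s2 @ r1) y1 (monom (w, u)))))"
    by (simp add: ph_append_left mult_swm)
  finally have *: "Phi u' w' (hm (w0, u0) (w, u)) = \<dots>" .
  have "HM (monom (w0, u0)) (monom (w, u)) = hm (w0, u0) (w, u)" by (simp add: HM_monom del: hm.simps)
  then have "Phi u' w' (HM (monom (w0, u0)) (cscale c (monom (w, u)))) = c * Phi u' w' (hm (w0, u0) (w, u))"
    by (simp only: HM_linear Phi_linear)
  then have "Phi u' w' (HM (monom (w0, u0)) (Poly_Mapping.single k c)) = c * Phi u' w' (hm (w0, u0) (w, u))" by (simp add: k del: hm.simps)
  then show "Phi u' w' (HM (monom (w0, u0)) (Poly_Mapping.single k c))
      = swp u0 (\<lambda>r1 r2. swp u' (\<lambda>s1 s2. swm w' (\<lambda>y1 y2.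
          ph s1 w0 * ph r2 y2 * Phi (s2 @ r1) y1 (Poly_Mapping.single k c))))"
    unfolding * by (simp add: k mult_swp mult_swm mult_ac)
qed (simp_all add: HM_linear Phi_linear distrib_left sweedler_add)

lemma Phi_HM_right:
  "Phi u' w' (HM p (monom (w0, u0)))
    = swm w0 (\<lambda>x1 x2. swp u' (\<lambda>s1 s2. swm w' (\<lambda>y1 y2. ph s2 x2 * ph u0 y1 * Phi s1 (x1 @ y2) p)))"
proof (rule additive_eqI[where h = "\<lambda>p. Phi u' w' (HM p (monom (w0, u0)))" and p = p])
  fix k :: "('g \<Rightarrow> complex) minus_gen list \<times> ('g \<Rightarrow> complex) plus_gen list" and c
  obtain w u where k: "k = (w, u)" by (cases k)
  have "Phi u' w' (hm (w, u) (w0, u0)) = swp u (\<lambda>r1 r2. swm w0 (\<lambda>x1 x2.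
      swp u' (\<lambda>s1 s2. swm w' (\<lambda>y1 y2. ph s2 x2 * ph u0 y1 * (ph s1 w * (ph r1 x1 * ph r2 y2))))))"
    by (simp add: Phi_def ev_swp ev_swm ph_append_left ph_append_right mult_swp mult_swm mult_ac)
  also have "\<dots> = swm w0 (\<lambda>x1 x2. swp u' (\<lambda>s1 s2. swm w' (\<lambda>y1 y2. swp u (\<lambda>r1 r2.
      ph s2 x2 * ph u0 y1 * (ph s1 w * (ph r1 x1 * ph r2 y2))))))"
    by (subst sweedler_swap, subst (2) sweedler_swap, subst (3) sweedler_swap) (rule refl)
  also have "\<dots> = swm w0 (\<lambda>x1 x2. swp u' (\<lambda>s1 s2. swm w' (\<lambda>y1 y2.
      ph s2 x2 * ph u0 y1 * Phi s1 (x1 @ y2) (monom (w, u)))))"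
    by (simp add: ph_append_right mult_swp)
  finally have *: "Phi u' w' (hm (w, u) (w0, u0)) = \<dots>" .
  have "HM (monom (w, u)) (monom (w0, u0)) = hm (w, u) (w0, u0)" by (simp add: HM_monom del: hm.simps)
  then have "Phi u' w' (HM (cscale c (monom (w, u))) (monom (w0, u0))) = c * Phi u' w' (hm (w, u) (w0, u0))"
    by (simp only: HM_linear Phi_linear)
  then have "Phi u' w' (HM (Poly_Mapping.single k c) (monom (w0, u0))) = c * Phi u' w' (hm (w, u) (w0, u0))" by (simp add: k del: hm.simps)
  then show "Phi u' w' (HM (Poly_Mapping.single k c) (monom (w0, u0)))
      = swm w0 (\<lambda>x1 x2. swp u' (\<lambda>s1 s2. swm w' (\<lambda>y1 y2.
          ph s2 x2 * ph u0 y1 * Phi s1 (x1 @ y2) (Poly_Mapping.single k c))))"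
    unfolding * by (simp add: k mult_swp mult_swm mult_ac)
qed (simp_all add: HM_linear Phi_linear distrib_left sweedler_add)

lemma HM_in_ker:
  assumes p: "p \<in> heis_ker D" and x: "x \<in> HF"
  shows "HM x p \<in> heis_ker D" "HM p x \<in> heis_ker D"
proof -
  have pH: "p \<in> HF" and P0: "Phi u' w' p = 0" for u' w' using p by (simp_all add: heis_ker_iff)
  have "Phi u' w' (HM (monom k) p) = 0" "Phi u' w' (HM p (monom k)) = 0" for u' w' k
    by (cases k; simp add: Phi_HM_left Phi_HM_right P0)+
  then have z: "Phi u' w' (HM (Poly_Mapping.single k c) p) = 0" "Phi u' w' (HM p (Poly_Mapping.single k c)) = 0" for u' w' k c
    using HM_linear(3)[of c "monom k" p] HM_linear(4)[of p c "monom k"] by (simp_all add: Phi_linear)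
  have "Phi u' w' (HM x p) = 0" for u' w'
    by (rule additive_eqI[where h = "\<lambda>x. Phi u' w' (HM x p)" and g = "\<lambda>_. 0"]) (simp_all add: HM_linear Phi_linear z)
  moreover have "Phi u' w' (HM p x) = 0" for u' w'
    by (rule additive_eqI[where h = "\<lambda>x. Phi u' w' (HM p x)" and g = "\<lambda>_. 0"]) (simp_all add: HM_linear Phi_linear z)
  ultimately show "HM x p \<in> heis_ker D" "HM p x \<in> heis_ker D"
    using HM_closed pH x by (simp_all add: heis_ker_iff)
qed

lemma heis_ideal: "ideal (heis_ker D) (heis_free D)"
proof (rule idealI)
  show "ring (heis_free D)" by (rule heis_free_ring)
  interpret R: ring "heis_free D" by (rule heis_free_ring)
  have sub: "heis_ker D \<subseteq> HF" by (auto simp: heis_ker_iff)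
  show "subgroup (heis_ker D) (add_monoid (heis_free D))"
  proof (rule R.add.subgroupI)
    fix a assume a: "a \<in> heis_ker D"
    have "- a \<in> HF" using a sub cs.subspace_neg[OF HF_subspace] by blast
    then have "\<ominus>\<^bsub>heis_free D\<^esub> a = - a"
      using a sub by (intro R.minus_equality) (auto simp: heis_free_simps)
    then show "\<ominus>\<^bsub>heis_free D\<^esub> a \<in> heis_ker D"
      using cs.subspace_neg[OF heis_ker_subspace a] by simp
  next
    fix a b assume "a \<in> heis_ker D" "b \<in> heis_ker D"
    then show "a \<oplus>\<^bsub>heis_free D\<^esub> b \<in> heis_ker D"
      using cs.subspace_add[OF heis_ker_subspace] by (simp add: heis_free_simps)
  qed (use sub cs.subspace_0[OF heis_ker_subspace] in auto)
  fix a x assume "a \<in> heis_ker D" "x \<in> carrier (heis_free D)"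
  then show "x \<otimes>\<^bsub>heis_free D\<^esub> a \<in> heis_ker D" "a \<otimes>\<^bsub>heis_free D\<^esub> x \<in> heis_ker D"
    using HM_in_ker sub by (auto simp: heis_free_simps heis_mult_eq)
qed

end

context q_boson
begin

abbreviation "HH \<equiv> heis D"

definition cl :: "'g mpfree \<Rightarrow> 'g mpfree set" where
  "cl p = heis_ker D +>\<^bsub>heis_free D\<^esub> p"

lemma heis_ring: "ring HH"
  unfolding heis_def by (rule ideal.quotient_is_ring[OF heis_ideal])

lemma cl_set: "cl p = (\<lambda>h. h + p) ` heis_ker D"
  by (auto simp: cl_def a_r_coset_def' heis_free_simps)

lemma cl_eq_iff:
  assumes "p \<in> HF" "q \<in> HF"
  shows "cl p = cl q \<longleftrightarrow> (\<forall>u' w'. Phi u' w' p = Phi u' w' q)"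
proof -
  have "cl p = cl q \<longleftrightarrow> p - q \<in> heis_ker D"
  proof
    assume "cl p = cl q"
    moreover have "p \<in> cl p" using cs.subspace_0[OF heis_ker_subspace] by (force simp: cl_set)
    ultimately obtain h where "h \<in> heis_ker D" "p = h + q" by (auto simp: cl_set)
    then show "p - q \<in> heis_ker D" by simp
  next
    assume d: "p - q \<in> heis_ker D"
    have "h + p = (h + (p - q)) + q" "h + q = (h - (p - q)) + p" for h by simp_all
    then show "cl p = cl q"
      unfolding cl_set
      using cs.subspace_add[OF heis_ker_subspace _ d] cs.subspace_diff[OF heis_ker_subspace _ d] by blast
  qed
  also have "\<dots> \<longleftrightarrow> (\<forall>u' w'. Phi u' w' (p - q) = 0)"
    using cs.subspace_diff[OF HF_subspace assms] by (simp add: heis_ker_iff)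
  finally show ?thesis by (simp add: Phi_linear)
qed

lemma heis_carrier: "carrier HH = cl ` HF"
  by (auto simp: heis_def FactRing_def A_RCOSETS_def' cl_def)

lemma cl_carrier: "p \<in> HF \<Longrightarrow> cl p \<in> carrier HH"
  by (simp add: heis_carrier)

lemma cl_add: assumes "p \<in> HF" "q \<in> HF" shows "cl p \<oplus>\<^bsub>HH\<^esub> cl q = cl (p + q)"
proof -
  interpret ideal "heis_ker D" "heis_free D" by (rule heis_ideal)
  show ?thesis using a_rcos_sum[OF assms] by (simp add: heis_def FactRing_def cl_def heis_free_simps)
qed

lemma cl_mult: assumes "p \<in> HF" "q \<in> HF" shows "cl p \<otimes>\<^bsub>HH\<^esub> cl q = cl (HM p q)"
proof -
  interpret ideal "heis_ker D" "heis_free D" by (rule heis_ideal)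
  show ?thesis
    using rcoset_mult_add[OF assms] by (simp add: heis_def FactRing_def cl_def heis_free_simps heis_mult_eq assms)
qed

lemma cl_zero: "\<zero>\<^bsub>HH\<^esub> = cl 0"
  by (auto simp: heis_def FactRing_def cl_set)

lemma cl_one: "\<one>\<^bsub>HH\<^esub> = cl 1"
  by (simp add: heis_def FactRing_def cl_def heis_free_simps)

lemma cl_minus: assumes "p \<in> HF" shows "\<ominus>\<^bsub>HH\<^esub> cl p = cl (- p)"
proof -
  interpret ring HH by (rule heis_ring)
  have m: "- p \<in> HF" using assms by (rule cs.subspace_neg[OF HF_subspace])
  show ?thesis by (rule minus_equality) (simp_all add: cl_add assms m cl_zero cl_carrier)
qed

lemma one_free: "(1 :: 'g pfree) = monom []" "(1 :: 'g mfree) = monom []"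
  by (simp_all add: monom_Nil del: single_one)

lemma one_carrier_free: "(1 :: 'g pfree) \<in> AA" "(1 :: 'g mfree) \<in> BB"
  unfolding one_free by simp_all

lemma tens_one: "tens (Poly_Mapping.single w c) (1 :: 'y free) = Poly_Mapping.single (w, []) c"
  "tens (1 :: 'x free) (Poly_Mapping.single u c) = Poly_Mapping.single ([], u) c"
  unfolding monom_Nil[symmetric] tens_lin_ext by simp_all

text \<open>\<open>fm b\<close> and \<open>ep a\<close> are the elements \<open>b \<sharp> 1\<close> and \<open>1 \<sharp> a\<close>.\<close>

definition "fm b = cl (tens b 1)"
definition "ep a = cl (tens 1 a)"

lemma sharp_eq: "sharp D b 1 = fm b" "sharp D 1 a = ep a"
  by (simp_all add: sharp_def cl_def fm_def ep_def)

lemma tens_one_HF: "b \<in> BB \<Longrightarrow> tens b 1 \<in> HF" "a \<in> AA \<Longrightarrow> tens 1 a \<in> HF"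
  by (simp_all add: tens_HF one_carrier_free)

lemma fm_carrier: "b \<in> BB \<Longrightarrow> fm b \<in> carrier HH"
  by (simp add: fm_def cl_carrier tens_one_HF)

lemma ph_Nil_Nil [simp]: "ph [] [] = 1"
  by (simp add: ph_Nil_left)

lemma Phi_fm: "Phi u' w' (tens b 1) = ev (ph u') b * ph [] w'"
  by (simp add: Phi_tens one_free del: single_one)

lemma Phi_ep: "Phi u' w' (tens 1 a) = ph u' [] * ev (\<lambda>u. ph u w') a"
  by (simp add: Phi_tens one_free del: single_one)

lemma fm_eq_iff: assumes "b \<in> BB" "b' \<in> BB" shows "fm b = fm b' \<longleftrightarrow> (\<forall>u. ev (ph u) b = ev (ph u) b')"
proof -
  have "fm b = fm b' \<longleftrightarrow> (\<forall>u' w'. ev (ph u') b * ph [] w' = ev (ph u') b' * ph [] w')"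
    by (simp add: fm_def cl_eq_iff tens_one_HF assms Phi_fm)
  also have "\<dots> \<longleftrightarrow> (\<forall>u. ev (ph u) b = ev (ph u) b')"
  proof
    assume *: "\<forall>u' w'. ev (ph u') b * ph [] w' = ev (ph u') b' * ph [] w'"
    then show "\<forall>u. ev (ph u) b = ev (ph u) b'" using *[rule_format, of _ "[]"] by simp
  qed simp
  finally show ?thesis .
qed

lemma ep_eqI: assumes "a \<in> AA" "a' \<in> AA" "\<And>w. ev (\<lambda>u. ph u w) a = ev (\<lambda>u. ph u w) a'" shows "ep a = ep a'"
  using assms by (simp add: ep_def cl_eq_iff tens_one_HF Phi_ep)

lemma HM_fm: assumes "b' \<in> BB" shows "HM (tens b 1) (tens b' 1) = tens (b * b') 1"
proof -
  have 1: "HM (tens (Poly_Mapping.single w c) 1) (tens (Poly_Mapping.single w' d) 1)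
      = tens (Poly_Mapping.single w c * Poly_Mapping.single w' d) 1" if "set w' \<subseteq> Xm" for w w' c d
  proof -
    have "hm (w, []) (w', []) = monom (w @ w', [])"
      using swm_counit_left[OF that, of "\<lambda>v. monom (w @ v, [])"] by simp
    then have "HM (monom (w, [])) (monom (w', [])) = monom (w @ w', [])"
      by (simp add: HM_monom del: hm.simps)
    then have "HM (cscale c (monom (w, []))) (cscale d (monom (w', []))) = cscale (d * c) (monom (w @ w', []))"
      by (simp only: HM_linear cs.scale_scale)
    then show ?thesis by (simp add: tens_one mult_single plus_list_def mult.commute)
  qed
  have 2: "HM (tens (Poly_Mapping.single w c) 1) (tens b' 1) = tens (Poly_Mapping.single w c * b') 1" for w c
    by (rule additive_eqI[where h = "\<lambda>b'. HM (tens (Poly_Mapping.single w c) 1) (tens b' 1)"])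
      (use assms in \<open>simp_all add: tens_linear HM_linear distrib_left 1 carrier_free\<close>)
  show ?thesis
    by (rule additive_eqI[where h = "\<lambda>b. HM (tens b 1) (tens b' 1)"])
      (simp_all add: tens_linear HM_linear distrib_right 2)
qed

lemma HM_ep: assumes "a \<in> AA" shows "HM (tens 1 a) (tens 1 a') = tens 1 (a * a')"
proof -
  have 1: "HM (tens 1 (Poly_Mapping.single u c)) (tens 1 (Poly_Mapping.single u' d))
      = tens 1 (Poly_Mapping.single u c * Poly_Mapping.single u' d)" if "set u \<subseteq> Xp" for u u' c d
  proof -
    have "hm ([], u) ([], u') = monom ([], u @ u')"
      using swp_counit_left_vector[OF that, of "\<lambda>v. monom ([], v @ u')"] by simp
    then have "HM (monom ([], u)) (monom ([], u')) = monom ([], u @ u')"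
      by (simp add: HM_monom del: hm.simps)
    then have "HM (cscale c (monom ([], u))) (cscale d (monom ([], u'))) = cscale (d * c) (monom ([], u @ u'))"
      by (simp only: HM_linear cs.scale_scale)
    then show ?thesis by (simp add: tens_one mult_single plus_list_def mult.commute)
  qed
  have 2: "HM (tens 1 a) (tens 1 (Poly_Mapping.single u' d)) = tens 1 (a * Poly_Mapping.single u' d)" for u' d
    by (rule additive_eqI[where h = "\<lambda>a. HM (tens 1 a) (tens 1 (Poly_Mapping.single u' d))"])
      (use assms in \<open>simp_all add: tens_linear HM_linear distrib_right 1 carrier_free\<close>)
  show ?thesis
    by (rule additive_eqI[where h = "\<lambda>a'. HM (tens 1 a) (tens 1 a')"])
      (simp_all add: tens_linear HM_linear distrib_left 2)
qed

lemma free_mult_closed: "a \<in> AA \<Longrightarrow> a' \<in> AA \<Longrightarrow> a * a' \<in> AA" "b \<in> BB \<Longrightarrow> b' \<in> BB \<Longrightarrow> b * b' \<in> BB"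
  unfolding carrier_free by (auto dest!: subsetD[OF keys_mult] simp: plus_list_def) blast+

lemma fm_mult: "b \<in> BB \<Longrightarrow> b' \<in> BB \<Longrightarrow> fm b \<otimes>\<^bsub>HH\<^esub> fm b' = fm (b * b')"
  by (simp add: fm_def cl_mult tens_one_HF HM_fm)

lemma ep_mult: "a \<in> AA \<Longrightarrow> a' \<in> AA \<Longrightarrow> ep a \<otimes>\<^bsub>HH\<^esub> ep a' = ep (a * a')"
  by (simp add: ep_def cl_mult tens_one_HF HM_ep)

lemma fm_add: "b \<in> BB \<Longrightarrow> b' \<in> BB \<Longrightarrow> fm b \<oplus>\<^bsub>HH\<^esub> fm b' = fm (b + b')"
  by (simp add: fm_def cl_add tens_one_HF tens_linear)

lemma ep_add: "a \<in> AA \<Longrightarrow> a' \<in> AA \<Longrightarrow> ep a \<oplus>\<^bsub>HH\<^esub> ep a' = ep (a + a')"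
  by (simp add: ep_def cl_add tens_one_HF tens_linear)

lemma fm_minus: "b \<in> BB \<Longrightarrow> \<ominus>\<^bsub>HH\<^esub> fm b = fm (- b)"
  by (simp add: fm_def cl_minus tens_one_HF tens_uminus)

lemma ep_minus: "a \<in> AA \<Longrightarrow> \<ominus>\<^bsub>HH\<^esub> ep a = ep (- a)"
  by (simp add: ep_def cl_minus tens_one_HF tens_uminus)

lemma fm_one: "fm 1 = \<one>\<^bsub>HH\<^esub>" and ep_one: "ep 1 = \<one>\<^bsub>HH\<^esub>"
  unfolding fm_def ep_def cl_one one_free one_monom tens_monom by simp_all

lemma fm_zero: "fm 0 = \<zero>\<^bsub>HH\<^esub>"
  by (simp add: fm_def cl_zero)

subsection \<open>Scalars\<close>

definition "sca c = cl (cscale c 1)"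

lemma scalar_elt_eq: "scalar_elt D c = sca c"
proof -
  have "tens 1 (cscale c 1) = (cscale c 1 :: 'g mpfree)"
    by (simp only: tens_linear) (simp add: one_free one_monom del: single_one)
  then show ?thesis by (simp add: scalar_elt_def sharp_def sca_def cl_def)
qed

lemma cscale_HF: "p \<in> HF \<Longrightarrow> cscale c p \<in> HF"
  by (rule cs.subspace_scale[OF HF_subspace])

lemma sca_carrier: "sca c \<in> carrier HH"
  by (simp add: sca_def cl_carrier cscale_HF one_HF)

lemma sca_mult:
  assumes "p \<in> HF" shows "sca c \<otimes>\<^bsub>HH\<^esub> cl p = cl (cscale c p)" "cl p \<otimes>\<^bsub>HH\<^esub> sca c = cl (cscale c p)"
  by (simp_all add: sca_def cl_mult cscale_HF one_HF assms HM_linear HM_one)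

lemma sca_central: "X \<in> carrier HH \<Longrightarrow> sca c \<otimes>\<^bsub>HH\<^esub> X = X \<otimes>\<^bsub>HH\<^esub> sca c"
  by (auto simp: heis_carrier sca_mult)

lemma sca_alg: "sca c \<otimes>\<^bsub>HH\<^esub> sca d = sca (c * d)" "sca c \<oplus>\<^bsub>HH\<^esub> sca d = sca (c + d)"
  "sca 1 = \<one>\<^bsub>HH\<^esub>" "sca 0 = \<zero>\<^bsub>HH\<^esub>"
proof -
  show "sca c \<otimes>\<^bsub>HH\<^esub> sca d = sca (c * d)"
    by (simp only: sca_def[of d] sca_mult(1) cscale_HF[OF one_HF] cs.scale_scale) (simp add: sca_def)
  show "sca c \<oplus>\<^bsub>HH\<^esub> sca d = sca (c + d)"
    by (simp add: sca_def cl_add cscale_HF one_HF cs.scale_left_distrib)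
  show "sca 1 = \<one>\<^bsub>HH\<^esub>" "sca 0 = \<zero>\<^bsub>HH\<^esub>" by (simp_all add: sca_def cl_one cl_zero)
qed

lemma fm_cscale: "b \<in> BB \<Longrightarrow> fm (cscale c b) = sca c \<otimes>\<^bsub>HH\<^esub> fm b"
  by (simp add: fm_def sca_mult tens_one_HF tens_linear)

lemma ep_cscale: "a \<in> AA \<Longrightarrow> ep (cscale c a) = sca c \<otimes>\<^bsub>HH\<^esub> ep a"
  by (simp add: ep_def sca_mult tens_one_HF tens_linear)

lemma fm_sca: "fm (cscale c 1) = sca c"
  using fm_cscale[OF one_carrier_free(2), of c] sca_carrier ring.ring_simprules(12)[OF heis_ring]
  by (simp add: fm_one) (metis heis_ring monoid.r_one ring_def)

subsection \<open>Generators and relations\<close>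

abbreviation "tt \<equiv> t_gen D"
abbreviation "ee \<equiv> e_prime D"
abbreviation "ff \<equiv> f_gen D"

lemma tt_eq: "tt k = cl (monom ([], [GenT k]))" and tt_ep: "tt k = ep (monom [GenT k])"
  by (simp_all add: t_gen_def sharp_eq ep_def tens_one)

lemma ff_eq: "ff i = cl (monom ([GenF i], []))" and ff_fm: "ff i = fm (monom [GenF i])"
  by (simp_all add: f_gen_def sharp_eq fm_def tens_one)

abbreviation "ew i \<equiv> [GenT (\<alpha> i), GenE i]"

lemma ee_eq: "ee i = cl (cscale (cc i) (monom ([], ew i)))" and ee_ep: "ee i = ep (cscale (cc i) (monom (ew i)))"
  by (simp_all add: e_prime_def sharp_eq ep_def e_prime_free_def cc_def tens_one)

lemma alpha_P: "i \<in> nodes D \<Longrightarrow> \<alpha> i \<in> P" "i \<in> nodes D \<Longrightarrow> - \<alpha> i \<in> P"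
  using lattice(2,5) by auto

lemma gen_HF:
  "k \<in> P \<Longrightarrow> monom ([], [GenT k]) \<in> HF" "i \<in> nodes D \<Longrightarrow> monom ([GenF i], []) \<in> HF"
  "i \<in> nodes D \<Longrightarrow> monom ([], ew i) \<in> HF"
  by (simp_all add: single_HF letters alpha_P)

lemma gen_carrier:
  "k \<in> P \<Longrightarrow> tt k \<in> carrier HH" "i \<in> nodes D \<Longrightarrow> ff i \<in> carrier HH" "i \<in> nodes D \<Longrightarrow> ee i \<in> carrier HH"
  by (simp_all add: tt_eq ff_eq ee_eq cl_carrier gen_HF cscale_HF del: cscale_single)

lemma rel_plus_zero: assumes "a \<in> rel_plus D" "a \<in> AA" shows "ev (\<lambda>u. ph u w) a = 0"
proof (cases "set w \<subseteq> Xm")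
  case True
  have "\<forall>a\<in>rel_plus D. \<forall>b\<in>BB. pairing D a b = 0"
    using pairing unfolding is_pairing_def Let_def by meson
  then have "pairing D a (monom w) = 0" using assms True by simp
  then show ?thesis using pairing_eq[of a "monom w"] assms True by simp
qed (simp add: ph_bad)

lemma ph_torus:
  "k \<in> P \<Longrightarrow> m \<in> P \<Longrightarrow> ph [GenT k, GenT m] w = ph [GenT (k + m)] w" "ph [GenT 0] w = ph [] w"
  "k \<in> P \<Longrightarrow> i \<in> nodes D \<Longrightarrow> ph [GenT k, GenE i, GenT (- k)] w = qform D (\<alpha> i) k * ph [GenE i] w"
proof -
  let ?R = "{monom [GenT l, GenT m] - monom [GenT (l + m)] | l m. l \<in> P \<and> m \<in> P} \<union> {monom [GenT 0] - 1} \<union>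
      {monom [GenT l, GenE i, GenT (- l)] - cscale (qform D (\<alpha> i) l) (monom [GenE i]) | l i. l \<in> P \<and> i \<in> nodes D}"
  have R: "?R \<subseteq> rel_plus D" unfolding rel_plus_def lattice(1) genideal_def by blast
  note d = cs.subspace_diff[OF carrier_free_subspace(1)]
  {
    assume k: "k \<in> P" "m \<in> P"
    have "ev (\<lambda>u. ph u w) (monom [GenT k, GenT m] - monom [GenT (k + m)]) = 0"
      by (rule rel_plus_zero[OF subsetD[OF R]]) (use k in blast, rule d, use k lattice(4) in \<open>simp_all add: letters\<close>)
    then show "ph [GenT k, GenT m] w = ph [GenT (k + m)] w" by (simp add: ev_diff)
  }
  have "ev (\<lambda>u. ph u w) (monom [GenT 0] - 1) = 0"
    by (rule rel_plus_zero[OF subsetD[OF R]]) (blast, rule d, use lattice(3) one_carrier_free in \<open>simp_all add: letters\<close>)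
  then show "ph [GenT 0] w = ph [] w" by (simp add: ev_diff one_free del: single_one)
  {
    assume k: "k \<in> P" "i \<in> nodes D"
    have "ev (\<lambda>u. ph u w) (monom [GenT k, GenE i, GenT (- k)] - cscale (qform D (\<alpha> i) k) (monom [GenE i])) = 0"
      by (rule rel_plus_zero[OF subsetD[OF R]])
        (use k in blast, rule d, use k lattice(5) in \<open>simp_all add: letters cs.subspace_scale[OF carrier_free_subspace(1)] del: cscale_single\<close>)
    then show "ph [GenT k, GenE i, GenT (- k)] w = qform D (\<alpha> i) k * ph [GenE i] w" by (simp add: ev_diff)
  }
qed

lemma tt_mult: "k \<in> P \<Longrightarrow> m \<in> P \<Longrightarrow> tt k \<otimes>\<^bsub>HH\<^esub> tt m = tt (k + m)"
  unfolding tt_ep using lattice(4)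
  by (simp add: ep_mult letters monom_mult) (rule ep_eqI; simp add: letters ph_torus)

lemma tt_zero: "tt 0 = \<one>\<^bsub>HH\<^esub>"
  unfolding tt_ep ep_one[symmetric]
  by (rule ep_eqI) (use lattice(3) one_carrier_free in \<open>simp_all add: letters ph_torus one_free del: single_one\<close>)

lemma tt_inverse: assumes "k \<in> P" shows "tt k \<otimes>\<^bsub>HH\<^esub> tt (- k) = \<one>\<^bsub>HH\<^esub>" "tt (- k) \<otimes>\<^bsub>HH\<^esub> tt k = \<one>\<^bsub>HH\<^esub>"
  using tt_mult[OF assms lattice(5)[OF assms]] tt_mult[OF lattice(5)[OF assms] assms] by (simp_all add: tt_zero)

abbreviation "\<kappa> k j \<equiv> qexp D (- dform D k (\<alpha> j))"

lemma qexp_nonzero: "qexp D c \<noteq> 0"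
  using qpow by (simp add: qexp_def is_qpow_def)

lemma tt_ff:
  assumes "k \<in> P" "j \<in> nodes D" shows "tt k \<otimes>\<^bsub>HH\<^esub> ff j = sca (\<kappa> k j) \<otimes>\<^bsub>HH\<^esub> (ff j \<otimes>\<^bsub>HH\<^esub> tt k)"
proof -
  have 1: "HM (monom ([], [GenT k])) (monom ([GenF j], [])) = cscale (\<kappa> k j) (monom ([GenF j], [GenT k]))"
    using assms alpha_P by (simp add: HM_monom ph_letters)
  have 2: "HM (monom ([GenF j], [])) (monom ([], [GenT k])) = monom ([GenF j], [GenT k])"
    by (simp add: HM_monom)
  have m: "monom ([GenF j], [GenT k]) \<in> HF" using assms by (simp add: single_HF letters)
  show ?thesis unfolding tt_eq ff_eq using assms
    by (simp only: cl_mult gen_HF 1 2 sca_mult(1)[OF m])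
qed

lemma ph_ew_letters:
  assumes "i \<in> nodes D"
  shows "j \<in> nodes D \<Longrightarrow> ph (ew i) [GenF j] = (if i = j then 1 / cc i else 0)" "m \<in> P \<Longrightarrow> ph (ew i) [GenT' m] = 0"
proof -
  have e: "ew i = [GenT (\<alpha> i)] @ [GenE i]" by simp
  show "j \<in> nodes D \<Longrightarrow> ph (ew i) [GenF j] = (if i = j then 1 / cc i else 0)"
    unfolding e ph_append_left using assms alpha_P by (simp add: ph_letters ph_Nil_right letters)
  show "m \<in> P \<Longrightarrow> ph (ew i) [GenT' m] = 0"
    unfolding e ph_append_left using assms alpha_P by (simp add: ph_letters)
qed

text \<open>The constant term of \<open>e'\<^sub>i f\<^sub>j\<close>, in the form in which it comes out of \<open>\<phi>(e\<^sub>i, f\<^sub>i) = 1 / (q\<^sub>i\<^sup>-\<^sup>1 - q\<^sub>i)\<close>;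
  it is \<open>\<delta>\<^sub>i\<^sub>j\<close> unless \<open>q\<^sub>i\<^sup>-\<^sup>1 = q\<^sub>i\<close>.\<close>

definition "dd i j = (if i = j then cc i * (1 / cc i) else 0)"

lemma ee_ff:
  assumes "i \<in> nodes D" "j \<in> nodes D"
  shows "ee i \<otimes>\<^bsub>HH\<^esub> ff j = sca (dd i j) \<oplus>\<^bsub>HH\<^esub> sca (\<kappa> (\<alpha> i) j) \<otimes>\<^bsub>HH\<^esub> (ff j \<otimes>\<^bsub>HH\<^esub> ee i)"
proof -
  interpret ring HH by (rule heis_ring)
  let ?m = "monom ([GenF j], ew i)" and ?t = "monom ([], [GenT (\<alpha> i), GenT (- \<alpha> i)])"
  have 1: "HM (monom ([], ew i)) (monom ([GenF j], [])) =
      cscale (if i = j then 1 / cc i else 0) ?t + cscale (\<kappa> (\<alpha> i) j) ?m"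
    using assms alpha_P by (simp add: HM_monom ph_letters ph_ew_letters)
  have 2: "HM (monom ([GenF j], [])) (monom ([], ew i)) = ?m"
    by (simp add: HM_monom)
  have m: "?m \<in> HF" "?t \<in> HF" using assms alpha_P by (simp_all add: single_HF letters)
  have t: "cl ?t = \<one>\<^bsub>HH\<^esub>"
    using tt_inverse(1)[OF alpha_P(1)[OF assms(1)]] assms alpha_P
    by (simp add: tt_ep ep_mult letters monom_mult) (simp add: ep_def one_free del: single_one)
  have "ee i \<otimes>\<^bsub>HH\<^esub> ff j = cl (cscale (cc i) (HM (monom ([], ew i)) (monom ([GenF j], []))))"
    unfolding ee_eq ff_eq using assms by (simp only: cl_mult cscale_HF gen_HF HM_linear)
  also have "\<dots> = cl (cscale (dd i j) ?t + cscale (\<kappa> (\<alpha> i) j) (cscale (cc i) ?m))"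
    unfolding 1 by (simp add: dd_def cs.scale_right_distrib mult.commute)
  also have "\<dots> = sca (dd i j) \<otimes>\<^bsub>HH\<^esub> cl ?t \<oplus>\<^bsub>HH\<^esub> sca (\<kappa> (\<alpha> i) j) \<otimes>\<^bsub>HH\<^esub> cl (cscale (cc i) ?m)"
    by (simp only: sca_mult(1) m cscale_HF cl_add)
  also have "cl (cscale (cc i) ?m) = ff j \<otimes>\<^bsub>HH\<^esub> ee i"
    unfolding ee_eq ff_eq using assms by (simp only: cl_mult cscale_HF gen_HF HM_linear 2)
  also have "sca (dd i j) \<otimes>\<^bsub>HH\<^esub> cl ?t = sca (dd i j)"
    by (simp add: t sca_carrier)
  finally show ?thesis .
qed

end

context q_boson
begin

section \<open>The q-Boson algebra\<close>

text \<open>Words in the \<open>f\<^sub>i\<close> and their span in the free algebra, whose image is \<open>B\<^sup>-\<^sup>-\<close>.\<close>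

definition "FW = {w. set w \<subseteq> GenF ` nodes D}"
definition "FF = {b :: 'g mfree. \<forall>w\<in>Poly_Mapping.keys b. w \<in> FW}"

lemma FW_Xm: "w \<in> FW \<Longrightarrow> set w \<subseteq> Xm"
  by (auto simp: FW_def gens_minus_def)

lemma FW_simps: "[] \<in> FW" "GenF i # w \<in> FW \<longleftrightarrow> i \<in> nodes D \<and> w \<in> FW" "GenT' m # w \<notin> FW"
  by (auto simp: FW_def)

lemma FF_subspace: "cs.subspace FF"
  unfolding FF_def by (rule supported_subspace)

lemma FF_BB: "b \<in> FF \<Longrightarrow> b \<in> BB"
  using FW_Xm by (auto simp: FF_def carrier_free)

lemma FF_mult: "b \<in> FF \<Longrightarrow> b' \<in> FF \<Longrightarrow> b * b' \<in> FF"
  unfolding FF_def FW_def by (auto dest!: subsetD[OF keys_mult] simp: plus_list_def) blast+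

lemma monom_FF: "monom w \<in> FF \<longleftrightarrow> w \<in> FW"
  by (simp add: FF_def)

lemma one_FF: "1 \<in> FF"
  by (simp add: one_free monom_FF FW_simps del: single_one)

lemma scalar_elt_sca: "scalar_elt D = sca"
  by (rule ext) (rule scalar_elt_eq)

lemma gen_subalgebra_eq: "gen_subalgebra D S = generate_ring HH (range sca \<union> S)"
  by (simp add: gen_subalgebra_def scalar_elt_sca)

lemma gen_subalgebra_subring:
  "S \<subseteq> carrier HH \<Longrightarrow> subring (gen_subalgebra D S) HH"
  unfolding gen_subalgebra_eq
  by (rule ring.generate_ring_is_subring[OF heis_ring]) (auto simp: sca_carrier)

lemma Bmm_eq: "Bmm D = fm ` FF"
proof
  show "Bmm D \<subseteq> fm ` FF"
  proof
    fix x assume "x \<in> Bmm D"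
    then show "x \<in> fm ` FF"
      unfolding Bmm_def gen_subalgebra_eq
    proof (induction rule: generate_ring.induct)
      case one
      show ?case using one_FF fm_one by (metis image_eqI)
    next
      case (incl h)
      then consider c where "h = sca c" | i where "i \<in> nodes D" "h = ff i" by blast
      then show ?case
      proof cases
        case 1
        then show ?thesis using fm_sca cs.subspace_scale[OF FF_subspace one_FF] by (metis image_eqI)
      next
        case 2
        then show ?thesis by (simp add: ff_fm monom_FF FW_simps)
      qed
    next
      case (a_inv h)
      then show ?case using fm_minus[OF FF_BB] cs.subspace_neg[OF FF_subspace] by auto
    next
      case (eng_add h1 h2)
      then show ?case using fm_add[OF FF_BB FF_BB] cs.subspace_add[OF FF_subspace] by auto
    next
      case (eng_mult h1 h2)
      then show ?case using fm_mult[OF FF_BB FF_BB] FF_mult by auto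
    qed
  qed
  have sub: "subring (Bmm D) HH"
    unfolding Bmm_def by (rule gen_subalgebra_subring) (auto simp: gen_carrier)
  have sca: "sca c \<in> Bmm D" for c
    unfolding Bmm_def gen_subalgebra_eq by (rule generate_ring.incl) simp
  have f: "fm (monom [GenF i]) \<in> Bmm D" if "i \<in> nodes D" for i
    unfolding Bmm_def gen_subalgebra_eq ff_fm[symmetric] using that by (intro generate_ring.incl) simp
  have word: "fm (monom w) \<in> Bmm D" if "w \<in> FW" for w
    using that
  proof (induction w)
    case Nil
    show ?case using subringE(3)[OF sub] fm_one by (simp add: monom_Nil del: single_one)
  next
    case (Cons g w)
    then obtain i where g: "g = GenF i" "i \<in> nodes D" "w \<in> FW" by (cases g) (auto simp: FW_simps)
    have "fm (monom [GenF i]) \<otimes>\<^bsub>HH\<^esub> fm (monom w) = fm (monom (g # w))"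
      using g by (simp add: fm_mult monom_mult letters FW_Xm)
    then show ?case using subringE(6)[OF sub f[OF g(2)] Cons.IH[OF g(3)]] by simp
  qed
  have W: "cs.subspace {b \<in> FF. fm b \<in> Bmm D}"
  proof (rule cs.subspaceI)
    show "0 \<in> {b \<in> FF. fm b \<in> Bmm D}"
      using subringE(2)[OF sub] cs.subspace_0[OF FF_subspace] by (simp add: fm_zero)
  next
    fix x y assume x: "x \<in> {b \<in> FF. fm b \<in> Bmm D}" and y: "y \<in> {b \<in> FF. fm b \<in> Bmm D}"
    then show "x + y \<in> {b \<in> FF. fm b \<in> Bmm D}"
      using subringE(7)[OF sub, of "fm x" "fm y"] cs.subspace_add[OF FF_subspace] by (simp add: fm_add FF_BB)
  next
    fix c x assume x: "x \<in> {b \<in> FF. fm b \<in> Bmm D}"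
    then show "cscale c x \<in> {b \<in> FF. fm b \<in> Bmm D}"
      using subringE(6)[OF sub sca, of "fm x"] cs.subspace_scale[OF FF_subspace] by (simp add: fm_cscale FF_BB)
  qed
  show "fm ` FF \<subseteq> Bmm D"
  proof
    fix x assume "x \<in> fm ` FF"
    then obtain b where b: "b \<in> FF" "x = fm b" by blast
    have "b \<in> {b \<in> FF. fm b \<in> Bmm D}"
      by (rule in_span_monoms[OF W]) (use b(1) word in \<open>auto simp: FF_def\<close>)
    then show "x \<in> Bmm D" using b by simp
  qed
qed

abbreviation "BQ \<equiv> carrier (Bq D)"
abbreviation "Bgens \<equiv> ee ` nodes D \<union> ff ` nodes D \<union> tt ` P"

lemma BQ_eq: "BQ = gen_subalgebra D Bgens"
  by (simp add: Bq_def lattice(1))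

lemma Bgens_carrier: "Bgens \<subseteq> carrier HH"
  by (auto simp: gen_carrier)

lemma BQ_subring: "subring BQ HH"
  unfolding BQ_eq by (rule gen_subalgebra_subring[OF Bgens_carrier])

lemma BQ_carrier: "x \<in> BQ \<Longrightarrow> x \<in> carrier HH"
  using subringE(1)[OF BQ_subring] by blast

lemma Bq_simps: "mult (Bq D) = mult HH" "one (Bq D) = one HH" "zero (Bq D) = zero HH" "add (Bq D) = add HH"
  by (simp_all add: Bq_def)

lemma Bq_ring: "ring (Bq D)"
  unfolding Bq_def gen_subalgebra_eq lattice(1)
  by (rule ring.generate_ring_is_ring[OF heis_ring]) (use Bgens_carrier sca_carrier in auto)

lemma Bq_minus: assumes "x \<in> BQ" shows "\<ominus>\<^bsub>Bq D\<^esub> x = \<ominus>\<^bsub>HH\<^esub> x"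
proof -
  interpret B: ring "Bq D" by (rule Bq_ring)
  interpret H: ring HH by (rule heis_ring)
  show ?thesis
  proof (rule B.minus_equality)
    show "\<ominus>\<^bsub>HH\<^esub> x \<in> BQ" using assms subringE(5)[OF BQ_subring] by blast
    show "\<ominus>\<^bsub>HH\<^esub> x \<oplus>\<^bsub>Bq D\<^esub> x = \<zero>\<^bsub>Bq D\<^esub>"
      using BQ_carrier[OF assms] by (simp add: Bq_simps H.l_neg)
  qed (rule assms)
qed

lemma BQ_gens: "sca c \<in> BQ" "i \<in> nodes D \<Longrightarrow> ee i \<in> BQ" "i \<in> nodes D \<Longrightarrow> ff i \<in> BQ" "k \<in> P \<Longrightarrow> tt k \<in> BQ"
  unfolding BQ_eq gen_subalgebra_eq by (rule generate_ring.incl; simp)+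

lemma gen_subalgebra_mono: "S \<subseteq> S' \<Longrightarrow> S' \<subseteq> carrier HH \<Longrightarrow> gen_subalgebra D S \<subseteq> gen_subalgebra D S'"
  unfolding gen_subalgebra_eq
  by (rule ring.mono_generate_ring[OF heis_ring]) (use sca_carrier in auto)

lemma Bmm_BQ: "Bmm D \<subseteq> BQ" and Bpp_BQ: "Bpp D \<subseteq> BQ"
  unfolding Bmm_def Bpp_def BQ_eq by (rule gen_subalgebra_mono[OF _ Bgens_carrier]; blast)+

lemma fm_BQ: "b \<in> FF \<Longrightarrow> fm b \<in> BQ"
  using Bmm_BQ by (auto simp: Bmm_eq)

text \<open>The commutation relation moves \<open>e'\<^sub>i\<close> past the letters of a word one by one; each step leaves a
  term in which \<open>e'\<^sub>i\<close> and the letter have been absorbed.\<close>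

lemma ee_word:
  assumes i: "i \<in> nodes D" and w: "w \<in> FW"
  shows "\<exists>y x. y \<in> FF \<and> (\<forall>v\<in>Poly_Mapping.keys y. length v < length w) \<and> x \<in> FF \<and>
      ee i \<otimes>\<^bsub>HH\<^esub> fm (monom w) = fm y \<oplus>\<^bsub>HH\<^esub> fm x \<otimes>\<^bsub>HH\<^esub> ee i"
  using w
proof (induction w)
  case Nil
  interpret ring HH by (rule heis_ring)
  have "ee i \<otimes>\<^bsub>HH\<^esub> fm (monom []) = fm 0 \<oplus>\<^bsub>HH\<^esub> fm 1 \<otimes>\<^bsub>HH\<^esub> ee i"
    using gen_carrier(3)[OF i] by (simp add: monom_Nil fm_one fm_zero del: single_one)
  moreover have "\<forall>v\<in>Poly_Mapping.keys (0 :: 'g mfree). length v < length []" by simp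
  ultimately show ?case
    using one_FF cs.subspace_0[OF FF_subspace] by blast
next
  case (Cons g w)
  interpret ring HH by (rule heis_ring)
  obtain j where g: "g = GenF j" "j \<in> nodes D" "w \<in> FW" using Cons.prems by (cases g) (auto simp: FW_simps)
  obtain y x where yx: "y \<in> FF" "\<forall>v\<in>Poly_Mapping.keys y. length v < length w" "x \<in> FF"
    "ee i \<otimes>\<^bsub>HH\<^esub> fm (monom w) = fm y \<oplus>\<^bsub>HH\<^esub> fm x \<otimes>\<^bsub>HH\<^esub> ee i"
    using Cons.IH[OF g(3)] by (elim exE conjE) (rule that)
  let ?F = "monom [GenF j] :: 'g mfree" and ?c = "sca (\<kappa> (\<alpha> i) j)"
  have F: "?F \<in> FF" "monom w \<in> FF" using g by (simp_all add: monom_FF FW_simps)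
  note c = gen_carrier(3)[OF i] fm_carrier[OF FF_BB[OF F(1)]] fm_carrier[OF FF_BB[OF F(2)]]
    fm_carrier[OF FF_BB[OF yx(1)]] fm_carrier[OF FF_BB[OF yx(3)]] sca_carrier
  let ?y = "cscale (dd i j) (monom w) + cscale (\<kappa> (\<alpha> i) j) (?F * y)" and ?x = "cscale (\<kappa> (\<alpha> i) j) (?F * x)"
  have yF: "cscale (dd i j) (monom w) \<in> FF" "cscale (\<kappa> (\<alpha> i) j) (?F * y) \<in> FF" "?x \<in> FF" "?F * y \<in> FF" "?F * x \<in> FF"
    using F yx FF_mult by (auto intro!: cs.subspace_scale[OF FF_subspace] simp del: cscale_single)
  have "fm (monom (g # w)) = fm ?F \<otimes>\<^bsub>HH\<^esub> fm (monom w)"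
    using fm_mult[OF FF_BB[OF F(1)] FF_BB[OF F(2)]] by (simp add: monom_mult g)
  then have "ee i \<otimes>\<^bsub>HH\<^esub> fm (monom (g # w)) = (ee i \<otimes>\<^bsub>HH\<^esub> fm ?F) \<otimes>\<^bsub>HH\<^esub> fm (monom w)"
    using c by (simp add: m_assoc)
  also have "\<dots> = (sca (dd i j) \<oplus>\<^bsub>HH\<^esub> ?c \<otimes>\<^bsub>HH\<^esub> (fm ?F \<otimes>\<^bsub>HH\<^esub> ee i)) \<otimes>\<^bsub>HH\<^esub> fm (monom w)"
    using ee_ff[OF i g(2)] by (simp add: ff_fm)
  also have "\<dots> = sca (dd i j) \<otimes>\<^bsub>HH\<^esub> fm (monom w) \<oplus>\<^bsub>HH\<^esub> ?c \<otimes>\<^bsub>HH\<^esub> (fm ?F \<otimes>\<^bsub>HH\<^esub> (ee i \<otimes>\<^bsub>HH\<^esub> fm (monom w)))"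
    using c by (simp add: l_distr m_assoc)
  also have "\<dots> = (sca (dd i j) \<otimes>\<^bsub>HH\<^esub> fm (monom w) \<oplus>\<^bsub>HH\<^esub> ?c \<otimes>\<^bsub>HH\<^esub> (fm ?F \<otimes>\<^bsub>HH\<^esub> fm y))
      \<oplus>\<^bsub>HH\<^esub> (?c \<otimes>\<^bsub>HH\<^esub> (fm ?F \<otimes>\<^bsub>HH\<^esub> fm x)) \<otimes>\<^bsub>HH\<^esub> ee i"
    unfolding yx(4) using c by (simp add: r_distr m_assoc a_assoc)
  also have "sca (dd i j) \<otimes>\<^bsub>HH\<^esub> fm (monom w) \<oplus>\<^bsub>HH\<^esub> ?c \<otimes>\<^bsub>HH\<^esub> (fm ?F \<otimes>\<^bsub>HH\<^esub> fm y) = fm ?y"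
    by (simp only: fm_mult[OF FF_BB[OF F(1)] FF_BB[OF yx(1)]] fm_cscale[OF FF_BB[OF F(2)], symmetric]
        fm_cscale[OF FF_BB[OF yF(4)], symmetric] fm_add[OF FF_BB[OF yF(1)] FF_BB[OF yF(2)]])
  also have "?c \<otimes>\<^bsub>HH\<^esub> (fm ?F \<otimes>\<^bsub>HH\<^esub> fm x) = fm ?x"
    by (simp only: fm_mult[OF FF_BB[OF F(1)] FF_BB[OF yx(3)]] fm_cscale[OF FF_BB[OF yF(5)], symmetric])
  finally have *: "ee i \<otimes>\<^bsub>HH\<^esub> fm (monom (g # w)) = fm ?y \<oplus>\<^bsub>HH\<^esub> fm ?x \<otimes>\<^bsub>HH\<^esub> ee i" .
  have "length v < length (g # w)" if "v \<in> Poly_Mapping.keys ?y" for v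
  proof -
    have "v \<in> Poly_Mapping.keys (monom w) \<or> v \<in> Poly_Mapping.keys (?F * y)"
      using subsetD[OF keys_add that] by (auto dest!: subsetD[OF keys_cscale] simp del: cscale_single)
    then show ?thesis
    proof
      assume "v \<in> Poly_Mapping.keys (?F * y)"
      then obtain v' where "v' \<in> Poly_Mapping.keys y" "v = [GenF j] @ v'"
        using keys_mult[of ?F y] by (auto simp: plus_list_def)
      then show ?thesis using yx(2) by simp
    qed simp
  qed
  with * yF(3) cs.subspace_add[OF FF_subspace yF(1,2)] show ?case
    by (intro exI[of _ ?y] exI[of _ ?x] conjI ballI)
qed

lemma tt_word:
  assumes k: "k \<in> P" and w: "w \<in> FW"
  shows "\<exists>c. tt k \<otimes>\<^bsub>HH\<^esub> fm (monom w) = sca c \<otimes>\<^bsub>HH\<^esub> (fm (monom w) \<otimes>\<^bsub>HH\<^esub> tt k)"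
  using w
proof (induction w)
  case Nil
  interpret ring HH by (rule heis_ring)
  show ?case using gen_carrier(1)[OF k]
    by (intro exI[of _ 1]) (simp add: monom_Nil fm_one sca_alg del: single_one)
next
  case (Cons g w)
  interpret ring HH by (rule heis_ring)
  obtain j where g: "g = GenF j" "j \<in> nodes D" "w \<in> FW" using Cons.prems by (cases g) (auto simp: FW_simps)
  obtain c where c: "tt k \<otimes>\<^bsub>HH\<^esub> fm (monom w) = sca c \<otimes>\<^bsub>HH\<^esub> (fm (monom w) \<otimes>\<^bsub>HH\<^esub> tt k)"
    using Cons.IH g(3) by blast
  let ?W = "fm (monom w)" and ?q = "sca (\<kappa> k j)"
  have F: "(monom [GenF j] :: 'g mfree) \<in> FF" "monom w \<in> FF" using g by (simp_all add: monom_FF FW_simps)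
  note cc = gen_carrier(1)[OF k] gen_carrier(2)[OF g(2)] fm_carrier[OF FF_BB[OF F(2)]] sca_carrier
  have e: "fm (monom (g # w)) = ff j \<otimes>\<^bsub>HH\<^esub> ?W"
    using fm_mult[OF FF_BB[OF F(1)] FF_BB[OF F(2)]] by (simp add: monom_mult g ff_fm)
  have "tt k \<otimes>\<^bsub>HH\<^esub> (ff j \<otimes>\<^bsub>HH\<^esub> ?W) = (?q \<otimes>\<^bsub>HH\<^esub> (ff j \<otimes>\<^bsub>HH\<^esub> tt k)) \<otimes>\<^bsub>HH\<^esub> ?W"
    using cc tt_ff[OF k g(2)] by (simp add: m_assoc[symmetric])
  also have "\<dots> = ?q \<otimes>\<^bsub>HH\<^esub> (ff j \<otimes>\<^bsub>HH\<^esub> (tt k \<otimes>\<^bsub>HH\<^esub> ?W))"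
    using cc by (simp add: m_assoc)
  also have "\<dots> = ?q \<otimes>\<^bsub>HH\<^esub> (ff j \<otimes>\<^bsub>HH\<^esub> sca c \<otimes>\<^bsub>HH\<^esub> (?W \<otimes>\<^bsub>HH\<^esub> tt k))"
    unfolding c using cc by (simp add: m_assoc)
  also have "ff j \<otimes>\<^bsub>HH\<^esub> sca c = sca c \<otimes>\<^bsub>HH\<^esub> ff j" using sca_central[OF cc(2)] by simp
  also have "?q \<otimes>\<^bsub>HH\<^esub> (sca c \<otimes>\<^bsub>HH\<^esub> ff j \<otimes>\<^bsub>HH\<^esub> (?W \<otimes>\<^bsub>HH\<^esub> tt k))
      = (?q \<otimes>\<^bsub>HH\<^esub> sca c) \<otimes>\<^bsub>HH\<^esub> (ff j \<otimes>\<^bsub>HH\<^esub> ?W \<otimes>\<^bsub>HH\<^esub> tt k)"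
    using cc by (simp add: m_assoc)
  finally show ?case unfolding e by (auto simp: sca_alg)
qed

lemma tt_conj_FF:
  assumes k: "k \<in> P" and x: "x \<in> FF"
  shows "\<exists>y\<in>FF. tt k \<otimes>\<^bsub>HH\<^esub> fm x = fm y \<otimes>\<^bsub>HH\<^esub> tt k"
proof -
  interpret ring HH by (rule heis_ring)
  let ?W = "{x \<in> FF. \<exists>y\<in>FF. tt k \<otimes>\<^bsub>HH\<^esub> fm x = fm y \<otimes>\<^bsub>HH\<^esub> tt k}"
  note t = gen_carrier(1)[OF k]
  have "x \<in> ?W"
  proof (rule in_span_monoms)
    show "cs.subspace ?W"
    proof (rule cs.subspaceI)
      show "0 \<in> ?W" using cs.subspace_0[OF FF_subspace] t by (auto intro!: bexI[of _ 0] simp: fm_zero)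
    next
      fix a b assume "a \<in> ?W" "b \<in> ?W"
      then obtain a' b' where h: "a \<in> FF" "b \<in> FF" "a' \<in> FF" "b' \<in> FF"
        "tt k \<otimes>\<^bsub>HH\<^esub> fm a = fm a' \<otimes>\<^bsub>HH\<^esub> tt k" "tt k \<otimes>\<^bsub>HH\<^esub> fm b = fm b' \<otimes>\<^bsub>HH\<^esub> tt k"
        by blast
      then have "tt k \<otimes>\<^bsub>HH\<^esub> fm (a + b) = fm (a' + b') \<otimes>\<^bsub>HH\<^esub> tt k"
        using t by (simp add: fm_add[symmetric] FF_BB fm_carrier r_distr l_distr)
      then show "a + b \<in> ?W"
        using h cs.subspace_add[OF FF_subspace] by blast
    next
      fix c a assume "a \<in> ?W"
      then obtain a' where h: "a \<in> FF" "a' \<in> FF" "tt k \<otimes>\<^bsub>HH\<^esub> fm a = fm a' \<otimes>\<^bsub>HH\<^esub> tt k" by blast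
      have "tt k \<otimes>\<^bsub>HH\<^esub> fm (cscale c a) = (tt k \<otimes>\<^bsub>HH\<^esub> sca c) \<otimes>\<^bsub>HH\<^esub> fm a"
        using t h by (simp add: fm_cscale FF_BB fm_carrier sca_carrier m_assoc)
      also have "\<dots> = sca c \<otimes>\<^bsub>HH\<^esub> (tt k \<otimes>\<^bsub>HH\<^esub> fm a)"
        using t h sca_central[OF t, of c, symmetric] by (simp add: FF_BB fm_carrier sca_carrier m_assoc)
      also have "\<dots> = fm (cscale c a') \<otimes>\<^bsub>HH\<^esub> tt k"
        using t h by (simp add: fm_cscale FF_BB fm_carrier sca_carrier m_assoc)
      finally show "cscale c a \<in> ?W"
        using h cs.subspace_scale[OF FF_subspace] by blast
    qed
    fix w assume "w \<in> Poly_Mapping.keys x"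
    then have w: "w \<in> FW" using x by (simp add: FF_def)
    obtain c where c: "tt k \<otimes>\<^bsub>HH\<^esub> fm (monom w) = sca c \<otimes>\<^bsub>HH\<^esub> (fm (monom w) \<otimes>\<^bsub>HH\<^esub> tt k)"
      using tt_word[OF k w] by blast
    have m: "monom w \<in> FF" using w by (simp add: monom_FF)
    have "tt k \<otimes>\<^bsub>HH\<^esub> fm (monom w) = fm (cscale c (monom w)) \<otimes>\<^bsub>HH\<^esub> tt k"
      unfolding c using FW_Xm[OF w] t by (simp add: fm_cscale fm_carrier sca_carrier m_assoc del: cscale_single)
    then show "monom w \<in> ?W" using m cs.subspace_scale[OF FF_subspace m] by blast
  qed
  then show ?thesis by blast
qed

end

locale q_boson_weight = q_boson D for D :: "'g::ab_group_add q_boson_data" +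
  fixes l :: "'g \<Rightarrow> complex"
  assumes l: "l \<in> weight_lattice D"
begin

section \<open>The left ideal of a weight\<close>

abbreviation "J \<equiv> I_ideal D l"
abbreviation "\<chi> k \<equiv> qform D l k"

definition "JE = {b \<otimes>\<^bsub>Bq D\<^esub> ee i | b i. b \<in> BQ \<and> i \<in> nodes D}"
definition "JT = {b \<otimes>\<^bsub>Bq D\<^esub> (tt k \<ominus>\<^bsub>Bq D\<^esub> scalar_elt D (\<chi> k)) | b k. b \<in> BQ \<and> k \<in> P}"

lemma J_eq: "J = generate (add_monoid (Bq D)) (JE \<union> JT)"
  by (simp add: I_ideal_def JE_def JT_def lattice(1))

sublocale B: ring "Bq D" by (rule Bq_ring)

lemma JT_base: "k \<in> P \<Longrightarrow> tt k \<ominus>\<^bsub>Bq D\<^esub> scalar_elt D (\<chi> k) \<in> BQ"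
  unfolding scalar_elt_sca by (intro B.minus_closed BQ_gens)

lemma J_gens: "JE \<union> JT \<subseteq> BQ"
  using JT_base BQ_gens by (auto simp: JE_def JT_def)

lemma J_subgroup: "subgroup J (add_monoid (Bq D))"
  unfolding J_eq by (rule B.add.generate_is_subgroup) (use J_gens in simp)

lemma J_BQ: "x \<in> J \<Longrightarrow> x \<in> BQ"
  using subgroup.subset[OF J_subgroup] by auto

lemma J_closed: "x \<in> J \<Longrightarrow> y \<in> J \<Longrightarrow> x \<oplus>\<^bsub>Bq D\<^esub> y \<in> J" "x \<in> J \<Longrightarrow> \<ominus>\<^bsub>Bq D\<^esub> x \<in> J" "\<zero>\<^bsub>Bq D\<^esub> \<in> J"
  using subgroup.m_closed[OF J_subgroup] subgroup.m_inv_closed[OF J_subgroup] subgroup.one_closed[OF J_subgroup]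
  by (auto simp: a_inv_def)

lemma J_left:
  assumes b: "b \<in> BQ" and x: "x \<in> J" shows "b \<otimes>\<^bsub>Bq D\<^esub> x \<in> J"
proof -
  have gen: "b \<otimes>\<^bsub>Bq D\<^esub> h \<in> JE \<union> JT" if h: "h \<in> JE \<union> JT" for h
    using h
  proof
    assume "h \<in> JE"
    then obtain c i where c: "h = c \<otimes>\<^bsub>Bq D\<^esub> ee i" "c \<in> BQ" "i \<in> nodes D" by (auto simp: JE_def)
    then have "b \<otimes>\<^bsub>Bq D\<^esub> h = (b \<otimes>\<^bsub>Bq D\<^esub> c) \<otimes>\<^bsub>Bq D\<^esub> ee i" using b BQ_gens by (simp add: B.m_assoc)
    then show ?thesis using c b unfolding JE_def by blast
  next
    assume "h \<in> JT"
    then obtain c k where c: "h = c \<otimes>\<^bsub>Bq D\<^esub> (tt k \<ominus>\<^bsub>Bq D\<^esub> scalar_elt D (\<chi> k))" "c \<in> BQ" "k \<in> P"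
      by (auto simp: JT_def)
    then have "b \<otimes>\<^bsub>Bq D\<^esub> h = (b \<otimes>\<^bsub>Bq D\<^esub> c) \<otimes>\<^bsub>Bq D\<^esub> (tt k \<ominus>\<^bsub>Bq D\<^esub> scalar_elt D (\<chi> k))"
      using b JT_base by (simp add: B.m_assoc)
    then show ?thesis using c b unfolding JT_def by blast
  qed
  from x have "x \<in> BQ \<and> b \<otimes>\<^bsub>Bq D\<^esub> x \<in> J"
    unfolding J_eq
  proof (induction rule: generate.induct)
    case one
    show ?case using b generate.one[of "add_monoid (Bq D)" "JE \<union> JT"] by simp
  next
    case (incl h)
    then show ?case using gen J_gens by (auto intro: generate.incl)
  next
    case (inv h)
    have hB: "h \<in> BQ" using inv J_gens by blast
    have "b \<otimes>\<^bsub>Bq D\<^esub> h \<in> generate (add_monoid (Bq D)) (JE \<union> JT)" using gen[OF inv] by (rule generate.incl)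
    then have "\<ominus>\<^bsub>Bq D\<^esub> (b \<otimes>\<^bsub>Bq D\<^esub> h) \<in> generate (add_monoid (Bq D)) (JE \<union> JT)"
      using J_closed(2) by (simp add: J_eq)
    moreover have "inv\<^bsub>add_monoid (Bq D)\<^esub> h = \<ominus>\<^bsub>Bq D\<^esub> h" by (simp add: a_inv_def)
    ultimately show ?case using b hB by (simp add: B.r_minus)
  next
    case (eng h1 h2)
    then show ?case using b generate.eng[of "b \<otimes>\<^bsub>Bq D\<^esub> h1" "add_monoid (Bq D)" "JE \<union> JT" "b \<otimes>\<^bsub>Bq D\<^esub> h2"]
      by (simp add: B.r_distr)
  qed
  then show ?thesis ..
qed

text \<open>The linear map \<open>b \<sharp> a \<mapsto> \<phi>(a, t'\<^sub>-\<^sub>\<lambda>) b\<close> from the Heisenberg double to \<open>U\<^sup>-\<close>, with the element of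
  \<open>U\<^sup>-\<close> recorded through its pairings with words.  Its kernel is a left ideal which contains \<open>J\<close>, and
  it is injective on \<open>B\<^sup>-\<^sup>-\<close>.\<close>

abbreviation "tlw \<equiv> [GenT' (- l)]"

definition proj :: "'g mpfree set \<Rightarrow> ('g \<Rightarrow> complex) plus_gen list \<Rightarrow> complex" where
  "proj X u' = Phi u' tlw (SOME p. p \<in> HF \<and> cl p = X)"

lemma ml: "- l \<in> P" using lattice(5)[OF l] .

lemma proj_cl: assumes "p \<in> HF" shows "proj (cl p) u' = Phi u' tlw p"
proof -
  let ?q = "SOME q. q \<in> HF \<and> cl q = cl p"
  have "?q \<in> HF \<and> cl ?q = cl p" by (rule someI[of _ p]) (simp add: assms)
  then show ?thesis using cl_eq_iff[of ?q p] assms by (simp add: proj_def)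
qed

lemma proj_add: "X \<in> carrier HH \<Longrightarrow> Y \<in> carrier HH \<Longrightarrow> proj (X \<oplus>\<^bsub>HH\<^esub> Y) u' = proj X u' + proj Y u'"
  by (auto simp: heis_carrier cl_add proj_cl cs.subspace_add[OF HF_subspace] Phi_linear)

lemma proj_minus: "X \<in> carrier HH \<Longrightarrow> proj (\<ominus>\<^bsub>HH\<^esub> X) u' = - proj X u'"
  by (auto simp: heis_carrier cl_minus proj_cl cs.subspace_neg[OF HF_subspace] Phi_linear)

lemma proj_zero: "proj \<zero>\<^bsub>HH\<^esub> u' = 0"
  by (simp add: cl_zero proj_cl cs.subspace_0[OF HF_subspace] Phi_linear)

text \<open>Pairing \<open>X Y\<close> with a word and \<open>t'\<^sub>-\<^sub>\<lambda>\<close> splits into pairings of \<open>Y\<close> with words and the same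
  \<open>t'\<^sub>-\<^sub>\<lambda>\<close>, because \<open>t'\<^sub>-\<^sub>\<lambda>\<close> is group-like.\<close>

lemma proj_left:
  assumes X: "X \<in> carrier HH" and Y: "Y \<in> carrier HH" and 0: "\<And>u'. proj Y u' = 0"
  shows "proj (X \<otimes>\<^bsub>HH\<^esub> Y) u' = 0"
proof -
  obtain x y where xy: "x \<in> HF" "y \<in> HF" "X = cl x" "Y = cl y" using X Y by (auto simp: heis_carrier)
  have y0: "Phi u' tlw y = 0" for u' using 0 xy by (simp add: proj_cl)
  have m: "Phi u' tlw (HM (monom k) y) = 0" for k
    by (cases k) (simp add: Phi_HM_left y0)
  have s: "Phi u' tlw (HM (Poly_Mapping.single k c) y) = 0" for k c
    using m[of k] HM_linear(3)[of c "monom k" y] by (simp add: Phi_linear)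
  have "Phi u' tlw (HM x y) = 0"
    by (rule additive_eqI[where h = "\<lambda>x. Phi u' tlw (HM x y)" and g = "\<lambda>_. 0"]) (simp_all add: HM_linear Phi_linear s)
  then show ?thesis using xy by (simp add: cl_mult proj_cl HM_closed)
qed

lemma ph_Nil_tlw [simp]: "ph [] tlw = 1"
  using ml by (simp add: ph_Nil_left letters)

lemma proj_fm: "b \<in> BB \<Longrightarrow> proj (fm b) u' = ev (ph u') b"
  by (simp add: fm_def proj_cl tens_one_HF Phi_fm)

lemma proj_ee: "i \<in> nodes D \<Longrightarrow> proj (ee i) u' = 0"
  using ml by (simp add: ee_eq proj_cl cscale_HF gen_HF Phi_linear ph_ew_letters del: cscale_single)

lemma proj_tt: assumes k: "k \<in> P" shows "proj (tt k \<ominus>\<^bsub>Bq D\<^esub> scalar_elt D (\<chi> k)) u' = 0"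
proof -
  interpret H: ring HH by (rule heis_ring)
  have e: "tt k \<ominus>\<^bsub>Bq D\<^esub> scalar_elt D (\<chi> k) = tt k \<oplus>\<^bsub>HH\<^esub> \<ominus>\<^bsub>HH\<^esub> sca (\<chi> k)"
    by (simp add: a_minus_def Bq_minus BQ_gens scalar_elt_sca Bq_simps)
  have "ph [GenT k] tlw = \<chi> k"
    using k ml lattice(7)[OF k l] lattice(6)[of k l] by (simp add: ph_letters)
  moreover have "proj (sca (\<chi> k)) u' = \<chi> k * ph u' []"
    unfolding fm_sca[symmetric]
    using proj_fm[of "cscale (\<chi> k) 1" u'] one_carrier_free(2)
    by (simp add: cs.subspace_scale[OF carrier_free_subspace(2)] ev_cscale) (simp add: one_free del: single_one)
  moreover have "proj (tt k) u' = ph u' [] * ph [GenT k] tlw"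
    using k by (simp add: tt_eq proj_cl gen_HF)
  ultimately show ?thesis
    unfolding e using k by (simp add: proj_add proj_minus gen_carrier sca_carrier)
qed

lemma proj_J: assumes "X \<in> J" shows "proj X u' = 0"
proof -
  have gen: "proj h u' = 0" if h: "h \<in> JE \<union> JT" for h u'
    using h
  proof
    assume "h \<in> JE"
    then obtain c i where c: "h = c \<otimes>\<^bsub>Bq D\<^esub> ee i" "c \<in> BQ" "i \<in> nodes D" by (auto simp: JE_def)
    then show ?thesis unfolding c(1) Bq_simps by (intro proj_left BQ_carrier BQ_gens proj_ee)
  next
    assume "h \<in> JT"
    then obtain c k where c: "h = c \<otimes>\<^bsub>Bq D\<^esub> (tt k \<ominus>\<^bsub>Bq D\<^esub> scalar_elt D (\<chi> k))" "c \<in> BQ" "k \<in> P"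
      by (auto simp: JT_def)
    have "proj (c \<otimes>\<^bsub>HH\<^esub> (tt k \<ominus>\<^bsub>Bq D\<^esub> scalar_elt D (\<chi> k))) u' = 0"
      by (rule proj_left[OF BQ_carrier[OF c(2)] BQ_carrier[OF JT_base[OF c(3)]]]) (rule proj_tt[OF c(3)])
    then show ?thesis by (simp add: c(1) Bq_simps)
  qed
  from assms have "X \<in> BQ \<and> (\<forall>u'. proj X u' = 0)"
    unfolding J_eq
  proof (induction rule: generate.induct)
    case one
    show ?case using B.zero_closed by (simp add: Bq_simps proj_zero)
  next
    case (incl h)
    then show ?case using gen J_gens by blast
  next
    case (inv h)
    have hB: "h \<in> BQ" using inv J_gens by blast
    have e: "inv\<^bsub>add_monoid (Bq D)\<^esub> h = \<ominus>\<^bsub>Bq D\<^esub> h" by (simp add: a_inv_def)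
    have "proj (\<ominus>\<^bsub>Bq D\<^esub> h) u' = 0" for u'
      unfolding Bq_minus[OF hB] using gen[OF inv, of u'] by (simp add: proj_minus[OF BQ_carrier[OF hB]])
    then show ?case unfolding e using B.a_inv_closed[OF hB] by blast
  next
    case (eng h1 h2)
    then have "h1 \<oplus>\<^bsub>Bq D\<^esub> h2 \<in> BQ" by simp
    then show ?case using eng by (simp add: Bq_simps proj_add BQ_carrier)
  qed
  then show ?thesis by blast
qed

lemma fm_inj_mod_J:
  assumes "x \<in> FF" "y \<in> FF" "X \<in> J" "fm x = fm y \<oplus>\<^bsub>HH\<^esub> X" shows "fm x = fm y"
proof -
  have "ev (ph u) x = ev (ph u) y" for u
  proof -
    have "proj (fm x) u = proj (fm y) u + proj X u"
      unfolding assms(4) by (intro proj_add fm_carrier FF_BB assms BQ_carrier J_BQ)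
    then show ?thesis using proj_J[OF assms(3)] assms(1,2) by (simp add: proj_fm FF_BB)
  qed
  then show ?thesis using fm_eq_iff[OF FF_BB[OF assms(1)] FF_BB[OF assms(2)]] by blast
qed

text \<open>The sum \<open>B\<^sup>-\<^sup>- + J\<close>.  It is stable under left multiplication by the generators, so it is all of \<open>B\<^sub>q\<close>.\<close>

definition "YY = {fm y \<oplus>\<^bsub>HH\<^esub> X | y X. y \<in> FF \<and> X \<in> J}"

lemma ee_J: "b \<in> BQ \<Longrightarrow> i \<in> nodes D \<Longrightarrow> b \<otimes>\<^bsub>HH\<^esub> ee i \<in> J"
  unfolding J_eq by (rule generate.incl) (auto simp: JE_def Bq_simps)

lemma tt_J: "b \<in> BQ \<Longrightarrow> k \<in> P \<Longrightarrow> b \<otimes>\<^bsub>HH\<^esub> (tt k \<ominus>\<^bsub>Bq D\<^esub> scalar_elt D (\<chi> k)) \<in> J"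
  unfolding J_eq by (rule generate.incl) (auto simp: JT_def Bq_simps)

lemmas J_closed_H = J_closed[unfolded Bq_simps]
lemmas J_left_H = J_left[unfolded Bq_simps]

lemma YY_closed:
  assumes "U \<in> YY" "V \<in> YY" shows "U \<oplus>\<^bsub>HH\<^esub> V \<in> YY" "\<ominus>\<^bsub>HH\<^esub> U \<in> YY"
proof -
  interpret H: ring HH by (rule heis_ring)
  obtain y X y' X' where u: "U = fm y \<oplus>\<^bsub>HH\<^esub> X" "y \<in> FF" "X \<in> J" and v: "V = fm y' \<oplus>\<^bsub>HH\<^esub> X'" "y' \<in> FF" "X' \<in> J"
    using assms by (auto simp: YY_def)
  note c = fm_carrier[OF FF_BB[OF u(2)]] fm_carrier[OF FF_BB[OF v(2)]] BQ_carrier[OF J_BQ[OF u(3)]] BQ_carrier[OF J_BQ[OF v(3)]]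
  have "U \<oplus>\<^bsub>HH\<^esub> V = (fm y \<oplus>\<^bsub>HH\<^esub> fm y') \<oplus>\<^bsub>HH\<^esub> (X \<oplus>\<^bsub>HH\<^esub> X')"
    unfolding u(1) v(1) using c by (simp add: H.a_ac)
  also have "\<dots> = fm (y + y') \<oplus>\<^bsub>HH\<^esub> (X \<oplus>\<^bsub>HH\<^esub> X')" by (simp add: fm_add FF_BB u v)
  finally show "U \<oplus>\<^bsub>HH\<^esub> V \<in> YY"
    using cs.subspace_add[OF FF_subspace u(2) v(2)] J_closed_H(1)[OF u(3) v(3)] unfolding YY_def by blast
  have "\<ominus>\<^bsub>HH\<^esub> X \<in> J" using J_closed(2)[OF u(3)] Bq_minus[OF J_BQ[OF u(3)]] by simp
  moreover have "\<ominus>\<^bsub>HH\<^esub> U = fm (- y) \<oplus>\<^bsub>HH\<^esub> \<ominus>\<^bsub>HH\<^esub> X"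
    unfolding u(1) using c by (simp add: H.minus_add fm_minus[symmetric] FF_BB u)
  ultimately show "\<ominus>\<^bsub>HH\<^esub> U \<in> YY" using cs.subspace_neg[OF FF_subspace u(2)] unfolding YY_def by blast
qed

lemma fm_YY: "y \<in> FF \<Longrightarrow> fm y \<in> YY"
proof -
  interpret H: ring HH by (rule heis_ring)
  assume y: "y \<in> FF"
  then have "fm y = fm y \<oplus>\<^bsub>HH\<^esub> \<zero>\<^bsub>HH\<^esub>" using fm_carrier[OF FF_BB[OF y]] by simp
  then show ?thesis using y J_closed_H(3) unfolding YY_def by blast
qed

lemma J_YY: "X \<in> J \<Longrightarrow> X \<in> YY"
proof -
  interpret H: ring HH by (rule heis_ring)
  assume X: "X \<in> J"
  then have "X = fm 0 \<oplus>\<^bsub>HH\<^esub> X" using BQ_carrier[OF J_BQ[OF X]] by (simp add: fm_zero)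
  then show ?thesis using X cs.subspace_0[OF FF_subspace] unfolding YY_def by blast
qed

lemma YY_BQ: "U \<in> YY \<Longrightarrow> U \<in> BQ"
  using B.a_closed fm_BQ J_BQ unfolding YY_def Bq_simps by blast

text \<open>The refinement by degree is what drives the proof that \<open>H(\<lambda>)\<close> is simple.\<close>

lemma ee_FF:
  assumes i: "i \<in> nodes D" and y: "y \<in> FF" and n: "\<forall>w\<in>Poly_Mapping.keys y. length w \<le> n"
  shows "\<exists>z X. z \<in> FF \<and> (\<forall>v\<in>Poly_Mapping.keys z. length v < n) \<and> X \<in> J \<and> ee i \<otimes>\<^bsub>HH\<^esub> fm y = fm z \<oplus>\<^bsub>HH\<^esub> X"
proof -
  interpret H: ring HH by (rule heis_ring)
  note e = gen_carrier(3)[OF i]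
  let ?S = "{z \<in> FF. \<forall>v\<in>Poly_Mapping.keys z. length v < n}"
  have S: "cs.subspace ?S"
    using cs.subspace_inter[OF FF_subspace supported_subspace[of "\<lambda>v. length v < n"]] by (simp add: Int_def)
  let ?W = "{y \<in> FF. \<exists>z\<in>?S. \<exists>X\<in>J. ee i \<otimes>\<^bsub>HH\<^esub> fm y = fm z \<oplus>\<^bsub>HH\<^esub> X}"
  have "y \<in> ?W"
  proof (rule in_span_monoms)
    show "cs.subspace ?W"
    proof (rule cs.subspaceI)
      have "ee i \<otimes>\<^bsub>HH\<^esub> fm 0 = fm 0 \<oplus>\<^bsub>HH\<^esub> \<zero>\<^bsub>HH\<^esub>" using e by (simp add: fm_zero)
      then show "0 \<in> ?W" using cs.subspace_0[OF FF_subspace] cs.subspace_0[OF S] J_closed_H(3) by blast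
    next
      fix a b assume "a \<in> ?W" "b \<in> ?W"
      then obtain z X z' X' where h: "a \<in> FF" "b \<in> FF" "z \<in> ?S" "z' \<in> ?S" "X \<in> J" "X' \<in> J"
        and ea: "ee i \<otimes>\<^bsub>HH\<^esub> fm a = fm z \<oplus>\<^bsub>HH\<^esub> X" and eb: "ee i \<otimes>\<^bsub>HH\<^esub> fm b = fm z' \<oplus>\<^bsub>HH\<^esub> X'" by blast
      have c: "fm z \<in> carrier HH" "fm z' \<in> carrier HH" "X \<in> carrier HH" "X' \<in> carrier HH"
        using h by (auto intro: fm_carrier FF_BB BQ_carrier J_BQ)
      have "ee i \<otimes>\<^bsub>HH\<^esub> fm (a + b) = ee i \<otimes>\<^bsub>HH\<^esub> fm a \<oplus>\<^bsub>HH\<^esub> ee i \<otimes>\<^bsub>HH\<^esub> fm b"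
        using e h by (simp add: fm_add[symmetric] FF_BB fm_carrier H.r_distr)
      also have "\<dots> = (fm z \<oplus>\<^bsub>HH\<^esub> fm z') \<oplus>\<^bsub>HH\<^esub> (X \<oplus>\<^bsub>HH\<^esub> X')"
        unfolding ea eb using c by (simp add: H.a_ac)
      also have "fm z \<oplus>\<^bsub>HH\<^esub> fm z' = fm (z + z')" using h by (simp add: fm_add FF_BB)
      finally show "a + b \<in> ?W"
        using cs.subspace_add[OF FF_subspace h(1,2)] cs.subspace_add[OF S h(3,4)] J_closed_H(1)[OF h(5,6)] by blast
    next
      fix c a assume "a \<in> ?W"
      then obtain z X where h: "a \<in> FF" "z \<in> ?S" "X \<in> J" and ea: "ee i \<otimes>\<^bsub>HH\<^esub> fm a = fm z \<oplus>\<^bsub>HH\<^esub> X" by blast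
      have cc: "fm z \<in> carrier HH" "X \<in> carrier HH"
        using h by (auto intro: fm_carrier FF_BB BQ_carrier J_BQ)
      have "ee i \<otimes>\<^bsub>HH\<^esub> fm (cscale c a) = (ee i \<otimes>\<^bsub>HH\<^esub> sca c) \<otimes>\<^bsub>HH\<^esub> fm a"
        using e h by (simp add: fm_cscale FF_BB fm_carrier sca_carrier H.m_assoc)
      also have "\<dots> = sca c \<otimes>\<^bsub>HH\<^esub> (fm z \<oplus>\<^bsub>HH\<^esub> X)"
        unfolding ea[symmetric] using e h sca_central[OF e, of c, symmetric] by (simp add: FF_BB fm_carrier sca_carrier H.m_assoc)
      also have "\<dots> = fm (cscale c z) \<oplus>\<^bsub>HH\<^esub> sca c \<otimes>\<^bsub>HH\<^esub> X"
        using h cc by (simp add: fm_cscale FF_BB sca_carrier H.r_distr)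
      finally show "cscale c a \<in> ?W"
        using cs.subspace_scale[OF FF_subspace h(1)] cs.subspace_scale[OF S h(2)] J_left_H[OF BQ_gens(1) h(3)] by blast
    qed
    fix w assume wk: "w \<in> Poly_Mapping.keys y"
    then have w: "w \<in> FW" using y by (simp add: FF_def)
    obtain z x where zx: "z \<in> FF" "\<forall>v\<in>Poly_Mapping.keys z. length v < length w" "x \<in> FF"
      "ee i \<otimes>\<^bsub>HH\<^esub> fm (monom w) = fm z \<oplus>\<^bsub>HH\<^esub> fm x \<otimes>\<^bsub>HH\<^esub> ee i"
      using ee_word[OF i w] by (elim exE conjE) (rule that)
    have "z \<in> ?S" using zx(1,2) bspec[OF n wk] by auto
    then show "monom w \<in> ?W" using w zx(4) ee_J[OF fm_BQ[OF zx(3)] i] by (simp only: mem_Collect_eq monom_FF) blast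
  qed
  then show ?thesis by blast
qed

lemma YY_gen:
  assumes g: "g = sca c \<or> (\<exists>i\<in>nodes D. g = ee i) \<or> (\<exists>i\<in>nodes D. g = ff i) \<or> (\<exists>k\<in>P. g = tt k)" and y: "y \<in> FF"
  shows "g \<otimes>\<^bsub>HH\<^esub> fm y \<in> YY"
proof -
  interpret H: ring HH by (rule heis_ring)
  have yB: "fm y \<in> carrier HH" using fm_carrier[OF FF_BB[OF y]] .
  consider "g = sca c" | i where "i \<in> nodes D" "g = ee i" | i where "i \<in> nodes D" "g = ff i" | k where "k \<in> P" "g = tt k"
    using g by blast
  then show ?thesis
  proof cases
    case 1
    then have "g \<otimes>\<^bsub>HH\<^esub> fm y = fm (cscale c y)" by (simp add: fm_cscale FF_BB y)
    then show ?thesis using fm_YY cs.subspace_scale[OF FF_subspace y] by simp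
  next
    case (2 i)
    obtain n where n: "\<forall>w\<in>Poly_Mapping.keys y. length w \<le> n"
      using finite_nat_set_iff_bounded_le[of "length ` Poly_Mapping.keys y"] by auto
    obtain z X where "z \<in> FF" "X \<in> J" "ee i \<otimes>\<^bsub>HH\<^esub> fm y = fm z \<oplus>\<^bsub>HH\<^esub> X"
      using ee_FF[OF 2(1) y n] by (elim exE conjE) (rule that)
    then show ?thesis using 2 unfolding YY_def by blast
  next
    case (3 i)
    then have "g \<otimes>\<^bsub>HH\<^esub> fm y = fm (monom [GenF i] * y)"
      using y by (simp add: ff_fm fm_mult FF_BB letters)
    moreover have "monom [GenF i] * y \<in> FF" using 3 y by (intro FF_mult) (simp_all add: monom_FF FW_simps)
    ultimately show ?thesis by (simp add: fm_YY)
  next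
    case (4 k)
    obtain z where z: "z \<in> FF" "tt k \<otimes>\<^bsub>HH\<^esub> fm y = fm z \<otimes>\<^bsub>HH\<^esub> tt k" using tt_conj_FF[OF 4(1) y] by blast
    let ?d = "tt k \<ominus>\<^bsub>Bq D\<^esub> scalar_elt D (\<chi> k)"
    note c = gen_carrier(1)[OF 4(1)] sca_carrier fm_carrier[OF FF_BB[OF z(1)]]
    have "tt k = ?d \<oplus>\<^bsub>HH\<^esub> sca (\<chi> k)"
      using c by (simp add: a_minus_def Bq_minus BQ_gens scalar_elt_sca Bq_simps H.a_assoc H.l_neg)
    then have "fm z \<otimes>\<^bsub>HH\<^esub> tt k = fm z \<otimes>\<^bsub>HH\<^esub> (?d \<oplus>\<^bsub>HH\<^esub> sca (\<chi> k))" by simp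
    also have "\<dots> = fm z \<otimes>\<^bsub>HH\<^esub> ?d \<oplus>\<^bsub>HH\<^esub> fm z \<otimes>\<^bsub>HH\<^esub> sca (\<chi> k)"
      using c BQ_carrier[OF JT_base[OF 4(1)]] by (rule_tac H.r_distr) auto
    also have "fm z \<otimes>\<^bsub>HH\<^esub> sca (\<chi> k) = fm (cscale (\<chi> k) z)"
      using sca_central[OF c(3)] by (simp add: fm_cscale FF_BB z)
    finally show ?thesis
      using 4 z YY_closed(1)[OF J_YY[OF tt_J[OF fm_BQ[OF z(1)] 4(1)]] fm_YY[OF cs.subspace_scale[OF FF_subspace z(1)]]]
      by simp
  qed
qed

theorem BQ_decomposition: assumes "b \<in> BQ" shows "b \<in> YY"
proof -
  interpret H: ring HH by (rule heis_ring)
  have "b \<in> BQ \<and> (\<forall>U\<in>YY. b \<otimes>\<^bsub>HH\<^esub> U \<in> YY)"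
    using assms unfolding BQ_eq gen_subalgebra_eq
  proof (induction rule: generate_ring.induct)
    case one
    have "\<one>\<^bsub>HH\<^esub> \<otimes>\<^bsub>HH\<^esub> U \<in> YY" if "U \<in> YY" for U
      using that BQ_carrier[OF YY_BQ[OF that]] by simp
    then show ?case by (auto intro: generate_ring.one)
  next
    case (incl h)
    have hB: "h \<in> BQ" unfolding BQ_eq gen_subalgebra_eq by (rule generate_ring.incl[OF incl])
    obtain c where h: "h = sca c \<or> (\<exists>i\<in>nodes D. h = ee i) \<or> (\<exists>i\<in>nodes D. h = ff i) \<or> (\<exists>k\<in>P. h = tt k)"
      using incl by blast
    have "h \<otimes>\<^bsub>HH\<^esub> U \<in> YY" if U: "U \<in> YY" for U
    proof -
      obtain y X where u: "U = fm y \<oplus>\<^bsub>HH\<^esub> X" "y \<in> FF" "X \<in> J" using U by (auto simp: YY_def)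
      have "h \<otimes>\<^bsub>HH\<^esub> U = h \<otimes>\<^bsub>HH\<^esub> fm y \<oplus>\<^bsub>HH\<^esub> h \<otimes>\<^bsub>HH\<^esub> X"
        unfolding u(1) using BQ_carrier[OF hB] fm_carrier[OF FF_BB[OF u(2)]] BQ_carrier[OF J_BQ[OF u(3)]]
        by (simp add: H.r_distr)
      then show ?thesis using YY_closed(1)[OF YY_gen[OF h u(2)] J_YY[OF J_left_H[OF hB u(3)]]] by simp
    qed
    then show ?case by (auto intro: generate_ring.incl[OF incl])
  next
    case (a_inv h)
    then have hH: "h \<in> BQ" by (simp add: BQ_eq gen_subalgebra_eq)
    have "(\<ominus>\<^bsub>HH\<^esub> h) \<otimes>\<^bsub>HH\<^esub> U \<in> YY" if U: "U \<in> YY" for U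
      using a_inv U YY_closed(2)[of "h \<otimes>\<^bsub>HH\<^esub> U"] BQ_carrier[OF hH] BQ_carrier[OF YY_BQ[OF U]]
      by (simp add: H.l_minus)
    then show ?case using a_inv by (auto intro: generate_ring.a_inv)
  next
    case (eng_add h1 h2)
    then have hH: "h1 \<in> BQ" "h2 \<in> BQ" by (simp_all add: BQ_eq gen_subalgebra_eq)
    have "(h1 \<oplus>\<^bsub>HH\<^esub> h2) \<otimes>\<^bsub>HH\<^esub> U \<in> YY" if U: "U \<in> YY" for U
      using eng_add U YY_closed(1) BQ_carrier[OF hH(1)] BQ_carrier[OF hH(2)] BQ_carrier[OF YY_BQ[OF U]]
      by (simp add: H.l_distr)
    then show ?case using eng_add by (auto intro: generate_ring.eng_add)
  next
    case (eng_mult h1 h2)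
    then have hH: "h1 \<in> BQ" "h2 \<in> BQ" by (simp_all add: BQ_eq gen_subalgebra_eq)
    have "(h1 \<otimes>\<^bsub>HH\<^esub> h2) \<otimes>\<^bsub>HH\<^esub> U \<in> YY" if U: "U \<in> YY" for U
      using eng_mult U BQ_carrier[OF hH(1)] BQ_carrier[OF hH(2)] BQ_carrier[OF YY_BQ[OF U]]
      by (simp add: H.m_assoc)
    then show ?case using eng_mult by (auto intro: generate_ring.eng_mult)
  qed
  moreover have "\<one>\<^bsub>HH\<^esub> \<in> YY" using fm_YY[OF one_FF] by (simp add: fm_one)
  ultimately have "b \<otimes>\<^bsub>HH\<^esub> \<one>\<^bsub>HH\<^esub> \<in> YY" by blast
  then show ?thesis using BQ_carrier[OF assms] by simp
qed

end

context q_boson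
begin

section \<open>Vectors that are killed by all \<open>e'\<^sub>i\<close>\<close>

lemma ph_replace:
  assumes "\<And>w. ph a w = c * ph a' w" shows "ph (u @ a @ v) w = c * ph (u @ a' @ v) w"
  unfolding ph_append_left assms by (simp add: mult_swm mult_ac)

lemma ph_torus_cancel: assumes "k \<in> P" shows "ph (u @ [GenT (- k), GenT k] @ v) w = ph (u @ v) w"
proof -
  have "ph [GenT (- k), GenT k] w = 1 * ph [] w" for w
    using ph_torus(1)[OF lattice(5)[OF assms] assms, of w] ph_torus(2)[of w] by simp
  from ph_replace[OF this] show ?thesis by simp
qed

lemma ph_E_T:
  assumes "k \<in> P" "i \<in> nodes D"
  shows "qform D (\<alpha> i) k * ph (u @ [GenE i, GenT k]) w = ph (u @ [GenT k, GenE i]) w"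
proof -
  have "ph (u @ [GenT k, GenE i, GenT (- k)] @ [GenT k]) w = qform D (\<alpha> i) k * ph (u @ [GenE i] @ [GenT k]) w"
    by (rule ph_replace) (rule ph_torus(3)[OF assms])
  moreover have "ph (u @ [GenT k, GenE i, GenT (- k)] @ [GenT k]) w = ph (u @ [GenT k, GenE i]) w"
    using ph_torus_cancel[OF assms(1), of "u @ [GenT k, GenE i]" "[]" w] by simp
  ultimately show ?thesis by simp
qed

text \<open>If \<open>q\<^sub>i\<^sup>-\<^sup>1 = q\<^sub>i\<close>, then \<open>\<phi>(e\<^sub>i, f\<^sub>i) = 1 / 0\<close>, which is \<open>0\<close> by convention, and \<open>e\<^sub>i\<close> lies in the radical.\<close>

lemma ph_E_zero:
  assumes i: "i \<in> nodes D" and c: "cc i = 0" shows "ph [GenE i] w = 0"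
proof (cases "set w \<subseteq> Xm")
  case True
  then show ?thesis
  proof (induction w)
    case Nil
    show ?case using i by (simp add: ph_Nil_right letters)
  next
    case (Cons g w)
    have "ph [GenE i] (g # w) = ph [GenE i] [g] * ph [GenT (- \<alpha> i)] w + ph [] [g] * ph [GenE i] w"
      using ph_append_right[of "[GenE i]" "[g]" w] by simp
    moreover have "ph [GenE i] [g] = 0"
      using Cons.prems i c by (cases g) (auto simp: ph_letters letters)
    ultimately show ?case using Cons by simp
  qed
qed (simp add: ph_bad)

text \<open>The scalar \<open>q\<^bsup>-(k,\<beta>)\<^esup>\<close> for a word of weight \<open>-\<beta>\<close> in the \<open>f\<^sub>i\<close>; words with a torus letter do not occur
  and get the value \<open>0\<close>.\<close>

fun tau :: "('g \<Rightarrow> complex) \<Rightarrow> ('g \<Rightarrow> complex) minus_gen list \<Rightarrow> complex" where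
  "tau k [] = 1" | "tau k (GenF j # w) = \<kappa> k j * tau k w" | "tau k (GenT' m # w) = 0"

lemma swm_torus:
  assumes k: "k \<in> P" and w: "w \<in> FW"
  shows "swm w (\<lambda>w1 w2. G w2 * ph [GenT k] w1) = tau k w * G w"
  using w
proof (induction w arbitrary: G)
  case Nil
  show ?case using k by (simp add: ph_Nil_right letters)
next
  case (Cons g w)
  obtain j where g: "g = GenF j" "j \<in> nodes D" "w \<in> FW" using Cons.prems by (cases g) (auto simp: FW_simps)
  have 1: "ph [GenT k] (GenF j # v) = 0" for v
    using ph_append_right[of "[GenT k]" "[GenF j]" v] ph_letters(4)[OF g(2) k] by simp
  have 2: "ph [GenT k] (GenT' (\<alpha> j) # v) = \<kappa> k j * ph [GenT k] v" for v
    using ph_append_right[of "[GenT k]" "[GenT' (\<alpha> j)]" v] ph_letters(2)[OF k alpha_P(1)[OF g(2)]] by simp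
  have "swm (g # w) (\<lambda>w1 w2. G w2 * ph [GenT k] w1) = swm w (\<lambda>w1 w2. \<kappa> k j * G (GenF j # w2) * ph [GenT k] w1)"
    by (simp add: g 1 2 mult_ac)
  also have "\<dots> = tau k w * (\<kappa> k j * G (GenF j # w))" by (rule Cons.IH[OF g(3)])
  finally show ?case by (simp add: g)
qed

text \<open>If \<open>\<phi>(a e\<^sub>i, x) = 0\<close> for all \<open>a\<close> and \<open>i\<close>, then \<open>x\<close> pairs with a word in the same way as a multiple
  of \<open>1\<close>, because modulo the torus relations every word that contains some \<open>e\<^sub>i\<close> ends with one.\<close>

lemma singular_vector_pairing:
  assumes "x \<in> FF" and "\<And>i u. i \<in> nodes D \<Longrightarrow> set u \<subseteq> Xp \<Longrightarrow> ev (ph (u @ [GenE i])) x = 0" and "set u \<subseteq> Xp"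
  shows "ev (ph u) x = epsp u * Poly_Mapping.lookup x []"
  using assms
proof (induction u arbitrary: x rule: rev_induct)
  case Nil
  have e: "epsm w = (if w = [] then 1 else 0)" if "w \<in> FW" for w
    using that by (cases w rule: epsm.cases) (auto simp: FW_simps)
  have "ev (ph []) x = ev (\<lambda>w. if w = [] then 1 else 0) x"
    using Nil.prems(1) by (intro ev_cong) (auto simp: FF_def ph_Nil_left FW_Xm e)
  also have "\<dots> = Poly_Mapping.lookup x []"
    by (simp add: ev_def pm_sum_def sum.delta' if_distrib in_keys_iff cong: if_cong)
  finally show ?case by simp
next
  case (snoc g u)
  show ?case
  proof (cases g)
    case (GenE i)
    have "epsp (u @ [GenE i]) = 0" by (induction u rule: epsp.induct) simp_all
    then show ?thesis using snoc.prems(2)[of i u] snoc.prems(3) GenE by (simp add: letters)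
  next
    case (GenT k)
    then have k: "k \<in> P" and u: "set u \<subseteq> Xp" using snoc.prems(3) by (simp_all add: letters)
    define x' where "x' = lin_ext (\<lambda>w. cscale (tau k w) (monom w)) x"
    have tw: "ph (v @ [GenT k]) w = tau k w * ph v w" if "w \<in> FW" for v w
      unfolding ph_append_left using swm_torus[OF k that, of "ph v"] .
    have x': "ev (ph v) x' = ev (ph (v @ [GenT k])) x" for v
      unfolding x'_def ev_lin_ext using snoc.prems(1)
      by (intro ev_cong) (simp add: FF_def tw del: ph_append_left)
    have FF': "x' \<in> FF"
      unfolding x'_def using snoc.prems(1)
      by (intro lin_ext_in_subspace FF_subspace cs.subspace_scale[OF FF_subspace]) (simp add: FF_def)
    have "ev (ph (v @ [GenE i])) x' = 0" if i: "i \<in> nodes D" and v: "set v \<subseteq> Xp" for i v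
    proof -
      have nz: "qform D (\<alpha> i) k \<noteq> 0" by (rule qexp_nonzero)
      have "qform D (\<alpha> i) k * ev (ph (v @ [GenE i])) x' = ev (\<lambda>w. qform D (\<alpha> i) k * ph (v @ [GenE i, GenT k]) w) x"
        unfolding x' ev_fun_mult by simp
      also have "\<dots> = ev (ph ((v @ [GenT k]) @ [GenE i])) x"
        unfolding ph_E_T[OF k i] by simp
      also have "\<dots> = 0" using snoc.prems(2)[OF i, of "v @ [GenT k]"] v k by (simp add: letters)
      finally show ?thesis using nz by simp
    qed
    from snoc.IH[OF FF' this u] have "ev (ph (u @ [GenT k])) x = epsp u * Poly_Mapping.lookup x' []"
      by (simp add: x')
    moreover have "Poly_Mapping.lookup x' [] = Poly_Mapping.lookup x []"
    proof -
      have "Poly_Mapping.lookup x' [] = (\<Sum>w\<in>Poly_Mapping.keys x. if w = [] then Poly_Mapping.lookup x w else 0)"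
        unfolding x'_def lin_ext_def lookup_sum by (intro sum.cong) (auto simp: lookup_single when_def)
      then show ?thesis by (simp add: in_keys_iff)
    qed
    moreover have "epsp (u @ [GenT k]) = epsp u" by (induction u rule: epsp.induct) simp_all
    ultimately show ?thesis using GenT by simp
  qed
qed

section \<open>Contraction and the action of \<open>B\<^sup>+\<^sup>+\<close>\<close>

lemma ev_swm_fun: "ev (\<lambda>v. swm w (\<lambda>w1 w2. G v w1 w2)) a = swm w (\<lambda>w1 w2. ev (\<lambda>v. G v w1 w2) a)"
  by (rule additive_eqI[where h = "ev (\<lambda>v. swm w (\<lambda>w1 w2. G v w1 w2))"])
    (simp_all add: ev_add sweedler_add mult_swm)

lemma ev_fun_mult_right: "ev (\<lambda>k. f k * c) p = ev f p * c"
  using ev_fun_mult[of c f p] by (simp add: mult.commute)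

lemma contract_eq:
  assumes a: "a \<in> AA" and b: "b \<in> BB"
  shows "contract D a b = lin_ext (\<lambda>w. swm w (\<lambda>w1 w2. Poly_Mapping.single w2 (ev (\<lambda>u. ph u w1) a))) b"
proof -
  let ?\<Phi> = "\<lambda>(w1, w2) c. cscale c (Poly_Mapping.single w2 (pairing D a (monom w1)))"
  have "contract D a b = pm_sum ?\<Phi> (lin_ext (coproduct (delta_minus D)) b)"
    by (simp add: contract_def comult_minus_eq pm_sum_def case_prod_unfold)
  also have "\<dots> = lin_ext (\<lambda>w. swm w (\<lambda>w1 w2. Poly_Mapping.single w2 (ev (\<lambda>u. ph u w1) a))) b"
  proof (rule additive_eqI[where h = "\<lambda>b. pm_sum ?\<Phi> (lin_ext (coproduct (delta_minus D)) b)"])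
    have add: "pm_sum ?\<Phi> (p + q) = pm_sum ?\<Phi> p + pm_sum ?\<Phi> q" for p q
      by (rule pm_sum_add) (auto simp: cs.scale_left_distrib simp del: cscale_single)
    show "pm_sum ?\<Phi> (lin_ext (coproduct (delta_minus D)) (p + q))
        = pm_sum ?\<Phi> (lin_ext (coproduct (delta_minus D)) p) + pm_sum ?\<Phi> (lin_ext (coproduct (delta_minus D)) q)" for p q
      unfolding lin_ext_add by (rule add)
    fix w c assume "w \<in> Poly_Mapping.keys b"
    then have w: "set w \<subseteq> Xm" using b by (simp add: carrier_free)
    have sc: "pm_sum ?\<Phi> (cscale c p) = cscale c (pm_sum ?\<Phi> p)" for p
    proof (rule additive_eqI[where h = "\<lambda>p. pm_sum ?\<Phi> (cscale c p)"])
      show "pm_sum ?\<Phi> (cscale c (Poly_Mapping.single k d)) = cscale c (pm_sum ?\<Phi> (Poly_Mapping.single k d))" for k d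
        by (cases k) (simp add: pm_sum_single mult.assoc)
    qed (simp_all only: cs.scale_right_distrib add)
    have "pm_sum ?\<Phi> (coproduct (delta_minus D) w) = swm w (\<lambda>w1 w2. Poly_Mapping.single w2 (pairing D a (monom w1)))"
      by (rule pm_sum_coproduct_scale)
    also have "\<dots> = swm w (\<lambda>w1 w2. Poly_Mapping.single w2 (ev (\<lambda>u. ph u w1) a))"
      by (rule sweedler_cong_set[OF closed_minus w]) (simp add: pairing_eq a)
    finally show "pm_sum ?\<Phi> (lin_ext (coproduct (delta_minus D)) (Poly_Mapping.single w c))
        = lin_ext (\<lambda>w. swm w (\<lambda>w1 w2. Poly_Mapping.single w2 (ev (\<lambda>u. ph u w1) a))) (Poly_Mapping.single w c)"
      by (simp only: lin_ext_single sc)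
  qed (rule lin_ext_add)
  finally show ?thesis .
qed

lemma contract_BB: assumes "a \<in> AA" "b \<in> BB" shows "contract D a b \<in> BB"
  unfolding contract_eq[OF assms]
proof (intro lin_ext_in_subspace carrier_free_subspace)
  fix w assume "w \<in> Poly_Mapping.keys b"
  then have "set w \<subseteq> Xm" using assms(2) by (simp add: carrier_free)
  then show "swm w (\<lambda>w1 w2. Poly_Mapping.single w2 (ev (\<lambda>u. ph u w1) a)) \<in> BB"
    by (rule sweedler_in_subspace[OF closed_minus _ carrier_free_subspace(2)]) (simp add: carrier_free)
qed

lemma ev_contract:
  assumes "a \<in> AA" "b \<in> BB"
  shows "ev (ph u') (contract D a b) = ev (\<lambda>w. ev (\<lambda>v. ph (u' @ v) w) a) b"
  unfolding contract_eq[OF assms] ev_lin_ext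
  by (simp add: ev_swm ph_append_left ev_swm_fun ev_fun_mult mult.commute[of "ph u' _"] ev_fun_mult_right)

lemma ev_mult: "ev f (a * a') = ev (\<lambda>u. ev (\<lambda>u'. f (u @ u')) a') a"
proof (rule additive_eqI[where h = "\<lambda>a. ev f (a * a')"])
  fix u c
  show "ev f (Poly_Mapping.single u c * a') = ev (\<lambda>u. ev (\<lambda>u'. f (u @ u')) a') (Poly_Mapping.single u c)"
    by (rule additive_eqI[where h = "\<lambda>a'. ev f (Poly_Mapping.single u c * a')"])
      (simp_all add: distrib_left ev_add mult_single plus_list_def mult_ac)
qed (simp_all add: distrib_right ev_add)

end

context q_boson_weight
begin

lemma ph_tlw: "ph [] (w @ tlw) = ph [] w"
  using ph_append_right[of "[]" w tlw] by simp

lemma ph_ew_tlw: "i \<in> nodes D \<Longrightarrow> ph (ew i) tlw = 0"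
  using ml by (simp add: ph_ew_letters)

lemma ph_TT_tlw: assumes "k \<in> P" shows "ph [GenT k, GenT (- k)] tlw = 1"
  using ph_torus(1)[OF assms lattice(5)[OF assms], of tlw] ph_torus(2)[of tlw] by simp

text \<open>For \<open>a\<close> in \<open>B\<^sup>+\<^sup>+\<close> one has \<open>\<phi>(a, b t'\<^sub>-\<^sub>\<lambda>) = \<phi>(a, b)\<close>, since this holds for the generators
  \<open>e'\<^sub>i = (q\<^sub>i\<^sup>-\<^sup>1 - q\<^sub>i) t\<^sub>i e\<^sub>i\<close>.\<close>

lemma Bpp_torus_invariant:
  assumes X: "X \<in> Bpp D"
  shows "\<exists>a\<in>AA. X = ep a \<and> (\<forall>w. ev (\<lambda>v. ph v (w @ tlw)) a = ev (\<lambda>v. ph v w) a)"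
  using X unfolding Bpp_def gen_subalgebra_eq
proof (induction rule: generate_ring.induct)
  case one
  have "\<forall>w. ev (\<lambda>v. ph v (w @ tlw)) 1 = ev (\<lambda>v. ph v w) 1" by (simp add: one_free ph_tlw del: single_one)
  then show ?case using one_carrier_free(1) ep_one by metis
next
  case (incl h)
  then consider c where "h = sca c" | i where "i \<in> nodes D" "h = ee i" by blast
  then show ?case
  proof cases
    case 1
    have "sca c = ep (cscale c 1)"
      using ep_cscale[OF one_carrier_free(1), of c] sca_carrier monoid.r_one[OF ring.is_monoid[OF heis_ring], of "sca c"] by (simp add: ep_one)
    moreover have "\<forall>w. ev (\<lambda>v. ph v (w @ tlw)) (cscale c 1) = ev (\<lambda>v. ph v w) (cscale c 1)"
      by (simp add: one_free ph_tlw del: single_one)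
    moreover have "cscale c 1 \<in> AA" by (rule cs.subspace_scale[OF carrier_free_subspace(1) one_carrier_free(1)])
    ultimately show ?thesis unfolding 1 by blast
  next
    case 2
    have inv: "ph (ew i) (w @ tlw) = ph (ew i) w" for w
      using 2 ph_append_right[of "ew i" w tlw] ph_TT_tlw[OF alpha_P(1)] ph_ew_tlw by simp
    let ?a = "cscale (cc i) (monom (ew i))"
    have "\<forall>w. ev (\<lambda>v. ph v (w @ tlw)) ?a = ev (\<lambda>v. ph v w) ?a"
      by (simp only: ev_cscale ev_single inv) simp
    moreover have "?a \<in> AA"
      using 2 alpha_P by (intro cs.subspace_scale[OF carrier_free_subspace(1)]) (simp add: letters)
    ultimately show ?thesis unfolding 2(2) ee_ep by blast
  qed
next
  case (a_inv h)
  then obtain a where "a \<in> AA" "h = ep a" "\<forall>w. ev (\<lambda>v. ph v (w @ tlw)) a = ev (\<lambda>v. ph v w) a" by blast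
  then have "- a \<in> AA" "\<ominus>\<^bsub>HH\<^esub> h = ep (- a)" "\<forall>w. ev (\<lambda>v. ph v (w @ tlw)) (- a) = ev (\<lambda>v. ph v w) (- a)"
    using cs.subspace_neg[OF carrier_free_subspace(1)] by (simp_all only: ep_minus ev_uminus simp_thms)
  then show ?case by blast
next
  case (eng_add h1 h2)
  then obtain a b where "a \<in> AA" "h1 = ep a" "\<forall>w. ev (\<lambda>v. ph v (w @ tlw)) a = ev (\<lambda>v. ph v w) a"
    "b \<in> AA" "h2 = ep b" "\<forall>w. ev (\<lambda>v. ph v (w @ tlw)) b = ev (\<lambda>v. ph v w) b" by blast
  then have "a + b \<in> AA" "h1 \<oplus>\<^bsub>HH\<^esub> h2 = ep (a + b)" "\<forall>w. ev (\<lambda>v. ph v (w @ tlw)) (a + b) = ev (\<lambda>v. ph v w) (a + b)"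
    using cs.subspace_add[OF carrier_free_subspace(1)] by (simp_all only: ep_add ev_add simp_thms)
  then show ?case by blast
next
  case (eng_mult h1 h2)
  then obtain a b where ab: "a \<in> AA" "h1 = ep a" "\<And>w. ev (\<lambda>v. ph v (w @ tlw)) a = ev (\<lambda>v. ph v w) a"
    "b \<in> AA" "h2 = ep b" "\<And>w. ev (\<lambda>v. ph v (w @ tlw)) b = ev (\<lambda>v. ph v w) b" by blast
  have pr: "ev (\<lambda>u. ev (\<lambda>v. swm w (\<lambda>w1 w2. F u w2 * G v w1)) b) a
      = swm w (\<lambda>w1 w2. ev (\<lambda>v. G v w1) b * ev (\<lambda>u. F u w2) a)" for w F G
  proof -
    have "ev (\<lambda>u. ev (\<lambda>v. swm w (\<lambda>w1 w2. F u w2 * G v w1)) b) a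
        = ev (\<lambda>u. swm w (\<lambda>w1 w2. ev (\<lambda>v. G v w1) b * F u w2)) a"
      by (simp add: ev_swm_fun ev_fun_mult mult.commute)
    then show ?thesis by (simp add: ev_swm_fun ev_fun_mult)
  qed
  have "ev (\<lambda>v. ph v (w @ tlw)) (a * b) = ev (\<lambda>v. ph v w) (a * b)" for w
    unfolding ev_mult ph_append_left sweedler_append by (simp add: pr ab(3,6))
  moreover have "a * b \<in> AA" "h1 \<otimes>\<^bsub>HH\<^esub> h2 = ep (a * b)" using ab by (simp_all add: ep_mult free_mult_closed)
  ultimately show ?case by blast
qed

text \<open>The Heisenberg product moves \<open>b\<close> past \<open>a\<close> by pairing; what is left of \<open>a\<close> is paired with \<open>t'\<^sub>-\<^sub>\<lambda>\<close>.\<close>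

lemma proj_ep_fm:
  assumes a: "a \<in> AA" and b: "b \<in> BB" and u': "set u' \<subseteq> Xp"
  shows "proj (ep a \<otimes>\<^bsub>HH\<^esub> fm b) u' = ev (\<lambda>w. ev (\<lambda>v. swp v (\<lambda>r1 r2. ph r2 tlw * ph (u' @ r1) w)) a) b"
proof -
  have 1: "Phi u' tlw (HM (monom ([], v)) (tens b 1)) = ev (\<lambda>w. swp v (\<lambda>r1 r2. ph r2 tlw * ph (u' @ r1) w)) b" for v
  proof -
    have "Phi u' tlw (HM (monom ([], v)) (tens b 1))
        = swp v (\<lambda>r1 r2. swp u' (\<lambda>s1 s2. ph s1 [] * (ph r2 tlw * ev (ph (s2 @ r1)) b)))"
      by (simp add: Phi_HM_left Phi_fm mult_ac)
    also have "\<dots> = swp v (\<lambda>r1 r2. ph r2 tlw * ev (ph (u' @ r1)) b)"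
      by (simp add: swp_counit_left[OF u'])
    also have "\<dots> = ev (\<lambda>w. swp v (\<lambda>r1 r2. ph r2 tlw * ph (u' @ r1) w)) b"
      by (rule additive_eqI[where g = "ev (\<lambda>w. swp v (\<lambda>r1 r2. ph r2 tlw * ph (u' @ r1) w))"
            and h = "\<lambda>b. swp v (\<lambda>r1 r2. ph r2 tlw * ev (ph (u' @ r1)) b)"])
        (simp_all add: ev_add sweedler_add mult_swp distrib_left mult_ac)
    finally show ?thesis .
  qed
  have "Phi u' tlw (HM (tens 1 a) (tens b 1)) = ev (\<lambda>v. Phi u' tlw (HM (monom ([], v)) (tens b 1))) a"
  proof (rule additive_eqI[where h = "\<lambda>a. Phi u' tlw (HM (tens 1 a) (tens b 1))"])
    fix v c
    have "HM (cscale c (monom ([], v))) (tens b 1) = cscale c (HM (monom ([], v)) (tens b 1))" by (rule HM_linear)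
    then show "Phi u' tlw (HM (tens 1 (Poly_Mapping.single v c)) (tens b 1))
        = ev (\<lambda>v. Phi u' tlw (HM (monom ([], v)) (tens b 1))) (Poly_Mapping.single v c)"
      by (simp add: tens_one Phi_linear)
  qed (simp_all add: tens_linear HM_linear Phi_linear ev_add)
  then have "proj (ep a \<otimes>\<^bsub>HH\<^esub> fm b) u' = ev (\<lambda>v. ev (\<lambda>w. swp v (\<lambda>r1 r2. ph r2 tlw * ph (u' @ r1) w)) b) a"
    by (simp add: ep_def fm_def cl_mult tens_one_HF a b proj_cl HM_closed 1)
  then show ?thesis by (simp add: ev_swap[where p = a])
qed

text \<open>By the decomposition the product is an element \<open>y\<close> of \<open>B\<^sup>-\<^sup>-\<close> modulo \<open>J\<close>, and \<open>y\<close> can be read off from its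
  pairings with words \<open>u'\<close>.  These are \<open>\<Sum> \<phi>(u', b\<^sub>(\<^sub>2\<^sub>)) \<phi>(a, b\<^sub>(\<^sub>1\<^sub>) t'\<^sub>-\<^sub>\<lambda>)\<close>, and torus invariance
  removes \<open>t'\<^sub>-\<^sub>\<lambda>\<close>.\<close>

theorem Bpp_action:
  assumes a: "a \<in> AA" "ep a \<in> Bpp D" and b: "b \<in> BB" "fm b \<in> Bmm D"
  shows "fm (contract D a b) \<in> Bmm D" "\<exists>X\<in>J. ep a \<otimes>\<^bsub>HH\<^esub> fm b = fm (contract D a b) \<oplus>\<^bsub>HH\<^esub> X"
proof -
  obtain a0 where a0: "a0 \<in> AA" "ep a = ep a0" "\<And>w. ev (\<lambda>v. ph v (w @ tlw)) a0 = ev (\<lambda>v. ph v w) a0"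
    using Bpp_torus_invariant[OF a(2)] by blast
  have "ev (\<lambda>v. ph v w) a = ev (\<lambda>v. ph v w) a0" for w
  proof -
    have "\<forall>u' w'. Phi u' w' (tens 1 a) = Phi u' w' (tens 1 a0)"
      using cl_eq_iff[OF tens_one_HF(2)[OF a(1)] tens_one_HF(2)[OF a0(1)]] a0(2)[unfolded ep_def] by (rule iffD1)
    then have "Phi [] w (tens 1 a) = Phi [] w (tens 1 a0)" by blast
    then show ?thesis by (simp add: Phi_ep)
  qed
  then have inv: "ev (\<lambda>v. ph v (w @ tlw)) a = ev (\<lambda>v. ph v w) a" for w using a0(3) by simp
  have "ep a \<otimes>\<^bsub>Bq D\<^esub> fm b \<in> BQ"
    using a(2) b(2) Bpp_BQ Bmm_BQ by blast
  then have "ep a \<otimes>\<^bsub>HH\<^esub> fm b \<in> YY" by (intro BQ_decomposition) (simp add: Bq_simps)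
  then obtain y X where yX: "ep a \<otimes>\<^bsub>HH\<^esub> fm b = fm y \<oplus>\<^bsub>HH\<^esub> X" "y \<in> FF" "X \<in> J" by (auto simp: YY_def)
  have swp: "swp v (\<lambda>r1 r2. ph r2 tlw * ph (u' @ r1) w) = swm w (\<lambda>w1 w2. ph u' w2 * ph v (w1 @ tlw))" for v u' w
  proof -
    have "swp v (\<lambda>r1 r2. ph r2 tlw * ph (u' @ r1) w)
        = swp v (\<lambda>r1 r2. swm w (\<lambda>w1 w2. ph u' w2 * (ph r1 w1 * ph r2 tlw)))"
      by (simp add: ph_append_left mult_swm mult_ac)
    also have "\<dots> = swm w (\<lambda>w1 w2. swp v (\<lambda>r1 r2. ph u' w2 * (ph r1 w1 * ph r2 tlw)))"
      by (rule sweedler_swap)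
    finally show ?thesis by (simp add: ph_append_right[of v _ tlw] mult_swp)
  qed
  have "ev (ph u') y = ev (ph u') (contract D a b)" for u'
  proof (cases "set u' \<subseteq> Xp")
    case True
    have "proj (ep a \<otimes>\<^bsub>HH\<^esub> fm b) u' = ev (ph u') y"
      unfolding yX(1) using yX(2,3) by (simp add: proj_add fm_carrier FF_BB BQ_carrier J_BQ proj_fm proj_J)
    moreover have "proj (ep a \<otimes>\<^bsub>HH\<^esub> fm b) u' = ev (ph u') (contract D a b)"
      unfolding proj_ep_fm[OF a(1) b(1) True] ev_contract[OF a(1) b(1)] swp
      by (simp add: ph_append_left ev_swm_fun ev_fun_mult inv)
    ultimately show ?thesis by simp
  next
    case False
    then have "ph u' = (\<lambda>w. 0)" by (simp add: ph_bad fun_eq_iff)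
    then show ?thesis by simp
  qed
  then have fm: "fm y = fm (contract D a b)"
    using fm_eq_iff[OF FF_BB[OF yX(2)] contract_BB[OF a(1) b(1)]] by blast
  then show "fm (contract D a b) \<in> Bmm D" using yX(2) by (simp add: Bmm_eq flip: fm)
  show "\<exists>X\<in>J. ep a \<otimes>\<^bsub>HH\<^esub> fm b = fm (contract D a b) \<oplus>\<^bsub>HH\<^esub> X" using yX fm by auto
qed

text \<open>Since \<open>e'\<^sub>i x\<close> lies in \<open>J\<close>, its projection is zero.  Pairing it with \<open>u t\<^sub>i\<^sup>-\<^sup>1\<close> gives
  \<open>\<phi>(u e\<^sub>i, x) = 0\<close> up to a nonzero factor, for all words \<open>u\<close>.\<close>

theorem singular_vector_scalar:
  assumes x: "x \<in> FF" and e: "\<And>i. i \<in> nodes D \<Longrightarrow> ee i \<otimes>\<^bsub>HH\<^esub> fm x \<in> J"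
  shows "\<exists>c. fm x = sca c"
proof -
  have Ezero: "ev (ph (u @ [GenE i])) x = 0" if i: "i \<in> nodes D" and u: "set u \<subseteq> Xp" for i u
  proof (cases "cc i = 0")
    case True
    have "ph (u @ [GenE i]) w = 0" for w unfolding ph_append_left by (simp add: ph_E_zero[OF i True])
    then have "ph (u @ [GenE i]) = (\<lambda>w. 0)" by (simp add: fun_eq_iff)
    then show ?thesis by simp
  next
    case False
    \<comment> \<open>The last letter cancels the factor \<open>t\<^sub>i\<close> of \<open>e'\<^sub>i\<close>.\<close>
    let ?v = "u @ [GenT (- \<alpha> i)]"
    have v: "set ?v \<subseteq> Xp" using u alpha_P i by (simp add: letters)
    have mc: "monom (ew i) \<in> AA" using i alpha_P by (simp add: letters)
    have "0 = proj (ee i \<otimes>\<^bsub>HH\<^esub> fm x) ?v" using proj_J[OF e[OF i]] by simp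
    also have "\<dots> = cc i * ev (\<lambda>w. swp (ew i) (\<lambda>r1 r2. ph r2 tlw * ph (?v @ r1) w)) x"
      unfolding ee_ep using proj_ep_fm[OF cs.subspace_scale[OF carrier_free_subspace(1) mc] FF_BB[OF x] v]
      by (simp only: ev_cscale ev_fun_mult) simp
    also have "(\<lambda>w. swp (ew i) (\<lambda>r1 r2. ph r2 tlw * ph (?v @ r1) w)) = (\<lambda>w. ph (?v @ ew i) w)"
      using i by (simp add: ph_TT_tlw[OF alpha_P(1)] ph_ew_tlw fun_eq_iff)
    also have "\<dots> = ph (u @ [GenE i])"
      using ph_torus_cancel[OF alpha_P(1)[OF i], of u "[GenE i]"] by (simp add: fun_eq_iff)
    finally show ?thesis using False by simp
  qed
  let ?c = "Poly_Mapping.lookup x []"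
  have "ev (ph u) x = ev (ph u) (cscale ?c 1)" for u
  proof (cases "set u \<subseteq> Xp")
    case True
    have "ev (ph u) (cscale ?c 1) = ?c * ph u []" by (simp only: ev_cscale) (simp add: one_free del: single_one)
    then show ?thesis using singular_vector_pairing[OF x Ezero True] True by (simp add: ph_Nil_right)
  next
    case False
    then have "ph u = (\<lambda>w. 0)" by (simp add: ph_bad fun_eq_iff)
    then show ?thesis by simp
  qed
  then have "fm x = fm (cscale ?c 1)"
    using fm_eq_iff[OF FF_BB[OF x] cs.subspace_scale[OF carrier_free_subspace(2) one_carrier_free(2)]] by blast
  then show ?thesis by (auto simp: fm_sca)
qed

end

section \<open>Quotient modules\<close>

lemma regular_module_simps:
  "carrier (regular_module R) = carrier R" "add (regular_module R) = add R" "zero (regular_module R) = zero R"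
  "smult (regular_module R) = mult R"
  by (simp_all add: regular_module_def)

lemma regular_left_module: assumes "ring R" shows "left_module R (regular_module R)"
proof -
  interpret ring R by (rule assms)
  have "abelian_group (regular_module R)"
    by (rule abelian_groupI) (auto simp: regular_module_simps a_ac intro: a_inv_closed l_neg)
  then show ?thesis
    by (intro left_module.intro left_module_axioms.intro assms)
      (auto simp: regular_module_simps l_distr r_distr m_assoc)
qed

locale quotient_of_left_module = left_module R M for R :: "('a, 'b) ring_scheme" and M :: "('a, 'm) module" +
  fixes N :: "'m set"
  assumes sub: "submodule N R M"
begin

lemma N_subgroup: "subgroup N (add_monoid M)" and N_smult: "a \<in> carrier R \<Longrightarrow> x \<in> N \<Longrightarrow> a \<odot>\<^bsub>M\<^esub> x \<in> N"
  using sub by (simp_all add: submodule_def submodule_axioms_def)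

sublocale A: abelian_subgroup N M
  by (intro abelian_subgroupI3 additive_subgroup.intro N_subgroup) unfold_locales

abbreviation "Q \<equiv> quotient_module M N"

lemma Q_simps: "carrier Q = a_rcosets\<^bsub>M\<^esub> N" "add Q = set_add M" "zero Q = N"
  "smult Q = (\<lambda>a X. \<Union>x\<in>X. N +>\<^bsub>M\<^esub> (a \<odot>\<^bsub>M\<^esub> x))"
  by (simp_all add: quotient_module_def)

lemma Q_carrier: "carrier Q = (\<lambda>m. N +>\<^bsub>M\<^esub> m) ` carrier M"
  by (auto simp: Q_simps A_RCOSETS_def')

lemma Q_add: "x \<in> carrier M \<Longrightarrow> y \<in> carrier M \<Longrightarrow> (N +>\<^bsub>M\<^esub> x) \<oplus>\<^bsub>Q\<^esub> (N +>\<^bsub>M\<^esub> y) = N +>\<^bsub>M\<^esub> (x \<oplus>\<^bsub>M\<^esub> y)"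
  by (simp add: Q_simps A.a_rcos_sum)

lemma coset_absorb: "h \<in> N \<Longrightarrow> m \<in> carrier M \<Longrightarrow> N +>\<^bsub>M\<^esub> (h \<oplus>\<^bsub>M\<^esub> m) = N +>\<^bsub>M\<^esub> m"
  using M.a_coset_add_assoc[OF A.a_subset A.a_Hcarr, of h m] A.a_rcos_const[of h] by simp

lemma Q_smult:
  assumes "a \<in> carrier R" "m \<in> carrier M"
  shows "a \<odot>\<^bsub>Q\<^esub> (N +>\<^bsub>M\<^esub> m) = N +>\<^bsub>M\<^esub> (a \<odot>\<^bsub>M\<^esub> m)"
proof -
  have "N +>\<^bsub>M\<^esub> (a \<odot>\<^bsub>M\<^esub> x) = N +>\<^bsub>M\<^esub> (a \<odot>\<^bsub>M\<^esub> m)" if x: "x \<in> N +>\<^bsub>M\<^esub> m" for x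
  proof -
    obtain h where h: "h \<in> N" "x = h \<oplus>\<^bsub>M\<^esub> m" using x by (auto simp: a_r_coset_def')
    then have "a \<odot>\<^bsub>M\<^esub> x = a \<odot>\<^bsub>M\<^esub> h \<oplus>\<^bsub>M\<^esub> a \<odot>\<^bsub>M\<^esub> m" using assms A.a_Hcarr by (simp add: smult_r_distr)
    then show ?thesis using coset_absorb N_smult h assms smult_closed by simp
  qed
  moreover have "m \<in> N +>\<^bsub>M\<^esub> m" using A.a_rcos_self[OF assms(2)] .
  ultimately show ?thesis unfolding Q_simps by blast
qed

lemma Q_eq_iff:
  assumes "x \<in> carrier M" "y \<in> carrier M"
  shows "N +>\<^bsub>M\<^esub> x = N +>\<^bsub>M\<^esub> y \<longleftrightarrow> (\<exists>h\<in>N. x = h \<oplus>\<^bsub>M\<^esub> y)"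
proof
  assume "N +>\<^bsub>M\<^esub> x = N +>\<^bsub>M\<^esub> y"
  then have "x \<in> N +>\<^bsub>M\<^esub> y" using A.a_rcos_self[OF assms(1)] by simp
  then show "\<exists>h\<in>N. x = h \<oplus>\<^bsub>M\<^esub> y" by (auto simp: a_r_coset_def')
next
  assume "\<exists>h\<in>N. x = h \<oplus>\<^bsub>M\<^esub> y"
  then show "N +>\<^bsub>M\<^esub> x = N +>\<^bsub>M\<^esub> y" using coset_absorb assms by auto
qed

lemma Q_left_module: "left_module R Q"
proof -
  have z: "zero Q = N +>\<^bsub>M\<^esub> \<zero>\<^bsub>M\<^esub>" using A.a_rcos_const[OF A.zero_closed] by (simp add: Q_simps)
  have "abelian_group Q"
  proof (rule abelian_groupI)
    fix X assume "X \<in> carrier Q"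
    then obtain x where x: "x \<in> carrier M" "X = N +>\<^bsub>M\<^esub> x" by (auto simp: Q_carrier)
    then have "(N +>\<^bsub>M\<^esub> (\<ominus>\<^bsub>M\<^esub> x)) \<oplus>\<^bsub>Q\<^esub> X = \<zero>\<^bsub>Q\<^esub>" by (simp add: Q_add z M.l_neg)
    then show "\<exists>Y\<in>carrier Q. Y \<oplus>\<^bsub>Q\<^esub> X = \<zero>\<^bsub>Q\<^esub>" using x by (auto simp: Q_carrier)
  qed (auto simp: Q_carrier Q_add z M.a_ac)
  then show ?thesis
    by (intro left_module.intro left_module_axioms.intro R.ring_axioms)
      (auto simp: Q_carrier Q_add Q_smult smult_closed smult_l_distr smult_r_distr smult_assoc smult_one)
qed

end

section \<open>The tensor product with a line\<close>

text \<open>The space \<open>V\<close> is given together with a family of linear functionals that separate its points;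
  they are used to show that \<open>x \<mapsto> x \<otimes> v\<close> is injective.\<close>

locale line_tensor =
  fixes V :: "(complex, 'a) module" and W :: "(complex, 'b) module" and v :: 'b and fn :: "'u \<Rightarrow> 'a \<Rightarrow> complex"
  assumes V_group: "abelian_group V"
    and V_smult: "x \<in> carrier V \<Longrightarrow> c \<odot>\<^bsub>V\<^esub> x \<in> carrier V"
    and fn_add: "x \<in> carrier V \<Longrightarrow> y \<in> carrier V \<Longrightarrow> fn u (x \<oplus>\<^bsub>V\<^esub> y) = fn u x + fn u y"
    and fn_smult: "x \<in> carrier V \<Longrightarrow> fn u (c \<odot>\<^bsub>V\<^esub> x) = c * fn u x"
    and fn_separate: "x \<in> carrier V \<Longrightarrow> y \<in> carrier V \<Longrightarrow> (\<And>u. fn u x = fn u y) \<Longrightarrow> x = y"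
    and W_line: "carrier W = range (\<lambda>c. c \<odot>\<^bsub>W\<^esub> v)" and W_inj: "c \<odot>\<^bsub>W\<^esub> v = d \<odot>\<^bsub>W\<^esub> v \<Longrightarrow> c = d"
    and W_add: "c \<odot>\<^bsub>W\<^esub> v \<oplus>\<^bsub>W\<^esub> d \<odot>\<^bsub>W\<^esub> v = (c + d) \<odot>\<^bsub>W\<^esub> v"
    and W_smult: "c \<odot>\<^bsub>W\<^esub> (d \<odot>\<^bsub>W\<^esub> v) = (c * d) \<odot>\<^bsub>W\<^esub> v" and W_one: "1 \<odot>\<^bsub>W\<^esub> v = v"
begin

interpretation V: abelian_group V by (rule V_group)

abbreviation "K \<equiv> tensor_relations V W"
abbreviation "T \<equiv> tensor_product V W"
abbreviation "Fr \<equiv> free_space (carrier V \<times> carrier W)"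

lemma K_subspace: "cs.subspace K"
  by (simp add: tensor_relations_def)

lemma v_in: "v \<in> carrier W"
  using W_one W_line by (metis rangeI)

lemma K_relations:
  "x \<in> carrier V \<Longrightarrow> x' \<in> carrier V \<Longrightarrow> y \<in> carrier W \<Longrightarrow> monom (x \<oplus>\<^bsub>V\<^esub> x', y) - monom (x, y) - monom (x', y) \<in> K"
  "x \<in> carrier V \<Longrightarrow> y \<in> carrier W \<Longrightarrow> monom (c \<odot>\<^bsub>V\<^esub> x, y) - cscale c (monom (x, y)) \<in> K"
  "x \<in> carrier V \<Longrightarrow> y \<in> carrier W \<Longrightarrow> monom (x, c \<odot>\<^bsub>W\<^esub> y) - cscale c (monom (x, y)) \<in> K"
  unfolding tensor_relations_def by (rule cs.span_base, blast)+

definition coset :: "('a \<times> 'b \<Rightarrow>\<^sub>0 complex) \<Rightarrow> ('a \<times> 'b \<Rightarrow>\<^sub>0 complex) set" where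
  "coset p = (\<lambda>k. k + p) ` K"

lemma coset_eq: "K +>\<^bsub>Fr\<^esub> p = coset p"
  by (auto simp: coset_def a_r_coset_def' free_space_def)

lemma coset_eq_iff: "coset p = coset q \<longleftrightarrow> p - q \<in> K"
proof
  assume "coset p = coset q"
  moreover have "p \<in> coset p" using cs.subspace_0[OF K_subspace] by (force simp: coset_def)
  ultimately obtain h where "h \<in> K" "p = h + q" by (auto simp: coset_def)
  then show "p - q \<in> K" by simp
next
  assume d: "p - q \<in> K"
  have "h + p = (h + (p - q)) + q" "h + q = (h - (p - q)) + p" for h by simp_all
  then show "coset p = coset q"
    unfolding coset_def using cs.subspace_add[OF K_subspace _ d] cs.subspace_diff[OF K_subspace _ d] by blast
qed

lemma T_carrier: "carrier T = coset ` carrier Fr" and T_zero: "zero T = coset 0"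
  and T_add: "coset p \<oplus>\<^bsub>T\<^esub> coset q = coset (p + q)"
proof -
  show "carrier T = coset ` carrier Fr"
    by (auto simp: tensor_product_def quotient_module_def A_RCOSETS_def' coset_eq)
  show "zero T = coset 0" by (simp add: tensor_product_def quotient_module_def coset_def)
  have "coset p <+>\<^bsub>Fr\<^esub> coset q = coset (p + q)"
  proof
    show "coset p <+>\<^bsub>Fr\<^esub> coset q \<subseteq> coset (p + q)"
    proof
      fix z assume "z \<in> coset p <+>\<^bsub>Fr\<^esub> coset q"
      then obtain h k where "h \<in> K" "k \<in> K" "z = (h + p) + (k + q)"
        by (auto simp: set_add_def' coset_def free_space_def)
      then have "z = (h + k) + (p + q)" "h + k \<in> K" using cs.subspace_add[OF K_subspace] by (simp_all add: algebra_simps)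
      then show "z \<in> coset (p + q)" by (auto simp: coset_def)
    qed
    show "coset (p + q) \<subseteq> coset p <+>\<^bsub>Fr\<^esub> coset q"
    proof
      fix z assume "z \<in> coset (p + q)"
      then obtain h where "h \<in> K" "z = (h + p) + (0 + q)" by (auto simp: coset_def algebra_simps)
      then show "z \<in> coset p <+>\<^bsub>Fr\<^esub> coset q"
        using cs.subspace_0[OF K_subspace] by (force simp: set_add_def' coset_def free_space_def)
    qed
  qed
  then show "coset p \<oplus>\<^bsub>T\<^esub> coset q = coset (p + q)" by (simp add: tensor_product_def quotient_module_def)
qed

definition \<theta> :: "'a \<Rightarrow> ('a \<times> 'b \<Rightarrow>\<^sub>0 complex) set" where
  "\<theta> x = pure_tensor V W x v"

lemma pure_eq: "pure_tensor V W x y = coset (monom (x, y))" and \<theta>_eq: "\<theta> x = coset (monom (x, v))"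
  by (simp_all add: pure_tensor_def \<theta>_def coset_eq)

lemma \<theta>_add: assumes "x \<in> carrier V" "y \<in> carrier V" shows "\<theta> (x \<oplus>\<^bsub>V\<^esub> y) = \<theta> x \<oplus>\<^bsub>T\<^esub> \<theta> y"
  using K_relations(1)[OF assms v_in] by (simp add: \<theta>_eq T_add coset_eq_iff diff_diff_add)

lemma pure_smult: assumes "x \<in> carrier V" shows "pure_tensor V W x (c \<odot>\<^bsub>W\<^esub> v) = \<theta> (c \<odot>\<^bsub>V\<^esub> x)"
proof -
  have "(monom (x, c \<odot>\<^bsub>W\<^esub> v) - cscale c (monom (x, v))) - (monom (c \<odot>\<^bsub>V\<^esub> x, v) - cscale c (monom (x, v))) \<in> K"
    by (intro cs.subspace_diff[OF K_subspace] K_relations assms v_in)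
  then show ?thesis by (simp add: pure_eq \<theta>_eq coset_eq_iff)
qed

lemma \<theta>_surj: "carrier T = \<theta> ` carrier V"
proof
  let ?S = "{p. \<exists>x\<in>carrier V. p - monom (x, v) \<in> K}"
  have S: "cs.subspace ?S"
  proof (rule cs.subspaceI)
    have "- (monom (\<zero>\<^bsub>V\<^esub> \<oplus>\<^bsub>V\<^esub> \<zero>\<^bsub>V\<^esub>, v) - monom (\<zero>\<^bsub>V\<^esub>, v) - monom (\<zero>\<^bsub>V\<^esub>, v)) \<in> K"
      by (intro cs.subspace_neg[OF K_subspace] K_relations v_in) simp_all
    then have "monom (\<zero>\<^bsub>V\<^esub>, v) \<in> K" by simp
    then have "0 - monom (\<zero>\<^bsub>V\<^esub>, v) \<in> K" using cs.subspace_neg[OF K_subspace] by simp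
    then show "0 \<in> ?S" using V.zero_closed by blast
  next
    fix p q assume "p \<in> ?S" "q \<in> ?S"
    then obtain x y where xy: "x \<in> carrier V" "p - monom (x, v) \<in> K" "y \<in> carrier V" "q - monom (y, v) \<in> K" by blast
    have "(p - monom (x, v)) + (q - monom (y, v)) - (monom (x \<oplus>\<^bsub>V\<^esub> y, v) - monom (x, v) - monom (y, v)) \<in> K"
      by (intro cs.subspace_diff[OF K_subspace] cs.subspace_add[OF K_subspace] K_relations xy v_in)
    then have "p + q - monom (x \<oplus>\<^bsub>V\<^esub> y, v) \<in> K" by (simp add: algebra_simps)
    then show "p + q \<in> ?S" using V.a_closed xy by blast
  next
    fix c p assume "p \<in> ?S"
    then obtain x where x: "x \<in> carrier V" "p - monom (x, v) \<in> K" by blast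
    have "cscale c (p - monom (x, v)) - (monom (c \<odot>\<^bsub>V\<^esub> x, v) - cscale c (monom (x, v))) \<in> K"
      by (intro cs.subspace_diff[OF K_subspace] cs.subspace_scale[OF K_subspace] K_relations x v_in)
    then have "cscale c p - monom (c \<odot>\<^bsub>V\<^esub> x, v) \<in> K" by (simp add: cs.scale_right_diff_distrib del: cscale_single)
    then show "cscale c p \<in> ?S" using V_smult x by blast
  qed
  show "carrier T \<subseteq> \<theta> ` carrier V"
  proof
    fix X assume "X \<in> carrier T"
    then obtain p where p: "Poly_Mapping.keys p \<subseteq> carrier V \<times> carrier W" "X = coset p"
      by (auto simp: T_carrier free_space_def)
    have "p \<in> ?S"
    proof (rule in_span_monoms[OF S])
      fix k assume "k \<in> Poly_Mapping.keys p"
      then obtain x c where k: "k = (x, c \<odot>\<^bsub>W\<^esub> v)" "x \<in> carrier V" using p(1) W_line by (cases k) auto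
      have "monom k - monom (c \<odot>\<^bsub>V\<^esub> x, v) \<in> K"
        using pure_smult[OF k(2), of c] by (simp add: pure_eq \<theta>_eq coset_eq_iff k(1))
      then show "monom k \<in> ?S" using V_smult k(2) by blast
    qed
    then show "X \<in> \<theta> ` carrier V" using p(2) by (auto simp: \<theta>_eq coset_eq_iff)
  qed
  show "\<theta> ` carrier V \<subseteq> carrier T"
    using v_in by (auto simp: T_carrier \<theta>_eq free_space_def)
qed

definition "crd w = (THE c. w = c \<odot>\<^bsub>W\<^esub> v)"

lemma crd: "crd (c \<odot>\<^bsub>W\<^esub> v) = c"
  unfolding crd_def using W_inj by (intro the_equality) auto

lemma \<theta>_inj: assumes "x \<in> carrier V" "y \<in> carrier V" "\<theta> x = \<theta> y" shows "x = y"
proof (rule fn_separate[OF assms(1,2)])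
  fix u
  let ?\<Lambda> = "ev (\<lambda>(x, w). fn u x * crd w)"
  have S: "cs.subspace {p. ?\<Lambda> p = 0}" by (auto simp: cs.subspace_def ev_add ev_cscale)
  have "K \<subseteq> {p. ?\<Lambda> p = 0}"
    unfolding tensor_relations_def
    by (rule cs.span_minimal[OF _ S])
      (auto simp: ev_diff ev_cscale fn_add fn_smult W_line W_add W_smult crd distrib_left distrib_right simp del: cscale_single)
  then have "?\<Lambda> (monom (x, v) - monom (y, v)) = 0" using assms(3) by (auto simp: \<theta>_eq coset_eq_iff)
  moreover have "crd v = 1" using crd[of 1] by (simp add: W_one)
  ultimately show "fn u x = fn u y" by (simp add: ev_diff)
qed

lemma \<theta>_bij: "bij_betw \<theta> (carrier V) (carrier T)"
  using \<theta>_inj \<theta>_surj by (auto simp: bij_betw_def inj_on_def)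

lemma T_group: "abelian_group T"
proof -
  have z: "zero T = \<theta> \<zero>\<^bsub>V\<^esub>"
  proof -
    have "- (monom (\<zero>\<^bsub>V\<^esub> \<oplus>\<^bsub>V\<^esub> \<zero>\<^bsub>V\<^esub>, v) - monom (\<zero>\<^bsub>V\<^esub>, v) - monom (\<zero>\<^bsub>V\<^esub>, v)) \<in> K"
      by (intro cs.subspace_neg[OF K_subspace] K_relations v_in) simp_all
    then have "- monom (\<zero>\<^bsub>V\<^esub>, v) \<in> K" using cs.subspace_neg[OF K_subspace, of "monom (\<zero>\<^bsub>V\<^esub>, v)"] by simp
    then show ?thesis by (simp add: T_zero \<theta>_eq coset_eq_iff)
  qed
  show ?thesis
  proof (rule abelian_groupI)
    fix X assume "X \<in> carrier T"
    then obtain x where x: "x \<in> carrier V" "X = \<theta> x" by (auto simp: \<theta>_surj)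
    have "\<theta> (\<ominus>\<^bsub>V\<^esub> x) \<oplus>\<^bsub>T\<^esub> X = \<zero>\<^bsub>T\<^esub>" using x by (simp add: \<theta>_add[symmetric] z V.l_neg)
    then show "\<exists>Y\<in>carrier T. Y \<oplus>\<^bsub>T\<^esub> X = \<zero>\<^bsub>T\<^esub>" using x by (auto simp: \<theta>_surj)
  qed (auto simp: \<theta>_surj \<theta>_add[symmetric] z V.a_ac)
qed

end

section \<open>The modules \<open>H(\<lambda>)\<close>\<close>

context q_boson_weight
begin

abbreviation "Rg \<equiv> regular_module (Bq D)"
abbreviation "Hm \<equiv> H_module D l"

lemma J_submodule: "submodule J (Bq D) Rg"
proof (intro submodule.intro submodule_axioms.intro)
  show "subgroup J (add_monoid Rg)"
    using J_subgroup by (simp add: subgroup_def m_inv_def regular_module_simps)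
qed (simp add: regular_module_simps J_left)

lemma quotient_H: "quotient_of_left_module (Bq D) Rg J"
  by (intro quotient_of_left_module.intro quotient_of_left_module_axioms.intro regular_left_module Bq_ring J_submodule)

interpretation Qm: quotient_of_left_module "Bq D" Rg J by (rule quotient_H)

text \<open>The canonical map from \<open>B\<^sub>q\<close> to \<open>H(\<lambda>)\<close>.\<close>

definition "hc x = J +>\<^bsub>Rg\<^esub> x"

lemma Hm_left_module: "left_module (Bq D) Hm"
  unfolding H_module_def by (rule Qm.Q_left_module)

lemma Hm_simps:
  "carrier Hm = hc ` BQ" "x \<in> BQ \<Longrightarrow> y \<in> BQ \<Longrightarrow> hc x \<oplus>\<^bsub>Hm\<^esub> hc y = hc (x \<oplus>\<^bsub>HH\<^esub> y)"
  "b \<in> BQ \<Longrightarrow> x \<in> BQ \<Longrightarrow> b \<odot>\<^bsub>Hm\<^esub> hc x = hc (b \<otimes>\<^bsub>HH\<^esub> x)"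
  unfolding H_module_def hc_def
  by (rule Qm.Q_carrier[unfolded regular_module_simps] Qm.Q_add[unfolded regular_module_simps Bq_simps]
      Qm.Q_smult[unfolded regular_module_simps Bq_simps]; assumption?)+

lemma hc_eq_iff: "x \<in> BQ \<Longrightarrow> y \<in> BQ \<Longrightarrow> hc x = hc y \<longleftrightarrow> (\<exists>X\<in>J. x = X \<oplus>\<^bsub>HH\<^esub> y)"
  using Qm.Q_eq_iff[of x y] by (simp add: hc_def regular_module_simps Bq_simps)

lemma Hm_zero: "\<zero>\<^bsub>Hm\<^esub> = hc \<zero>\<^bsub>HH\<^esub>"
proof -
  have "J +>\<^bsub>Rg\<^esub> \<zero>\<^bsub>Rg\<^esub> = J" by (rule Qm.A.a_rcos_const) (rule Qm.A.zero_closed)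
  then show ?thesis by (simp add: H_module_def quotient_module_def hc_def regular_module_simps Bq_simps)
qed

lemma hc_J: "X \<in> J \<Longrightarrow> x \<in> BQ \<Longrightarrow> hc (x \<oplus>\<^bsub>HH\<^esub> X) = hc x"
proof -
  interpret H: ring HH by (rule heis_ring)
  assume X: "X \<in> J" and x: "x \<in> BQ"
  have "x \<oplus>\<^bsub>HH\<^esub> X \<in> BQ" using x J_BQ[OF X] subringE(7)[OF BQ_subring] by blast
  moreover have "x \<oplus>\<^bsub>HH\<^esub> X = X \<oplus>\<^bsub>HH\<^esub> x" using x X by (simp add: H.a_comm BQ_carrier J_BQ)
  ultimately show ?thesis using hc_eq_iff x X by blast
qed

lemmas BQ_closed = subringE(6,7,3,2,5)[OF BQ_subring]

lemma one_bar_eq: "one_bar D l = hc \<one>\<^bsub>HH\<^esub>"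
  by (simp add: one_bar_def hc_def a_r_coset_def' regular_module_simps Bq_simps)

lemma smult_one_bar: "x \<in> BQ \<Longrightarrow> x \<odot>\<^bsub>Hm\<^esub> one_bar D l = hc x"
proof -
  interpret H: ring HH by (rule heis_ring)
  show "x \<in> BQ \<Longrightarrow> x \<odot>\<^bsub>Hm\<^esub> one_bar D l = hc x" by (simp add: one_bar_eq Hm_simps BQ_closed BQ_carrier)
qed

lemma hc_Bmm_bij: "bij_betw hc (Bmm D) (carrier Hm)"
proof -
  interpret H: ring HH by (rule heis_ring)
  have "inj_on hc (Bmm D)"
  proof (rule inj_onI)
    fix x y assume "x \<in> Bmm D" "y \<in> Bmm D" and e: "hc x = hc y"
    then obtain a b where ab: "x = fm a" "a \<in> FF" "y = fm b" "b \<in> FF" by (auto simp: Bmm_eq)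
    then obtain X where X: "X \<in> J" "fm a = X \<oplus>\<^bsub>HH\<^esub> fm b" using e hc_eq_iff[OF fm_BQ fm_BQ] by blast
    then have "fm a = fm b \<oplus>\<^bsub>HH\<^esub> X" using ab by (simp add: H.a_comm BQ_carrier J_BQ fm_BQ)
    then show "x = y" using fm_inj_mod_J[OF ab(2,4) X(1)] ab by simp
  qed
  moreover have "hc ` Bmm D = carrier Hm"
  proof
    show "hc ` Bmm D \<subseteq> carrier Hm" using Bmm_BQ by (auto simp: Hm_simps)
    show "carrier Hm \<subseteq> hc ` Bmm D"
    proof
      fix U assume "U \<in> carrier Hm"
      then obtain x where x: "x \<in> BQ" "U = hc x" by (auto simp: Hm_simps)
      obtain y X where yX: "x = fm y \<oplus>\<^bsub>HH\<^esub> X" "y \<in> FF" "X \<in> J" using BQ_decomposition[OF x(1)] by (auto simp: YY_def)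
      then have "U = hc (fm y)" using x(2) hc_J[OF yX(3) fm_BQ[OF yX(2)]] by simp
      then show "U \<in> hc ` Bmm D" using yX(2) by (auto simp: Bmm_eq)
    qed
  qed
  ultimately show ?thesis by (simp add: bij_betw_def)
qed

lemma Bmm_subring: "subring (Bmm D) HH"
  unfolding Bmm_def by (rule gen_subalgebra_subring) (auto simp: gen_carrier)

lemmas zero_Bmm = subringE(2)[OF Bmm_subring] and one_Bmm = subringE(3)[OF Bmm_subring]

text \<open>A submodule that contains the class of a nonzero element of \<open>B\<^sup>-\<^sup>-\<close> of degree at most \<open>n\<close> contains
  the class of \<open>1\<close>: either all \<open>e'\<^sub>i\<close> kill it and it is a nonzero scalar, or some \<open>e'\<^sub>i\<close> maps it to a
  nonzero element of smaller degree.\<close>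

lemma submodule_contains_one:
  assumes N: "submodule N (Bq D) Hm"
  shows "x \<in> FF \<Longrightarrow> (\<forall>w\<in>Poly_Mapping.keys x. length w \<le> n) \<Longrightarrow> fm x \<noteq> \<zero>\<^bsub>HH\<^esub> \<Longrightarrow> hc (fm x) \<in> N \<Longrightarrow> hc \<one>\<^bsub>HH\<^esub> \<in> N"
proof (induction n arbitrary: x rule: less_induct)
  case (less n)
  interpret H: ring HH by (rule heis_ring)
  have Nsm: "b \<odot>\<^bsub>Hm\<^esub> U \<in> N" if "b \<in> BQ" "U \<in> N" for b U
    using N that by (simp add: submodule_def submodule_axioms_def)
  note x = less.prems(1)
  show ?case
  proof (cases "\<forall>i\<in>nodes D. ee i \<otimes>\<^bsub>HH\<^esub> fm x \<in> J")
    case True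
    then obtain c where c: "fm x = sca c" using singular_vector_scalar[OF x] by blast
    then have "c \<noteq> 0" using less.prems(3) sca_alg(4) by auto
    then have "sca (1 / c) \<otimes>\<^bsub>HH\<^esub> fm x = \<one>\<^bsub>HH\<^esub>" by (simp add: c sca_alg)
    then show ?thesis using Nsm[OF BQ_gens(1) less.prems(4), of "1 / c"] Hm_simps(3)[OF BQ_gens(1) fm_BQ[OF x]] by simp
  next
    case False
    then obtain i where i: "i \<in> nodes D" "ee i \<otimes>\<^bsub>HH\<^esub> fm x \<notin> J" by blast
    obtain z X where z: "z \<in> FF" "\<forall>v\<in>Poly_Mapping.keys z. length v < n" "X \<in> J" "ee i \<otimes>\<^bsub>HH\<^esub> fm x = fm z \<oplus>\<^bsub>HH\<^esub> X"
      using ee_FF[OF i(1) x less.prems(2)] by (elim exE conjE) (rule that)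
    have nz: "fm z \<noteq> \<zero>\<^bsub>HH\<^esub>"
      using i(2) z(3,4) BQ_carrier[OF J_BQ[OF z(3)]] by auto
    then have "Poly_Mapping.keys z \<noteq> {}" by (auto simp: fm_zero)
    then obtain v where "v \<in> Poly_Mapping.keys z" by blast
    then have n: "n > 0" using bspec[OF z(2), of v] by linarith
    have "ee i \<odot>\<^bsub>Hm\<^esub> hc (fm x) \<in> N" by (rule Nsm[OF BQ_gens(2)[OF i(1)] less.prems(4)])
    then have "hc (fm z) \<in> N"
      using Hm_simps(3)[OF BQ_gens(2)[OF i(1)] fm_BQ[OF x]] hc_J[OF z(3) fm_BQ[OF z(1)]] by (simp add: z(4))
    moreover have "\<forall>v\<in>Poly_Mapping.keys z. length v \<le> n - 1" using z(2) by fastforce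
    moreover have "n - 1 < n" using n by simp
    ultimately show ?thesis using less.IH[of "n - 1" z] z(1) nz by blast
  qed
qed

theorem H_simple: "simple_module (Bq D) Hm"
  unfolding simple_module_def
proof (intro conjI allI impI)
  interpret H: ring HH by (rule heis_ring)
  show "left_module (Bq D) Hm" by (rule Hm_left_module)
  have ph1: "fm 1 \<noteq> fm 0"
  proof
    assume "fm 1 = fm 0"
    then have "ev (ph []) 1 = ev (ph []) 0"
      using fm_eq_iff[OF one_carrier_free(2) cs.subspace_0[OF carrier_free_subspace(2)]] by blast
    then show False by (simp add: one_free del: single_one)
  qed
  show "carrier Hm \<noteq> {\<zero>\<^bsub>Hm\<^esub>}"
  proof
    assume "carrier Hm = {\<zero>\<^bsub>Hm\<^esub>}"
    then have "hc \<one>\<^bsub>HH\<^esub> = hc \<zero>\<^bsub>HH\<^esub>" using Hm_simps(1) BQ_closed(3) Hm_zero by auto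
    then have "\<one>\<^bsub>HH\<^esub> = \<zero>\<^bsub>HH\<^esub>"
      using hc_Bmm_bij one_Bmm zero_Bmm by (auto simp: bij_betw_def inj_on_def)
    then show False using ph1 by (simp add: fm_one fm_zero)
  qed
  fix N assume N: "submodule N (Bq D) Hm"
  then have Nsub: "subgroup N (add_monoid Hm)" by (simp add: submodule_def)
  have Nz: "\<zero>\<^bsub>Hm\<^esub> \<in> N" using subgroup.one_closed[OF Nsub] by simp
  have Nc: "N \<subseteq> carrier Hm" using subgroup.subset[OF Nsub] by simp
  show "N = {\<zero>\<^bsub>Hm\<^esub>} \<or> N = carrier Hm"
  proof (rule disjCI)
    assume "N \<noteq> carrier Hm"
    show "N = {\<zero>\<^bsub>Hm\<^esub>}"
    proof (rule ccontr)
      assume "N \<noteq> {\<zero>\<^bsub>Hm\<^esub>}"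
      then obtain U where U: "U \<in> N" "U \<noteq> \<zero>\<^bsub>Hm\<^esub>" using Nz by blast
      have "U \<in> hc ` fm ` FF" using U(1) Nc hc_Bmm_bij by (simp only: bij_betw_def Bmm_eq) blast
      then obtain x where x: "x \<in> FF" "U = hc (fm x)" by blast
      have nz: "fm x \<noteq> \<zero>\<^bsub>HH\<^esub>" using U(2) x(2) Hm_zero by auto
      obtain n where n: "\<forall>w\<in>Poly_Mapping.keys x. length w \<le> n"
        using finite_nat_set_iff_bounded_le[of "length ` Poly_Mapping.keys x"] by auto
      have one: "hc \<one>\<^bsub>HH\<^esub> \<in> N" by (rule submodule_contains_one[OF N x(1) n nz]) (use U(1) x(2) in simp)
      have "V \<in> N" if V: "V \<in> carrier Hm" for V
      proof -
        obtain b where b: "b \<in> BQ" "V = hc b" using V by (auto simp: Hm_simps)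
        have "b \<odot>\<^bsub>Hm\<^esub> hc \<one>\<^bsub>HH\<^esub> \<in> N" using N b(1) one by (simp add: submodule_def submodule_axioms_def)
        then show ?thesis using b smult_one_bar[OF b(1)] by (simp add: one_bar_eq)
      qed
      then show False using Nc \<open>N \<noteq> carrier Hm\<close> by blast
    qed
  qed
qed

text \<open>On the right, \<open>t\<^sub>\<mu>\<close> acts modulo \<open>J\<close> as the scalar \<open>q\<^bsup>(\<lambda>,\<mu>)\<^esup>\<close>.\<close>

lemma hc_torus:
  assumes k: "k \<in> P" and z: "z \<in> BQ" shows "hc (z \<otimes>\<^bsub>HH\<^esub> tt k) = hc (sca (\<chi> k) \<otimes>\<^bsub>HH\<^esub> z)"
proof -
  interpret H: ring HH by (rule heis_ring)
  let ?d = "tt k \<ominus>\<^bsub>Bq D\<^esub> scalar_elt D (\<chi> k)"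
  note c = gen_carrier(1)[OF k] sca_carrier BQ_carrier[OF z] BQ_carrier[OF JT_base[OF k]]
  have "tt k = ?d \<oplus>\<^bsub>HH\<^esub> sca (\<chi> k)"
    using c(1,2) k by (simp add: a_minus_def Bq_minus BQ_gens scalar_elt_sca Bq_simps H.a_assoc H.l_neg)
  then have "z \<otimes>\<^bsub>HH\<^esub> tt k = z \<otimes>\<^bsub>HH\<^esub> (?d \<oplus>\<^bsub>HH\<^esub> sca (\<chi> k))" by simp
  also have "\<dots> = z \<otimes>\<^bsub>HH\<^esub> ?d \<oplus>\<^bsub>HH\<^esub> z \<otimes>\<^bsub>HH\<^esub> sca (\<chi> k)"
    by (rule H.r_distr) (rule c)+
  also have "\<dots> = z \<otimes>\<^bsub>HH\<^esub> sca (\<chi> k) \<oplus>\<^bsub>HH\<^esub> z \<otimes>\<^bsub>HH\<^esub> ?d"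
    by (rule H.a_comm) (rule H.m_closed c)+
  also have "z \<otimes>\<^bsub>HH\<^esub> sca (\<chi> k) = sca (\<chi> k) \<otimes>\<^bsub>HH\<^esub> z" by (rule sca_central[OF c(3), symmetric])
  finally have "z \<otimes>\<^bsub>HH\<^esub> tt k = sca (\<chi> k) \<otimes>\<^bsub>HH\<^esub> z \<oplus>\<^bsub>HH\<^esub> z \<otimes>\<^bsub>HH\<^esub> ?d" .
  then show ?thesis by (simp only: hc_J[OF tt_J[OF z k] BQ_closed(1)[OF BQ_gens(1) z]])
qed

lemma tt_inv: assumes k: "k \<in> P" shows "inv\<^bsub>Bq D\<^esub> tt k = tt (- k)"
proof (rule B.inv_char)
  show "tt k \<otimes>\<^bsub>Bq D\<^esub> tt (- k) = \<one>\<^bsub>Bq D\<^esub>" "tt (- k) \<otimes>\<^bsub>Bq D\<^esub> tt k = \<one>\<^bsub>Bq D\<^esub>"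
    using tt_inverse[OF k] by (simp_all only: Bq_simps)
qed (rule BQ_gens(4) k lattice(5))+

lemma tt_conj:
  assumes k: "k \<in> P" and x: "x \<in> Bmm D"
  defines "z \<equiv> tt k \<otimes>\<^bsub>Bq D\<^esub> x \<otimes>\<^bsub>Bq D\<^esub> inv\<^bsub>Bq D\<^esub> tt k"
  shows "z \<in> Bmm D" "tt k \<otimes>\<^bsub>HH\<^esub> x = z \<otimes>\<^bsub>HH\<^esub> tt k"
proof -
  interpret H: ring HH by (rule heis_ring)
  obtain a where a: "x = fm a" "a \<in> FF" using x unfolding Bmm_eq by blast
  obtain y where y: "y \<in> FF" "tt k \<otimes>\<^bsub>HH\<^esub> fm a = fm y \<otimes>\<^bsub>HH\<^esub> tt k" using tt_conj_FF[OF k a(2)] by blast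
  note c = gen_carrier(1)[OF k] gen_carrier(1)[OF lattice(5)[OF k]] fm_carrier[OF FF_BB[OF y(1)]]
  have "z = fm y \<otimes>\<^bsub>HH\<^esub> tt k \<otimes>\<^bsub>HH\<^esub> tt (- k)"
    by (simp only: z_def tt_inv[OF k] Bq_simps a(1) y(2))
  also have "\<dots> = fm y"
    by (simp only: H.m_assoc[OF c(3,1,2)] tt_inverse[OF k] H.r_one[OF c(3)])
  finally have "z = fm y" .
  then show "z \<in> Bmm D" "tt k \<otimes>\<^bsub>HH\<^esub> x = z \<otimes>\<^bsub>HH\<^esub> tt k" using y a by (simp_all add: Bmm_eq)
qed

section \<open>The module on \<open>B\<^sup>-\<^sup>- \<otimes> \<complex>v\<close>\<close>

lemma sca_Bmm: "sca c \<in> Bmm D"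
  unfolding Bmm_def gen_subalgebra_eq by (intro generate_ring.incl UnI1 rangeI)

lemma ee_Bpp: "i \<in> nodes D \<Longrightarrow> ee i \<in> Bpp D"
  unfolding Bpp_def gen_subalgebra_eq by (intro generate_ring.incl UnI2 imageI)

lemma ff_Bmm: "i \<in> nodes D \<Longrightarrow> ff i \<in> Bmm D"
  unfolding Bmm_def gen_subalgebra_eq by (intro generate_ring.incl UnI2 imageI)

text \<open>The separating functionals on \<open>B\<^sup>-\<^sup>-\<close> are the pairings with words.  The line is spanned by \<open>v \<noteq> 0\<close>, so
  multiples of \<open>v\<close> determine their coefficient.\<close>

lemma line_tensor_Bmm:
  fixes M :: "('g mpfree set, 'm) module"
  assumes M: "left_module (Bq D) M" and v: "v \<in> carrier M" "v \<noteq> \<zero>\<^bsub>M\<^esub>"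
  shows "line_tensor (Bmm_space D) (line_space D M v) v (\<lambda>u X. proj X u)"
proof -
  interpret H: ring HH by (rule heis_ring)
  interpret M: left_module "Bq D" M by (rule M)
  note s = subringE[OF Bmm_subring]
  have Vs: "carrier (Bmm_space D) = Bmm D" "add (Bmm_space D) = add HH" "zero (Bmm_space D) = zero HH"
    "smult (Bmm_space D) = (\<lambda>c x. sca c \<otimes>\<^bsub>HH\<^esub> x)"
    by (simp_all add: Bmm_space_def scalar_elt_sca)
  have Ws: "carrier (line_space D M v) = range (\<lambda>c. sca c \<odot>\<^bsub>M\<^esub> v)" "add (line_space D M v) = add M"
    "smult (line_space D M v) = (\<lambda>c x. sca c \<odot>\<^bsub>M\<^esub> x)"
    by (auto simp: line_space_def scalar_elt_sca)
  have c: "x \<in> Bmm D \<Longrightarrow> x \<in> carrier HH" for x using s(1) by blast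
  have add: "sca c \<odot>\<^bsub>M\<^esub> v \<oplus>\<^bsub>M\<^esub> sca d \<odot>\<^bsub>M\<^esub> v = sca (c + d) \<odot>\<^bsub>M\<^esub> v" for c d
    using M.smult_l_distr[OF BQ_gens(1) BQ_gens(1) v(1), of c d] by (simp add: Bq_simps sca_alg)
  have mult: "sca c \<odot>\<^bsub>M\<^esub> (sca d \<odot>\<^bsub>M\<^esub> v) = sca (c * d) \<odot>\<^bsub>M\<^esub> v" for c d
    using M.smult_assoc[OF BQ_gens(1) BQ_gens(1) v(1), of c d] by (simp add: Bq_simps sca_alg)
  have one: "sca 1 \<odot>\<^bsub>M\<^esub> v = v" using M.smult_one[OF v(1)] by (simp add: Bq_simps sca_alg)
  have cl: "sca c \<odot>\<^bsub>M\<^esub> v \<in> carrier M" for c using M.smult_closed[OF BQ_gens(1) v(1)] .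
  have r0: "a \<odot>\<^bsub>M\<^esub> \<zero>\<^bsub>M\<^esub> = \<zero>\<^bsub>M\<^esub>" if a: "a \<in> BQ" for a
  proof -
    have "a \<odot>\<^bsub>M\<^esub> \<zero>\<^bsub>M\<^esub> \<oplus>\<^bsub>M\<^esub> a \<odot>\<^bsub>M\<^esub> \<zero>\<^bsub>M\<^esub> = a \<odot>\<^bsub>M\<^esub> \<zero>\<^bsub>M\<^esub>"
      using M.smult_r_distr[OF a M.M.zero_closed M.M.zero_closed] by simp
    then show ?thesis using M.smult_closed[OF a M.M.zero_closed] by (metis M.M.add.l_cancel_one)
  qed
  have inj: "c = d" if e: "sca c \<odot>\<^bsub>M\<^esub> v = sca d \<odot>\<^bsub>M\<^esub> v" for c d
  proof (rule ccontr)
    assume cd: "c \<noteq> d"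
    have "sca d \<odot>\<^bsub>M\<^esub> v \<oplus>\<^bsub>M\<^esub> sca (c - d) \<odot>\<^bsub>M\<^esub> v = sca d \<odot>\<^bsub>M\<^esub> v" using e by (simp add: add)
    then have "sca (c - d) \<odot>\<^bsub>M\<^esub> v = \<zero>\<^bsub>M\<^esub>" using cl[of d] cl[of "c - d"] by (metis M.M.add.l_cancel_one)
    then have "sca (1 / (c - d) * (c - d)) \<odot>\<^bsub>M\<^esub> v = \<zero>\<^bsub>M\<^esub>" 
      using r0[OF BQ_gens(1), of "1 / (c - d)"] mult[of "1 / (c - d)" "c - d"] by (simp only:)
    then show False using v(2) one cd by simp
  qed
  show ?thesis
  proof (rule line_tensor.intro)
    show "abelian_group (Bmm_space D)"
    proof (rule abelian_groupI)
      fix x assume "x \<in> carrier (Bmm_space D)"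
      then show "\<exists>y\<in>carrier (Bmm_space D). y \<oplus>\<^bsub>Bmm_space D\<^esub> x = \<zero>\<^bsub>Bmm_space D\<^esub>"
        unfolding Vs using s(5) c H.l_neg by blast
    qed (unfold Vs, auto simp: s(2,7) c H.a_ac)
    show "carrier (line_space D M v) = range (\<lambda>c. c \<odot>\<^bsub>line_space D M v\<^esub> v)" unfolding Ws ..
    fix u :: "('g \<Rightarrow> complex) plus_gen list" and x y c
    assume x: "x \<in> carrier (Bmm_space D)"
    show "c \<odot>\<^bsub>Bmm_space D\<^esub> x \<in> carrier (Bmm_space D)"
      using x s(6)[OF sca_Bmm] by (simp add: Vs)
    obtain a where a: "a \<in> FF" "x = fm a" using x by (auto simp: Vs Bmm_eq)
    have "proj (sca c \<otimes>\<^bsub>HH\<^esub> fm a) u = proj (fm (cscale c a)) u" by (simp add: fm_cscale FF_BB a)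
    also have "\<dots> = c * proj (fm a) u"
      using a by (simp add: proj_fm FF_BB cs.subspace_scale[OF carrier_free_subspace(2)] ev_cscale)
    finally show "proj (c \<odot>\<^bsub>Bmm_space D\<^esub> x) u = c * proj x u" by (simp add: Vs a)
    assume y: "y \<in> carrier (Bmm_space D)"
    show "proj (x \<oplus>\<^bsub>Bmm_space D\<^esub> y) u = proj x u + proj y u"
      using x y c by (simp add: Vs proj_add)
    obtain b where b: "b \<in> FF" "y = fm b" using y by (auto simp: Vs Bmm_eq)
    assume "\<And>u. proj x u = proj y u"
    then show "x = y" using a b by (simp add: fm_eq_iff FF_BB proj_fm)
  qed (simp_all add: Ws add mult one inj)
qed

end

context q_boson_weight
begin

lemma hc_Bmm_smult: "f \<in> BQ \<Longrightarrow> x \<in> Bmm D \<Longrightarrow> f \<odot>\<^bsub>Hm\<^esub> hc x = hc (f \<otimes>\<^bsub>HH\<^esub> x)"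
  using Hm_simps(3) Bmm_BQ by blast

lemma hc_Bpp_smult:
  assumes a: "a \<in> AA" "ep a \<in> Bpp D" and b: "b \<in> BB" "fm b \<in> Bmm D"
  shows "ep a \<odot>\<^bsub>Hm\<^esub> hc (fm b) = hc (fm (contract D a b))"
proof -
  obtain X where X: "X \<in> J" "ep a \<otimes>\<^bsub>HH\<^esub> fm b = fm (contract D a b) \<oplus>\<^bsub>HH\<^esub> X" using Bpp_action(2)[OF assms] by blast
  have "ep a \<odot>\<^bsub>Hm\<^esub> hc (fm b) = hc (ep a \<otimes>\<^bsub>HH\<^esub> fm b)" using a(2) b(2) Bpp_BQ by (intro hc_Bmm_smult) blast+
  also have "\<dots> = hc (fm (contract D a b))"
    using hc_J[OF X(1)] Bpp_action(1)[OF assms] Bmm_BQ by (simp only: X(2)) blast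
  finally show ?thesis .
qed

lemma hc_tt_smult:
  assumes k: "k \<in> P" and x: "x \<in> Bmm D"
  shows "tt k \<odot>\<^bsub>Hm\<^esub> hc x = hc (sca (\<chi> k) \<otimes>\<^bsub>HH\<^esub> (tt k \<otimes>\<^bsub>Bq D\<^esub> x \<otimes>\<^bsub>Bq D\<^esub> inv\<^bsub>Bq D\<^esub> tt k))"
    (is "_ = hc (_ \<otimes>\<^bsub>HH\<^esub> ?z)")
proof -
  have z: "?z \<in> BQ" using tt_conj(1)[OF k x] Bmm_BQ by blast
  have "tt k \<odot>\<^bsub>Hm\<^esub> hc x = hc (tt k \<otimes>\<^bsub>HH\<^esub> x)" by (rule hc_Bmm_smult[OF BQ_gens(4)[OF k] x])
  also have "\<dots> = hc (?z \<otimes>\<^bsub>HH\<^esub> tt k)" by (rule arg_cong[OF tt_conj(2)[OF k x]])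
  finally show ?thesis using hc_torus[OF k z] by (rule trans)
qed

lemma ee_ep_free: "i \<in> nodes D \<Longrightarrow> ee i = ep (e_prime_free D i)" "i \<in> nodes D \<Longrightarrow> e_prime_free D i \<in> AA"
proof -
  show "ee i = ep (e_prime_free D i)" by (simp only: e_prime_def sharp_eq)
  show "e_prime_free D i \<in> AA" if "i \<in> nodes D"
    unfolding e_prime_free_def using that
    by (intro cs.subspace_scale[OF carrier_free_subspace(1)]) (simp add: letters alpha_P)
qed

end

text \<open>Each module axiom for \<open>N\<close> may be checked after applying the injective map \<open>h\<close>.\<close>

lemma left_module_transport:
  assumes M: "left_module R M" and N: "abelian_group N" and h: "bij_betw h (carrier N) (carrier M)"
    and add: "\<And>x y. x \<in> carrier N \<Longrightarrow> y \<in> carrier N \<Longrightarrow> h (x \<oplus>\<^bsub>N\<^esub> y) = h x \<oplus>\<^bsub>M\<^esub> h y"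
    and closed: "\<And>a x. a \<in> carrier R \<Longrightarrow> x \<in> carrier N \<Longrightarrow> a \<odot>\<^bsub>N\<^esub> x \<in> carrier N"
    and smult: "\<And>a x. a \<in> carrier R \<Longrightarrow> x \<in> carrier N \<Longrightarrow> h (a \<odot>\<^bsub>N\<^esub> x) = a \<odot>\<^bsub>M\<^esub> h x"
  shows "left_module R N"
proof -
  interpret M: left_module R M by (rule M)
  interpret N: abelian_group N by (rule N)
  have c: "h x \<in> carrier M" if "x \<in> carrier N" for x using h that by (auto simp: bij_betw_def)
  have inj: "x = y" if "h x = h y" "x \<in> carrier N" "y \<in> carrier N" for x y
    using h that by (auto simp: bij_betw_def inj_on_def)
  show ?thesis
    by (intro left_module.intro left_module_axioms.intro M.R.ring_axioms N; (rule closed, assumption+ | rule inj))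
      (simp_all add: add smult closed c M.smult_l_distr M.smult_r_distr M.smult_assoc M.smult_one)
qed

locale q_boson_line = q_boson_weight D l for D :: "'g::ab_group_add q_boson_data" and l +
  fixes M :: "('g mpfree set, 'm) module" and v :: 'm
  assumes M: "left_module (Bq D) M" and v: "v \<in> carrier M" "v \<noteq> \<zero>\<^bsub>M\<^esub>" and weight: "v \<in> weight_space D M l"
begin

sublocale L: line_tensor "Bmm_space D" "line_space D M v" v "\<lambda>u X. proj X u"
  by (rule line_tensor_Bmm[OF M v])

lemma Bmm_space_simps: "carrier (Bmm_space D) = Bmm D" "add (Bmm_space D) = add HH"
    "smult (Bmm_space D) = (\<lambda>c x. sca c \<otimes>\<^bsub>HH\<^esub> x)"
  by (simp_all add: Bmm_space_def scalar_elt_sca)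

lemmas \<theta>_bij = L.\<theta>_bij[unfolded Bmm_space_simps]
lemmas \<theta>_add = L.\<theta>_add[unfolded Bmm_space_simps]

lemma \<theta>_carrier: "x \<in> Bmm D \<Longrightarrow> L.\<theta> x \<in> carrier L.T" and \<theta>_cases: "X \<in> carrier L.T \<Longrightarrow> \<exists>x\<in>Bmm D. X = L.\<theta> x"
  using \<theta>_bij by (auto simp: bij_betw_def)

lemma tt_pure_tensor:
  assumes "k \<in> P" "z \<in> Bmm D" shows "Bmm_tensor D M v z (tt k \<odot>\<^bsub>M\<^esub> v) = L.\<theta> (sca (\<chi> k) \<otimes>\<^bsub>HH\<^esub> z)"
proof -
  have "tt k \<odot>\<^bsub>M\<^esub> v = sca (qform D k l) \<odot>\<^bsub>M\<^esub> v"
    using weight assms(1) by (simp add: weight_space_def lattice(1) scalar_elt_sca)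
  also have "qform D k l = \<chi> k" using lattice(6)[of k l] by simp
  also have "sca (\<chi> k) \<odot>\<^bsub>M\<^esub> v = \<chi> k \<odot>\<^bsub>line_space D M v\<^esub> v" by (simp add: line_space_def scalar_elt_sca)
  finally show ?thesis using L.pure_smult[of z "\<chi> k"] assms(2) by (simp only: Bmm_space_simps)
qed

text \<open>The isomorphism \<open>x \<otimes> v \<mapsto> x.1\<close> to \<open>H(\<lambda>)\<close>, as a map on the underlying space of the tensor product.\<close>

definition "\<Psi> X = hc (the_inv_into (Bmm D) L.\<theta> X)"

lemma Psi_\<theta>: "x \<in> Bmm D \<Longrightarrow> \<Psi> (L.\<theta> x) = hc x"
  unfolding \<Psi>_def using \<theta>_bij by (simp add: bij_betw_def the_inv_into_f_f)

lemma Psi_bij: "bij_betw \<Psi> (carrier L.T) (carrier Hm)"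
  using bij_betw_trans[OF bij_betw_the_inv_into[OF \<theta>_bij] hc_Bmm_bij] by (simp add: \<Psi>_def[abs_def] comp_def)

lemma Psi_add: assumes "X \<in> carrier L.T" "Y \<in> carrier L.T" shows "\<Psi> (X \<oplus>\<^bsub>L.T\<^esub> Y) = \<Psi> X \<oplus>\<^bsub>Hm\<^esub> \<Psi> Y"
proof -
  obtain x y where xy: "x \<in> Bmm D" "y \<in> Bmm D" "X = L.\<theta> x" "Y = L.\<theta> y" using \<theta>_cases assms by meson
  then have "\<Psi> (X \<oplus>\<^bsub>L.T\<^esub> Y) = hc (x \<oplus>\<^bsub>HH\<^esub> y)"
    using Psi_\<theta>[OF subringE(7)[OF Bmm_subring xy(1,2)]] by (simp only: \<theta>_add)
  moreover have "hc x \<oplus>\<^bsub>Hm\<^esub> hc y = hc (x \<oplus>\<^bsub>HH\<^esub> y)" using xy(1,2) Bmm_BQ by (intro Hm_simps(2)) blast+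
  ultimately show ?thesis using xy by (simp only: Psi_\<theta>)
qed

lemma is_tensor_module_iff:
  "is_tensor_module D M v N \<longleftrightarrow>
     left_module (Bq D) N \<and> carrier N = carrier L.T \<and> zero N = zero L.T \<and> add N = add L.T \<and>
     (\<forall>a\<in>AA. \<forall>b\<in>BB. ep a \<in> Bpp D \<and> fm b \<in> Bmm D \<longrightarrow> ep a \<odot>\<^bsub>N\<^esub> L.\<theta> (fm b) = L.\<theta> (fm (contract D a b))) \<and>
     (\<forall>f\<in>Bmm D. \<forall>x\<in>Bmm D. f \<odot>\<^bsub>N\<^esub> L.\<theta> x = L.\<theta> (f \<otimes>\<^bsub>HH\<^esub> x)) \<and>
     (\<forall>k\<in>P. \<forall>x\<in>Bmm D. tt k \<odot>\<^bsub>N\<^esub> L.\<theta> x =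
        L.\<theta> (sca (\<chi> k) \<otimes>\<^bsub>HH\<^esub> (tt k \<otimes>\<^bsub>Bq D\<^esub> x \<otimes>\<^bsub>Bq D\<^esub> inv\<^bsub>Bq D\<^esub> tt k)))"
proof -
  have t: "(\<forall>k\<in>P. \<forall>x\<in>Bmm D. tt k \<odot>\<^bsub>N\<^esub> L.\<theta> x =
        Bmm_tensor D M v (tt k \<otimes>\<^bsub>Bq D\<^esub> x \<otimes>\<^bsub>Bq D\<^esub> inv\<^bsub>Bq D\<^esub> tt k) (tt k \<odot>\<^bsub>M\<^esub> v)) \<longleftrightarrow>
     (\<forall>k\<in>P. \<forall>x\<in>Bmm D. tt k \<odot>\<^bsub>N\<^esub> L.\<theta> x =
        L.\<theta> (sca (\<chi> k) \<otimes>\<^bsub>HH\<^esub> (tt k \<otimes>\<^bsub>Bq D\<^esub> x \<otimes>\<^bsub>Bq D\<^esub> inv\<^bsub>Bq D\<^esub> tt k)))"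
    by (intro ball_cong refl) (simp only: tt_pure_tensor tt_conj(1))
  show ?thesis
    unfolding is_tensor_module_def Let_def sharp_eq lattice(1) L.\<theta>_def[symmetric] t
    by (simp only: Bq_simps)
qed

lemma sca_minus: assumes "h \<in> carrier HH" shows "\<ominus>\<^bsub>HH\<^esub> h = sca (- 1) \<otimes>\<^bsub>HH\<^esub> h"
proof -
  interpret H: ring HH by (rule heis_ring)
  have "sca (- 1) \<otimes>\<^bsub>HH\<^esub> h \<oplus>\<^bsub>HH\<^esub> sca 1 \<otimes>\<^bsub>HH\<^esub> h = sca 0 \<otimes>\<^bsub>HH\<^esub> h"
    using H.l_distr[OF sca_carrier sca_carrier assms, of "- 1" 1] by (simp add: sca_alg(2) del: sca_alg(3))
  then have "sca (- 1) \<otimes>\<^bsub>HH\<^esub> h \<oplus>\<^bsub>HH\<^esub> h = \<zero>\<^bsub>HH\<^esub>" using assms by (simp add: sca_alg(3,4))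
  then show ?thesis using assms sca_carrier by (intro H.minus_equality) simp_all
qed

text \<open>The prescribed action determines that of each generator \<open>e'\<^sub>i\<close>, \<open>f\<^sub>i\<close>, \<open>t\<^sub>\<mu>\<close>, where it agrees with the action
  on \<open>H(\<lambda>)\<close>; the module axioms carry the agreement to the generated algebra.\<close>

proposition Psi_smult:
  assumes N: "is_tensor_module D M v N" and a: "a \<in> BQ"
  shows "\<forall>X\<in>carrier N. \<Psi> (a \<odot>\<^bsub>N\<^esub> X) = a \<odot>\<^bsub>Hm\<^esub> \<Psi> X"
proof -
  interpret H: ring HH by (rule heis_ring)
  note NN = N[unfolded is_tensor_module_iff]
  have lm: "left_module (Bq D) N" and cN: "carrier N = carrier L.T" and aN: "add N = add L.T"
    and act_pp: "\<And>a b. a \<in> AA \<Longrightarrow> b \<in> BB \<Longrightarrow> ep a \<in> Bpp D \<Longrightarrow> fm b \<in> Bmm D \<Longrightarrow> ep a \<odot>\<^bsub>N\<^esub> L.\<theta> (fm b) = L.\<theta> (fm (contract D a b))"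
    and act_mm: "\<And>f x. f \<in> Bmm D \<Longrightarrow> x \<in> Bmm D \<Longrightarrow> f \<odot>\<^bsub>N\<^esub> L.\<theta> x = L.\<theta> (f \<otimes>\<^bsub>HH\<^esub> x)"
    and act_t: "\<And>k x. k \<in> P \<Longrightarrow> x \<in> Bmm D \<Longrightarrow> tt k \<odot>\<^bsub>N\<^esub> L.\<theta> x =
        L.\<theta> (sca (\<chi> k) \<otimes>\<^bsub>HH\<^esub> (tt k \<otimes>\<^bsub>Bq D\<^esub> x \<otimes>\<^bsub>Bq D\<^esub> inv\<^bsub>Bq D\<^esub> tt k))"
    using NN by blast+
  interpret N: left_module "Bq D" N by (rule lm)
  interpret Hm: left_module "Bq D" Hm by (rule Hm_left_module)
  have ic: "\<Psi> X \<in> carrier Hm" if "X \<in> carrier N" for X using Psi_bij that cN by (auto simp: bij_betw_def)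
  have iadd: "\<Psi> (X \<oplus>\<^bsub>N\<^esub> Y) = \<Psi> X \<oplus>\<^bsub>Hm\<^esub> \<Psi> Y" if "X \<in> carrier N" "Y \<in> carrier N" for X Y
    using Psi_add that by (simp only: aN cN)
  have mm: "\<Psi> (f \<odot>\<^bsub>N\<^esub> L.\<theta> x) = f \<odot>\<^bsub>Hm\<^esub> \<Psi> (L.\<theta> x)" if f: "f \<in> Bmm D" and x: "x \<in> Bmm D" for f x
  proof -
    have "f \<in> BQ" using f Bmm_BQ by blast
    then show ?thesis
      by (simp only: act_mm[OF f x] Psi_\<theta>[OF x] Psi_\<theta>[OF subringE(6)[OF Bmm_subring f x]] hc_Bmm_smult[OF _ x])
  qed
  have gen: "\<Psi> (g \<odot>\<^bsub>N\<^esub> L.\<theta> x) = g \<odot>\<^bsub>Hm\<^esub> \<Psi> (L.\<theta> x)" if g: "g \<in> range sca \<union> Bgens" and x: "x \<in> Bmm D" for g x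
  proof -
    obtain c where "g = sca c \<or> (\<exists>i\<in>nodes D. g = ee i) \<or> (\<exists>i\<in>nodes D. g = ff i) \<or> (\<exists>k\<in>P. g = tt k)"
      using g by blast
    then consider "g = sca c" | i where "i \<in> nodes D" "g = ee i" | i where "i \<in> nodes D" "g = ff i" | k where "k \<in> P" "g = tt k"
      by blast
    then show ?thesis
    proof cases
      case 1 then show ?thesis using mm[OF sca_Bmm x] by simp
    next
      case (3 i) then show ?thesis using mm[OF ff_Bmm x] by simp
    next
      case (2 i)
      obtain b where b: "x = fm b" "b \<in> FF" using x unfolding Bmm_eq by blast
      note e = ee_ep_free[OF 2(1)]
      have p: "ep (e_prime_free D i) \<in> Bpp D" "fm b \<in> Bmm D" using ee_Bpp[OF 2(1)] e(1) x b(1) by simp_all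
      have "\<Psi> (ep (e_prime_free D i) \<odot>\<^bsub>N\<^esub> L.\<theta> (fm b)) = \<Psi> (L.\<theta> (fm (contract D (e_prime_free D i) b)))"
        by (simp only: act_pp[OF e(2) FF_BB[OF b(2)] p])
      also have "\<dots> = hc (fm (contract D (e_prime_free D i) b))"
        by (rule Psi_\<theta>[OF Bpp_action(1)[OF e(2) p(1) FF_BB[OF b(2)] p(2)]])
      also have "\<dots> = ep (e_prime_free D i) \<odot>\<^bsub>Hm\<^esub> hc (fm b)"
        by (rule hc_Bpp_smult[OF e(2) p(1) FF_BB[OF b(2)] p(2), symmetric])
      finally show ?thesis by (simp only: 2(2) b(1) e(1) Psi_\<theta>[OF p(2)])
    next
      case (4 k)
      have "\<Psi> (tt k \<odot>\<^bsub>N\<^esub> L.\<theta> x) = tt k \<odot>\<^bsub>Hm\<^esub> hc x"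
        by (simp only: act_t[OF 4(1) x] hc_tt_smult[OF 4(1) x]
            Psi_\<theta>[OF subringE(6)[OF Bmm_subring sca_Bmm tt_conj(1)[OF 4(1) x]]])
      then show ?thesis by (simp only: 4(2) Psi_\<theta>[OF x])
    qed
  qed
  have gen': "\<Psi> (g \<odot>\<^bsub>N\<^esub> X) = g \<odot>\<^bsub>Hm\<^esub> \<Psi> X" if g: "g \<in> range sca \<union> Bgens" and X: "X \<in> carrier N" for g X
    using \<theta>_cases[of X] gen[OF g] X cN by auto
  have gBQ: "g \<in> BQ" if "g \<in> generate_ring HH (range sca \<union> Bgens)" for g
    using that by (simp only: BQ_eq gen_subalgebra_eq)
  have mult: "\<Psi> ((g \<otimes>\<^bsub>HH\<^esub> g') \<odot>\<^bsub>N\<^esub> X) = (g \<otimes>\<^bsub>HH\<^esub> g') \<odot>\<^bsub>Hm\<^esub> \<Psi> X"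
    if g: "g \<in> BQ" "g' \<in> BQ" and e: "\<forall>X\<in>carrier N. \<Psi> (g \<odot>\<^bsub>N\<^esub> X) = g \<odot>\<^bsub>Hm\<^esub> \<Psi> X"
      "\<forall>X\<in>carrier N. \<Psi> (g' \<odot>\<^bsub>N\<^esub> X) = g' \<odot>\<^bsub>Hm\<^esub> \<Psi> X" and X: "X \<in> carrier N" for g g' X
    using N.smult_assoc[OF g X] Hm.smult_assoc[OF g ic[OF X]] e N.smult_closed[OF g(2) X] X by (simp add: Bq_simps)
  show ?thesis
    using a unfolding BQ_eq gen_subalgebra_eq
  proof (induction rule: generate_ring.induct)
    case one
    show ?case using N.smult_one Hm.smult_one ic by (simp add: Bq_simps)
  next
    case (incl g)
    then show ?case using gen' by blast
  next
    case (a_inv g)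
    then have g: "g \<in> BQ" by (rule_tac gBQ)
    show ?case
      unfolding sca_minus[OF BQ_carrier[OF g]]
      using mult[OF BQ_gens(1) g _ a_inv.IH] gen'[of "sca (- 1)"] by blast
  next
    case (eng_add g g')
    then have g: "g \<in> BQ" "g' \<in> BQ" by (auto intro: gBQ)
    show ?case
    proof
      fix X assume X: "X \<in> carrier N"
      show "\<Psi> ((g \<oplus>\<^bsub>HH\<^esub> g') \<odot>\<^bsub>N\<^esub> X) = (g \<oplus>\<^bsub>HH\<^esub> g') \<odot>\<^bsub>Hm\<^esub> \<Psi> X"
        using N.smult_l_distr[OF g X] Hm.smult_l_distr[OF g ic[OF X]] iadd[OF N.smult_closed[OF g(1) X] N.smult_closed[OF g(2) X]]
          eng_add.IH X by (simp add: Bq_simps)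
    qed
  next
    case (eng_mult g g')
    then have g: "g \<in> BQ" "g' \<in> BQ" by (auto intro: gBQ)
    show ?case using mult[OF g eng_mult.IH] by blast
  qed
qed

theorem tensor_module_iso:
  assumes N: "is_tensor_module D M v N" shows "module_iso (Bq D) N Hm \<Psi>"
proof -
  have NN: "left_module (Bq D) N" "carrier N = carrier L.T" "add N = add L.T"
    using N by (simp_all only: is_tensor_module_iff)
  show ?thesis
    unfolding module_iso_def NN(2,3)
    using NN(1) Hm_left_module Psi_bij Psi_add Psi_smult[OF N] by (simp only: NN(2)) blast
qed

text \<open>The action of \<open>B\<^sub>q\<close> on \<open>H(\<lambda>)\<close>, transported along the bijection, has the prescribed values on the
  generating subalgebras.\<close>

theorem tensor_module_exists: "\<exists>N. is_tensor_module D M v N"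
proof -
  let ?s = "\<lambda>a X. the_inv_into (carrier L.T) \<Psi> (a \<odot>\<^bsub>Hm\<^esub> \<Psi> X)"
  define N :: "('g mpfree set, ('g mpfree set \<times> 'm \<Rightarrow>\<^sub>0 complex) set) module"
    where "N = \<lparr>carrier = carrier L.T, mult = (\<lambda>X Y. X), one = zero L.T, zero = zero L.T, add = add L.T, smult = ?s\<rparr>"
  have N: "carrier N = carrier L.T" "zero N = zero L.T" "add N = add L.T" "smult N = ?s" by (simp_all add: N_def)
  interpret Hm: left_module "Bq D" Hm by (rule Hm_left_module)
  interpret T: abelian_group L.T by (rule L.T_group)
  have inj: "inj_on \<Psi> (carrier L.T)" and im: "\<Psi> ` carrier L.T = carrier Hm" using Psi_bij by (simp_all add: bij_betw_def)
  have ic: "\<Psi> X \<in> carrier Hm" if "X \<in> carrier L.T" for X using im that by blast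
  have s: "?s a X \<in> carrier L.T" "\<Psi> (?s a X) = a \<odot>\<^bsub>Hm\<^esub> \<Psi> X" if "a \<in> BQ" "X \<in> carrier L.T" for a X
  proof -
    have "a \<odot>\<^bsub>Hm\<^esub> \<Psi> X \<in> \<Psi> ` carrier L.T" unfolding im by (rule Hm.smult_closed[OF that(1) ic[OF that(2)]])
    then show "?s a X \<in> carrier L.T" "\<Psi> (?s a X) = a \<odot>\<^bsub>Hm\<^esub> \<Psi> X"
      using the_inv_into_into[OF inj _ subset_refl] f_the_inv_into_f[OF inj] by blast+
  qed
  have eq: "?s a X = Y" if "Y \<in> carrier L.T" "a \<odot>\<^bsub>Hm\<^esub> \<Psi> X = \<Psi> Y" for a X Y
    using the_inv_into_f_f[OF inj that(1)] that(2) by simp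
  have "abelian_group N"
  proof (rule abelian_groupI; unfold N)
    fix x assume "x \<in> carrier L.T"
    then show "\<exists>y\<in>carrier L.T. y \<oplus>\<^bsub>L.T\<^esub> x = \<zero>\<^bsub>L.T\<^esub>" using T.a_inv_closed T.l_neg by blast
  qed (simp_all add: T.a_ac)
  then have "left_module (Bq D) N"
    by (rule left_module_transport[OF Hm_left_module, where h = \<Psi>]) (unfold N, simp_all only: Psi_bij Psi_add s)
  moreover have "ep a \<odot>\<^bsub>N\<^esub> L.\<theta> (fm b) = L.\<theta> (fm (contract D a b))"
    if h: "a \<in> AA" "b \<in> BB" "ep a \<in> Bpp D" "fm b \<in> Bmm D" for a b
    unfolding N
    by (rule eq) (simp_all only: Psi_\<theta> \<theta>_carrier Bpp_action(1)[OF h(1,3,2,4)] h(4) hc_Bpp_smult[OF h(1,3,2,4)])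
  moreover have "f \<odot>\<^bsub>N\<^esub> L.\<theta> x = L.\<theta> (f \<otimes>\<^bsub>HH\<^esub> x)" if h: "f \<in> Bmm D" "x \<in> Bmm D" for f x
  proof -
    have "f \<in> BQ" using h(1) Bmm_BQ by blast
    then show ?thesis
      unfolding N
      by (rule_tac eq) (simp_all only: Psi_\<theta> \<theta>_carrier subringE(6)[OF Bmm_subring h] h(2) hc_Bmm_smult)
  qed
  moreover have "tt k \<odot>\<^bsub>N\<^esub> L.\<theta> x = L.\<theta> (sca (\<chi> k) \<otimes>\<^bsub>HH\<^esub> (tt k \<otimes>\<^bsub>Bq D\<^esub> x \<otimes>\<^bsub>Bq D\<^esub> inv\<^bsub>Bq D\<^esub> tt k))"
    if h: "k \<in> P" "x \<in> Bmm D" for k x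
    unfolding N
    by (rule eq) (simp_all only: Psi_\<theta> \<theta>_carrier subringE(6)[OF Bmm_subring sca_Bmm tt_conj(1)[OF h]] h(2) hc_tt_smult[OF h])
  ultimately have "is_tensor_module D M v N" unfolding is_tensor_module_iff using N(1-3) by blast
  then show ?thesis ..
qed

lemma Psi_tensor: assumes "x \<in> Bmm D" shows "\<Psi> (Bmm_tensor D M v x v) = x \<odot>\<^bsub>Hm\<^esub> one_bar D l"
proof -
  have "x \<in> BQ" using assms Bmm_BQ by blast
  then show ?thesis using Psi_\<theta>[OF assms] by (simp only: smult_one_bar L.\<theta>_def)
qed

end

theorem corollary4:
  fixes D :: "'g::ab_group_add q_boson_data"
    and M :: "('g mpfree set, 'm) module"
  assumes "q_boson_datum D"
  shows "(\<forall>l\<in>weight_lattice D. \<forall>v.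
      category_O D M \<and> maximal_vector D M v \<and> v \<in> weight_space D M l \<longrightarrow>
        (\<exists>N. is_tensor_module D M v N) \<and>
        (\<forall>N. is_tensor_module D M v N \<longrightarrow>
          (\<exists>h. module_iso (Bq D) N (H_module D l) h \<and>
            (\<forall>x\<in>Bmm D. h (Bmm_tensor D M v x v) = x \<odot>\<^bsub>H_module D l\<^esub> one_bar D l)))) \<and>
    (\<forall>l\<in>weight_lattice D. simple_module (Bq D) (H_module D l))"
proof -
  have weight: "q_boson_weight D l" if "l \<in> weight_lattice D" for l
    using assms that by (intro q_boson_weight.intro q_boson.intro q_boson_weight_axioms.intro)
  have line: "(\<exists>N. is_tensor_module D M v N) \<and>
        (\<forall>N. is_tensor_module D M v N \<longrightarrow>
          (\<exists>h. module_iso (Bq D) N (H_module D l) h \<and>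
            (\<forall>x\<in>Bmm D. h (Bmm_tensor D M v x v) = x \<odot>\<^bsub>H_module D l\<^esub> one_bar D l)))"
    if l: "l \<in> weight_lattice D" and h: "category_O D M" "maximal_vector D M v" "v \<in> weight_space D M l" for l v
  proof -
    have "q_boson_line D l M v"
      using weight[OF l] h by (intro q_boson_line.intro q_boson_line_axioms.intro) (simp_all add: category_O_def maximal_vector_def)
    then interpret q_boson_line D l M v .
    show ?thesis using tensor_module_exists tensor_module_iso Psi_tensor by blast
  qed
  have "simple_module (Bq D) (H_module D l)" if "l \<in> weight_lattice D" for l
    by (rule q_boson_weight.H_simple[OF weight[OF that]])
  then show ?thesis using line by blast
qed

end
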